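(* Let $(M,\operatorname{g},\omega)$ be a (compact) Fano Kähler manifold with $\omega$ representing its first Chern class. Let $G$ be a Lie group acting on $M$ by holomorphic isometries. Suppose that $\mu\in\mathfrak g^*$ is such that the ray reduced space is a well defined Kähler orbifold $(M_{\mathbb R^+\mu},\omega_{\mathbb R^+\mu})$, and assume that the kernel group $K_\mu$ is compact. Then the Ricci form of the ray reduced space is given by $$\rho_{\mathbb R^+\mu}=\omega_{\mathbb R^+\mu}+\frac{\sqrt{-1}}{2\pi}\,\partial\bar\partial\Big(f_{\mathbb R^+\mu}+\log\Vert\xi'\wedge\eta'\Vert^2_{\mathbb R^+\mu}\Big),$$ where $f_{\mathbb R^+\mu}$ and $\Vert\xi'\wedge\eta'\Vert_{\mathbb R^+\mu}$ are the functions on $M_{\mathbb R^+\mu}$ induced (by $K_\mu$-projection) by $f$ and by the pointwise norm of the multivector $\xi'\wedge\eta'$. Consequently, $M_{\mathbb R^+\mu}$ is also Fano.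
   Context: $\mathbb R^+=(0,\infty)$, $\mathbb R^+\mu=\{r\mu:r>0\}$. $G_\mu$ is the coadjoint isotropy group of $\mu$, $\mathfrak g_\mu$ its Lie algebra; the kernel group $K_\mu$ is the unique connected normal Lie subgroup of $G_\mu$ with Lie algebra $\mathfrak k_\mu=\ker(\mu|_{\mathfrak g_\mu})$. The Ricci form $\rho$ is normalized so that it represents the first Chern class; $f$ is a smooth real function with $\rho-\omega=\frac{\sqrt{-1}}{2\pi}\partial\bar\partial f$. In local holomorphic coordinates $\omega=\frac{\sqrt{-1}}{2\pi}\operatorname{g}_{\alpha\bar\beta}dz^\alpha\wedge d\bar z^\beta$. Momentum map: for $\xi\in\mathfrak g$ with infinitesimal generator $\xi_M$, put $\xi'_M=\frac12(\xi_M-\sqrt{-1}\,\mathcal C\xi_M)$, $\mathcal C$ the complex structure. Let $u_{\xi'_M}$ be the unique complex-valued function with $\operatorname{grad}u_{\xi'_M}=\xi'_M$ and $\Delta_fu_{\xi'_M}=u_{\xi'_M}$, where $\operatorname{grad}u=\operatorname{g}^{i\bar j}\frac{\partial u}{\partial\bar z_j}\partial_{z_i}$ and $\Delta_fu=\Delta u-\operatorname{grad}u(f)$, $\Delta$ being the (nonnegative) complex Laplacian. The momentum map is $J:M\to\mathfrak g^*$, $\langle J(x),\xi\rangle=\frac{\sqrt{-1}}{2\pi}u_{\xi'_M}(x)$. Ray reduced space: $M_{\mathbb R^+\mu}=J^{-1}(\mathbb R^+\mu)/K_\mu$, with projected Kähler structure; it is assumed that $\ker\mu+\mathfrak g_\mu=\mathfrak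 g$, $K_\mu$ acts properly and by isometries on $J^{-1}(\mathbb R^+\mu)$ and $J$ is transverse to $\mathbb R^+\mu$. Multivector: fix a decomposition $\mathfrak g=\mathfrak g_\mu\oplus\mathfrak m$ with $\mu|_{\mathfrak m}=0$ and let $\mathfrak m_M(x)=\{\xi_M(x):\xi\in\mathfrak m\}$. Bases $\{\xi_i\}_{i=1,\dots,k}$ of $\mathfrak k_\mu$ and $\{\eta_j\}_{j=1,\dots,m}$ of $\mathfrak m$ are chosen so that the infinitesimal generators form orthogonal frames of the vertical distribution of $\pi_{\mathbb R^+\mu}:J^{-1}(\mathbb R^+\mu)\to M_{\mathbb R^+\mu}$ and of $\mathfrak m_M$, respectively. Then $\xi'\wedge\eta'=\xi'_{1M}\wedge\dots\wedge\xi'_{kM}\wedge\eta'_{1M}\wedge\dots\wedge\eta'_{mM}$, with pointwise norm taken with respect to the metric $\operatorname{g}$.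
   Formalization: Assumes ‖ξ'∧η'‖ is nonzero on J^{-1}(R^+μ), so that the logarithm is defined; with a projected Kähler structure the norm vanishes identically when 𝔪≠0. Fano for the quotient means ω represents c_1; compactness of the quotient is not claimed. Dimensions are positive. *)

theory Defs
  imports "HOL-Analysis.Analysis" "HOL-Algebra.Group_Action"
begin

section \<open>Local calculus\<close>

text \<open>Meant for open \<open>S\<close>: all iterated directional derivatives exist and are continuous.\<close>

primrec Ck_on ::
  "nat \<Rightarrow> 'a::real_normed_vector set \<Rightarrow> ('a \<Rightarrow> 'b::real_normed_vector) \<Rightarrow> bool" where
  "Ck_on 0 S f \<longleftrightarrow> continuous_on S f"
| "Ck_on (Suc k) S f \<longleftrightarrow> (\<forall>x\<in>S. f differentiable (at x)) \<and>
     (\<forall>v. Ck_on k S (\<lambda>x. frechet_derivative f (at x) v))"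

definition smooth_on ::
  "'a::real_normed_vector set \<Rightarrow> ('a \<Rightarrow> 'b::real_normed_vector) \<Rightarrow> bool" where
  "smooth_on S f \<longleftrightarrow> (\<forall>k. Ck_on k S f)"

definition holo_on ::
  "(complex^'n) set \<Rightarrow> (complex^'n \<Rightarrow> complex^'m) \<Rightarrow> bool" where
  "holo_on S f \<longleftrightarrow> (\<forall>z\<in>S. f differentiable (at z) \<and>
     (\<forall>v. frechet_derivative f (at z) (\<i> *s v) = \<i> *s frechet_derivative f (at z) v))"

definition dz :: "'n \<Rightarrow> (complex^'n \<Rightarrow> complex) \<Rightarrow> complex^'n \<Rightarrow> complex" where
  "dz \<alpha> u z = (frechet_derivative u (at z) (axis \<alpha> 1)
      - \<i> * frechet_derivative u (at z) (axis \<alpha> \<i>)) / 2"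

definition dzbar :: "'n \<Rightarrow> (complex^'n \<Rightarrow> complex) \<Rightarrow> complex^'n \<Rightarrow> complex" where
  "dzbar \<alpha> u z = (frechet_derivative u (at z) (axis \<alpha> 1)
      + \<i> * frechet_derivative u (at z) (axis \<alpha> \<i>)) / 2"

definition ddbar :: "(complex^'n \<Rightarrow> complex) \<Rightarrow> complex^'n \<Rightarrow> complex^'n^'n" where
  "ddbar u z = (\<chi> \<alpha> \<beta>. dz \<alpha> (dzbar \<beta> u) z)"

text \<open>A matrix \<open>a\<close> with entries \<open>a $ \<alpha> $ \<beta>\<close> is read as the coefficients of a tensor
  \<open>a\<^sub>\<alpha>\<^sub>\<beta> dz\<^sub>\<alpha> \<otimes> dzbar\<^sub>\<beta>\<close> (see \<open>hform\<close>) or of the (1,1)-form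
  \<open>(\<i>/2\<pi>) a\<^sub>\<alpha>\<^sub>\<beta> dz\<^sub>\<alpha> \<and> dzbar\<^sub>\<beta>\<close> (see \<open>form11\<close>).  A real tangent vector is given by its
  coordinates \<open>v :: complex^'n\<close>; the complex structure is then \<open>v \<mapsto> \<i> *s v\<close>, and
  \<open>v\<close> is also the list of components of its (1,0)-part \<open>(v - \<i> C v)/2 = \<Sum> v\<^sub>\<alpha> \<partial>\<^sub>\<alpha>\<close>.\<close>

definition hform :: "complex^'n^'n \<Rightarrow> complex^'n \<Rightarrow> complex^'n \<Rightarrow> complex" where
  "hform a v w = (\<Sum>\<alpha>\<in>UNIV. \<Sum>\<beta>\<in>UNIV. a $ \<alpha> $ \<beta> * v $ \<alpha> * cnj (w $ \<beta>))"

definition form11 :: "complex^'n^'n \<Rightarrow> complex^'n \<Rightarrow> complex^'n \<Rightarrow> complex" where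
  "form11 a v w = \<i> / (2 * of_real pi) * (hform a v w - hform a w v)"

definition ext_deriv1 ::
  "('a::real_normed_vector \<Rightarrow> 'a \<Rightarrow> 'b::real_normed_vector) \<Rightarrow> 'a \<Rightarrow> 'a \<Rightarrow> 'a \<Rightarrow> 'b" where
  "ext_deriv1 \<theta> z v w =
     frechet_derivative (\<lambda>y. \<theta> y w) (at z) v - frechet_derivative (\<lambda>y. \<theta> y v) (at z) w"

definition ext_deriv2 ::
  "('a::real_normed_vector \<Rightarrow> 'a \<Rightarrow> 'a \<Rightarrow> 'b::real_normed_vector) \<Rightarrow> 'a \<Rightarrow> 'a \<Rightarrow> 'a \<Rightarrow> 'a \<Rightarrow> 'b" where
  "ext_deriv2 \<theta> z u v w =
     frechet_derivative (\<lambda>y. \<theta> y v w) (at z) u - frechet_derivative (\<lambda>y. \<theta> y u w) (at z) v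
   + frechet_derivative (\<lambda>y. \<theta> y u v) (at z) w"

definition grad10 :: "complex^'n^'n \<Rightarrow> (complex^'n \<Rightarrow> complex) \<Rightarrow> complex^'n \<Rightarrow> complex^'n" where
  \<comment> \<open>the inverse metric is normalized by \<open>\<Sum>\<^sub>j g\<^sup>i\<^sup>j g\<^sub>k\<^sub>j = \<delta>\<^sup>i\<^sub>k\<close> (\<open>j\<close> the barred index), hence the transpose\<close>
  "grad10 a u z = matrix_inv (transpose a) *v (\<chi> j. dzbar j u z)"

definition laplace :: "complex^'n^'n \<Rightarrow> (complex^'n \<Rightarrow> complex) \<Rightarrow> complex^'n \<Rightarrow> complex" where
  "laplace a u z =
     - (\<Sum>i\<in>UNIV. \<Sum>j\<in>UNIV. matrix_inv (transpose a) $ i $ j * ddbar u z $ i $ j)"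

definition laplace_f ::
  "complex^'n^'n \<Rightarrow> (complex^'n \<Rightarrow> real) \<Rightarrow> (complex^'n \<Rightarrow> complex) \<Rightarrow> complex^'n \<Rightarrow> complex" where
  "laplace_f a f u z =
     laplace a u z - (\<Sum>i\<in>UNIV. grad10 a u z $ i * dz i (\<lambda>y. complex_of_real (f y)) z)"

section \<open>Orbifolds and manifolds\<close>

text \<open>An orbifold chart is a quotient map \<open>cpar\<close> from an open set of the model space modulo a
  finite group of automorphisms onto an open set of the space.  A manifold chart is the
  case of the trivial group, given by its parametrization.  The regularity of the maps is a
  parameter \<open>P\<close> (\<open>smooth_on\<close> or \<open>holo_on\<close>).\<close>

record ('e, 'x) ochart =
  cdom :: "'e set"
  cgrp :: "('e \<Rightarrow> 'e) set"
  cpar :: "'e \<Rightarrow> 'x"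

definition cimg :: "('e, 'x) ochart \<Rightarrow> 'x set" where
  "cimg c = cpar c ` cdom c"

definition coords :: "('e, 'x) ochart \<Rightarrow> 'x \<Rightarrow> 'e" where
  "coords c = inv_into (cdom c) (cpar c)"

definition orbifold_chart ::
  "('e::topological_space set \<Rightarrow> ('e \<Rightarrow> 'e) \<Rightarrow> bool) \<Rightarrow> 'x topology \<Rightarrow> ('e, 'x) ochart \<Rightarrow> bool" where
  "orbifold_chart P T c \<longleftrightarrow>
     open (cdom c) \<and> connected (cdom c) \<and> cdom c \<noteq> {} \<and>
     finite (cgrp c) \<and> subgroup (cgrp c) (BijGroup (cdom c)) \<and> (\<forall>\<gamma>\<in>cgrp c. P (cdom c) \<gamma>) \<and>
     continuous_map (top_of_set (cdom c)) T (cpar c) \<and> open_map (top_of_set (cdom c)) T (cpar c) \<and>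
     (\<forall>z\<in>cdom c. \<forall>w\<in>cdom c. cpar c z = cpar c w \<longleftrightarrow> (\<exists>\<gamma>\<in>cgrp c. \<gamma> z = w))"

definition transition ::
  "('e::topological_space set \<Rightarrow> ('e \<Rightarrow> 'e) \<Rightarrow> bool) \<Rightarrow> ('e, 'x) ochart \<Rightarrow> ('e, 'x) ochart
    \<Rightarrow> 'e set \<Rightarrow> ('e \<Rightarrow> 'e) \<Rightarrow> bool" where
  "transition P c d W l \<longleftrightarrow>
     open W \<and> W \<subseteq> cdom c \<and> open (l ` W) \<and> l ` W \<subseteq> cdom d \<and>
     inj_on l W \<and> P W l \<and> P (l ` W) (inv_into W l) \<and> (\<forall>z\<in>W. cpar d (l z) = cpar c z)"

definition orbifold ::
  "('e::topological_space set \<Rightarrow> ('e \<Rightarrow> 'e) \<Rightarrow> bool) \<Rightarrow> 'x topology \<Rightarrow> ('e, 'x) ochart set \<Rightarrow> bool" where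
  "orbifold P T A \<longleftrightarrow>
     Hausdorff_space T \<and> second_countable T \<and>
     (\<forall>c\<in>A. orbifold_chart P T c) \<and> topspace T = (\<Union>c\<in>A. cimg c) \<and>
     (\<forall>c\<in>A. \<forall>d\<in>A. \<forall>z\<in>cdom c. \<forall>w\<in>cdom d. cpar c z = cpar d w \<longrightarrow>
        (\<exists>W l. transition P c d W l \<and> z \<in> W \<and> l z = w))"

definition manifold ::
  "('e::topological_space set \<Rightarrow> ('e \<Rightarrow> 'e) \<Rightarrow> bool) \<Rightarrow> 'x topology \<Rightarrow> ('e, 'x) ochart set \<Rightarrow> bool" where
  "manifold P T A \<longleftrightarrow> orbifold P T A \<and> (\<forall>c\<in>A. cgrp c = {\<lambda>z\<in>cdom c. z})"

definition smooth_fun ::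
  "('e::real_normed_vector, 'x) ochart set \<Rightarrow> ('x \<Rightarrow> 'b::real_normed_vector) \<Rightarrow> bool" where
  "smooth_fun A u \<longleftrightarrow> (\<forall>c\<in>A. smooth_on (cdom c) (u \<circ> cpar c))"

definition smooth_into ::
  "'x topology \<Rightarrow> ('e::real_normed_vector, 'x) ochart set \<Rightarrow> 's::real_normed_vector set
    \<Rightarrow> ('s \<Rightarrow> 'x) \<Rightarrow> bool" where
  \<comment> \<open>for open \<open>S\<close> and a manifold \<open>(T, A)\<close>\<close>
  "smooth_into T A S F \<longleftrightarrow> F ` S \<subseteq> topspace T \<and>
     (\<forall>d\<in>A. open {s \<in> S. F s \<in> cimg d} \<and> smooth_on {s \<in> S. F s \<in> cimg d} (coords d \<circ> F))"

section \<open>Kaehler metrics, Ricci form, first Chern class\<close>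

text \<open>A Kaehler structure assigns to each chart the matrix \<open>g\<^sub>\<alpha>\<^sub>\<beta>\<close> as a function of the coordinates;
  the Kaehler form is \<open>form11\<close> of this matrix.\<close>

type_synonym ('n, 'x) htensor =
  "(complex^'n, 'x) ochart \<Rightarrow> complex^'n \<Rightarrow> complex^'n^'n"

definition kahler_metric :: "(complex^'n, 'x) ochart set \<Rightarrow> ('n::finite, 'x) htensor \<Rightarrow> bool" where
  "kahler_metric A h \<longleftrightarrow>
     (\<forall>c\<in>A. smooth_on (cdom c) (h c) \<and>
        (\<forall>z\<in>cdom c.
           (\<forall>\<alpha> \<beta>. h c z $ \<beta> $ \<alpha> = cnj (h c z $ \<alpha> $ \<beta>)) \<and>
           (\<forall>v. v \<noteq> 0 \<longrightarrow> 0 < Re (hform (h c z) v v)) \<and>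
           (\<forall>u v w. ext_deriv2 (\<lambda>y. form11 (h c y)) z u v w = 0))) \<and>
     (\<forall>c\<in>A. \<forall>d\<in>A. \<forall>W l. transition holo_on c d W l \<longrightarrow>
        (\<forall>z\<in>W. \<forall>v w. hform (h c z) v w =
           hform (h d (l z)) (frechet_derivative l (at z) v) (frechet_derivative l (at z) w)))"

definition ricci_form ::
  "(complex^'n \<Rightarrow> complex^'n^'n) \<Rightarrow> complex^'n \<Rightarrow> complex^'n \<Rightarrow> complex^'n \<Rightarrow> complex" where
  "ricci_form a z = form11 (- ddbar (\<lambda>y. complex_of_real (ln (Re (det (a y))))) z)"

definition one_form ::
  "(complex^'n, 'x) ochart set \<Rightarrow>
    ((complex^'n, 'x) ochart \<Rightarrow> complex^'n \<Rightarrow> complex^'n \<Rightarrow> real) \<Rightarrow> bool" where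
  "one_form A \<theta> \<longleftrightarrow>
     (\<forall>c\<in>A. (\<forall>z\<in>cdom c. linear (\<theta> c z)) \<and> (\<forall>v. smooth_on (cdom c) (\<lambda>z. \<theta> c z v))) \<and>
     (\<forall>c\<in>A. \<forall>d\<in>A. \<forall>W l. transition holo_on c d W l \<longrightarrow>
        (\<forall>z\<in>W. \<forall>v. \<theta> c z v = \<theta> d (l z) (frechet_derivative l (at z) v)))"

text \<open>The first Chern class is the de Rham class of the Ricci form.\<close>

definition represents_c1 :: "(complex^'n, 'x) ochart set \<Rightarrow> ('n::finite, 'x) htensor \<Rightarrow> bool" where
  "represents_c1 A h \<longleftrightarrow>
     (\<exists>\<theta>. one_form A \<theta> \<and>
        (\<forall>c\<in>A. \<forall>z\<in>cdom c. \<forall>v w.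
           ricci_form (h c) z v w - form11 (h c z) v w = complex_of_real (ext_deriv1 (\<theta> c) z v w)))"

text \<open>Fano in the sense that the Kaehler form lies in the first Chern class; compactness is
  stated separately where it is wanted, since a ray reduced space need not be compact.\<close>

definition fano_kahler ::
  "'x topology \<Rightarrow> (complex^'n, 'x) ochart set \<Rightarrow> ('n::finite, 'x) htensor \<Rightarrow> bool" where
  "fano_kahler T A h \<longleftrightarrow> orbifold holo_on T A \<and> kahler_metric A h \<and> represents_c1 A h"

definition ricci_potential ::
  "(complex^'n, 'x) ochart set \<Rightarrow> ('n::finite, 'x) htensor \<Rightarrow> ('x \<Rightarrow> real) \<Rightarrow> bool" where
  "ricci_potential A h f \<longleftrightarrow> smooth_fun A f \<and>
     (\<forall>c\<in>A. \<forall>z\<in>cdom c. \<forall>v w.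
        ricci_form (h c) z v w - form11 (h c z) v w =
        form11 (ddbar (\<lambda>y. complex_of_real (f (cpar c y))) z) v w)"

section \<open>Lie groups\<close>

definition lie_group ::
  "('g, 'b) monoid_scheme \<Rightarrow> 'g topology \<Rightarrow> (real^'p, 'g) ochart set \<Rightarrow> bool" where
  "lie_group G TG E \<longleftrightarrow> group G \<and> topspace TG = carrier G \<and> manifold smooth_on TG E \<and>
     (\<forall>a\<in>E. \<forall>b\<in>E. smooth_into TG E (cdom a \<times> cdom b)
        (\<lambda>(s, t). cpar a s \<otimes>\<^bsub>G\<^esub> cpar b t)) \<and>
     (\<forall>a\<in>E. smooth_into TG E (cdom a) (\<lambda>s. inv\<^bsub>G\<^esub> (cpar a s)))"

text \<open>The Lie algebra, i.e. the tangent space at the identity, is identified with \<open>real^'p\<close> by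
  means of a chart \<open>e\<close> around the identity.\<close>

definition Ad ::
  "('g, 'b) monoid_scheme \<Rightarrow> (real^'p, 'g) ochart \<Rightarrow> 'g \<Rightarrow> real^'p \<Rightarrow> real^'p" where
  "Ad G e g = frechet_derivative
     (\<lambda>s. coords e (g \<otimes>\<^bsub>G\<^esub> cpar e s \<otimes>\<^bsub>G\<^esub> inv\<^bsub>G\<^esub> g)) (at (coords e \<one>\<^bsub>G\<^esub>))"

definition coadjoint ::
  "('g, 'b) monoid_scheme \<Rightarrow> (real^'p, 'g) ochart \<Rightarrow> 'g \<Rightarrow> (real^'p \<Rightarrow> real) \<Rightarrow> real^'p \<Rightarrow> real" where
  "coadjoint G e g \<mu> = (\<lambda>\<xi>. \<mu> (Ad G e (inv\<^bsub>G\<^esub> g) \<xi>))"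

definition isotropy ::
  "('g, 'b) monoid_scheme \<Rightarrow> (real^'p, 'g) ochart \<Rightarrow> (real^'p \<Rightarrow> real) \<Rightarrow> 'g set" where
  "isotropy G e \<mu> = {g \<in> carrier G. coadjoint G e g \<mu> = \<mu>}"

definition one_parameter ::
  "('g, 'b) monoid_scheme \<Rightarrow> 'g topology \<Rightarrow> (real^'p, 'g) ochart set \<Rightarrow> (real \<Rightarrow> 'g) \<Rightarrow> bool" where
  "one_parameter G TG E \<gamma> \<longleftrightarrow> smooth_into TG E UNIV \<gamma> \<and> (\<forall>s t. \<gamma> (s + t) = \<gamma> s \<otimes>\<^bsub>G\<^esub> \<gamma> t)"

definition lie_algebra_of ::
  "('g, 'b) monoid_scheme \<Rightarrow> 'g topology \<Rightarrow> (real^'p, 'g) ochart set \<Rightarrow> (real^'p, 'g) ochart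
    \<Rightarrow> 'g set \<Rightarrow> (real^'p) set" where
  \<comment> \<open>for a closed subgroup \<open>H\<close>: the set of \<open>\<xi>\<close> with \<open>exp (t \<xi>) \<in> H\<close> for all \<open>t\<close>\<close>
  "lie_algebra_of G TG E e H =
     {vector_derivative (\<lambda>t. coords e (\<gamma> t)) (at 0) | \<gamma>. one_parameter G TG E \<gamma> \<and> range \<gamma> \<subseteq> H}"

definition isotropy_algebra ::
  "('g, 'b) monoid_scheme \<Rightarrow> 'g topology \<Rightarrow> (real^'p, 'g) ochart set \<Rightarrow> (real^'p, 'g) ochart
    \<Rightarrow> (real^'p \<Rightarrow> real) \<Rightarrow> (real^'p) set" where
  "isotropy_algebra G TG E e \<mu> = lie_algebra_of G TG E e (isotropy G e \<mu>)"

definition kernel_algebra ::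
  "('g, 'b) monoid_scheme \<Rightarrow> 'g topology \<Rightarrow> (real^'p, 'g) ochart set \<Rightarrow> (real^'p, 'g) ochart
    \<Rightarrow> (real^'p \<Rightarrow> real) \<Rightarrow> (real^'p) set" where
  "kernel_algebra G TG E e \<mu> = {\<xi> \<in> isotropy_algebra G TG E e \<mu>. \<mu> \<xi> = 0}"

text \<open>A compact Lie subgroup is closed, and closed subgroups are Lie subgroups (Cartan), so
  compactness takes the place of a separate manifold structure on the subgroup.\<close>

definition compact_kernel_group ::
  "('g, 'b) monoid_scheme \<Rightarrow> 'g topology \<Rightarrow> (real^'p, 'g) ochart set \<Rightarrow> (real^'p, 'g) ochart
    \<Rightarrow> (real^'p \<Rightarrow> real) \<Rightarrow> 'g set \<Rightarrow> bool" where
  "compact_kernel_group G TG E e \<mu> K \<longleftrightarrow>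
     normal K (G\<lparr>carrier := isotropy G e \<mu>\<rparr>) \<and> compactin TG K \<and> connectedin TG K \<and>
     lie_algebra_of G TG E e K = kernel_algebra G TG E e \<mu>"

section \<open>Actions and momentum map\<close>

definition smooth_action ::
  "('g, 'b) monoid_scheme \<Rightarrow> (real^'p, 'g) ochart set \<Rightarrow> 'm topology \<Rightarrow> (complex^'n, 'm) ochart set
    \<Rightarrow> ('g \<Rightarrow> 'm \<Rightarrow> 'm) \<Rightarrow> bool" where
  "smooth_action G E T A act \<longleftrightarrow> group_action G (topspace T) act \<and>
     (\<forall>a\<in>E. \<forall>c\<in>A. smooth_into T A (cdom a \<times> cdom c) (\<lambda>(s, z). act (cpar a s) (cpar c z)))"

definition holomorphic_isometry ::
  "(complex^'n, 'm) ochart set \<Rightarrow> ('n::finite, 'm) htensor \<Rightarrow> ('m \<Rightarrow> 'm) \<Rightarrow> bool" where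
  "holomorphic_isometry A h F \<longleftrightarrow>
     (\<forall>c\<in>A. \<forall>d\<in>A. let W = {z \<in> cdom c. F (cpar c z) \<in> cimg d}; l = coords d \<circ> F \<circ> cpar c in
        open W \<and> holo_on W l \<and>
        (\<forall>z\<in>W. \<forall>v w. hform (h c z) v w =
           hform (h d (l z)) (frechet_derivative l (at z) v) (frechet_derivative l (at z) w)))"

definition generator ::
  "('g, 'b) monoid_scheme \<Rightarrow> (real^'p, 'g) ochart \<Rightarrow> ('g \<Rightarrow> 'm \<Rightarrow> 'm)
    \<Rightarrow> (complex^'n, 'm) ochart \<Rightarrow> complex^'n \<Rightarrow> real^'p \<Rightarrow> complex^'n" where
  \<comment> \<open>components of \<open>\<xi>\<^sub>M\<close>, and of its (1,0)-part, at the point with coordinates \<open>z\<close>\<close>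
  "generator G e act c z = frechet_derivative
     (\<lambda>s. coords c (act (cpar e s) (cpar c z))) (at (coords e \<one>\<^bsub>G\<^esub>))"

definition momentum_map ::
  "('g, 'b) monoid_scheme \<Rightarrow> (real^'p, 'g) ochart \<Rightarrow> ('g \<Rightarrow> 'm \<Rightarrow> 'm)
    \<Rightarrow> (complex^'n, 'm) ochart set \<Rightarrow> ('n::finite, 'm) htensor \<Rightarrow> ('m \<Rightarrow> real)
    \<Rightarrow> 'm topology \<Rightarrow> ('m \<Rightarrow> real^'p \<Rightarrow> real) \<Rightarrow> bool" where
  "momentum_map G e act A h f T J \<longleftrightarrow>
     (\<forall>\<xi>. \<exists>u :: 'm \<Rightarrow> complex. smooth_fun A u \<and>
        (\<forall>c\<in>A. \<forall>z\<in>cdom c.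
           grad10 (h c z) (u \<circ> cpar c) z = generator G e act c z \<xi> \<and>
           laplace_f (h c z) (f \<circ> cpar c) (u \<circ> cpar c) z = u (cpar c z)) \<and>
        (\<forall>x\<in>topspace T. complex_of_real (J x \<xi>) = \<i> / (2 * of_real pi) * u x))"

section \<open>Ray reduction\<close>

definition ray_preimage ::
  "'m topology \<Rightarrow> ('m \<Rightarrow> real^'p \<Rightarrow> real) \<Rightarrow> (real^'p \<Rightarrow> real) \<Rightarrow> 'm set" where
  "ray_preimage T J \<mu> = {x \<in> topspace T. \<exists>r>0. J x = (\<lambda>\<xi>. r * \<mu> \<xi>)}"

definition dJ ::
  "('m \<Rightarrow> real^'p \<Rightarrow> real) \<Rightarrow> (complex^'n, 'm) ochart \<Rightarrow> complex^'n \<Rightarrow> complex^'n \<Rightarrow> real^'p \<Rightarrow> real" where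
  "dJ J c z v = (\<lambda>\<xi>. frechet_derivative (\<lambda>y. J (cpar c y) \<xi>) (at z) v)"

definition transverse_to_ray ::
  "(complex^'n, 'm) ochart set \<Rightarrow> 'm topology \<Rightarrow> ('m \<Rightarrow> real^'p \<Rightarrow> real) \<Rightarrow> (real^'p \<Rightarrow> real) \<Rightarrow> bool" where
  "transverse_to_ray A T J \<mu> \<longleftrightarrow>
     (\<forall>c\<in>A. \<forall>z\<in>cdom c. cpar c z \<in> ray_preimage T J \<mu> \<longrightarrow>
        (\<forall>\<nu>. linear \<nu> \<longrightarrow> (\<exists>v t. \<nu> = (\<lambda>\<xi>. dJ J c z v \<xi> + t * \<mu> \<xi>))))"

text \<open>The tangent space of the (transverse) preimage of the ray, and the orthogonal complement
  in it of the orbit directions of the kernel group.\<close>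

definition ray_tangent ::
  "('m \<Rightarrow> real^'p \<Rightarrow> real) \<Rightarrow> (real^'p \<Rightarrow> real) \<Rightarrow> (complex^'n, 'm) ochart \<Rightarrow> complex^'n
    \<Rightarrow> (complex^'n) set" where
  "ray_tangent J \<mu> c z = {v. \<exists>t. dJ J c z v = (\<lambda>\<xi>. t * \<mu> \<xi>)}"

definition horizontal ::
  "('m \<Rightarrow> real^'p \<Rightarrow> real) \<Rightarrow> (real^'p \<Rightarrow> real) \<Rightarrow> ('n::finite, 'm) htensor
    \<Rightarrow> ((complex^'n, 'm) ochart \<Rightarrow> complex^'n \<Rightarrow> real^'p \<Rightarrow> complex^'n) \<Rightarrow> (real^'p) set
    \<Rightarrow> (complex^'n, 'm) ochart \<Rightarrow> complex^'n \<Rightarrow> (complex^'n) set" where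
  "horizontal J \<mu> h gen k c z =
     {v \<in> ray_tangent J \<mu> c z. \<forall>\<xi>\<in>k. Re (hform (h c z) v (gen c z \<xi>)) = 0}"

text \<open>The Kaehler structure \<open>(B, hr)\<close> on the quotient is the projected one: locally the quotient
  map \<open>\<pi>\<close> on \<open>N\<close> lifts to a smooth map \<open>p\<close> into the orbifold chart (extended off \<open>N\<close>) whose
  derivative maps the horizontal spaces, which are invariant under the complex structure,
  complex-linearly and isometrically onto the tangent spaces.\<close>

definition projected_kahler ::
  "(complex^'n, 'm) ochart set \<Rightarrow> ('n::finite, 'm) htensor
    \<Rightarrow> ((complex^'n, 'm) ochart \<Rightarrow> complex^'n \<Rightarrow> (complex^'n) set) \<Rightarrow> 'm set \<Rightarrow> ('m \<Rightarrow> 'y)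
    \<Rightarrow> (complex^'q, 'y) ochart set \<Rightarrow> ('q::finite, 'y) htensor \<Rightarrow> bool" where
  "projected_kahler A h H N \<pi> B hr \<longleftrightarrow>
     (\<forall>c\<in>A. \<forall>z\<in>cdom c. cpar c z \<in> N \<longrightarrow>
        (\<forall>v\<in>H c z. \<i> *s v \<in> H c z) \<and>
        (\<forall>b\<in>B. \<forall>w\<in>cdom b. cpar b w = \<pi> (cpar c z) \<longrightarrow>
           (\<exists>W p. open W \<and> z \<in> W \<and> W \<subseteq> cdom c \<and> smooth_on W p \<and> p ` W \<subseteq> cdom b \<and> p z = w \<and>
              (\<forall>y\<in>W. cpar c y \<in> N \<longrightarrow>
                 cpar b (p y) = \<pi> (cpar c y) \<and>
                 frechet_derivative p (at y) ` H c y = UNIV \<and>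
                 (\<forall>v\<in>H c y. frechet_derivative p (at y) (\<i> *s v)
                            = \<i> *s frechet_derivative p (at y) v) \<and>
                 (\<forall>v\<in>H c y. \<forall>v'\<in>H c y.
                    hform (hr b (p y)) (frechet_derivative p (at y) v) (frechet_derivative p (at y) v')
                    = hform (h c y) v v')))))"

definition ray_projection ::
  "('g, 'b) monoid_scheme \<Rightarrow> 'g set \<Rightarrow> ('g \<Rightarrow> 'm \<Rightarrow> 'm) \<Rightarrow> 'm \<Rightarrow> 'm set" where
  "ray_projection G K act x = orbit (G\<lparr>carrier := K\<rparr>) act x"

definition proper_action_on :: "'g topology \<Rightarrow> 'g set \<Rightarrow> 'm topology \<Rightarrow> 'm set \<Rightarrow> ('g \<Rightarrow> 'm \<Rightarrow> 'm) \<Rightarrow> bool" where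
  "proper_action_on TG K T N act \<longleftrightarrow>
     proper_map (prod_topology (subtopology TG K) (subtopology T N))
       (prod_topology (subtopology T N) (subtopology T N)) (\<lambda>(k, x). (x, act k x))"

text \<open>The quotient of \<open>N\<close> by the kernel group, with the quotient topology \<open>Y\<close>, is a Kaehler
  orbifold with the projected structure.\<close>

definition ray_reduced_kahler_orbifold ::
  "('g, 'b) monoid_scheme \<Rightarrow> 'g topology \<Rightarrow> (real^'p, 'g) ochart set \<Rightarrow> (real^'p, 'g) ochart
    \<Rightarrow> 'm topology \<Rightarrow> (complex^'n, 'm) ochart set \<Rightarrow> ('n::finite, 'm) htensor
    \<Rightarrow> ('g \<Rightarrow> 'm \<Rightarrow> 'm) \<Rightarrow> ('m \<Rightarrow> real^'p \<Rightarrow> real) \<Rightarrow> (real^'p \<Rightarrow> real) \<Rightarrow> 'g set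
    \<Rightarrow> 'm set topology \<Rightarrow> (complex^'q, 'm set) ochart set \<Rightarrow> ('q::finite, 'm set) htensor \<Rightarrow> bool" where
  "ray_reduced_kahler_orbifold G TG E e T A h act J \<mu> K Y B hr \<longleftrightarrow>
     {a + b | a b. \<mu> a = 0 \<and> b \<in> isotropy_algebra G TG E e \<mu>} = UNIV \<and>
     transverse_to_ray A T J \<mu> \<and>
     proper_action_on TG K T (ray_preimage T J \<mu>) act \<and>
     quotient_map (subtopology T (ray_preimage T J \<mu>)) Y (ray_projection G K act) \<and>
     orbifold holo_on Y B \<and> kahler_metric B hr \<and>
     projected_kahler A h
       (horizontal J \<mu> h (generator G e act) (kernel_algebra G TG E e \<mu>))
       (ray_preimage T J \<mu>) (ray_projection G K act) B hr"

definition descend :: "('m \<Rightarrow> 'b) \<Rightarrow> 'm set \<Rightarrow> 'b" where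
  "descend F y = F (SOME x. x \<in> y)"

section \<open>Multivectors\<close>

definition basis_of :: "'v::real_vector set \<Rightarrow> 'v list \<Rightarrow> bool" where
  "basis_of S bs \<longleftrightarrow> distinct bs \<and> independent (set bs) \<and> span (set bs) = S"

definition orthogonal_list :: "complex^'n^'n \<Rightarrow> (complex^'n) list \<Rightarrow> bool" where
  "orthogonal_list a vs \<longleftrightarrow> 0 \<notin> set vs \<and>
     (\<forall>i<length vs. \<forall>j<length vs. i \<noteq> j \<longrightarrow> Re (hform a (vs ! i) (vs ! j)) = 0)"

text \<open>Norm of the wedge product of (1,0)-vectors: square root of the Gram determinant.\<close>

definition mv_norm :: "complex^'n^'n \<Rightarrow> (complex^'n) list \<Rightarrow> real" where
  "mv_norm a vs = sqrt (Re (\<Sum>p | p permutes {..<length vs}.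
     of_int (sign p) * (\<Prod>i<length vs. hform a (vs ! i) (vs ! p i))))"

definition wedge_norm ::
  "(complex^'n, 'm) ochart set \<Rightarrow> ('n::finite, 'm) htensor
    \<Rightarrow> ((complex^'n, 'm) ochart \<Rightarrow> complex^'n \<Rightarrow> real^'p \<Rightarrow> complex^'n) \<Rightarrow> (real^'p) list
    \<Rightarrow> 'm \<Rightarrow> real" where
  "wedge_norm A h gen bs x =
     (let c = SOME c. c \<in> A \<and> x \<in> cimg c; z = coords c x in mv_norm (h c z) (map (gen c z) bs))"

definition adapted_frames ::
  "(complex^'n, 'm) ochart set \<Rightarrow> ('n::finite, 'm) htensor
    \<Rightarrow> ((complex^'n, 'm) ochart \<Rightarrow> complex^'n \<Rightarrow> real^'p \<Rightarrow> complex^'n) \<Rightarrow> 'm set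
    \<Rightarrow> (real^'p) list \<Rightarrow> bool" where
  "adapted_frames A h gen N bs \<longleftrightarrow>
     (\<forall>c\<in>A. \<forall>z\<in>cdom c. cpar c z \<in> N \<longrightarrow> orthogonal_list (h c z) (map (gen c z) bs))"

end

theory Submission
  imports Defs
begin

text \<open>On the quotient choose a local section \<open>s\<close> of the projection from the preimage \<open>N\<close> of the ray.  It is only
  holomorphic modulo the orbit directions: \<open>dzbar i s = \<Sum>\<^sub>j a\<^sub>i\<^sub>j X\<^sub>j\<close> for the generators \<open>X\<^sub>j\<close> of \<open>\<xi>s\<close>.  Let
  \<open>\<tau>\<close> be the determinant of the frame consisting of the \<open>X\<^sub>j\<close> and the \<open>dz m s\<close>, and put \<open>\<Phi> = ln det h + f\<close>.  Comparing
  Gram determinants, \<open>\<bar>\<tau>\<bar>\<^sup>2 det h = (\<Prod>\<^sub>j \<parallel>X\<^sub>j\<parallel>\<^sup>2) det hr\<close>, so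
  \<open>ln det hr + f + ln \<Prod>\<^sub>j \<parallel>X\<^sub>j\<parallel>\<^sup>2 = ln \<bar>\<tau>\<bar>\<^sup>2 + \<Phi> \<circ> s\<close>.  Compactness of \<open>K\<close> makes its Lie algebra unimodular, and the vanishing
  of the momentum map on it says \<open>div X\<^sub>j + X\<^sub>j \<Phi> = 0\<close> along \<open>N\<close>; together these make the antiholomorphic derivatives
  of \<open>ln \<tau>\<close> cancel the failure of \<open>s\<close> to be holomorphic.  Hence \<open>ddbar\<close> of the right hand side is \<open>ddbar \<Phi> = - h\<close>
  evaluated on horizontal vectors, which is \<open>- hr\<close>.

  Since the horizontal spaces are complex and the multivector does not vanish, \<open>\<eta>s\<close> is empty as soon as \<open>N\<close> is not,
  so the norm of the multivector is the product of the \<open>\<parallel>X\<^sub>j\<parallel>\<close>.  Finally \<open>form11 (ddbar F)\<close> is the exterior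
  derivative of \<open>v \<mapsto> - dF(\<i> v) / 4\<pi>\<close>, whence the statement about the first Chern class.\<close>

section \<open>Smooth maps\<close>

text \<open>In general \<open>N\<close> contains no holomorphic slice. If \<open>s\<close> were
  holomorphic, \<open>\<tau>\<close> would be holomorphic too and
  \<open>ln \<bar>\<tau>\<bar>\<^sup>2\<close> would contribute nothing to \<open>ddbar\<close>. In
  fact \<open>dzbar i\<close> moves the columns of the frame by the Jacobian of
  \<open>\<Sum>\<^sub>l a\<^sub>i\<^sub>l X\<^sub>l\<close> (coefficients frozen), up to
  combinations of the \<open>X\<^sub>j\<close>. The Jacobian adds the divergences of the
  \<open>X\<^sub>l\<close> to \<open>dzbar i (ln \<tau>)\<close>; the combinations add traces of
  \<open>ad\<close>, which is where unimodularity enters. The momentum condition then rewrites the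
  divergences as derivatives of \<open>\<Phi>\<close>, precisely those that the chain rule for
  \<open>\<Phi> \<circ> s\<close> produces with the opposite sign. Why only horizontal vectors
  remain: the slice stays where the momentum map vanishes on the kernel algebra, so the vertical
  part of its derivative has real coefficients. The vertical coefficients of \<open>dz i s\<close>
  are therefore conjugate to those of \<open>dzbar i s\<close>, and their contributions to
  \<open>ddbar\<close> cancel in pairs.\<close>

lemma frechet_eq: "(f has_derivative f') (at x) \<Longrightarrow> frechet_derivative f (at x) = f'"
  by (rule frechet_derivative_at[symmetric])

text \<open>The derivative at a point depends on a neighbourhood, so agreement on an open set passes
  to the derivatives of every order. The induction therefore generalizes over both
  functions.\<close>

lemma Ck_on_cong:
  assumes "open S" "\<And>x. x \<in> S \<Longrightarrow> f x = g x" "Ck_on k S f"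
  shows "Ck_on k S g"
  using assms(2,3)
proof (induction k arbitrary: f g)
  case 0
  then show ?case using continuous_on_cong[OF refl] by (metis Ck_on.simps(1))
next
  case (Suc k)
  have d: "(g has_derivative frechet_derivative f (at x)) (at x)" if "x \<in> S" for x
    using Suc.prems that assms(1) has_derivative_transform_within_open
    by (metis Ck_on.simps(2) frechet_derivative_works)
  have "Ck_on k S (\<lambda>x. frechet_derivative g (at x) v)" for v
    by (rule Suc.IH[of "\<lambda>x. frechet_derivative f (at x) v"])
      (use Suc.prems in \<open>simp_all add: frechet_eq[OF d]\<close>)
  moreover have "\<forall>x\<in>S. g differentiable (at x)" using d by (blast intro: differentiableI)
  ultimately show ?case by simp
qed

text \<open>\<open>Ck_on\<close> controls derivatives in fixed directions only. Expanding a
  direction that varies with the point reduces it to finitely many fixed ones.\<close>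

lemma linear_eq_sum_Basis:
  fixes f :: "'a::euclidean_space \<Rightarrow> 'b::real_vector"
  assumes "linear f"
  shows "f w = (\<Sum>b\<in>Basis. (w \<bullet> b) *\<^sub>R f b)"
proof -
  have "f w = f (\<Sum>b\<in>Basis. (w \<bullet> b) *\<^sub>R b)" by (simp only: euclidean_representation)
  also have "\<dots> = (\<Sum>b\<in>Basis. (w \<bullet> b) *\<^sub>R f b)" by (simp only: linear_sum[OF assms] linear_cmul[OF assms])
  finally show ?thesis .
qed

lemma Ck_on_SucI:
  assumes "open S" "\<And>x. x \<in> S \<Longrightarrow> (f has_derivative f' x) (at x)" "\<And>v. Ck_on k S (\<lambda>x. f' x v)"
  shows "Ck_on (Suc k) S f"
proof -
  have "Ck_on k S (\<lambda>x. frechet_derivative f (at x) v)" for v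
    by (rule Ck_on_cong[OF assms(1) _ assms(3)[of v]]) (simp add: frechet_eq[OF assms(2)])
  then show ?thesis using assms(2) by (auto intro: differentiableI)
qed

lemma Ck_on_Suc_has_derivative:
  "Ck_on (Suc k) S f \<Longrightarrow> x \<in> S \<Longrightarrow> (f has_derivative frechet_derivative f (at x)) (at x)"
  using frechet_derivative_works by auto

lemma Ck_on_Suc_imp: "Ck_on (Suc k) S f \<Longrightarrow> Ck_on k S f"
proof (induction k arbitrary: f)
  case 0
  then show ?case
    by (auto intro!: continuous_at_imp_continuous_on differentiable_imp_continuous_within)
next
  case (Suc k)
  then show ?case by (metis Ck_on.simps(2))
qed

lemma Ck_on_subset: "Ck_on k S f \<Longrightarrow> T \<subseteq> S \<Longrightarrow> Ck_on k T f"
  by (induction k arbitrary: f) (auto intro: continuous_on_subset)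

lemma Ck_on_local:
  assumes "\<And>x. x \<in> S \<Longrightarrow> \<exists>U. open U \<and> x \<in> U \<and> Ck_on k U f"
  shows "Ck_on k S f"
  using assms
proof (induction k arbitrary: f)
  case 0
  then show ?case
    by (metis Ck_on.simps(1) continuous_at_imp_continuous_on continuous_on_eq_continuous_at)
next
  case (Suc k)
  have "f differentiable (at x)" if "x \<in> S" for x using Suc.prems[OF that] by auto
  moreover have "Ck_on k S (\<lambda>x. frechet_derivative f (at x) v)" for v
    by (rule Suc.IH) (metis Suc.prems Ck_on.simps(2))
  ultimately show ?case by simp
qed

lemma Ck_on_const: "Ck_on k S (\<lambda>x. c)"
  by (induction k arbitrary: c) auto

lemma Ck_on_bounded_linear:
  assumes "open S" "bounded_linear L" "Ck_on k S f"
  shows "Ck_on k S (\<lambda>x. L (f x))"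
  using assms(3)
proof (induction k arbitrary: f)
  case 0
  then show ?case using assms(2) bounded_linear.continuous_on by auto
next
  case (Suc k)
  show ?case
    by (rule Ck_on_SucI[OF assms(1) bounded_linear.has_derivative[OF assms(2)]], 
        rule Ck_on_Suc_has_derivative[OF Suc.prems]) (use Suc in auto)
qed

lemma Ck_on_add:
  assumes "open S" "Ck_on k S f" "Ck_on k S g"
  shows "Ck_on k S (\<lambda>x. f x + g x)"
  using assms(2,3)
proof (induction k arbitrary: f g)
  case 0
  then show ?case by (auto intro: continuous_on_add)
next
  case (Suc k)
  show ?case
    by (rule Ck_on_SucI[OF assms(1) has_derivative_add], 
        rule Ck_on_Suc_has_derivative[OF Suc.prems(1)], assumption,
        rule Ck_on_Suc_has_derivative[OF Suc.prems(2)]) (use Suc in auto)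
qed

lemma Ck_on_sum:
  assumes "open S" "\<And>i. i \<in> I \<Longrightarrow> Ck_on k S (f i)"
  shows "Ck_on k S (\<lambda>x. \<Sum>i\<in>I. f i x)"
  using assms(2)
  by (induction I rule: infinite_finite_induct) (auto intro!: Ck_on_const Ck_on_add[OF assms(1)])

text \<open>The product rule leaves one factor undifferentiated, so the induction step also uses
  both hypotheses one order lower.\<close>

lemma Ck_on_bilinear:
  assumes "open S" "bounded_bilinear B" "Ck_on k S f" "Ck_on k S g"
  shows "Ck_on k S (\<lambda>x. B (f x) (g x))"
  using assms(3,4)
proof (induction k arbitrary: f g)
  case 0
  then show ?case using bounded_bilinear.continuous_on[OF assms(2)] by auto
next
  case (Suc k)
  note IH = Suc.IH and pr = Suc.prems
  show ?case
    by (rule Ck_on_SucI[OF assms(1) bounded_bilinear.FDERIV[OF assms(2)]], 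
        rule Ck_on_Suc_has_derivative[OF pr(1)], assumption,
        rule Ck_on_Suc_has_derivative[OF pr(2)], assumption,
        intro Ck_on_add[OF assms(1)] IH)
      (use pr Ck_on_Suc_imp[OF pr(1)] Ck_on_Suc_imp[OF pr(2)] in auto)
qed

text \<open>In the chain rule the derivative of \<open>g\<close> is taken in the moving direction
  \<open>frechet_derivative f (at x) v\<close>. Its basis expansion is a sum of products, and the
  induction hypothesis, applied to the partial derivatives of \<open>g\<close> instead of
  \<open>g\<close>, covers one factor.\<close>

lemma Ck_on_compose:
  fixes g :: "'b::euclidean_space \<Rightarrow> 'c::real_normed_vector"
  assumes "open S" "open T" "Ck_on k S f" "Ck_on k T g" "f ` S \<subseteq> T"
  shows "Ck_on k S (\<lambda>x. g (f x))"
  using assms(3-)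
proof (induction k arbitrary: g)
  case 0
  then show ?case by (auto intro: continuous_on_compose2)
next
  case (Suc k)
  have d: "((\<lambda>x. g (f x)) has_derivative
      (\<lambda>v. \<Sum>b\<in>Basis. (frechet_derivative f (at x) v \<bullet> b) *\<^sub>R frechet_derivative g (at (f x)) b)) (at x)"
    if "x \<in> S" for x
  proof -
    have g: "(g has_derivative frechet_derivative g (at (f x))) (at (f x))"
      using Ck_on_Suc_has_derivative[OF Suc.prems(2)] that Suc.prems(3) by auto
    show ?thesis
      by (rule has_derivative_eq_rhs[OF has_derivative_compose[OF Ck_on_Suc_has_derivative[OF Suc.prems(1) that] g]])
        (rule ext, rule linear_eq_sum_Basis[OF has_derivative_linear[OF g]])
  qed
  have "Ck_on k S f" using Ck_on_Suc_imp[OF Suc.prems(1)] .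
  then have 1: "Ck_on k S (\<lambda>x. frechet_derivative g (at (f x)) b)" for b
    using Suc.IH[of "\<lambda>y. frechet_derivative g (at y) b"] Suc.prems by simp
  have 2: "Ck_on k S (\<lambda>x. frechet_derivative f (at x) v \<bullet> b)" for v b
    using Ck_on_bounded_linear[OF assms(1) bounded_linear_inner_left, of k "\<lambda>x. frechet_derivative f (at x) v" b]
      Suc.prems(1) by simp
  show ?case
  proof (rule Ck_on_SucI[OF assms(1) d])
    show "Ck_on k S (\<lambda>x. \<Sum>b\<in>Basis. (frechet_derivative f (at x) v \<bullet> b) *\<^sub>R frechet_derivative g (at (f x)) b)" for v
      by (rule Ck_on_sum[OF assms(1)], rule Ck_on_bilinear[OF assms(1) bounded_bilinear_scaleR 2 1])
  qed
qed

lemma Ck_on_ident: "open S \<Longrightarrow> Ck_on k S (\<lambda>x. x)"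
  by (cases k) (auto intro!: Ck_on_const continuous_on_id)

section \<open>Closure properties of smooth functions\<close>

lemma smooth_onI: "(\<And>k. Ck_on k S f) \<Longrightarrow> smooth_on S f" by (simp add: smooth_on_def)
lemma smooth_onD: "smooth_on S f \<Longrightarrow> Ck_on k S f" by (simp add: smooth_on_def)

lemma smooth_on_cong: "open S \<Longrightarrow> (\<And>x. x \<in> S \<Longrightarrow> f x = g x) \<Longrightarrow> smooth_on S f \<Longrightarrow> smooth_on S g"
  unfolding smooth_on_def using Ck_on_cong by blast

lemma smooth_on_has_derivative:
  "smooth_on S f \<Longrightarrow> x \<in> S \<Longrightarrow> (f has_derivative frechet_derivative f (at x)) (at x)"
  using Ck_on_Suc_has_derivative smooth_onD by blast

lemma smooth_on_differentiable: "smooth_on S f \<Longrightarrow> x \<in> S \<Longrightarrow> f differentiable (at x)"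
  using smooth_on_has_derivative differentiableI by blast

lemma smooth_on_frechet_derivative: "smooth_on S f \<Longrightarrow> smooth_on S (\<lambda>x. frechet_derivative f (at x) v)"
  unfolding smooth_on_def using Ck_on.simps(2) by blast

lemma smooth_on_continuous: "smooth_on S f \<Longrightarrow> continuous_on S f"
  unfolding smooth_on_def using Ck_on.simps(1) by blast

lemma smooth_on_subset: "smooth_on S f \<Longrightarrow> T \<subseteq> S \<Longrightarrow> smooth_on T f"
  unfolding smooth_on_def using Ck_on_subset by blast

lemma smooth_on_local: "(\<And>x. x \<in> S \<Longrightarrow> \<exists>U. open U \<and> x \<in> U \<and> smooth_on U f) \<Longrightarrow> smooth_on S f"
  unfolding smooth_on_def by (meson Ck_on_local)

lemma smooth_on_const: "smooth_on S (\<lambda>x. c)"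
  by (simp add: smooth_on_def Ck_on_const)

lemma smooth_on_ident: "open S \<Longrightarrow> smooth_on S (\<lambda>x. x)"
  by (simp add: smooth_on_def Ck_on_ident)

lemma smooth_on_bounded_linear: "bounded_linear L \<Longrightarrow> open S \<Longrightarrow> smooth_on S f \<Longrightarrow> smooth_on S (\<lambda>x. L (f x))"
  unfolding smooth_on_def using Ck_on_bounded_linear by blast

lemma smooth_on_linear:
  fixes L :: "'b::euclidean_space \<Rightarrow> 'c::real_normed_vector"
  shows "linear L \<Longrightarrow> open S \<Longrightarrow> smooth_on S f \<Longrightarrow> smooth_on S (\<lambda>x. L (f x))"
  by (simp add: linear_conv_bounded_linear smooth_on_bounded_linear)

lemma smooth_on_add: "open S \<Longrightarrow> smooth_on S f \<Longrightarrow> smooth_on S g \<Longrightarrow> smooth_on S (\<lambda>x. f x + g x)"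
  unfolding smooth_on_def using Ck_on_add by blast

lemma smooth_on_minus: "open S \<Longrightarrow> smooth_on S f \<Longrightarrow> smooth_on S (\<lambda>x. - f x)"
  by (rule smooth_on_bounded_linear[OF bounded_linear_minus[OF bounded_linear_ident]])

lemma smooth_on_diff: "open S \<Longrightarrow> smooth_on S f \<Longrightarrow> smooth_on S g \<Longrightarrow> smooth_on S (\<lambda>x. f x - g x)"
  using smooth_on_add[of S f "\<lambda>x. - g x"] smooth_on_minus[of S g] by simp

lemma smooth_on_sum:
  "open S \<Longrightarrow> (\<And>i. i \<in> I \<Longrightarrow> smooth_on S (f i)) \<Longrightarrow> smooth_on S (\<lambda>x. \<Sum>i\<in>I. f i x)"
  by (intro smooth_onI Ck_on_sum) (auto dest: smooth_onD)

lemma smooth_on_bilinear: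
  "bounded_bilinear B \<Longrightarrow> open S \<Longrightarrow> smooth_on S f \<Longrightarrow> smooth_on S g \<Longrightarrow> smooth_on S (\<lambda>x. B (f x) (g x))"
  unfolding smooth_on_def using Ck_on_bilinear by blast

lemmas smooth_on_mult = smooth_on_bilinear[OF bounded_bilinear_mult]

lemma smooth_on_prod:
  fixes f :: "'i \<Rightarrow> 'a::real_normed_vector \<Rightarrow> 'b::{real_normed_algebra,comm_ring_1}"
  assumes "open S" "\<And>i. i \<in> I \<Longrightarrow> smooth_on S (f i)"
  shows "smooth_on S (\<lambda>x. \<Prod>i\<in>I. f i x)"
  using assms(2)
  by (induction I rule: infinite_finite_induct) (auto intro!: smooth_on_const smooth_on_mult[OF assms(1)])

lemma smooth_on_compose:
  fixes g :: "'b::euclidean_space \<Rightarrow> 'c::real_normed_vector"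
  shows "smooth_on T g \<Longrightarrow> open S \<Longrightarrow> open T \<Longrightarrow> smooth_on S f \<Longrightarrow> f ` S \<subseteq> T \<Longrightarrow> smooth_on S (\<lambda>x. g (f x))"
  unfolding smooth_on_def using Ck_on_compose by blast

lemma smooth_on_Pair:
  fixes f :: "'a::real_normed_vector \<Rightarrow> 'b::real_normed_vector" and g :: "'a \<Rightarrow> 'c::real_normed_vector"
  assumes "open S" "smooth_on S f" "smooth_on S g"
  shows "smooth_on S (\<lambda>x. (f x, g x))"
proof -
  have "bounded_linear (\<lambda>x::'b. (x, 0::'c))" "bounded_linear (\<lambda>x::'c. (0::'b, x))"
    by (auto intro!: bounded_linear_Pair bounded_linear_ident bounded_linear_zero)
  from smooth_on_add[OF assms(1) smooth_on_bounded_linear[OF this(1) assms(1,2)]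
      smooth_on_bounded_linear[OF this(2) assms(1,3)]]
  show ?thesis by simp
qed

text \<open>The derivative of the reciprocal is a polynomial in the reciprocal itself and the
  derivative of \<open>f\<close>, so each order of regularity yields the next.\<close>

lemma smooth_on_inverse:
  fixes f :: "'a::real_normed_vector \<Rightarrow> 'b::real_normed_field"
  assumes "open S" "smooth_on S f" "\<And>x. x \<in> S \<Longrightarrow> f x \<noteq> 0"
  shows "smooth_on S (\<lambda>x. inverse (f x))"
proof (rule smooth_onI)
  show "Ck_on k S (\<lambda>x. inverse (f x))" for k
  proof (induction k)
    case 0
    then show ?case using assms smooth_on_continuous by (auto intro!: continuous_on_inverse)
  next
    case (Suc k)
    show ?case
    proof (rule Ck_on_SucI[OF assms(1)])
      show "((\<lambda>x. inverse (f x)) has_derivative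
         (\<lambda>h. - (inverse (f x) * frechet_derivative f (at x) h * inverse (f x)))) (at x)" if "x \<in> S" for x
        by (rule Deriv.has_derivative_inverse[OF assms(3)[OF that] smooth_on_has_derivative[OF assms(2) that]])
      show "Ck_on k S (\<lambda>x. - (inverse (f x) * frechet_derivative f (at x) v * inverse (f x)))" for v
        by (intro Ck_on_bounded_linear[OF assms(1) bounded_linear_minus[OF bounded_linear_ident]]
            Ck_on_bilinear[OF assms(1) bounded_bilinear_mult] Suc.IH)
          (simp add: smooth_onD[OF smooth_on_frechet_derivative[OF assms(2)]])
    qed
  qed
qed

lemma smooth_on_divide:
  fixes f g :: "'a::real_normed_vector \<Rightarrow> 'b::real_normed_field"
  assumes "open S" "smooth_on S f" "smooth_on S g" "\<And>x. x \<in> S \<Longrightarrow> g x \<noteq> 0"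
  shows "smooth_on S (\<lambda>x. f x / g x)"
  unfolding divide_inverse using assms by (intro smooth_on_mult smooth_on_inverse) auto

text \<open>One differentiation removes the logarithm: the derivative is a product of functions
  already known to be smooth.\<close>

lemma smooth_on_ln:
  fixes f :: "'a::real_normed_vector \<Rightarrow> real"
  assumes "open S" "smooth_on S f" "\<And>x. x \<in> S \<Longrightarrow> f x > 0"
  shows "smooth_on S (\<lambda>x. ln (f x))"
proof (rule smooth_onI)
  fix k
  have "Ck_on (Suc k) S (\<lambda>x. ln (f x))"
  proof (rule Ck_on_SucI[OF assms(1)])
    show "((\<lambda>x. ln (f x)) has_derivative (\<lambda>h. frechet_derivative f (at x) h * inverse (f x))) (at x)"
      if "x \<in> S" for x
      using has_derivative_ln[OF assms(3)[OF that] smooth_on_has_derivative[OF assms(2) that]] by (simp add: field_simps)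
    show "Ck_on k S (\<lambda>x. frechet_derivative f (at x) v * inverse (f x))" for v
      using assms
      by (intro smooth_onD smooth_on_mult smooth_on_frechet_derivative smooth_on_inverse) force+
  qed
  then show "Ck_on k S (\<lambda>x. ln (f x))" by (rule Ck_on_Suc_imp)
qed

lemma bounded_linear_axis: "bounded_linear (axis i :: 'b::real_normed_vector \<Rightarrow> 'b^'n::finite)"
proof
  show "axis i (x + y) = axis i x + (axis i y :: 'b^'n)" for x y by (auto simp: axis_def vec_eq_iff)
  show "axis i (r *\<^sub>R x) = r *\<^sub>R (axis i x :: 'b^'n)" for r x by (auto simp: axis_def vec_eq_iff)
  have "norm (axis i x :: 'b^'n) \<le> norm x * 1" for x
  proof -
    have "norm (axis i x :: 'b^'n) \<le> (\<Sum>j\<in>UNIV. norm (axis i x $ j :: 'b))"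
      by (simp add: norm_vec_def L2_set_le_sum)
    also have "\<dots> = (\<Sum>j\<in>UNIV. if j = i then norm x else 0)"
      by (intro sum.cong) (auto simp: axis_def)
    finally show ?thesis by simp
  qed
  then show "\<exists>K. \<forall>x. norm (axis i x :: 'b^'n) \<le> norm x * K" by blast
qed

lemma vec_eq_sum_axis: "(x :: 'b::comm_monoid_add^'n::finite) = (\<Sum>i\<in>UNIV. axis i (x $ i))"
  by (simp add: vec_eq_iff axis_def)

lemma smooth_on_vecI:
  fixes f :: "'a::real_normed_vector \<Rightarrow> 'b::real_normed_vector^'n::finite"
  assumes "open S" "\<And>i. smooth_on S (\<lambda>x. f x $ i)"
  shows "smooth_on S f"
proof -
  have "smooth_on S (\<lambda>x. \<Sum>i\<in>UNIV. axis i (f x $ i) :: 'b^'n)"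
    by (intro smooth_on_sum smooth_on_bounded_linear[OF bounded_linear_axis] assms)
  then show ?thesis
    by (rule smooth_on_cong[OF assms(1), rotated]) (rule vec_eq_sum_axis[symmetric])
qed

lemma smooth_on_vec_nth: "open S \<Longrightarrow> smooth_on S f \<Longrightarrow> smooth_on S (\<lambda>x. f x $ i)"
  by (rule smooth_on_bounded_linear[OF bounded_linear_vec_nth])

lemmas smooth_on_cnj = smooth_on_bounded_linear[OF bounded_linear_cnj]
  and smooth_on_Re = smooth_on_bounded_linear[OF bounded_linear_Re]
  and smooth_on_of_real = smooth_on_bounded_linear[OF bounded_linear_of_real]

text \<open>A factor that vanishes at the point lets the other factor be merely continuous. This is
  how an inverse operator gets differentiated when nothing beyond its continuity is known.\<close>

lemma has_derivative_vanishing_times_continuous: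
  fixes c :: "'a::real_normed_vector \<Rightarrow> real" and d :: "'a \<Rightarrow> 'b::real_normed_vector"
  assumes c: "(c has_derivative c') (at x)" "c x = 0" and d: "isCont d x"
  shows "((\<lambda>y. c y *\<^sub>R d y) has_derivative (\<lambda>h. c' h *\<^sub>R d x)) (at x)"
proof -
  have l: "bounded_linear c'" using c(1) has_derivative_bounded_linear by blast
  then obtain K where K: "\<And>h. norm (c' h) \<le> norm h * K" "0 < K"
    using bounded_linear.pos_bounded by blast
  have 1: "((\<lambda>y. (c y - c' (y - x)) /\<^sub>R norm (y - x)) \<longlongrightarrow> 0) (at x)"
    using c by (simp add: has_derivative_at_within)
  have 2: "((\<lambda>y. ((c y - c' (y - x)) /\<^sub>R norm (y - x)) *\<^sub>R d y) \<longlongrightarrow> 0 *\<^sub>R d x) (at x)"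
    using 1 d by (intro tendsto_scaleR) (auto simp: isCont_def)
  have b: "\<forall>\<^sub>F y in at x. norm (c' (y - x) / norm (y - x)) \<le> K"
  proof (rule always_eventually, rule allI)
    fix y show "norm (c' (y - x) / norm (y - x)) \<le> K"
      using K(1)[of "y - x"] K(2) by (cases "y = x") (auto simp: field_simps linear_0[OF bounded_linear.linear[OF l]])
  qed
  have "((\<lambda>y. d y - d x) \<longlongrightarrow> 0) (at x)" using d by (simp add: isCont_def LIM_zero_iff)
  then have 3: "((\<lambda>y. (c' (y - x) / norm (y - x)) *\<^sub>R (d y - d x)) \<longlongrightarrow> 0) (at x)"
    by (rule tendsto_0_le[of _ _ _ K]) (use b in eventually_elim, simp add: mult.commute[of _ K] mult_right_mono flip: times_divide_eq_left)
  have "((\<lambda>y. (c y *\<^sub>R d y - c x *\<^sub>R d x - c' (y - x) *\<^sub>R d x) /\<^sub>R norm (y - x)) \<longlongrightarrow> 0) (at x)"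
  proof -
    \<comment> \<open>The remainder splits into the remainder of \<open>c\<close> times
      \<open>d\<close> and a bounded quotient times the oscillation of \<open>d\<close> at
      \<open>x\<close>.\<close>
    have "(\<lambda>y. (c y *\<^sub>R d y - c x *\<^sub>R d x - c' (y - x) *\<^sub>R d x) /\<^sub>R norm (y - x)) =
      (\<lambda>y. ((c y - c' (y - x)) /\<^sub>R norm (y - x)) *\<^sub>R d y + (c' (y - x) / norm (y - x)) *\<^sub>R (d y - d x))"
      using c(2) by (simp add: fun_eq_iff scaleR_diff_left scaleR_diff_right divide_inverse mult.commute right_diff_distrib left_diff_distrib)
    then show ?thesis using tendsto_add[OF 2 3] by simp
  qed
  then show ?thesis
    by (simp add: has_derivative_at_within bounded_linear_scaleR_const[OF l])
qed

text \<open>From \<open>B y - B y0 = B y (A y0 - A y) B y0\<close>: the first factor on the right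
  stays bounded near \<open>y0\<close> because \<open>A y\<close> is bounded below there.\<close>

lemma continuous_operator_inverse:
  fixes A B :: "'y::topological_space \<Rightarrow> 'a::euclidean_space \<Rightarrow> 'a"
  assumes A: "\<And>y. y \<in> V \<Longrightarrow> linear (A y)" and B: "\<And>y. y \<in> V \<Longrightarrow> linear (B y)"
    and AB: "\<And>y v. y \<in> V \<Longrightarrow> A y (B y v) = v" and BA: "\<And>y v. y \<in> V \<Longrightarrow> B y (A y v) = v"
    and cont: "\<And>v. continuous_on V (\<lambda>y. A y v)"
  shows "continuous_on V (\<lambda>y. B y v)"
  unfolding continuous_on_def
proof
  fix y0 assume y0: "y0 \<in> V"
  obtain C where C: "C > 0" "\<And>v. norm (B y0 v) \<le> norm v * C"
    using B[OF y0] bounded_linear.pos_bounded linear_conv_bounded_linear by blast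
  define \<epsilon> where "\<epsilon> y = (\<Sum>b\<in>Basis. norm (A y b - A y0 b))" for y
  have "((\<lambda>y. \<Sum>b\<in>Basis. norm (A y b - A y0 b)) \<longlongrightarrow> (\<Sum>b\<in>(Basis::'a set). 0)) (at y0 within V)"
    using cont y0 by (intro tendsto_sum tendsto_norm_zero LIM_zero) (simp add: continuous_on_def)
  then have \<epsilon>: "(\<epsilon> \<longlongrightarrow> 0) (at y0 within V)" by (simp add: \<epsilon>_def[abs_def])
  have le: "norm (A y u - A y0 u) \<le> \<epsilon> y * norm u" if y: "y \<in> V" for y u
  proof -
    have lin: "linear (\<lambda>u. A y u - A y0 u)" using A[OF y] A[OF y0] by (intro linear_compose_sub)
    have "norm (A y u - A y0 u) = norm (\<Sum>b\<in>Basis. (u \<bullet> b) *\<^sub>R (A y b - A y0 b))"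
      by (simp only: linear_eq_sum_Basis[OF lin, of u])
    also have "\<dots> \<le> (\<Sum>b\<in>Basis. norm u * norm (A y b - A y0 b))"
      by (intro sum_norm_le) (auto intro!: mult_right_mono Basis_le_norm)
    finally show ?thesis by (simp add: \<epsilon>_def sum_distrib_left mult.commute)
  qed
  \<comment> \<open>Within this distance of \<open>A y0\<close>, the operator \<open>A y\<close>
    retains half of the lower bound \<open>1 / C\<close> of \<open>A y0\<close>.\<close>
  have "\<forall>\<^sub>F y in at y0 within V. \<epsilon> y < 1 / (2 * C)"
    by (rule order_tendstoD(2)[OF \<epsilon>]) (use C in auto)
  moreover have "\<forall>\<^sub>F y in at y0 within V. y \<in> V" by (auto simp: eventually_at_filter)
  ultimately have ev: "\<forall>\<^sub>F y in at y0 within V. norm (B y v - B y0 v) \<le> norm (\<epsilon> y) * (2 * C * norm (B y0 v))"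
  proof eventually_elim
    case (elim y)
    have e0: "\<epsilon> y \<ge> 0" by (simp add: \<epsilon>_def sum_nonneg)
    have key: "norm u \<le> 2 * C * norm (A y u)" for u
    proof -
      have "norm u \<le> C * norm (A y0 u)" using C(2)[of "A y0 u"] BA[OF y0] by (simp add: mult.commute)
      also have "\<dots> \<le> C * (norm (A y u) + \<epsilon> y * norm u)"
        using le[OF elim(2), of u] norm_triangle_sub[of "A y0 u" "A y u"] C(1)
        by (intro mult_left_mono) (auto simp: norm_minus_commute)
      also have "\<dots> \<le> C * norm (A y u) + norm u / 2"
        using elim(1) C(1) mult_right_mono[of "C * \<epsilon> y" "1/2" "norm u"] by (simp add: field_simps)
      finally show ?thesis by simp
    qed
    have "A y (B y v - B y0 v) = A y0 (B y0 v) - A y (B y0 v)"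
      using AB elim(2) y0 by (simp add: linear_diff[OF A[OF elim(2)]])
    then have "norm (B y v - B y0 v) \<le> 2 * C * norm (A y (B y0 v) - A y0 (B y0 v))"
      using key[of "B y v - B y0 v"] by (simp add: norm_minus_commute)
    also have "\<dots> \<le> 2 * C * (\<epsilon> y * norm (B y0 v))"
      using le[OF elim(2)] C(1) by (intro mult_left_mono) auto
    finally show ?case using e0 by (simp add: mult_ac)
  qed
  have "((\<lambda>y. B y v - B y0 v) \<longlongrightarrow> 0) (at y0 within V)"
    by (rule tendsto_0_le[OF \<epsilon> ev])
  then show "((\<lambda>y. B y v) \<longlongrightarrow> B y0 v) (at y0 within V)" by (simp add: LIM_zero_iff)
qed

text \<open>Differentiating \<open>A B = 1\<close> gives \<open>B' = - B A' B\<close>. The right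
  hand side involves only \<open>A'\<close> and \<open>B\<close> itself, so regularity is gained one
  order at a time, starting from continuity.\<close>

lemma Ck_on_operator_inverse:
  fixes A B :: "'y::real_normed_vector \<Rightarrow> 'a::euclidean_space \<Rightarrow> 'a"
  assumes V: "open V" and A: "\<And>y. y \<in> V \<Longrightarrow> linear (A y)" and B: "\<And>y. y \<in> V \<Longrightarrow> linear (B y)"
    and AB: "\<And>y v. y \<in> V \<Longrightarrow> A y (B y v) = v" and BA: "\<And>y v. y \<in> V \<Longrightarrow> B y (A y v) = v"
    and sm: "\<And>v. Ck_on k V (\<lambda>y. A y v)"
  shows "Ck_on k V (\<lambda>y. B y v)"
  using sm
proof (induction k arbitrary: v)
  case 0
  have "continuous_on V (\<lambda>y. B y v)"
    by (rule continuous_operator_inverse[OF A B AB BA]) (use 0 in auto)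
  then show ?case by simp
next
  case (Suc k)
  have ck: "Ck_on k V (\<lambda>y. A y v)" for v using Suc.prems Ck_on_Suc_imp by blast
  note IH = Suc.IH[OF ck]
  have cont: "continuous_on V (\<lambda>y. B y v)" for v
  proof (rule continuous_operator_inverse[OF A B AB BA])
    show "continuous_on V (\<lambda>y. A y v)" for v
      using Suc.prems[of v] differentiable_imp_continuous_within
      by (auto intro!: continuous_at_imp_continuous_on)
  qed
  define D where "D y w u = (\<Sum>b'\<in>Basis. (w \<bullet> b') *\<^sub>R frechet_derivative (\<lambda>y. A y b') (at y) u)" for y w u
  have D: "((\<lambda>z. A z w) has_derivative D y w) (at y)" if y: "y \<in> V" for w y
  proof (rule has_derivative_transform_within_open[OF _ V y])
    show "((\<lambda>z. \<Sum>b'\<in>Basis. (w \<bullet> b') *\<^sub>R A z b') has_derivative D y w) (at y)"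
      unfolding D_def[abs_def]
      by (intro has_derivative_sum has_derivative_scaleR_right Ck_on_Suc_has_derivative[OF Suc.prems y])
    show "(\<Sum>b'\<in>Basis. (w \<bullet> b') *\<^sub>R A z b') = A z w" if "z \<in> V" for z
      by (rule linear_eq_sum_Basis[OF A[OF that], symmetric])
  qed
  \<comment> \<open>\<open>D y (B y v) u\<close> is the derivative of \<open>A\<close> in direction
    \<open>u\<close>, applied to \<open>B y v\<close>; the sum over the basis applies
    \<open>B y\<close> to it.\<close>
  define E where "E y u = - (\<Sum>b\<in>Basis. (D y (B y v) u \<bullet> b) *\<^sub>R B y b)" for y u
  show ?case
  proof (rule Ck_on_SucI[OF V, of _ E])
    fix y assume y: "y \<in> V"
    let ?w = "B y v"
    have c: "((\<lambda>z. (A z ?w - A y ?w) \<bullet> b) has_derivative (\<lambda>u. D y ?w u \<bullet> b)) (at y)" for b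
      using has_derivative_inner_left[OF has_derivative_diff[OF D[OF y] has_derivative_const], of ?w "A y ?w" b] by simp
    have ct: "isCont (\<lambda>z. B z b) y" for b
      using cont V y continuous_on_eq_continuous_at by blast
    \<comment> \<open>With \<open>w = B y v\<close> one has
      \<open>B z v = w - B z (A z w - A y w)\<close>. The argument of \<open>B z\<close> on the
      right is differentiable and vanishes at \<open>z = y\<close>, so continuity of
      \<open>B\<close> is enough.\<close>
    have "((\<lambda>z. \<Sum>b\<in>Basis. ((A z ?w - A y ?w) \<bullet> b) *\<^sub>R B z b) has_derivative
        (\<lambda>u. \<Sum>b\<in>Basis. (D y ?w u \<bullet> b) *\<^sub>R B y b)) (at y)"
      by (intro has_derivative_sum has_derivative_vanishing_times_continuous[OF c _ ct]) simp
    then have d: "((\<lambda>z. B y v - (\<Sum>b\<in>Basis. ((A z ?w - A y ?w) \<bullet> b) *\<^sub>R B z b)) has_derivative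
        (\<lambda>u. 0 - (\<Sum>b\<in>Basis. (D y ?w u \<bullet> b) *\<^sub>R B y b))) (at y)"
      by (intro has_derivative_diff has_derivative_const)
    have "((\<lambda>z. B z v) has_derivative (\<lambda>u. 0 - (\<Sum>b\<in>Basis. (D y ?w u \<bullet> b) *\<^sub>R B y b))) (at y)"
    proof (rule has_derivative_transform_within_open[OF d V y])
      fix z assume z: "z \<in> V"
      have "(\<Sum>b\<in>Basis. ((A z ?w - A y ?w) \<bullet> b) *\<^sub>R B z b) = B z (A z ?w - A y ?w)"
        by (rule linear_eq_sum_Basis[OF B[OF z], symmetric])
      also have "\<dots> = ?w - B z v" using BA[OF z] AB[OF y] by (simp add: linear_diff[OF B[OF z]])
      finally show "B y v - (\<Sum>b\<in>Basis. ((A z ?w - A y ?w) \<bullet> b) *\<^sub>R B z b) = B z v" by simp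
    qed
    then show "((\<lambda>z. B z v) has_derivative E y) (at y)" by (simp add: E_def[abs_def])
  next
    fix u
    note bs = Ck_on_bilinear[OF V bounded_bilinear_scaleR]
    have 1: "Ck_on k V (\<lambda>y. B y w \<bullet> b)" for w b
      by (rule Ck_on_bounded_linear[OF V bounded_linear_inner_left IH])
    have 2: "Ck_on k V (\<lambda>y. frechet_derivative (\<lambda>y. A y b') (at y) u)" for b'
      using Suc.prems by simp
    have 3: "Ck_on k V (\<lambda>y. D y (B y v) u)"
      unfolding D_def by (rule Ck_on_sum[OF V], rule bs[OF 1 2])
    have 4: "Ck_on k V (\<lambda>y. D y (B y v) u \<bullet> b)" for b
      by (rule Ck_on_bounded_linear[OF V bounded_linear_inner_left 3])
    have "Ck_on k V (\<lambda>y. \<Sum>b\<in>Basis. (D y (B y v) u \<bullet> b) *\<^sub>R B y b)"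
      by (rule Ck_on_sum[OF V], rule bs[OF 4 IH])
    then show "Ck_on k V (\<lambda>y. E y u)"
      unfolding E_def by (rule Ck_on_bounded_linear[OF V bounded_linear_minus[OF bounded_linear_ident]])
  qed
qed

text \<open>The derivative of \<open>g\<close> inverts the derivative of \<open>Q\<close> at
  \<open>g y\<close> (by dimension the one-sided inverse is two-sided). If \<open>g\<close> is of
  class \<open>k\<close>, so is its derivative, and \<open>g\<close> is of class
  \<open>k + 1\<close>.\<close>

lemma smooth_on_inverse_function:
  fixes Q g :: "'a::euclidean_space \<Rightarrow> 'a"
  assumes V: "open V" and U: "open U" and gU: "g ` V \<subseteq> U" and Q: "smooth_on U Q"
    and g: "\<And>y. y \<in> V \<Longrightarrow> (g has_derivative g' y) (at y)"
    and inv: "\<And>y v. y \<in> V \<Longrightarrow> frechet_derivative Q (at (g y)) (g' y v) = v"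
  shows "smooth_on V g"
proof (rule smooth_onI)
  have linQ: "linear (frechet_derivative Q (at (g y)))" if "y \<in> V" for y
    using gU that smooth_on_has_derivative[OF Q] has_derivative_linear by blast
  have ling: "linear (g' y)" if "y \<in> V" for y using g[OF that] has_derivative_linear by blast
  have inv2: "g' y (frechet_derivative Q (at (g y)) v) = v" if y: "y \<in> V" for y v
  proof -
    have "inj (g' y)" using inv[OF y] by (metis injI)
    then have "surj (g' y)" using ling[OF y] linear_injective_imp_surjective by blast
    then obtain w where "v = g' y w" by blast
    then show ?thesis using inv[OF y] by simp
  qed
  show "Ck_on k V g" for k
  proof (induction k)
    case 0
    have "isCont g y" if "y \<in> V" for y by (rule has_derivative_continuous[OF g[OF that]])
    then show ?case by (simp add: continuous_at_imp_continuous_on)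
  next
    case (Suc k)
    show ?case
    proof (rule Ck_on_SucI[OF V g])
      show "Ck_on k V (\<lambda>y. g' y v)" for v
      proof (rule Ck_on_operator_inverse[OF V linQ ling inv inv2])
        show "Ck_on k V (\<lambda>y. frechet_derivative Q (at (g y)) w)" for w
          by (rule Ck_on_compose[OF V U Suc.IH smooth_onD[OF smooth_on_frechet_derivative[OF Q]] gU])
      qed
    qed
  qed
qed

text \<open>The second difference \<open>\<Delta> v w t\<close> is symmetric in \<open>v\<close> and
  \<open>w\<close>; two uses of the mean value theorem show that its quotient by
  \<open>t\<^sup>2\<close> tends to the mixed derivative in the given order.\<close>

lemma second_derivative_symmetric_real:
  fixes f :: "'a::real_normed_vector \<Rightarrow> real"
  assumes S: "open S" and f: "smooth_on S f" and x: "x \<in> S"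
  shows "frechet_derivative (\<lambda>y. frechet_derivative f (at y) v) (at x) w
       = frechet_derivative (\<lambda>y. frechet_derivative f (at y) w) (at x) v"
proof -
  define D where "D v y = frechet_derivative f (at y) v" for v y
  define DD where "DD v w y = frechet_derivative (D v) (at y) w" for v w y
  have smD: "smooth_on S (D v)" for v unfolding D_def[abs_def] by (rule smooth_on_frechet_derivative[OF f])
  have smDD: "smooth_on S (DD v w)" for v w unfolding DD_def[abs_def] by (rule smooth_on_frechet_derivative[OF smD])
  have line: "((\<lambda>s. g (p + s *\<^sub>R v)) has_real_derivative frechet_derivative g (at (p + s *\<^sub>R v)) v) (at s)"
    if "smooth_on S g" "p + s *\<^sub>R v \<in> S" for g :: "'a \<Rightarrow> real" and p s v
  proof -
    have "((\<lambda>s. p + s *\<^sub>R v) has_derivative (\<lambda>h. h *\<^sub>R v)) (at s)"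
      by (auto intro!: derivative_eq_intros)
    from has_derivative_compose[OF this smooth_on_has_derivative[OF that]]
    have "((\<lambda>s. g (p + s *\<^sub>R v)) has_derivative (\<lambda>h. frechet_derivative g (at (p + s *\<^sub>R v)) (h *\<^sub>R v))) (at s)" .
    moreover have "(\<lambda>h. frechet_derivative g (at (p + s *\<^sub>R v)) (h *\<^sub>R v)) = (*) (frechet_derivative g (at (p + s *\<^sub>R v)) v)"
      using linear_cmul[OF has_derivative_linear[OF smooth_on_has_derivative[OF that]]] by (simp add: fun_eq_iff mult.commute)
    ultimately show ?thesis by (simp add: has_field_derivative_def)
  qed
  obtain e where e: "e > 0" "ball x e \<subseteq> S" using S x open_contains_ball by blast
  \<comment> \<open>This bound on both parameters keeps the parallelogram at \<open>x\<close> with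
    sides along \<open>v\<close> and \<open>w\<close> inside the ball.\<close>
  define r where "r v w = e / (norm v + norm w + 1)" for v w :: 'a
  have rpos: "r v w > 0" for v w by (auto simp: r_def intro!: divide_pos_pos add_nonneg_pos e)
  have inS: "x + s *\<^sub>R v + t *\<^sub>R w \<in> S" if "0 \<le> s" "s < r v w" "0 \<le> t" "t < r v w" for s t v w
  proof -
    have "norm (s *\<^sub>R v + t *\<^sub>R w) \<le> s * norm v + t * norm w"
      using that by (intro order_trans[OF norm_triangle_ineq]) auto
    also have "\<dots> \<le> r v w * norm v + r v w * norm w"
      using that by (intro add_mono mult_right_mono) auto
    also have "\<dots> < r v w * (norm v + norm w + 1)" using rpos by (simp add: algebra_simps)
    also have "\<dots> = e"
      using norm_ge_zero[of v] norm_ge_zero[of w] by (simp add: r_def del: norm_ge_zero)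
    finally show ?thesis using e(2) by (auto simp: dist_norm add.assoc norm_minus_commute subset_iff)
  qed
  define \<Delta> where "\<Delta> v w t = f (x + t *\<^sub>R v + t *\<^sub>R w) - f (x + t *\<^sub>R v) - f (x + t *\<^sub>R w) + f x" for v w t
  have key: "\<exists>a b. 0 \<le> a \<and> a \<le> t \<and> 0 \<le> b \<and> b \<le> t \<and> \<Delta> v w t = t\<^sup>2 * DD v w (x + a *\<^sub>R v + b *\<^sub>R w)"
    if t: "0 < t" "t < r v w" for v w t
  proof -
    define \<phi> where "\<phi> s = f ((x + t *\<^sub>R w) + s *\<^sub>R v) - f (x + s *\<^sub>R v)" for s
    have "\<exists>a. 0 < a \<and> a < t \<and> \<phi> t - \<phi> 0 = (t - 0) * (D v (x + t *\<^sub>R w + a *\<^sub>R v) - D v (x + a *\<^sub>R v))"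
    proof (rule MVT2[OF t(1)])
      fix s assume s: "0 \<le> s" "s \<le> t"
      show "(\<phi> has_real_derivative D v (x + t *\<^sub>R w + s *\<^sub>R v) - D v (x + s *\<^sub>R v)) (at s)"
        unfolding \<phi>_def D_def
        by (intro DERIV_diff line[OF f])
          (use inS[of s v w t] inS[of s v w 0] s t in \<open>simp_all add: add.assoc add.commute[of "s *\<^sub>R v"]\<close>)
    qed
    then obtain a where a: "0 < a" "a < t"
      "\<phi> t - \<phi> 0 = t * (D v (x + t *\<^sub>R w + a *\<^sub>R v) - D v (x + a *\<^sub>R v))" by auto
    have "\<exists>b. 0 < b \<and> b < t \<and> D v ((x + a *\<^sub>R v) + t *\<^sub>R w) - D v ((x + a *\<^sub>R v) + 0 *\<^sub>R w)
        = (t - 0) * DD v w ((x + a *\<^sub>R v) + b *\<^sub>R w)"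
      unfolding DD_def
    proof (rule MVT2[OF t(1)], rule line[OF smD])
      show "x + a *\<^sub>R v + s *\<^sub>R w \<in> S" if "0 \<le> s" "s \<le> t" for s
        using that a t by (intro inS) auto
    qed
    then obtain b where b: "0 < b" "b < t"
      "D v (x + a *\<^sub>R v + t *\<^sub>R w) - D v (x + a *\<^sub>R v) = t * DD v w (x + a *\<^sub>R v + b *\<^sub>R w)" by auto
    have "\<Delta> v w t = \<phi> t - \<phi> 0"
      by (simp add: \<Delta>_def \<phi>_def add.assoc add.commute[of "t *\<^sub>R v"])
    also have "\<dots> = t * (t * DD v w (x + a *\<^sub>R v + b *\<^sub>R w))"
      using a(3) b(3) by (simp add: algebra_simps)
    finally show ?thesis using a b by (intro exI[of _ a] exI[of _ b]) (simp add: power2_eq_square)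
  qed
  have lim: "((\<lambda>t. \<Delta> v w t / t\<^sup>2) \<longlongrightarrow> DD v w x) (at_right 0)" for v w
  proof -
    have "\<forall>t. \<exists>a b. 0 < t \<and> t < r v w \<longrightarrow> 0 \<le> a \<and> a \<le> t \<and> 0 \<le> b \<and> b \<le> t \<and> \<Delta> v w t = t\<^sup>2 * DD v w (x + a *\<^sub>R v + b *\<^sub>R w)"
      using key[of _ v w] by meson
    then obtain a b where ab: "\<And>t. 0 < t \<Longrightarrow> t < r v w \<Longrightarrow> 0 \<le> a t \<and> a t \<le> t \<and> 0 \<le> b t \<and> b t \<le> t \<and>
        \<Delta> v w t = t\<^sup>2 * DD v w (x + a t *\<^sub>R v + b t *\<^sub>R w)" by metis
    have ev: "\<forall>\<^sub>F t in at_right 0. 0 < t \<and> t < r v w"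
      using rpos[of v w] by (auto simp: eventually_at_right)
    have tid: "((\<lambda>t::real. t) \<longlongrightarrow> 0) (at_right 0)" by (rule tendsto_ident_at)
    have "\<forall>\<^sub>F t in at_right 0. 0 \<le> a t \<and> a t \<le> t \<and> 0 \<le> b t \<and> b t \<le> t"
      using ev by (rule eventually_mono) (use ab in blast)
    then have "\<forall>\<^sub>F t in at_right 0. 0 \<le> a t" "\<forall>\<^sub>F t in at_right 0. a t \<le> t"
      "\<forall>\<^sub>F t in at_right 0. 0 \<le> b t" "\<forall>\<^sub>F t in at_right 0. b t \<le> t"
      by (auto elim!: eventually_mono)
    then have a0: "(a \<longlongrightarrow> 0) (at_right 0)" "(b \<longlongrightarrow> 0) (at_right 0)"
      using tendsto_sandwich[OF _ _ tendsto_const tid] by blast+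
    have "((\<lambda>t. x + a t *\<^sub>R v + b t *\<^sub>R w) \<longlongrightarrow> x + 0 *\<^sub>R v + 0 *\<^sub>R w) (at_right 0)"
      by (intro tendsto_intros a0)
    moreover have "isCont (DD v w) x"
      using smooth_on_continuous[OF smDD] S x continuous_on_eq_continuous_at by blast
    ultimately have "((\<lambda>t. DD v w (x + a t *\<^sub>R v + b t *\<^sub>R w)) \<longlongrightarrow> DD v w x) (at_right 0)"
      using isCont_tendsto_compose by fastforce
    then show ?thesis
    proof (rule Lim_transform_eventually)
      show "\<forall>\<^sub>F t in at_right 0. DD v w (x + a t *\<^sub>R v + b t *\<^sub>R w) = \<Delta> v w t / t\<^sup>2"
        using ev by (rule eventually_mono) (use ab in auto)
    qed
  qed
  have "\<Delta> v w = \<Delta> w v" by (simp add: fun_eq_iff \<Delta>_def add.assoc add.commute[of "_ *\<^sub>R v"])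
  then have "DD v w x = DD w v x"
    using lim[of v w] lim[of w v] tendsto_unique[OF trivial_limit_at_right_real] by metis
  then show ?thesis by (simp add: DD_def D_def[abs_def])
qed

lemma second_derivative_symmetric:
  fixes f :: "'a::real_normed_vector \<Rightarrow> 'b::euclidean_space"
  assumes S: "open S" and f: "smooth_on S f" and x: "x \<in> S"
  shows "frechet_derivative (\<lambda>y. frechet_derivative f (at y) v) (at x) w
       = frechet_derivative (\<lambda>y. frechet_derivative f (at y) w) (at x) v"
proof (rule euclidean_eqI)
  fix b :: 'b
  have 1: "frechet_derivative (\<lambda>y. g y \<bullet> b) (at y) u = frechet_derivative g (at y) u \<bullet> b"
    if "smooth_on S g" "y \<in> S" for g :: "'a \<Rightarrow> 'b" and y u
    using frechet_eq[OF has_derivative_inner_left[OF smooth_on_has_derivative[OF that], of b]] by simp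
  have 2: "frechet_derivative (\<lambda>y. frechet_derivative f (at y) v) (at x) w \<bullet> b
      = frechet_derivative (\<lambda>y. frechet_derivative (\<lambda>y. f y \<bullet> b) (at y) v) (at x) w" for v w
  proof -
    have "frechet_derivative (\<lambda>y. frechet_derivative (\<lambda>y. f y \<bullet> b) (at y) v) (at x) =
        frechet_derivative (\<lambda>y. frechet_derivative f (at y) v \<bullet> b) (at x)"
    proof (rule frechet_derivative_transform_within_open[OF _ S x])
      have "smooth_on S (\<lambda>y. frechet_derivative (\<lambda>y. f y \<bullet> b) (at y) v)"
        by (intro smooth_on_frechet_derivative smooth_on_bounded_linear[OF bounded_linear_inner_left] S f)
      then show "(\<lambda>y. frechet_derivative (\<lambda>y. f y \<bullet> b) (at y) v) differentiable at x"
        using smooth_on_differentiable x by blast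
    qed (use 1[OF f] in auto)
    then show ?thesis using 1[OF smooth_on_frechet_derivative[OF f] x] by simp
  qed
  show "frechet_derivative (\<lambda>y. frechet_derivative f (at y) v) (at x) w \<bullet> b =
      frechet_derivative (\<lambda>y. frechet_derivative f (at y) w) (at x) v \<bullet> b"
    unfolding 2
    by (rule second_derivative_symmetric_real[OF S _ x])
      (rule smooth_on_bounded_linear[OF bounded_linear_inner_left S f])
qed

section \<open>Wirtinger derivatives\<close>

lemma frechet_derivative_worksI:
  "f differentiable (at x) \<Longrightarrow> (f has_derivative frechet_derivative f (at x)) (at x)"
  by (simp add: frechet_derivative_works)

lemma axis_imaginary: "axis i \<i> = \<i> *s (axis i 1 :: complex^'n::finite)"
  by (simp add: vec_eq_iff axis_def)

lemma scaleC_of_real: "complex_of_real r *s v = r *\<^sub>R (v :: complex^'n::finite)"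
  unfolding vec_eq_iff by (simp add: complex_eq_iff)

text \<open>The two coefficients belong to the complex linear and the antilinear part of
  \<open>L\<close>; they are the combinations that define \<open>dz\<close> and
  \<open>dzbar\<close>.\<close>

lemma real_linear_wirtinger:
  fixes L :: "complex^'n::finite \<Rightarrow> complex"
  assumes "linear L"
  shows "L v = (\<Sum>i\<in>UNIV. (L (axis i 1) - \<i> * L (axis i \<i>)) / 2 * v $ i
      + (L (axis i 1) + \<i> * L (axis i \<i>)) / 2 * cnj (v $ i))"
proof -
  have "v = (\<Sum>i\<in>UNIV. Re (v $ i) *\<^sub>R axis i 1 + Im (v $ i) *\<^sub>R axis i \<i>)"
    by (simp add: vec_eq_iff axis_def complex_eq_iff sum.distrib if_distrib cong: if_cong)
  then have "L v = L (\<Sum>i\<in>UNIV. Re (v $ i) *\<^sub>R axis i 1 + Im (v $ i) *\<^sub>R axis i \<i>)" by (rule arg_cong)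
  also have "\<dots> = (\<Sum>i\<in>UNIV. Re (v $ i) *\<^sub>R L (axis i 1) + Im (v $ i) *\<^sub>R L (axis i \<i>))"
    by (simp only: linear_sum[OF assms] linear_add[OF assms] linear_cmul[OF assms])
  also have "\<dots> = (\<Sum>i\<in>UNIV. (L (axis i 1) - \<i> * L (axis i \<i>)) / 2 * v $ i
      + (L (axis i 1) + \<i> * L (axis i \<i>)) / 2 * cnj (v $ i))"
  proof (rule sum.cong[OF refl])
    fix i
    show "Re (v $ i) *\<^sub>R L (axis i 1) + Im (v $ i) *\<^sub>R L (axis i \<i>) =
      (L (axis i 1) - \<i> * L (axis i \<i>)) / 2 * v $ i + (L (axis i 1) + \<i> * L (axis i \<i>)) / 2 * cnj (v $ i)"
      by (simp add: complex_eq_iff field_simps)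
  qed
  finally show ?thesis .
qed

lemma has_derivative_wirtinger:
  assumes "(u has_derivative u') (at z)"
  shows "u' v = (\<Sum>i\<in>UNIV. dz i u z * v $ i + dzbar i u z * cnj (v $ i))"
  unfolding dz_def dzbar_def frechet_eq[OF assms]
  by (rule real_linear_wirtinger[OF has_derivative_linear[OF assms]])

lemma dz_eq: "(u has_derivative u') (at z) \<Longrightarrow> dz i u z = (u' (axis i 1) - \<i> * u' (axis i \<i>)) / 2"
  and dzbar_eq: "(u has_derivative u') (at z) \<Longrightarrow> dzbar i u z = (u' (axis i 1) + \<i> * u' (axis i \<i>)) / 2"
  by (simp_all add: dz_def dzbar_def frechet_eq)

lemma dz_cong:
  assumes "open S" "z \<in> S" "\<And>y. y \<in> S \<Longrightarrow> u y = v y" "u differentiable (at z)"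
  shows "dz i u z = dz i v z" and "dzbar i u z = dzbar i v z"
proof -
  have "frechet_derivative u (at z) = frechet_derivative v (at z)"
    by (rule frechet_derivative_transform_within_open[OF assms(4,1,2,3)])
  then show "dz i u z = dz i v z" "dzbar i u z = dzbar i v z" by (simp_all add: dz_def dzbar_def)
qed

lemma dz_const: "dz i (\<lambda>y. c) z = 0" "dzbar i (\<lambda>y. c) z = 0"
  by (simp_all add: dz_def dzbar_def)

lemma dz_add:
  assumes "u differentiable (at z)" "v differentiable (at z)"
  shows "dz i (\<lambda>y. u y + v y) z = dz i u z + dz i v z"
    and "dzbar i (\<lambda>y. u y + v y) z = dzbar i u z + dzbar i v z"
  using assms[THEN frechet_derivative_worksI]
  by (simp_all add: dz_eq[OF has_derivative_add] dzbar_eq[OF has_derivative_add] dz_eq dzbar_eq field_simps)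

lemma dz_mult:
  assumes "u differentiable (at z)" "v differentiable (at z)"
  shows "dz i (\<lambda>y. u y * v y) z = dz i u z * v z + u z * dz i v z"
    and "dzbar i (\<lambda>y. u y * v y) z = dzbar i u z * v z + u z * dzbar i v z"
  using assms[THEN frechet_derivative_worksI]
  by (simp_all add: dz_eq[OF has_derivative_mult] dzbar_eq[OF has_derivative_mult] dz_eq dzbar_eq field_simps)

lemma dz_minus:
  assumes "u differentiable (at z)"
  shows "dz i (\<lambda>y. - u y) z = - dz i u z" and "dzbar i (\<lambda>y. - u y) z = - dzbar i u z"
  using assms[THEN frechet_derivative_worksI]
  by (simp_all add: dz_eq[OF has_derivative_minus] dzbar_eq[OF has_derivative_minus] dz_eq dzbar_eq field_simps)

lemma dz_sum:
  assumes "\<And>j. j \<in> I \<Longrightarrow> u j differentiable (at z)"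
  shows "dz i (\<lambda>y. \<Sum>j\<in>I. u j y) z = (\<Sum>j\<in>I. dz i (u j) z)"
    and "dzbar i (\<lambda>y. \<Sum>j\<in>I. u j y) z = (\<Sum>j\<in>I. dzbar i (u j) z)"
proof -
  have "((\<lambda>y. \<Sum>j\<in>I. u j y) has_derivative (\<lambda>h. \<Sum>j\<in>I. frechet_derivative (u j) (at z) h)) (at z)"
    using assms by (intro has_derivative_sum frechet_derivative_worksI)
  from dz_eq[OF this] dzbar_eq[OF this] show "dz i (\<lambda>y. \<Sum>j\<in>I. u j y) z = (\<Sum>j\<in>I. dz i (u j) z)"
    "dzbar i (\<lambda>y. \<Sum>j\<in>I. u j y) z = (\<Sum>j\<in>I. dzbar i (u j) z)"
    by (simp_all add: dz_def dzbar_def sum_distrib_left sum_divide_distrib sum_subtractf sum.distrib add_divide_distrib diff_divide_distrib)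
qed

lemma dz_inverse:
  assumes "u differentiable (at z)" "u z \<noteq> 0"
  shows "dz i (\<lambda>y. inverse (u y)) z = - dz i u z / (u z)\<^sup>2"
    and "dzbar i (\<lambda>y. inverse (u y)) z = - dzbar i u z / (u z)\<^sup>2"
proof -
  have u: "(u has_derivative frechet_derivative u (at z)) (at z)"
    by (rule frechet_derivative_worksI[OF assms(1)])
  show "dz i (\<lambda>y. inverse (u y)) z = - dz i u z / (u z)\<^sup>2"
    "dzbar i (\<lambda>y. inverse (u y)) z = - dzbar i u z / (u z)\<^sup>2"
    unfolding dz_eq[OF Deriv.has_derivative_inverse[OF assms(2) u]] dz_eq[OF u]
      dzbar_eq[OF Deriv.has_derivative_inverse[OF assms(2) u]] dzbar_eq[OF u]
    using assms(2) by (simp_all add: field_simps power2_eq_square)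
qed

text \<open>Since \<open>s\<close> need not be holomorphic, both derivatives of \<open>u\<close>
  enter. The conjugated factors are the derivatives of the conjugate coordinates of
  \<open>s\<close>.\<close>

lemma dz_compose:
  fixes s :: "complex^'q::finite \<Rightarrow> complex^'n::finite"
  assumes s: "s differentiable (at w)" and u: "u differentiable (at (s w))"
  shows "dz i (\<lambda>y. u (s y)) w = (\<Sum>\<alpha>\<in>UNIV. dz \<alpha> u (s w) * dz i (\<lambda>y. s y $ \<alpha>) w
      + dzbar \<alpha> u (s w) * cnj (dzbar i (\<lambda>y. s y $ \<alpha>) w))"
    and "dzbar i (\<lambda>y. u (s y)) w = (\<Sum>\<alpha>\<in>UNIV. dz \<alpha> u (s w) * dzbar i (\<lambda>y. s y $ \<alpha>) w
      + dzbar \<alpha> u (s w) * cnj (dz i (\<lambda>y. s y $ \<alpha>) w))"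
proof -
  let ?s = "frechet_derivative s (at w)" and ?u = "frechet_derivative u (at (s w))"
  have ds: "(s has_derivative ?s) (at w)" using s frechet_derivative_worksI by blast
  have du: "(u has_derivative ?u) (at (s w))" using u frechet_derivative_worksI by blast
  have d: "((\<lambda>y. u (s y)) has_derivative (\<lambda>h. ?u (?s h))) (at w)" by (rule has_derivative_compose[OF ds du])
  have c: "((\<lambda>y. s y $ \<alpha>) has_derivative (\<lambda>h. ?s h $ \<alpha>)) (at w)" for \<alpha>
    using bounded_linear.has_derivative[OF bounded_linear_vec_nth ds] .
  show "dz i (\<lambda>y. u (s y)) w = (\<Sum>\<alpha>\<in>UNIV. dz \<alpha> u (s w) * dz i (\<lambda>y. s y $ \<alpha>) w
      + dzbar \<alpha> u (s w) * cnj (dzbar i (\<lambda>y. s y $ \<alpha>) w))"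
    unfolding dz_eq[OF d] dz_eq[OF c] dzbar_eq[OF c] has_derivative_wirtinger[OF du]
    unfolding sum_distrib_left sum_subtractf[symmetric] sum_divide_distrib
    by (rule sum.cong[OF refl]) (simp add: field_simps)
  show "dzbar i (\<lambda>y. u (s y)) w = (\<Sum>\<alpha>\<in>UNIV. dz \<alpha> u (s w) * dzbar i (\<lambda>y. s y $ \<alpha>) w
      + dzbar \<alpha> u (s w) * cnj (dz i (\<lambda>y. s y $ \<alpha>) w))"
    unfolding dzbar_eq[OF d] dz_eq[OF c] dzbar_eq[OF c] has_derivative_wirtinger[OF du]
    unfolding sum_distrib_left sum.distrib[symmetric] sum_divide_distrib
    by (rule sum.cong[OF refl]) (simp add: field_simps)
qed

lemma smooth_on_dz:
  assumes "open S" "smooth_on S u"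
  shows "smooth_on S (dz i u)" and "smooth_on S (dzbar i u)"
proof -
  note f = smooth_on_frechet_derivative[OF assms(2)]
  have "smooth_on S (\<lambda>z. (frechet_derivative u (at z) (axis i 1) - \<i> * frechet_derivative u (at z) (axis i \<i>)) * (1/2))"
    by (intro smooth_on_mult smooth_on_diff smooth_on_const f assms(1))
  then show "smooth_on S (dz i u)" by (simp add: dz_def[abs_def])
  have "smooth_on S (\<lambda>z. (frechet_derivative u (at z) (axis i 1) + \<i> * frechet_derivative u (at z) (axis i \<i>)) * (1/2))"
    by (intro smooth_on_mult smooth_on_add smooth_on_const f assms(1))
  then show "smooth_on S (dzbar i u)" by (simp add: dzbar_def[abs_def])
qed

lemma dz_commute:
  assumes S: "open S" and u: "smooth_on S u" and z: "z \<in> S"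
  shows "dz i (dz j u) z = dz j (dz i u) z"
    and "dz i (dzbar j u) z = dzbar j (dz i u) z"
    and "dzbar i (dzbar j u) z = dzbar j (dzbar i u) z"
proof -
  define D where "D v = (\<lambda>y. frechet_derivative u (at y) v)" for v
  have sm: "(D v has_derivative frechet_derivative (D v) (at z)) (at z)" for v
    unfolding D_def by (rule smooth_on_has_derivative[OF smooth_on_frechet_derivative[OF u] z])
  note sm = sm[unfolded D_def]
  have sym: "frechet_derivative (D v) (at z) w = frechet_derivative (D w) (at z) v" for v w
    unfolding D_def by (rule second_derivative_symmetric[OF S u z])
  have 1: "(dz j u has_derivative (\<lambda>h. (frechet_derivative (\<lambda>y. frechet_derivative u (at y) (axis j 1)) (at z) h - \<i> * frechet_derivative (\<lambda>y. frechet_derivative u (at y) (axis j \<i>)) (at z) h) / 2)) (at z)" for j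
    unfolding dz_def[abs_def] by (intro bounded_linear.has_derivative[OF bounded_linear_divide] has_derivative_diff has_derivative_mult_right sm)
  have 2: "(dzbar j u has_derivative (\<lambda>h. (frechet_derivative (\<lambda>y. frechet_derivative u (at y) (axis j 1)) (at z) h + \<i> * frechet_derivative (\<lambda>y. frechet_derivative u (at y) (axis j \<i>)) (at z) h) / 2)) (at z)" for j
    unfolding dzbar_def[abs_def] by (intro bounded_linear.has_derivative[OF bounded_linear_divide] has_derivative_add has_derivative_mult_right sm)
  show "dz i (dz j u) z = dz j (dz i u) z" 
    unfolding dz_eq[OF 1] by (simp add: sym[unfolded D_def, of "axis j _"] field_simps)
  show "dz i (dzbar j u) z = dzbar j (dz i u) z"
    unfolding dz_eq[OF 2] dzbar_eq[OF 1] by (simp add: sym[unfolded D_def, of "axis j _"] field_simps)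
  show "dzbar i (dzbar j u) z = dzbar j (dzbar i u) z"
    unfolding dzbar_eq[OF 2] by (simp add: sym[unfolded D_def, of "axis j _"] field_simps)
qed

lemma holomorphic_dz:
  assumes "(u has_derivative u') (at z)" "\<And>v. u' (\<i> *s v) = \<i> * u' v"
  shows "dzbar i u z = 0" and "dz i u z = u' (axis i 1)" and "u' v = (\<Sum>i\<in>UNIV. dz i u z * v $ i)"
proof -
  show b: "dzbar i u z = 0" for i
    unfolding dzbar_eq[OF assms(1)] axis_imaginary assms(2) by (simp add: algebra_simps)
  show "dz i u z = u' (axis i 1)"
    unfolding dz_eq[OF assms(1)] axis_imaginary assms(2) by (simp add: algebra_simps)
  show "u' v = (\<Sum>i\<in>UNIV. dz i u z * v $ i)"
    using has_derivative_wirtinger[OF assms(1)] b by simp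
qed

lemma dz_of_real:
  assumes "(f has_derivative f') (at z)"
  shows "dzbar i (\<lambda>y. complex_of_real (f y)) z = cnj (dz i (\<lambda>y. complex_of_real (f y)) z)"
    and "complex_of_real (f' v) = 2 * Re (\<Sum>i\<in>UNIV. dz i (\<lambda>y. complex_of_real (f y)) z * v $ i)"
proof -
  have d: "((\<lambda>y. complex_of_real (f y)) has_derivative (\<lambda>h. complex_of_real (f' h))) (at z)"
    by (rule bounded_linear.has_derivative[OF bounded_linear_of_real assms])
  show b: "dzbar i (\<lambda>y. complex_of_real (f y)) z = cnj (dz i (\<lambda>y. complex_of_real (f y)) z)" for i
    unfolding dz_eq[OF d] dzbar_eq[OF d] by simp
  show "complex_of_real (f' v) = 2 * Re (\<Sum>i\<in>UNIV. dz i (\<lambda>y. complex_of_real (f y)) z * v $ i)"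
    unfolding has_derivative_wirtinger[OF d] sum.distrib b
    using complex_add_cnj[of "\<Sum>i\<in>UNIV. dz i (\<lambda>y. complex_of_real (f y)) z * v $ i"] by simp
qed

section \<open>Determinants and Hermitian forms\<close>

definition leibniz :: "'i set \<Rightarrow> ('i \<Rightarrow> 'i \<Rightarrow> 'a::comm_ring_1) \<Rightarrow> 'a" where
  "leibniz S f = (\<Sum>p | p permutes S. of_int (sign p) * (\<Prod>i\<in>S. f i (p i)))"

lemma leibniz_diagonal:
  assumes "finite S" "\<And>i j. i \<in> S \<Longrightarrow> j \<in> S \<Longrightarrow> i \<noteq> j \<Longrightarrow> f i j = 0"
  shows "leibniz S f = (\<Prod>i\<in>S. f i i)"
proof -
  have "leibniz S f = (\<Sum>p\<in>{id}. of_int (sign p) * (\<Prod>i\<in>S. f i (p i)))"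
    unfolding leibniz_def
  proof (rule sum.mono_neutral_right)
    show "finite {p. p permutes S}" by (rule finite_permutations[OF assms(1)])
    show "{id} \<subseteq> {p. p permutes S}" by (simp add: permutes_id)
    show "\<forall>p\<in>{p. p permutes S} - {id}. of_int (sign p) * (\<Prod>i\<in>S. f i (p i)) = 0"
    proof
      fix p assume p: "p \<in> {p. p permutes S} - {id}"
      then obtain i where i: "p i \<noteq> i" by (auto simp: fun_eq_iff)
      from p have pp: "p permutes S" by simp
      have iS: "i \<in> S" "p i \<in> S" using i permutes_not_in[OF pp] permutes_in_image[OF pp] by blast+
      then have "f i (p i) = 0" using assms(2)[OF iS] i by metis
      then have "(\<Prod>i\<in>S. f i (p i)) = 0"
        using iS(1) assms(1) by (intro prod_zero) auto
      then show "of_int (sign p) * (\<Prod>i\<in>S. f i (p i)) = 0" by simp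
    qed
  qed
  then show ?thesis by simp
qed

text \<open>A permutation that moves a point outside \<open>S\<close> picks up a zero entry of the
  padded matrix, so only permutations of \<open>S\<close> contribute.\<close>

lemma det_pad_eq_leibniz:
  fixes f :: "'n::finite \<Rightarrow> 'n \<Rightarrow> 'a::comm_ring_1"
  shows "det (\<chi> i j. if i \<in> S \<and> j \<in> S then f i j else if i = j then 1 else 0) = leibniz S f"
proof -
  let ?A = "\<chi> i j. if i \<in> S \<and> j \<in> S then f i j else if i = j then 1 else 0"
  have "det ?A = (\<Sum>p | p permutes S. of_int (sign p) * (\<Prod>i\<in>UNIV. ?A $ i $ p i))"
    unfolding det_def
  proof (rule sum.mono_neutral_right)
    show "{p. p permutes S} \<subseteq> {p. p permutes (UNIV::'n set)}" using permutes_subset by blast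
    show "\<forall>p\<in>{p. p permutes UNIV} - {p. p permutes S}. of_int (sign p) * (\<Prod>i\<in>UNIV. ?A $ i $ p i) = 0"
    proof
      fix p assume p: "p \<in> {p. p permutes (UNIV::'n set)} - {p. p permutes S}"
      then obtain i where i: "i \<notin> S" "p i \<noteq> i" using permutes_superset[of p UNIV S] by auto
      then have "?A $ i $ p i = 0" by auto
      then have "(\<Prod>i\<in>UNIV. ?A $ i $ p i) = 0" by (intro prod_zero[OF finite bexI[of _ i]]) auto
      then show "of_int (sign p) * (\<Prod>i\<in>UNIV. ?A $ i $ p i) = 0" by simp
    qed
  qed auto
  also have "\<dots> = leibniz S f"
    unfolding leibniz_def
  proof (rule sum.cong[OF refl])
    fix p assume "p \<in> {p. p permutes S}"
    then have p: "p permutes S" by simp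
    have "(\<Prod>i\<in>UNIV. ?A $ i $ p i) = (\<Prod>i\<in>S. ?A $ i $ p i)"
      by (rule prod.mono_neutral_right) (auto simp: permutes_not_in[OF p])
    also have "\<dots> = (\<Prod>i\<in>S. f i (p i))"
      using permutes_in_image[OF p] by (intro prod.cong) auto
    finally show "of_int (sign p) * (\<Prod>i\<in>UNIV. ?A $ i $ p i) = of_int (sign p) * (\<Prod>i\<in>S. f i (p i))" by simp
  qed
  finally show ?thesis .
qed

lemma det_eq_leibniz: "det (A :: 'a::comm_ring_1^'n::finite^'n) = leibniz UNIV (\<lambda>i j. A $ i $ j)"
  by (simp add: det_def leibniz_def)

lemma sign_conjugate:
  assumes "finite S" "p permutes S" "bij_betw r S R"
  shows "sign (\<lambda>x. if x \<in> R then r (p (inv_into S r x)) else x) = sign p"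
proof -
  have "(\<lambda>x. if x \<in> R then r (p (inv_into S r x)) else x) = map_permutation S r p"
    using assms(3) by (auto simp: map_permutation_def restrict_id_def bij_betw_def fun_eq_iff)
  then show ?thesis using sign_map_permutation[OF _ assms(2,1)] assms(3) bij_betw_imp_inj_on by metis
qed

lemma leibniz_reindex:
  assumes S: "finite S" and r: "bij_betw r S R"
  shows "leibniz R f = leibniz S (\<lambda>i j. f (r i) (r j))"
proof -
  let ?c = "\<lambda>p x. if x \<in> R then r (p (inv_into S r x)) else x"
  have "leibniz R f = (\<Sum>p | p permutes S. of_int (sign (?c p)) * (\<Prod>i\<in>R. f i (?c p i)))"
    unfolding leibniz_def by (rule sum.reindex_bij_betw[OF bij_betw_permutations[OF r], symmetric])
  also have "\<dots> = leibniz S (\<lambda>i j. f (r i) (r j))"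
    unfolding leibniz_def
  proof (rule sum.cong[OF refl])
    fix p assume "p \<in> {p. p permutes S}"
    then have p: "p permutes S" by simp
    have "(\<Prod>i\<in>R. f i (?c p i)) = (\<Prod>i\<in>S. f (r i) (?c p (r i)))"
      by (rule prod.reindex_bij_betw[OF r, symmetric])
    also have "\<dots> = (\<Prod>i\<in>S. f (r i) (r (p i)))"
      using r by (intro prod.cong) (auto simp: bij_betw_def)
    finally show "of_int (sign (?c p)) * (\<Prod>i\<in>R. f i (?c p i)) = of_int (sign p) * (\<Prod>i\<in>S. f (r i) (r (p i)))"
      using sign_conjugate[OF S p r] by simp
  qed
  finally show ?thesis .
qed


lemma det_eq_prod_diagonal:
  fixes A :: "'a::comm_ring_1^'n::finite^'n"
  assumes "\<And>p. p permutes UNIV \<Longrightarrow> p \<noteq> id \<Longrightarrow> \<exists>i. A $ i $ p i = 0"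
  shows "det A = (\<Prod>i\<in>UNIV. A $ i $ i)"
proof -
  have "det A = (\<Sum>p\<in>{id}. of_int (sign p) * (\<Prod>i\<in>UNIV. A $ i $ p i))"
    unfolding det_def
  proof (rule sum.mono_neutral_right)
    show "\<forall>p\<in>{p. p permutes UNIV} - {id}. of_int (sign p) * (\<Prod>i\<in>UNIV. A $ i $ p i) = 0"
    proof
      fix p assume "p \<in> {p. p permutes (UNIV::'n set)} - {id}"
      then obtain i where "A $ i $ p i = 0" using assms by auto
      then have "(\<Prod>i\<in>UNIV. A $ i $ p i) = 0" by (intro prod_zero[OF finite bexI[of _ i]]) auto
      then show "of_int (sign p) * (\<Prod>i\<in>UNIV. A $ i $ p i) = 0" by simp
    qed
  qed (auto simp: permutes_id)
  then show ?thesis by simp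
qed

text \<open>The matrix deviates from the identity only in rows outside \<open>R\<close> and columns
  inside \<open>R\<close>, so it is block triangular with unit blocks on the diagonal.\<close>

lemma det_unipotent:
  fixes A :: "'a::comm_ring_1^'n::finite^'n"
  assumes "\<And>i j. i \<in> R \<or> j \<notin> R \<Longrightarrow> A $ i $ j = (if i = j then 1 else 0)"
  shows "det A = 1"
proof -
  have "\<exists>i. A $ i $ p i = 0" if p: "p permutes UNIV" "p \<noteq> id" for p
  proof (cases "\<exists>i\<in>R. p i \<noteq> i")
    case True
    then show ?thesis using assms by metis
  next
    case False
    then have "p permutes (- R)" using permutes_superset[OF p(1), of "- R"] by auto
    moreover obtain i where i: "p i \<noteq> i" using p(2) by (auto simp: fun_eq_iff)
    ultimately have "p i \<notin> R" using False permutes_in_image by fastforce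
    then show ?thesis using assms[of i "p i"] i by auto
  qed
  then have "det A = (\<Prod>i\<in>UNIV. A $ i $ i)" by (rule det_eq_prod_diagonal)
  also have "\<dots> = (\<Prod>i\<in>(UNIV::'n set). 1)" using assms by (intro prod.cong refl) metis
  finally show ?thesis by simp
qed

text \<open>The matrix factors into a diagonal matrix, which carries the entries outside the range
  of \<open>r\<close>, and the block indexed by that range, padded by the identity.\<close>

lemma det_block_diagonal:
  fixes A :: "'a::comm_ring_1^'n::finite^'n" and r :: "'q::finite \<Rightarrow> 'n"
  assumes r: "inj r" and A: "\<And>i j. i \<notin> range r \<or> j \<notin> range r \<Longrightarrow> i \<noteq> j \<Longrightarrow> A $ i $ j = 0"
  shows "det A = (\<Prod>i\<in>- range r. A $ i $ i) * det (\<chi> a b. A $ r a $ r b)"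
proof -
  let ?d = "\<lambda>i. if i \<in> range r then 1 else A $ i $ i"
  let ?D = "(\<chi> i j. if i = j then ?d i else 0) :: 'a^'n^'n"
  let ?P = "(\<chi> i j. if i \<in> range r \<and> j \<in> range r then A $ i $ j else if i = j then 1 else 0) :: 'a^'n^'n"
  have "A = ?D ** ?P"
  proof -
    have "(?D ** ?P) $ i $ j = (\<Sum>k\<in>UNIV. if k = i then ?d i * ?P $ k $ j else 0)" for i j
      unfolding matrix_matrix_mult_def vec_lambda_beta by (intro sum.cong refl) simp
    then have "(?D ** ?P) $ i $ j = ?d i * ?P $ i $ j" for i j by (simp only: sum.delta finite UNIV_I if_True)
    moreover have "?d i * ?P $ i $ j = A $ i $ j" for i j
      using A[of i j] by (cases "i \<in> range r"; cases "j \<in> range r"; cases "i = j") (simp_all only: vec_lambda_beta if_True if_False simp_thms mult_1_left mult_1_right mult_zero_right mult_zero_left)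
    ultimately have e: "(?D ** ?P) $ i $ j = A $ i $ j" for i j by (rule trans)
    show ?thesis by (rule vec_eq_iff[THEN iffD2], rule allI, rule vec_eq_iff[THEN iffD2], rule allI, rule e[symmetric])
  qed
  then have "det A = det (?D ** ?P)" by (rule arg_cong)
  also have "\<dots> = det ?D * det ?P" by (rule det_mul)
  also have "det ?D = (\<Prod>i\<in>UNIV. ?D $ i $ i)" by (rule det_diagonal) simp
  also have "\<dots> = (\<Prod>i\<in>- range r. A $ i $ i)"
    by (rule prod.mono_neutral_cong_right) auto
  also have "det ?P = leibniz (range r) (\<lambda>i j. A $ i $ j)" by (rule det_pad_eq_leibniz)
  also have "\<dots> = leibniz UNIV (\<lambda>a b. A $ r a $ r b)"
    by (rule leibniz_reindex) (use r in \<open>auto simp: bij_betw_def\<close>)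
  also have "\<dots> = det (\<chi> a b. A $ r a $ r b)" by (simp add: det_eq_leibniz)
  finally show ?thesis .
qed

text \<open>A permutation other than the identity moves at least two points. Differentiating one
  factor of its product leaves a vanishing off-diagonal factor, so only the diagonal term
  survives.\<close>

lemma has_derivative_det_at_one:
  fixes A :: "'x::real_normed_vector \<Rightarrow> 'a::real_normed_field^'n::finite^'n"
  assumes A: "(A has_derivative A') (at x)" and one: "A x = mat 1"
  shows "((\<lambda>y. det (A y)) has_derivative (\<lambda>h. trace (A' h))) (at x)"
proof -
  have c: "((\<lambda>y. A y $ i $ j) has_derivative (\<lambda>h. A' h $ i $ j)) (at x)" for i j
    by (intro bounded_linear.has_derivative[OF bounded_linear_vec_nth] A)
  have d: "((\<lambda>y. det (A y)) has_derivative
    (\<lambda>h. \<Sum>p | p permutes UNIV. of_int (sign p) * (\<Sum>i\<in>UNIV. A' h $ i $ p i * (\<Prod>j\<in>UNIV - {i}. A x $ j $ p j)))) (at x)"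
    unfolding det_def by (intro has_derivative_sum has_derivative_mult_right has_derivative_prod c)
  have "(\<Sum>p | p permutes UNIV. of_int (sign p) * (\<Sum>i\<in>UNIV. A' h $ i $ p i * (\<Prod>j\<in>UNIV - {i}. A x $ j $ p j)))
    = trace (A' h)" (is "?l = _") for h
  proof -
    have "?l = (\<Sum>p\<in>{id}. of_int (sign p) * (\<Sum>i\<in>UNIV. A' h $ i $ p i * (\<Prod>j\<in>UNIV - {i}. A x $ j $ p j)))"
    proof (rule sum.mono_neutral_right)
      show "\<forall>p\<in>{p. p permutes UNIV} - {id}. of_int (sign p) *
          (\<Sum>i\<in>UNIV. A' h $ i $ p i * (\<Prod>j\<in>UNIV - {i}. A x $ j $ p j)) = 0"
      proof
        fix p assume "p \<in> {p. p permutes (UNIV::'n set)} - {id}"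
        then have p: "p permutes UNIV" "p \<noteq> id" by auto
        then obtain a where a: "p a \<noteq> a" by (auto simp: fun_eq_iff)
        have pa: "p (p a) \<noteq> p a" using a permutes_inj[OF p(1)] by (auto dest: injD)
        have "(\<Prod>j\<in>UNIV - {i}. A x $ j $ p j) = 0" for i
        proof -
          obtain j where "j \<noteq> i" "p j \<noteq> j" using a pa by metis
          then show ?thesis by (intro prod_zero bexI[of _ j]) (auto simp: one mat_def)
        qed
        then show "of_int (sign p) * (\<Sum>i\<in>UNIV. A' h $ i $ p i * (\<Prod>j\<in>UNIV - {i}. A x $ j $ p j)) = 0"
          by (simp only: mult_zero_right sum.neutral_const)
      qed
    qed (auto simp: permutes_id)
    then show ?thesis by (simp add: one mat_def trace_def)
  qed
  with d show ?thesis by simp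
qed

text \<open>Jacobi's formula, reduced to the identity matrix by multiplication with the left inverse
  \<open>N\<close> of the value at \<open>x\<close>.\<close>

lemma has_derivative_det:
  fixes A :: "'x::real_normed_vector \<Rightarrow> 'a::real_normed_field^'n::finite^'n"
  assumes A: "(A has_derivative A') (at x)" and N: "N ** A x = mat 1"
  shows "((\<lambda>y. det (A y)) has_derivative (\<lambda>h. det (A x) * trace (N ** A' h))) (at x)"
proof -
  have entry: "((\<lambda>y. A y $ i $ j) has_derivative (\<lambda>h. A' h $ i $ j)) (at x)" for i j
    by (intro bounded_linear.has_derivative[OF bounded_linear_vec_nth] A)
  have vec: "((\<lambda>y. \<Sum>i\<in>UNIV. axis i (\<Sum>j\<in>UNIV. axis j ((N ** A y) $ i $ j)))
      has_derivative (\<lambda>h. \<Sum>i\<in>UNIV. axis i (\<Sum>j\<in>UNIV. axis j ((N ** A' h) $ i $ j)))) (at x)"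
    unfolding matrix_matrix_mult_def vec_lambda_beta
    by (intro has_derivative_sum bounded_linear.has_derivative[OF bounded_linear_axis] has_derivative_mult_right entry)
  have "((\<lambda>y. N ** A y) has_derivative (\<lambda>h. N ** A' h)) (at x)"
    using vec by (simp add: vec_eq_sum_axis[symmetric])
  from has_derivative_det_at_one[OF this N]
  have "((\<lambda>y. det N * det (A y)) has_derivative (\<lambda>h. trace (N ** A' h))) (at x)"
    by (simp add: det_mul)
  from has_derivative_mult_right[OF this, of "det (A x)"]
  have "((\<lambda>y. det (A x) * (det N * det (A y))) has_derivative (\<lambda>h. det (A x) * trace (N ** A' h))) (at x)" .
  moreover have "det (A x) * (det N * c) = c" for c
  proof -
    have "det N * det (A x) = 1" using arg_cong[OF N, of det] by (simp add: det_mul)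
    then have "(det N * det (A x)) * c = c" by simp
    then show ?thesis by (simp only: mult_ac)
  qed
  ultimately show ?thesis by simp
qed

lemma dz_det:
  fixes A :: "complex^'q::finite \<Rightarrow> complex^'n::finite^'n"
  assumes A: "A differentiable (at x)" and N: "N ** A x = mat 1"
  shows "dz i (\<lambda>y. det (A y)) x = det (A x) * trace (N ** (\<chi> \<alpha> \<beta>. dz i (\<lambda>y. A y $ \<alpha> $ \<beta>) x))"
    and "dzbar i (\<lambda>y. det (A y)) x = det (A x) * trace (N ** (\<chi> \<alpha> \<beta>. dzbar i (\<lambda>y. A y $ \<alpha> $ \<beta>) x))"
proof -
  let ?A = "frechet_derivative A (at x)"
  have dA: "(A has_derivative ?A) (at x)" by (rule frechet_derivative_worksI[OF A])
  have entry: "((\<lambda>y. A y $ \<alpha> $ \<beta>) has_derivative (\<lambda>h. ?A h $ \<alpha> $ \<beta>)) (at x)" for \<alpha> \<beta>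
    by (intro bounded_linear.has_derivative[OF bounded_linear_vec_nth] dA)
  note d = has_derivative_det[OF dA N]
  show "dz i (\<lambda>y. det (A y)) x = det (A x) * trace (N ** (\<chi> \<alpha> \<beta>. dz i (\<lambda>y. A y $ \<alpha> $ \<beta>) x))"
    unfolding dz_eq[OF d] dz_eq[OF entry] trace_def matrix_matrix_mult_def
    unfolding vec_lambda_beta sum_distrib_left sum_subtractf[symmetric] sum_divide_distrib
    by (intro sum.cong refl) (simp add: field_simps)
  show "dzbar i (\<lambda>y. det (A y)) x = det (A x) * trace (N ** (\<chi> \<alpha> \<beta>. dzbar i (\<lambda>y. A y $ \<alpha> $ \<beta>) x))"
    unfolding dzbar_eq[OF d] dzbar_eq[OF entry] trace_def matrix_matrix_mult_def
    unfolding vec_lambda_beta sum_distrib_left sum.distrib[symmetric] sum_divide_distrib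
    by (intro sum.cong refl) (simp add: field_simps)
qed

lemma smooth_on_det:
  fixes A :: "'a::real_normed_vector \<Rightarrow> 'b::real_normed_field^'n::finite^'n"
  assumes "open S" "smooth_on S A"
  shows "smooth_on S (\<lambda>x. det (A x))"
  unfolding det_def
  by (intro smooth_on_sum smooth_on_mult smooth_on_const smooth_on_prod smooth_on_vec_nth assms)

lemma matrix_inv_right: "invertible A \<Longrightarrow> A ** matrix_inv A = mat 1"
  and matrix_inv_left: "invertible A \<Longrightarrow> matrix_inv A ** A = mat 1"
  unfolding invertible_def matrix_inv_def by (drule someI_ex, simp)+

lemma sum_delta_mult:
  fixes g :: "'n::finite \<Rightarrow> 'a::semiring_1"
  shows "(\<Sum>k\<in>UNIV. (if i = k then 1 else 0) * g k) = g i"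
proof -
  have "(\<Sum>k\<in>UNIV. (if i = k then 1 else 0) * g k) = (\<Sum>k\<in>UNIV. if k = i then g k else 0)"
    by (intro sum.cong refl) simp
  then show ?thesis by simp
qed

section \<open>Hermitian forms, Gram matrices and positive definiteness\<close>

lemma hform_add_left: "hform a (v + v') w = hform a v w + hform a v' w"
  and hform_add_right: "hform a v (w + w') = hform a v w + hform a v w'"
  by (simp_all add: hform_def algebra_simps sum.distrib)

lemma hform_diff_left: "hform a (v - v') w = hform a v w - hform a v' w"
  by (simp add: hform_def algebra_simps sum_subtractf)

lemma hform_scale_left: "hform a (c *s v) w = c * hform a v w"
  and hform_scale_right: "hform a v (c *s w) = cnj c * hform a v w"
  by (simp_all add: hform_def sum_distrib_left mult_ac)

lemma hform_scaleR_left: "hform a (r *\<^sub>R v) w = complex_of_real r * hform a v w"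
  and hform_scaleR_right: "hform a v (r *\<^sub>R w) = complex_of_real r * hform a v w"
  by (simp_all add: hform_scale_left hform_scale_right flip: scaleC_of_real)

lemma hform_zero_left: "hform a 0 w = 0" and hform_zero_right: "hform a v 0 = 0"
  by (simp_all add: hform_def)

lemma hform_sum_left: "hform a (\<Sum>i\<in>I. v i) w = (\<Sum>i\<in>I. hform a (v i) w)"
  by (induction I rule: infinite_finite_induct) (simp_all add: hform_add_left hform_zero_left)

lemma hform_sum_right: "hform a v (\<Sum>i\<in>I. w i) = (\<Sum>i\<in>I. hform a v (w i))"
  by (induction I rule: infinite_finite_induct) (simp_all add: hform_add_right hform_zero_right)

lemma hform_axis: "hform a (axis i 1) (axis j 1) = a $ i $ j"
proof -
  have "hform a (axis i 1) (axis j 1) = (\<Sum>\<alpha>\<in>UNIV. if \<alpha> = i then (\<Sum>\<beta>\<in>UNIV. if \<beta> = j then a $ \<alpha> $ \<beta> else 0) else 0)"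
    unfolding hform_def
  proof (rule sum.cong[OF refl])
    fix \<alpha>
    have "(\<Sum>\<beta>\<in>UNIV. a $ \<alpha> $ \<beta> * axis i 1 $ \<alpha> * cnj (axis j 1 $ \<beta>)) =
      (\<Sum>\<beta>\<in>UNIV. if \<beta> = j then a $ \<alpha> $ \<beta> * axis i 1 $ \<alpha> else 0)"
      by (intro sum.cong refl) (simp add: axis_def)
    then show "(\<Sum>\<beta>\<in>UNIV. a $ \<alpha> $ \<beta> * axis i 1 $ \<alpha> * cnj (axis j 1 $ \<beta>)) =
      (if \<alpha> = i then (\<Sum>\<beta>\<in>UNIV. if \<beta> = j then a $ \<alpha> $ \<beta> else 0) else 0)"
      by (simp add: axis_def)
  qed
  then show ?thesis by simp
qed

lemma hform_add: "hform (a + b) v w = hform a v w + hform b v w"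
  by (simp add: hform_def sum.distrib algebra_simps)

lemma hform_scaleR_matrix: "hform (r *\<^sub>R a) v w = r *\<^sub>R hform a v w"
  unfolding hform_def vector_scaleR_component scaleR_sum_right by simp

lemma hform_hermitian:
  assumes "\<And>\<alpha> \<beta>. a $ \<beta> $ \<alpha> = cnj (a $ \<alpha> $ \<beta>)"
  shows "hform a w v = cnj (hform a v w)"
proof -
  have "hform a w v = (\<Sum>\<alpha>\<in>UNIV. \<Sum>\<beta>\<in>UNIV. cnj (a $ \<beta> $ \<alpha>) * w $ \<alpha> * cnj (v $ \<beta>))"
    unfolding hform_def by (intro sum.cong refl, subst assms, rule refl)
  also have "\<dots> = (\<Sum>\<beta>\<in>UNIV. \<Sum>\<alpha>\<in>UNIV. cnj (a $ \<beta> $ \<alpha>) * w $ \<alpha> * cnj (v $ \<beta>))" by (rule sum.swap)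
  finally show ?thesis by (simp add: hform_def mult_ac)
qed

text \<open>Replacing \<open>v\<close> by \<open>\<i> *s v\<close> turns the antisymmetric
  combination of \<open>hform\<close> in \<open>form11\<close> into the symmetric one; the two
  together recover \<open>hform\<close>, hence the matrix.\<close>

lemma form11_inject:
  assumes "\<And>v w. form11 a v w = form11 b v w"
  shows "a = b"
proof -
  have 1: "hform a v w - hform a w v = hform b v w - hform b w v" for v w
    using assms[of v w] by (simp add: form11_def)
  have "hform a v w = hform b v w" for v w
  proof -
    have "\<i> * (hform a v w + hform a w v) = \<i> * (hform b v w + hform b w v)"
      using 1[of "\<i> *s v" w] by (simp add: hform_scale_left hform_scale_right distrib_left)
    then have 2: "hform a v w + hform a w v = hform b v w + hform b w v" by simp
    have "(hform a v w - hform a w v) + (hform a v w + hform a w v)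
        = (hform b v w - hform b w v) + (hform b v w + hform b w v)"
      by (simp only: 1 2)
    then show ?thesis by simp
  qed
  then show ?thesis by (metis hform_axis vec_eq_iff)
qed

lemma form11_add: "form11 (a + b) v w = form11 a v w + form11 b v w"
  by (simp add: form11_def hform_add algebra_simps)

definition cnj_mat :: "complex^'n^'m \<Rightarrow> complex^'n^'m" where
  "cnj_mat A = (\<chi> i j. cnj (A $ i $ j))"

lemma det_cnj_mat: "det (cnj_mat A) = cnj (det (A :: complex^'n::finite^'n))"
  by (simp add: det_def cnj_mat_def)

text \<open>The Gram matrix of the columns is the congruence of \<open>a\<close> by
  \<open>C\<close>, conjugated on the right factor.\<close>

lemma det_hform_columns:
  fixes a C :: "complex^'n::finite^'n"
  shows "det (\<chi> i j. hform a (column i C) (column j C)) = det C * det a * cnj (det C)"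
proof -
  have "(\<chi> i j. hform a (column i C) (column j C)) = transpose C ** a ** cnj_mat C"
    unfolding vec_eq_iff
  proof (intro allI)
    fix i j
    have "hform a (column i C) (column j C) = (\<Sum>\<beta>\<in>UNIV. \<Sum>\<alpha>\<in>UNIV. a $ \<alpha> $ \<beta> * C $ \<alpha> $ i * cnj (C $ \<beta> $ j))"
      unfolding hform_def column_def by (subst sum.swap) simp
    then show "(\<chi> i j. hform a (column i C) (column j C)) $ i $ j = (transpose C ** a ** cnj_mat C) $ i $ j"
      by (simp add: transpose_def cnj_mat_def matrix_matrix_mult_def sum_distrib_right sum_distrib_left mult.commute mult.left_commute)
  qed
  then show ?thesis by (simp add: det_mul det_cnj_mat)
qed

lemma hform_eq_transpose: "hform a v w = (\<Sum>\<beta>\<in>UNIV. (transpose a *v v) $ \<beta> * cnj (w $ \<beta>))"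
  unfolding hform_def matrix_vector_mult_def transpose_def by (subst sum.swap) (simp add: sum_distrib_right)

text \<open>The determinant is real because conjugating a Hermitian matrix transposes it, and
  nonzero because a kernel vector would be isotropic. It is positive because it cannot change sign
  on the segment of positive definite matrices from the identity to \<open>a\<close>.\<close>

lemma hermitian_posdef_det:
  fixes a :: "complex^'n::finite^'n"
  assumes herm: "\<And>\<alpha> \<beta>. a $ \<beta> $ \<alpha> = cnj (a $ \<alpha> $ \<beta>)" and pos: "\<And>v. v \<noteq> 0 \<Longrightarrow> 0 < Re (hform a v v)"
  shows "Im (det a) = 0" "Re (det a) > 0" "invertible (transpose a)"
proof -
  have nz: "det b \<noteq> 0" if "\<And>v. v \<noteq> 0 \<Longrightarrow> 0 < Re (hform b v v)" for b :: "complex^'n^'n"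
  proof
    assume "det b = 0"
    then have "\<not> inj ((*v) (transpose b))" using det_nz_iff_inj_gen[of "(*v) (transpose b)"]
      by (simp add: matrix_vector_mul_linear_gen)
    then obtain v where v: "v \<noteq> 0" "transpose b *v v = 0"
      by (auto simp: vec.inj_iff_eq_0)
    then have "hform b v v = 0" by (simp add: hform_eq_transpose)
    then show False using that[OF v(1)] by simp
  qed
  have im: "Im (det b) = 0" if "\<And>\<alpha> \<beta>. b $ \<beta> $ \<alpha> = cnj (b $ \<alpha> $ \<beta>)" for b :: "complex^'n^'n"
  proof -
    have "transpose b = cnj_mat b" by (simp add: vec_eq_iff transpose_def cnj_mat_def that[symmetric])
    then have "det b = cnj (det b)" by (metis det_transpose det_cnj_mat)
    then show ?thesis by (simp add: complex_eq_iff)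
  qed
  show "Im (det a) = 0" by (rule im[OF herm])
  have "det (transpose a) \<noteq> 0" using nz[OF pos] by simp
  then show "invertible (transpose a)" by (simp add: invertible_det_nz)
  define b where "b t = (1 - t) *\<^sub>R mat 1 + t *\<^sub>R a" for t :: real
  have bpos: "0 < Re (hform (b t) v v)" if t01: "0 \<le> t" "t \<le> 1" and v0: "v \<noteq> 0" for t v
  proof -
    have "hform (b t) v v = (1 - t) *\<^sub>R hform (mat 1) v v + t *\<^sub>R hform a v v"
      by (simp add: b_def hform_add hform_scaleR_matrix)
    moreover have "hform (mat 1) v v = (\<Sum>i\<in>UNIV. v $ i * cnj (v $ i))"
    proof -
      have "(\<Sum>\<beta>\<in>UNIV. mat 1 $ \<alpha> $ \<beta> * v $ \<alpha> * cnj (v $ \<beta>)) = (\<Sum>\<beta>\<in>UNIV. if \<beta> = \<alpha> then v $ \<alpha> * cnj (v $ \<beta>) else 0)" for \<alpha>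
        by (intro sum.cong refl) (simp add: mat_def)
      then show ?thesis by (simp add: hform_def)
    qed
    then have "hform (mat 1) v v = complex_of_real (\<Sum>i\<in>UNIV. (cmod (v $ i))\<^sup>2)" 
      by (simp add: complex_norm_square del: of_real_power)
    moreover have "(\<Sum>i\<in>UNIV. (cmod (v $ i))\<^sup>2) > 0"
    proof -
      obtain i where "v $ i \<noteq> 0" using v0 by (auto simp: vec_eq_iff)
      then show ?thesis by (intro sum_pos2[of _ i]) auto
    qed
    ultimately have "Re (hform (b t) v v) = (1 - t) * (\<Sum>i\<in>UNIV. (cmod (v $ i))\<^sup>2) + t * Re (hform a v v)" by simp
    then show ?thesis using pos[OF v0] t01 \<open>(\<Sum>i\<in>UNIV. (cmod (v $ i))\<^sup>2) > 0\<close>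
      by (cases "t = 0") (simp_all add: add_nonneg_pos)
  qed
  have bherm: "b t $ \<beta> $ \<alpha> = cnj (b t $ \<alpha> $ \<beta>)" for t \<alpha> \<beta>
    by (simp add: b_def mat_def herm[symmetric])
  have ne: "Re (det (b t)) \<noteq> 0" if "0 \<le> t" "t \<le> 1" for t
    using nz[OF bpos[OF that]] im[OF bherm] by (simp add: complex_eq_iff)
  have cont: "continuous_on {0..1} (\<lambda>t. Re (det (b t)))"
    unfolding det_def b_def by (intro continuous_intros)
  have b0: "Re (det (b 0)) = 1" by (simp add: b_def)
  show "Re (det a) > 0"
  proof (rule ccontr)
    assume "\<not> 0 < Re (det a)"
    then have "Re (det (b 1)) \<le> 0" by (simp add: b_def)
    then obtain t where "0 \<le> t" "t \<le> 1" "Re (det (b t)) = 0"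
      using IVT2'[OF _ _ _ cont, of 0] b0 by auto
    then show False using ne by blast
  qed
qed

section \<open>The Ricci potential of a local quotient\<close>

text \<open>The logarithmic derivative of \<open>\<tau>\<close> plus its conjugate, without a choice
  of branch of the complex logarithm.\<close>

lemma has_derivative_ln_norm:
  assumes \<tau>: "(\<tau> has_derivative \<tau>') (at w)" and nz: "\<tau> w \<noteq> 0"
  shows "((\<lambda>y. complex_of_real (ln ((cmod (\<tau> y))\<^sup>2))) has_derivative (\<lambda>h. \<tau>' h / \<tau> w + cnj (\<tau>' h / \<tau> w))) (at w)"
proof -
  have "((\<lambda>y. Re (\<tau> y * cnj (\<tau> y))) has_derivative (\<lambda>h. Re (\<tau> w * cnj (\<tau>' h) + \<tau>' h * cnj (\<tau> w)))) (at w)"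
    by (intro has_derivative_Re has_derivative_mult has_derivative_cnj \<tau>)
  moreover have r: "Re (z * cnj z) = (cmod z)\<^sup>2" for z
    by (simp add: cmod_power2 flip: power2_eq_square)
  ultimately have 1: "((\<lambda>y. (cmod (\<tau> y))\<^sup>2) has_derivative (\<lambda>h. Re (\<tau> w * cnj (\<tau>' h) + \<tau>' h * cnj (\<tau> w)))) (at w)"
    by simp
  have pos: "0 < (cmod (\<tau> w))\<^sup>2" using nz by simp
  have "((\<lambda>y. complex_of_real (ln ((cmod (\<tau> y))\<^sup>2))) has_derivative
      (\<lambda>h. complex_of_real (Re (\<tau> w * cnj (\<tau>' h) + \<tau>' h * cnj (\<tau> w)) * inverse ((cmod (\<tau> w))\<^sup>2)))) (at w)"
    by (rule bounded_linear.has_derivative[OF bounded_linear_of_real has_derivative_ln[OF pos 1]])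
  moreover have e: "complex_of_real (Re (\<tau> w * cnj t + t * cnj (\<tau> w)) * inverse ((cmod (\<tau> w))\<^sup>2)) = t / \<tau> w + cnj (t / \<tau> w)" for t
  proof -
    have "\<tau> w * cnj t + t * cnj (\<tau> w) = of_real (Re (\<tau> w * cnj t + t * cnj (\<tau> w)))"
      by (simp add: complex_eq_iff)
    then have "complex_of_real (Re (\<tau> w * cnj t + t * cnj (\<tau> w)) * inverse ((cmod (\<tau> w))\<^sup>2))
      = (\<tau> w * cnj t + t * cnj (\<tau> w)) / (\<tau> w * cnj (\<tau> w))"
      unfolding complex_norm_square[symmetric] of_real_mult of_real_inverse by (simp only: divide_inverse)
    also have "\<dots> = t / \<tau> w + cnj (t / \<tau> w)" using nz by (simp add: field_simps)
    finally show ?thesis .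
  qed
  ultimately show ?thesis unfolding e by simp
qed

lemma smooth_on_ln_norm:
  fixes \<tau> :: "'a::real_normed_vector \<Rightarrow> complex"
  assumes "open V" "smooth_on V \<tau>" "\<And>w. w \<in> V \<Longrightarrow> \<tau> w \<noteq> 0"
  shows "smooth_on V (\<lambda>y. ln ((cmod (\<tau> y))\<^sup>2))"
proof -
  have "smooth_on V (\<lambda>y. Re (\<tau> y * cnj (\<tau> y)))"
    by (intro smooth_on_Re smooth_on_mult smooth_on_cnj assms)
  moreover have "Re (z * cnj z) = (cmod z)\<^sup>2" for z by (simp add: cmod_power2 flip: power2_eq_square)
  ultimately show ?thesis using assms by (intro smooth_on_ln) auto
qed

text \<open>The factor \<open>\<tau>\<close> corrects a slice \<open>s\<close> that is holomorphic only modulo the orbit directions.\<close>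

lemma ddbar_reduced_potential:
  fixes s :: "complex^'q::finite \<Rightarrow> complex^'n::finite" and \<Phi> :: "complex^'n \<Rightarrow> real"
  defines "\<Phi>c \<equiv> \<lambda>y. complex_of_real (\<Phi> y)"
  assumes V: "open V" and S: "open S" and sVS: "s ` V \<subseteq> S" and s: "smooth_on V s"
    and \<Phi>: "smooth_on S \<Phi>" and \<tau>: "smooth_on V \<tau>" and nz: "\<And>w. w \<in> V \<Longrightarrow> \<tau> w \<noteq> 0"
    and flow: "\<And>w i. w \<in> V \<Longrightarrow> dzbar i \<tau> w = - \<tau> w * (\<Sum>\<alpha>\<in>UNIV. dz \<alpha> \<Phi>c (s w) * dzbar i (\<lambda>y. s y $ \<alpha>) w)"
    and \<phi>: "\<And>w. w \<in> V \<Longrightarrow> \<phi> w = ln ((cmod (\<tau> w))\<^sup>2) + \<Phi> (s w)"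
    and w: "w \<in> V"
  shows "ddbar (\<lambda>y. complex_of_real (\<phi> y)) w $ l $ i =
    (\<Sum>\<alpha>\<in>UNIV. \<Sum>\<beta>\<in>UNIV. ddbar \<Phi>c (s w) $ \<alpha> $ \<beta> *
      (dz l (\<lambda>y. s y $ \<alpha>) w * cnj (dz i (\<lambda>y. s y $ \<beta>) w)
       - dzbar i (\<lambda>y. s y $ \<alpha>) w * cnj (dzbar l (\<lambda>y. s y $ \<beta>) w)))"
proof -
  define u where "u y = complex_of_real (ln ((cmod (\<tau> y))\<^sup>2)) + \<Phi>c (s y)" for y
  define P where "P \<alpha> = dz \<alpha> \<Phi>c" for \<alpha>
  define \<sigma> where "\<sigma> \<alpha> y = s y $ \<alpha>" for \<alpha> y
  have \<Phi>c: "smooth_on S \<Phi>c" unfolding \<Phi>c_def by (rule smooth_on_of_real[OF S \<Phi>])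
  have P: "smooth_on S (P \<alpha>)" for \<alpha> unfolding P_def by (rule smooth_on_dz[OF S \<Phi>c])
  have sm: "smooth_on V (\<sigma> \<alpha>)" for \<alpha> unfolding \<sigma>_def by (rule smooth_on_vec_nth[OF V s])
  have Ps: "smooth_on V (\<lambda>y. P \<alpha> (s y))" for \<alpha> by (rule smooth_on_compose[OF P V S s sVS])
  have smu: "smooth_on V u"
    unfolding u_def
    by (intro smooth_on_add V smooth_on_of_real smooth_on_ln_norm \<tau> nz smooth_on_compose[OF \<Phi>c V S s sVS])
  have tau_inv: "smooth_on V (\<lambda>y. inverse (\<tau> y))" by (rule smooth_on_inverse[OF V \<tau> nz])
  note dif = smooth_on_differentiable
  have sdif: "s differentiable (at y)" if "y \<in> V" for y by (rule dif[OF s that])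
  have inS: "s y \<in> S" if "y \<in> V" for y using sVS that by blast
  \<comment> \<open>By \<open>flow\<close>, \<open>dzbar l \<tau> / \<tau>\<close> is the negative
    of the sum that the antiholomorphic derivatives of \<open>s\<close> contribute. Both occur here
    conjugated, and they cancel.\<close>
  have du: "dz l u y = dz l \<tau> y * inverse (\<tau> y) + (\<Sum>\<alpha>\<in>UNIV. P \<alpha> (s y) * dz l (\<sigma> \<alpha>) y)" if y: "y \<in> V" for y l
  proof -
    let ?L = "\<lambda>y. complex_of_real (ln ((cmod (\<tau> y))\<^sup>2))"
    have d: "(?L has_derivative (\<lambda>h. frechet_derivative \<tau> (at y) h / \<tau> y + cnj (frechet_derivative \<tau> (at y) h / \<tau> y))) (at y)"
      by (rule has_derivative_ln_norm[OF smooth_on_has_derivative[OF \<tau> y] nz[OF y]])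
    have dL: "dz l ?L y = dz l \<tau> y / \<tau> y + cnj (dzbar l \<tau> y / \<tau> y)"
      unfolding dz_eq[OF d] dz_eq[OF smooth_on_has_derivative[OF \<tau> y]] dzbar_eq[OF smooth_on_has_derivative[OF \<tau> y]]
      using nz[OF y] by (simp add: field_simps)
    have fl: "dzbar l \<tau> y / \<tau> y = - (\<Sum>\<alpha>\<in>UNIV. P \<alpha> (s y) * dzbar l (\<sigma> \<alpha>) y)"
      using nz[OF y] flow[OF y, of l] by (simp add: P_def \<sigma>_def[abs_def])
    have real: "dzbar \<alpha> \<Phi>c (s y) = cnj (P \<alpha> (s y))" for \<alpha>
      unfolding P_def \<Phi>c_def by (rule dz_of_real(1)[OF smooth_on_has_derivative[OF \<Phi> inS[OF y]]])
    have dS: "dz l (\<lambda>y. \<Phi>c (s y)) y = (\<Sum>\<alpha>\<in>UNIV. P \<alpha> (s y) * dz l (\<sigma> \<alpha>) y) + cnj (\<Sum>\<alpha>\<in>UNIV. P \<alpha> (s y) * dzbar l (\<sigma> \<alpha>) y)"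
      unfolding dz_compose(1)[OF sdif[OF y] dif[OF \<Phi>c inS[OF y]]]
      by (simp add: P_def real[unfolded P_def] \<sigma>_def[abs_def] sum.distrib)
    have "dz l u y = dz l ?L y + dz l (\<lambda>y. \<Phi>c (s y)) y"
      unfolding u_def
    proof (rule dz_add)
      show "?L differentiable at y" using d differentiableI by blast
      show "(\<lambda>y. \<Phi>c (s y)) differentiable at y" by (rule dif[OF smooth_on_compose[OF \<Phi>c V S s sVS] y])
    qed
    then show ?thesis unfolding dL dS fl by (simp add: divide_inverse)
  qed
  have "ddbar (\<lambda>y. complex_of_real (\<phi> y)) w $ l $ i = dz l (dzbar i u) w"
  proof -
    have eq: "u y = complex_of_real (\<phi> y)" if "y \<in> V" for y using \<phi>[OF that] by (simp add: u_def \<Phi>c_def)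
    have "dzbar i u y = dzbar i (\<lambda>y. complex_of_real (\<phi> y)) y" if "y \<in> V" for y
      by (rule dz_cong(2)[OF V that eq dif[OF smu that]])
    then have "dz l (dzbar i u) w = dz l (dzbar i (\<lambda>y. complex_of_real (\<phi> y))) w"
      by (rule dz_cong(1)[OF V w _ dif[OF smooth_on_dz(2)[OF V smu] w]])
    then show ?thesis by (simp add: ddbar_def)
  qed
  also have "\<dots> = dzbar i (dz l u) w" by (rule dz_commute(2)[OF V smu w])
  also have "\<dots> = dzbar i (\<lambda>y. dz l \<tau> y * inverse (\<tau> y) + (\<Sum>\<alpha>\<in>UNIV. P \<alpha> (s y) * dz l (\<sigma> \<alpha>) y)) w"
    by (rule dz_cong(2)[OF V w du dif[OF smooth_on_dz(1)[OF V smu] w]])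
  also have "\<dots> = dzbar i (dz l \<tau>) w * inverse (\<tau> w) + dz l \<tau> w * (- dzbar i \<tau> w / (\<tau> w)\<^sup>2)
      + (\<Sum>\<alpha>\<in>UNIV. dzbar i (\<lambda>y. P \<alpha> (s y)) w * dz l (\<sigma> \<alpha>) w + P \<alpha> (s w) * dzbar i (dz l (\<sigma> \<alpha>)) w)"
  proof -
    have 1: "(\<lambda>y. dz l \<tau> y * inverse (\<tau> y)) differentiable at w"
      by (intro dif[OF _ w] smooth_on_mult V smooth_on_dz(1) \<tau> tau_inv)
    have 2: "(\<lambda>y. P \<alpha> (s y) * dz l (\<sigma> \<alpha>) y) differentiable at w" for \<alpha>
      by (intro dif[OF _ w] smooth_on_mult V smooth_on_dz(1) sm Ps)
    have 3: "(\<lambda>y. \<Sum>\<alpha>\<in>UNIV. P \<alpha> (s y) * dz l (\<sigma> \<alpha>) y) differentiable at w"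
      by (intro dif[OF _ w] smooth_on_sum smooth_on_mult V smooth_on_dz(1) sm Ps)
    show ?thesis
      unfolding dz_add(2)[OF 1 3] dz_sum(2)[OF 2] dz_mult(2)[OF dif[OF smooth_on_dz(1)[OF V \<tau>] w] dif[OF tau_inv w]]
        dz_mult(2)[OF dif[OF Ps w] dif[OF smooth_on_dz(1)[OF V sm] w]] dz_inverse(2)[OF dif[OF \<tau> w] nz[OF w]] ..
  qed
  \<comment> \<open>Mixed derivatives commute, so \<open>dzbar i\<close> of
    \<open>dz l \<tau> / \<tau>\<close> is \<open>dz l\<close> of
    \<open>dzbar i \<tau> / \<tau>\<close>, which \<open>flow\<close> expresses through
    \<open>s\<close>.\<close>
  also have "dzbar i (dz l \<tau>) w * inverse (\<tau> w) + dz l \<tau> w * (- dzbar i \<tau> w / (\<tau> w)\<^sup>2)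
     = - (\<Sum>\<alpha>\<in>UNIV. dz l (\<lambda>y. P \<alpha> (s y)) w * dzbar i (\<sigma> \<alpha>) w + P \<alpha> (s w) * dz l (dzbar i (\<sigma> \<alpha>)) w)"
  proof -
    have 2: "(\<lambda>y. P \<alpha> (s y) * dzbar i (\<sigma> \<alpha>) y) differentiable at w" for \<alpha>
      by (intro dif[OF _ w] smooth_on_mult V smooth_on_dz(2) sm Ps)
    have 3: "(\<lambda>y. \<Sum>\<alpha>\<in>UNIV. P \<alpha> (s y) * dzbar i (\<sigma> \<alpha>) y) differentiable at w"
      by (intro dif[OF _ w] smooth_on_sum smooth_on_mult V smooth_on_dz(2) sm Ps)
    have "dz l (\<lambda>y. dzbar i \<tau> y * inverse (\<tau> y)) w = dz l (\<lambda>y. - (\<Sum>\<alpha>\<in>UNIV. P \<alpha> (s y) * dzbar i (\<sigma> \<alpha>) y)) w"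
    proof (rule dz_cong(1)[OF V w])
      show "dzbar i \<tau> y * inverse (\<tau> y) = - (\<Sum>\<alpha>\<in>UNIV. P \<alpha> (s y) * dzbar i (\<sigma> \<alpha>) y)" if "y \<in> V" for y
        using nz[OF that] flow[OF that, of i] by (simp add: P_def \<sigma>_def[abs_def])
      show "(\<lambda>y. dzbar i \<tau> y * inverse (\<tau> y)) differentiable at w"
        by (intro dif[OF _ w] smooth_on_mult V smooth_on_dz(2) \<tau> tau_inv)
    qed
    moreover have "dz l (\<lambda>y. dzbar i \<tau> y * inverse (\<tau> y)) w
        = dzbar i (dz l \<tau>) w * inverse (\<tau> w) + dzbar i \<tau> w * (- dz l \<tau> w / (\<tau> w)\<^sup>2)"
      unfolding dz_mult(1)[OF dif[OF smooth_on_dz(2)[OF V \<tau>] w] dif[OF tau_inv w]]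
        dz_inverse(1)[OF dif[OF \<tau> w] nz[OF w]] dz_commute(2)[OF V \<tau> w] ..
    moreover have "dz l (\<lambda>y. - (\<Sum>\<alpha>\<in>UNIV. P \<alpha> (s y) * dzbar i (\<sigma> \<alpha>) y)) w =
        - (\<Sum>\<alpha>\<in>UNIV. dz l (\<lambda>y. P \<alpha> (s y)) w * dzbar i (\<sigma> \<alpha>) w + P \<alpha> (s w) * dz l (dzbar i (\<sigma> \<alpha>)) w)"
      unfolding dz_minus(1)[OF 3] dz_sum(1)[OF 2]
        dz_mult(1)[OF dif[OF Ps w] dif[OF smooth_on_dz(2)[OF V sm] w]] ..
    ultimately show ?thesis by (simp add: mult.commute)
  qed
  also have "- (\<Sum>\<alpha>\<in>UNIV. dz l (\<lambda>y. P \<alpha> (s y)) w * dzbar i (\<sigma> \<alpha>) w + P \<alpha> (s w) * dz l (dzbar i (\<sigma> \<alpha>)) w)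
     + (\<Sum>\<alpha>\<in>UNIV. dzbar i (\<lambda>y. P \<alpha> (s y)) w * dz l (\<sigma> \<alpha>) w + P \<alpha> (s w) * dzbar i (dz l (\<sigma> \<alpha>)) w)
     = (\<Sum>\<alpha>\<in>UNIV. dzbar i (\<lambda>y. P \<alpha> (s y)) w * dz l (\<sigma> \<alpha>) w - dz l (\<lambda>y. P \<alpha> (s y)) w * dzbar i (\<sigma> \<alpha>) w)"
    by (simp add: dz_commute(2)[OF V sm w] sum.distrib sum_subtractf)
  also have "\<dots> = (\<Sum>\<alpha>\<in>UNIV. \<Sum>\<beta>\<in>UNIV. dz \<beta> (P \<alpha>) (s w) * (dzbar i (\<sigma> \<beta>) w * dz l (\<sigma> \<alpha>) w)
         - dz \<beta> (P \<alpha>) (s w) * (dz l (\<sigma> \<beta>) w * dzbar i (\<sigma> \<alpha>) w)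
         + ddbar \<Phi>c (s w) $ \<alpha> $ \<beta> * (dz l (\<sigma> \<alpha>) w * cnj (dz i (\<sigma> \<beta>) w) - dzbar i (\<sigma> \<alpha>) w * cnj (dzbar l (\<sigma> \<beta>) w)))"
  proof (rule sum.cong[OF refl])
    fix \<alpha>
    have "dzbar \<beta> (P \<alpha>) (s w) = ddbar \<Phi>c (s w) $ \<alpha> $ \<beta>" for \<beta>
      using dz_commute(2)[OF S \<Phi>c inS[OF w]] by (simp add: ddbar_def P_def)
    then have e: "dzbar i (\<lambda>y. P \<alpha> (s y)) w = (\<Sum>\<beta>\<in>UNIV. dz \<beta> (P \<alpha>) (s w) * dzbar i (\<sigma> \<beta>) w
        + ddbar \<Phi>c (s w) $ \<alpha> $ \<beta> * cnj (dz i (\<sigma> \<beta>) w))"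
      "dz l (\<lambda>y. P \<alpha> (s y)) w = (\<Sum>\<beta>\<in>UNIV. dz \<beta> (P \<alpha>) (s w) * dz l (\<sigma> \<beta>) w
        + ddbar \<Phi>c (s w) $ \<alpha> $ \<beta> * cnj (dzbar l (\<sigma> \<beta>) w))"
      unfolding dz_compose[OF sdif[OF w] dif[OF P inS[OF w]]] by (simp_all add: \<sigma>_def[abs_def])
    show "dzbar i (\<lambda>y. P \<alpha> (s y)) w * dz l (\<sigma> \<alpha>) w - dz l (\<lambda>y. P \<alpha> (s y)) w * dzbar i (\<sigma> \<alpha>) w =
      (\<Sum>\<beta>\<in>UNIV. dz \<beta> (P \<alpha>) (s w) * (dzbar i (\<sigma> \<beta>) w * dz l (\<sigma> \<alpha>) w)
         - dz \<beta> (P \<alpha>) (s w) * (dz l (\<sigma> \<beta>) w * dzbar i (\<sigma> \<alpha>) w)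
         + ddbar \<Phi>c (s w) $ \<alpha> $ \<beta> * (dz l (\<sigma> \<alpha>) w * cnj (dz i (\<sigma> \<beta>) w) - dzbar i (\<sigma> \<alpha>) w * cnj (dzbar l (\<sigma> \<beta>) w)))"
      unfolding e sum_distrib_right sum_subtractf[symmetric]
      by (intro sum.cong refl) (simp add: algebra_simps)
  qed
  also have "\<dots> = (\<Sum>\<alpha>\<in>UNIV. \<Sum>\<beta>\<in>UNIV. dz \<beta> (P \<alpha>) (s w) * (dzbar i (\<sigma> \<beta>) w * dz l (\<sigma> \<alpha>) w))
      - (\<Sum>\<alpha>\<in>UNIV. \<Sum>\<beta>\<in>UNIV. dz \<beta> (P \<alpha>) (s w) * (dz l (\<sigma> \<beta>) w * dzbar i (\<sigma> \<alpha>) w))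
      + (\<Sum>\<alpha>\<in>UNIV. \<Sum>\<beta>\<in>UNIV. ddbar \<Phi>c (s w) $ \<alpha> $ \<beta> * (dz l (\<sigma> \<alpha>) w * cnj (dz i (\<sigma> \<beta>) w) - dzbar i (\<sigma> \<alpha>) w * cnj (dzbar l (\<sigma> \<beta>) w)))"
    by (simp only: sum.distrib sum_subtractf)
  \<comment> \<open>The second derivatives of \<open>\<Phi>\<close> of type (2,0) are symmetric in
    the two indices, so the terms that contain them cancel.\<close>
  also have "(\<Sum>\<alpha>\<in>UNIV. \<Sum>\<beta>\<in>UNIV. dz \<beta> (P \<alpha>) (s w) * (dz l (\<sigma> \<beta>) w * dzbar i (\<sigma> \<alpha>) w)) =
     (\<Sum>\<alpha>\<in>UNIV. \<Sum>\<beta>\<in>UNIV. dz \<beta> (P \<alpha>) (s w) * (dzbar i (\<sigma> \<beta>) w * dz l (\<sigma> \<alpha>) w))"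
    by (subst sum.swap, intro sum.cong refl)
      (simp only: P_def dz_commute(1)[OF S \<Phi>c inS[OF w], symmetric] mult.commute mult.left_commute)
  finally show ?thesis by (simp add: \<sigma>_def[abs_def])
qed

section \<open>The Kaehler identity and the weighted Laplacian\<close>

lemma dz_entry_scale:
  assumes "(h has_derivative h') (at z)"
  shows "((\<lambda>y. hform (h y) v w) has_derivative (\<lambda>u. hform (h' u) v w)) (at z)"
proof -
  have e: "((\<lambda>y. h y $ \<alpha> $ \<beta>) has_derivative (\<lambda>u. h' u $ \<alpha> $ \<beta>)) (at z)" for \<alpha> \<beta>
    by (intro bounded_linear.has_derivative[OF bounded_linear_vec_nth] assms)
  show ?thesis unfolding hform_def by (intro has_derivative_sum has_derivative_mult_left e)
qed

text \<open>Closedness is an identity about real tangent vectors. Evaluating it on the eight triples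
  of axis vectors and their multiples by \<open>\<i>\<close> isolates the part of type (2,1), on
  which it is the symmetry in the first two indices.\<close>

lemma kahler_identity:
  fixes h :: "complex^'n::finite \<Rightarrow> complex^'n^'n"
  assumes h: "h differentiable (at z)"
    and closed: "\<And>u v w. ext_deriv2 (\<lambda>y. form11 (h y)) z u v w = 0"
  shows "dz i (\<lambda>y. h y $ k $ j) z = dz k (\<lambda>y. h y $ i $ j) z"
proof -
  let ?h = "frechet_derivative h (at z)"
  define T where "T u v w = hform (?h u) v w" for u v w
  have dh: "(h has_derivative ?h) (at z)" by (rule frechet_derivative_worksI[OF h])
  have d: "frechet_derivative (\<lambda>y. form11 (h y) v w) (at z) u = \<i> / (2 * of_real pi) * (T u v w - T u w v)" for u v w
    unfolding form11_def T_def
    by (rule fun_cong[OF frechet_eq]) (intro has_derivative_mult_right has_derivative_diff dz_entry_scale dh)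
  have c: "\<i> / (2 * of_real pi) \<noteq> (0::complex)" by simp
  have E: "(T u v w - T u w v) - (T v u w - T v w u) + (T w u v - T w v u) = 0" for u v w
    using closed[of u v w] c unfolding ext_deriv2_def d right_diff_distrib[symmetric] distrib_left[symmetric]
    by (simp only: mult_eq_0_iff) simp
  have sl: "T u (\<i> *s v) w = \<i> * T u v w" and sr: "T u v (\<i> *s w) = - (\<i> * T u v w)" for u v w
    by (simp_all add: T_def hform_scale_left hform_scale_right)
  have dT: "dz i (\<lambda>y. h y $ k $ j) z = (T (axis i 1) (axis k 1) (axis j 1) - \<i> * T (\<i> *s axis i 1) (axis k 1) (axis j 1)) / 2" for i k
  proof -
    have "((\<lambda>y. h y $ k $ j) has_derivative (\<lambda>u. ?h u $ k $ j)) (at z)"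
      by (intro bounded_linear.has_derivative[OF bounded_linear_vec_nth] dh)
    then show ?thesis by (simp add: dz_eq T_def hform_axis axis_imaginary)
  qed
  note E8 = E[of "axis i 1" "axis k 1" "axis j 1"] E[of "\<i> *s axis i 1" "axis k 1" "axis j 1"]
    E[of "axis i 1" "\<i> *s axis k 1" "axis j 1"] E[of "\<i> *s axis i 1" "\<i> *s axis k 1" "axis j 1"]
    E[of "axis i 1" "axis k 1" "\<i> *s axis j 1"] E[of "\<i> *s axis i 1" "axis k 1" "\<i> *s axis j 1"]
    E[of "axis i 1" "\<i> *s axis k 1" "\<i> *s axis j 1"] E[of "\<i> *s axis i 1" "\<i> *s axis k 1" "\<i> *s axis j 1"]
  show ?thesis
    unfolding dT using E8[unfolded sl sr] by (simp add: complex_eq_iff; linarith)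
qed

lemma transpose_inverse_sum:
  assumes "invertible (transpose a)"
  shows "(\<Sum>j\<in>UNIV. matrix_inv (transpose a) $ i $ j * a $ k $ j) = (if i = k then 1 else 0)"
  using matrix_inv_left[OF assms]
  unfolding vec_eq_iff matrix_matrix_mult_def mat_def by (simp add: transpose_def)

text \<open>The gradient equation says \<open>dzbar j u = (\<Sum>k. h z $ k $ j * X z $ k)\<close>.
  Differentiating once more and tracing with the inverse metric produces the divergence of
  \<open>X\<close> and a derivative of the metric. The Kaehler identity turns the latter into the
  derivative of \<open>ln (det h)\<close> along \<open>X\<close>.\<close>

lemma laplace_f_eq_divergence:
  fixes h :: "complex^'n::finite \<Rightarrow> complex^'n^'n" and X :: "complex^'n \<Rightarrow> complex^'n"
  assumes S: "open S" and z: "z \<in> S" and h: "smooth_on S h" and X: "smooth_on S X" and u: "smooth_on S u"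
    and herm: "\<And>z \<alpha> \<beta>. z \<in> S \<Longrightarrow> h z $ \<beta> $ \<alpha> = cnj (h z $ \<alpha> $ \<beta>)"
    and pos: "\<And>z v. z \<in> S \<Longrightarrow> v \<noteq> 0 \<Longrightarrow> 0 < Re (hform (h z) v v)"
    and closed: "\<And>u v w. ext_deriv2 (\<lambda>y. form11 (h y)) z u v w = 0"
    and f: "smooth_on S f"
    and grad: "\<And>z. z \<in> S \<Longrightarrow> grad10 (h z) u z = X z"
  shows "laplace_f (h z) f u z = - ((\<Sum>i\<in>UNIV. dz i (\<lambda>y. X y $ i) z)
      + (\<Sum>k\<in>UNIV. dz k (\<lambda>y. complex_of_real (ln (Re (det (h y))) + f y)) z * X z $ k))"
    and "z \<in> S \<Longrightarrow> dzbar j u z = (\<Sum>k\<in>UNIV. h z $ k $ j * X z $ k)"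
proof -
  have inv: "invertible (transpose (h y))" if "y \<in> S" for y
    by (rule hermitian_posdef_det(3)[OF herm[OF that] pos[OF that]])
  have ub: "dzbar j u y = (\<Sum>k\<in>UNIV. h y $ k $ j * X y $ k)" if y: "y \<in> S" for y j
  proof -
    have "transpose (h y) *v X y = (transpose (h y) ** matrix_inv (transpose (h y))) *v (\<chi> j. dzbar j u y)"
      using grad[OF y, symmetric] by (simp add: grad10_def matrix_vector_mul_assoc)
    then have "transpose (h y) *v X y = (\<chi> j. dzbar j u y)" by (simp add: matrix_inv_right[OF inv[OF y]])
    then show ?thesis by (simp add: vec_eq_iff matrix_vector_mult_def transpose_def)
  qed
  show "z \<in> S \<Longrightarrow> dzbar j u z = (\<Sum>k\<in>UNIV. h z $ k $ j * X z $ k)" by (rule ub)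
  let ?G = "matrix_inv (transpose (h z))"
  note dif = smooth_on_differentiable
  have hs: "smooth_on S (\<lambda>y. h y $ k $ j)" for k j by (intro smooth_on_vec_nth S h)
  have Xs: "smooth_on S (\<lambda>y. X y $ k)" for k by (intro smooth_on_vec_nth S X)
  have dd: "ddbar u z $ i $ j = (\<Sum>k\<in>UNIV. dz k (\<lambda>y. h y $ i $ j) z * X z $ k + h z $ k $ j * dz i (\<lambda>y. X y $ k) z)" for i j
  proof -
    have "dz i (dzbar j u) z = dz i (\<lambda>y. \<Sum>k\<in>UNIV. h y $ k $ j * X y $ k) z"
      by (rule dz_cong(1)[OF S z ub dif[OF smooth_on_dz(2)[OF S u] z]])
    also have "\<dots> = (\<Sum>k\<in>UNIV. dz i (\<lambda>y. h y $ k $ j) z * X z $ k + h z $ k $ j * dz i (\<lambda>y. X y $ k) z)"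
      unfolding dz_sum(1)[OF dif[OF smooth_on_mult[OF S hs Xs] z]] dz_mult(1)[OF dif[OF hs z] dif[OF Xs z]] ..
    also have "\<dots> = (\<Sum>k\<in>UNIV. dz k (\<lambda>y. h y $ i $ j) z * X z $ k + h z $ k $ j * dz i (\<lambda>y. X y $ k) z)"
      unfolding kahler_identity[OF dif[OF h z] closed, of i] ..
    finally show ?thesis by (simp add: ddbar_def)
  qed
  have dets: "smooth_on S (\<lambda>y. det (h y))" by (rule smooth_on_det[OF S h])
  have detpos: "Re (det (h y)) > 0" "Im (det (h y)) = 0" if "y \<in> S" for y
    using hermitian_posdef_det(1,2)[OF herm[OF that] pos[OF that]] by auto
  have detk: "dz k (\<lambda>y. complex_of_real (ln (Re (det (h y))))) z = (\<Sum>i\<in>UNIV. \<Sum>j\<in>UNIV. ?G $ i $ j * dz k (\<lambda>y. h y $ i $ j) z)" for k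
  proof -
    let ?d = "frechet_derivative (\<lambda>y. det (h y)) (at z)"
    have d: "((\<lambda>y. det (h y)) has_derivative ?d) (at z)" by (rule smooth_on_has_derivative[OF dets z])
    have dr: "((\<lambda>y. complex_of_real (ln (Re (det (h y))))) has_derivative (\<lambda>v. complex_of_real (Re (?d v) * inverse (Re (det (h z)))))) (at z)"
      by (intro bounded_linear.has_derivative[OF bounded_linear_of_real] has_derivative_ln detpos z has_derivative_Re d)
    \<comment> \<open>On \<open>S\<close> the determinant is real, so its derivative is real as well
      and \<open>ln (Re (det (h y)))\<close> has the logarithmic derivative of
      \<open>det (h y)\<close>.\<close>
    have d0: "((\<lambda>y. complex_of_real (Re (det (h y)))) has_derivative ?d) (at z)"
      by (rule has_derivative_transform_within_open[OF d S z]) (simp add: complex_eq_iff detpos)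
    have d1: "((\<lambda>y. complex_of_real (Re (det (h y)))) has_derivative (\<lambda>v. complex_of_real (Re (?d v)))) (at z)"
      by (intro bounded_linear.has_derivative[OF bounded_linear_of_real] has_derivative_Re d)
    have "?d = (\<lambda>v. complex_of_real (Re (?d v)))" by (rule has_derivative_unique[OF d0 d1])
    then have re: "complex_of_real (Re (?d v)) = ?d v" for v by (rule fun_cong[OF sym])
    have "dz k (\<lambda>y. complex_of_real (ln (Re (det (h y))))) z = dz k (\<lambda>y. det (h y)) z / of_real (Re (det (h z)))"
      unfolding dz_eq[OF dr] dz_eq[OF d] of_real_mult re of_real_inverse by (simp only: divide_inverse algebra_simps)
    also have "of_real (Re (det (h z))) = det (h z)" by (simp add: complex_eq_iff detpos z)
    also have "dz k (\<lambda>y. det (h y)) z = det (h z) * trace (transpose ?G ** (\<chi> \<alpha> \<beta>. dz k (\<lambda>y. h y $ \<alpha> $ \<beta>) z))"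
    proof (rule dz_det(1)[OF dif[OF h z]])
      have "transpose (transpose (h z) ** ?G) = mat 1" unfolding matrix_inv_right[OF inv[OF z]] by (rule transpose_mat)
      then show "transpose ?G ** h z = mat 1" by (simp add: matrix_transpose_mul)
    qed
    also have "det (h z) * trace (transpose ?G ** (\<chi> \<alpha> \<beta>. dz k (\<lambda>y. h y $ \<alpha> $ \<beta>) z)) / det (h z)
       = trace (transpose ?G ** (\<chi> \<alpha> \<beta>. dz k (\<lambda>y. h y $ \<alpha> $ \<beta>) z))"
      using detpos[OF z] by auto
    also have "\<dots> = (\<Sum>j\<in>UNIV. \<Sum>i\<in>UNIV. ?G $ i $ j * dz k (\<lambda>y. h y $ i $ j) z)"
      by (simp add: trace_def matrix_matrix_mult_def transpose_def)
    also have "\<dots> = (\<Sum>i\<in>UNIV. \<Sum>j\<in>UNIV. ?G $ i $ j * dz k (\<lambda>y. h y $ i $ j) z)" by (rule sum.swap)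
    finally show ?thesis .
  qed
  have "(\<Sum>i\<in>UNIV. \<Sum>j\<in>UNIV. ?G $ i $ j * ddbar u z $ i $ j) =
      (\<Sum>i\<in>UNIV. \<Sum>j\<in>UNIV. \<Sum>k\<in>UNIV. ?G $ i $ j * dz k (\<lambda>y. h y $ i $ j) z * X z $ k)
    + (\<Sum>i\<in>UNIV. \<Sum>j\<in>UNIV. \<Sum>k\<in>UNIV. ?G $ i $ j * h z $ k $ j * dz i (\<lambda>y. X y $ k) z)"
    unfolding dd by (simp add: sum_distrib_left sum.distrib distrib_left mult.assoc)
  also have "(\<Sum>i\<in>UNIV. \<Sum>j\<in>UNIV. \<Sum>k\<in>UNIV. ?G $ i $ j * dz k (\<lambda>y. h y $ i $ j) z * X z $ k)
    = (\<Sum>k\<in>UNIV. dz k (\<lambda>y. complex_of_real (ln (Re (det (h y))))) z * X z $ k)"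
    unfolding detk sum_distrib_right
    by (rule trans[OF sum.cong[OF refl sum.swap] sum.swap])
  also have "(\<Sum>i\<in>UNIV. \<Sum>j\<in>UNIV. \<Sum>k\<in>UNIV. ?G $ i $ j * h z $ k $ j * dz i (\<lambda>y. X y $ k) z)
    = (\<Sum>i\<in>UNIV. \<Sum>k\<in>UNIV. (\<Sum>j\<in>UNIV. ?G $ i $ j * h z $ k $ j) * dz i (\<lambda>y. X y $ k) z)"
    unfolding sum_distrib_right by (intro sum.cong refl sum.swap)
  also have "\<dots> = (\<Sum>i\<in>UNIV. dz i (\<lambda>y. X y $ i) z)"
    unfolding transpose_inverse_sum[OF inv[OF z]] sum_delta_mult ..
  finally have lap: "laplace (h z) u z = - ((\<Sum>k\<in>UNIV. dz k (\<lambda>y. complex_of_real (ln (Re (det (h y))))) z * X z $ k)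
      + (\<Sum>i\<in>UNIV. dz i (\<lambda>y. X y $ i) z))"
    by (simp add: laplace_def)
  have "dz k (\<lambda>y. complex_of_real (ln (Re (det (h y))) + f y)) z
     = dz k (\<lambda>y. complex_of_real (ln (Re (det (h y))))) z + dz k (\<lambda>y. complex_of_real (f y)) z" for k
    unfolding of_real_add
    by (rule dz_add; rule dif[OF _ z]; intro smooth_on_of_real S f smooth_on_ln smooth_on_Re dets detpos)
  then show "laplace_f (h z) f u z = - ((\<Sum>i\<in>UNIV. dz i (\<lambda>y. X y $ i) z)
      + (\<Sum>k\<in>UNIV. dz k (\<lambda>y. complex_of_real (ln (Re (det (h y))) + f y)) z * X z $ k))"
    by (simp add: laplace_f_def lap grad[OF z] distrib_right sum.distrib mult.commute algebra_simps)
qed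

text \<open>The columns must be indexed by the coordinate type \<open>'n\<close>, while the frame
  consists of generators numbered by naturals and of vectors indexed by \<open>'q\<close>. The
  bijection \<open>\<sigma>\<close> distributes them over the columns; another choice changes the
  determinant at most by a sign.\<close>

definition frame_matrix ::
  "('n \<Rightarrow> nat + 'q) \<Rightarrow> (nat \<Rightarrow> complex^'n) \<Rightarrow> ('q \<Rightarrow> complex^'n) \<Rightarrow> complex^'n^'n" where
  "frame_matrix \<sigma> x y = (\<chi> \<alpha> \<iota>. case \<sigma> \<iota> of Inl j \<Rightarrow> x j $ \<alpha> | Inr m \<Rightarrow> y m $ \<alpha>)"

lemma sum_reindex_Plus:
  fixes \<sigma> :: "'n::finite \<Rightarrow> nat + 'q::finite"
  assumes "bij_betw \<sigma> UNIV ({..<k} <+> UNIV)"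
  shows "(\<Sum>\<iota>\<in>UNIV. g (\<sigma> \<iota>)) = (\<Sum>j<k. g (Inl j)) + (\<Sum>m\<in>UNIV. g (Inr m))"
proof -
  have "(\<Sum>\<iota>\<in>UNIV. g (\<sigma> \<iota>)) = (\<Sum>x\<in>{..<k} <+> UNIV. g x)" by (rule sum.reindex_bij_betw[OF assms])
  then show ?thesis by (simp add: sum.Plus comp_def)
qed

text \<open>Expressing columns in a frame is multiplication of the frame matrix by the coefficients
  from the right. Determinant and trace of the coefficients can then be treated apart from the
  frame.\<close>

lemma frame_coefficients:
  fixes \<sigma> :: "'n::finite \<Rightarrow> nat + 'q::finite" and M :: "complex^'n^'n"
  assumes \<sigma>: "bij_betw \<sigma> UNIV ({..<k} <+> UNIV)"
    and cols: "\<And>\<alpha> \<iota>. M $ \<alpha> $ \<iota> = (\<Sum>j<k. x j $ \<alpha> * c (Inl j) (\<sigma> \<iota>)) + (\<Sum>m\<in>UNIV. y m $ \<alpha> * c (Inr m) (\<sigma> \<iota>))"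
  shows "M = frame_matrix \<sigma> x y ** (\<chi> \<iota>' \<iota>. c (\<sigma> \<iota>') (\<sigma> \<iota>))"
  unfolding vec_eq_iff matrix_matrix_mult_def
proof (intro allI, simp only: vec_lambda_beta)
  fix \<alpha> \<iota>
  let ?g = "\<lambda>x'. (case x' of Inl j \<Rightarrow> x j $ \<alpha> | Inr m \<Rightarrow> y m $ \<alpha>) * c x' (\<sigma> \<iota>)"
  have "(\<Sum>\<iota>'\<in>UNIV. frame_matrix \<sigma> x y $ \<alpha> $ \<iota>' * c (\<sigma> \<iota>') (\<sigma> \<iota>)) = (\<Sum>\<iota>'\<in>UNIV. ?g (\<sigma> \<iota>'))"
    by (simp add: frame_matrix_def)
  also have "\<dots> = M $ \<alpha> $ \<iota>" unfolding sum_reindex_Plus[OF \<sigma>, of ?g] cols by simp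
  finally show "M $ \<alpha> $ \<iota> = (\<Sum>\<iota>'\<in>UNIV. frame_matrix \<sigma> x y $ \<alpha> $ \<iota>' * c (\<sigma> \<iota>') (\<sigma> \<iota>))" by simp
qed

lemma trace_frame_coefficients:
  fixes \<sigma> :: "'n::finite \<Rightarrow> nat + 'q::finite"
  assumes "bij_betw \<sigma> UNIV ({..<k} <+> UNIV)"
  shows "trace (\<chi> \<iota>' \<iota>. c (\<sigma> \<iota>') (\<sigma> \<iota>)) = (\<Sum>j<k. c (Inl j) (Inl j)) + (\<Sum>m\<in>UNIV. c (Inr m) (Inr m))"
  unfolding trace_def using sum_reindex_Plus[OF assms, of "\<lambda>x. c x x"] by simp

text \<open>The structure constants \<open>c\<close> enter only through the traces of \<open>ad\<close>, which vanish for a unimodular algebra.\<close>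

lemma dzbar_frame_det:
  fixes s :: "complex^'q::finite \<Rightarrow> complex^'n::finite" and X :: "nat \<Rightarrow> complex^'n \<Rightarrow> complex^'n"
  assumes V: "open V" and S: "open S" and sVS: "s ` V \<subseteq> S" and s: "smooth_on V s"
    and X: "\<And>j. j < k \<Longrightarrow> smooth_on S (X j)"
    and holo: "\<And>j i \<alpha> y. j < k \<Longrightarrow> y \<in> S \<Longrightarrow> dzbar i (\<lambda>y. X j y $ \<alpha>) y = 0"
    and a: "\<And>i j. j < k \<Longrightarrow> smooth_on V (a i j)"
    and bracket: "\<And>l j \<alpha> y. l < k \<Longrightarrow> j < k \<Longrightarrow> y \<in> S \<Longrightarrow>
      (\<Sum>\<beta>\<in>UNIV. dz \<beta> (\<lambda>y. X l y $ \<alpha>) y * X j y $ \<beta>) =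
      (\<Sum>\<beta>\<in>UNIV. dz \<beta> (\<lambda>y. X j y $ \<alpha>) y * X l y $ \<beta>) + (\<Sum>m<k. c l j m * X m y $ \<alpha>)"
    and unimod: "\<And>l. l < k \<Longrightarrow> (\<Sum>j<k. c l j j) = 0"
    and slice: "\<And>i \<alpha> w. w \<in> V \<Longrightarrow> dzbar i (\<lambda>y. s y $ \<alpha>) w = (\<Sum>j<k. a i j w * X j (s w) $ \<alpha>)"
    and \<sigma>: "bij_betw \<sigma> UNIV ({..<k} <+> UNIV)"
  defines "\<tau> \<equiv> \<lambda>w. det (frame_matrix \<sigma> (\<lambda>j. X j (s w)) (\<lambda>m. \<chi> \<alpha>. dz m (\<lambda>y. s y $ \<alpha>) w))"
  assumes nz: "\<And>w. w \<in> V \<Longrightarrow> \<tau> w \<noteq> 0" and w: "w \<in> V"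
  shows "smooth_on V \<tau>"
    and "dzbar i \<tau> w = \<tau> w * (\<Sum>l<k. a i l w * (\<Sum>\<beta>\<in>UNIV. dz \<beta> (\<lambda>y. X l y $ \<beta>) (s w)))"
proof -
  define C where "C w = frame_matrix \<sigma> (\<lambda>j. X j (s w)) (\<lambda>m. \<chi> \<alpha>. dz m (\<lambda>y. s y $ \<alpha>) w)" for w
  note dif = smooth_on_differentiable
  have lk: "l < k" if "\<sigma> \<iota> = Inl l" for \<iota> l
    using bij_betwE[OF \<sigma>, rule_format, of \<iota>] that by auto
  have ss: "smooth_on V (\<lambda>y. s y $ \<alpha>)" for \<alpha> by (rule smooth_on_vec_nth[OF V s])
  have Xc: "smooth_on S (\<lambda>y. X j y $ \<alpha>)" if "j < k" for j \<alpha> by (rule smooth_on_vec_nth[OF S X[OF that]])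
  have Xs: "smooth_on V (\<lambda>y. X j (s y) $ \<alpha>)" if "j < k" for j \<alpha>
    by (rule smooth_on_compose[OF Xc[OF that] V S s sVS])
  have entry: "(\<lambda>w. C w $ \<alpha> $ \<iota>) = (case \<sigma> \<iota> of Inl j \<Rightarrow> (\<lambda>w. X j (s w) $ \<alpha>) | Inr m \<Rightarrow> dz m (\<lambda>y. s y $ \<alpha>))" for \<alpha> \<iota>
    by (simp add: C_def frame_matrix_def fun_eq_iff split: sum.split)
  have Csm: "smooth_on V C"
  proof (intro smooth_on_vecI V)
    show "smooth_on V (\<lambda>w. C w $ \<alpha> $ \<iota>)" for \<alpha> \<iota>
      unfolding entry using lk smooth_on_dz(1)[OF V ss] Xs by (cases "\<sigma> \<iota>") auto
  qed
  have \<tau>: "\<tau> = (\<lambda>w. det (C w))" by (simp add: \<tau>_def C_def)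
  show "smooth_on V \<tau>" unfolding \<tau> by (rule smooth_on_det[OF V Csm])
  define N where "N = matrix_inv (C w)"
  have inv: "invertible (C w)" using nz[OF w] by (simp add: \<tau> invertible_det_nz)
  have NC: "N ** C w = mat 1" "C w ** N = mat 1"
    unfolding N_def by (rule matrix_inv_left[OF inv], rule matrix_inv_right[OF inv])
  \<comment> \<open>The Jacobian of the vector field \<open>\<Sum>l. a i l w * X l\<close> with
    coefficients frozen at \<open>w\<close>. Its trace is the sum in the conclusion.\<close>
  define A :: "complex^'n^'n" where "A = (\<chi> \<alpha> \<beta>. \<Sum>l<k. a i l w * dz \<beta> (\<lambda>y. X l y $ \<alpha>) (s w))"
  \<comment> \<open>Apart from \<open>A\<close>, the derivative of the frame consists of
    combinations of the generators alone: structure constants for the columns \<open>X j\<close>,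
    derivatives of the coefficients \<open>a\<close> for the columns \<open>dz m s\<close>.\<close>
  define r where "r x' x = (case x' of Inr _ \<Rightarrow> 0 | Inl m' \<Rightarrow> (case x of Inl j \<Rightarrow> - (\<Sum>l<k. a i l w * c l j m') | Inr m \<Rightarrow> dz m (a i m') w))"
    for x' x :: "nat + 'q"
  define D where "D = (\<chi> \<alpha> \<iota>. dzbar i (\<lambda>w. C w $ \<alpha> $ \<iota>) w)"
  have sw: "s w \<in> S" using sVS w by blast
  have sd: "s differentiable (at w)" by (rule dif[OF s w])
  have compbar: "dzbar i (\<lambda>y. X j (s y) $ \<alpha>) w = (\<Sum>\<beta>\<in>UNIV. dz \<beta> (\<lambda>y. X j y $ \<alpha>) (s w) * dzbar i (\<lambda>y. s y $ \<beta>) w)"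
    and comp: "dz m (\<lambda>y. X j (s y) $ \<alpha>) w = (\<Sum>\<beta>\<in>UNIV. dz \<beta> (\<lambda>y. X j y $ \<alpha>) (s w) * dz m (\<lambda>y. s y $ \<beta>) w)"
    if "j < k" for j \<alpha> m
    unfolding dz_compose[OF sd dif[OF Xc[OF that] sw]] holo[OF that sw] by simp_all
  have AC: "(A ** C w) $ \<alpha> $ \<iota> = (case \<sigma> \<iota> of
      Inl j \<Rightarrow> \<Sum>l<k. a i l w * (\<Sum>\<beta>\<in>UNIV. dz \<beta> (\<lambda>y. X l y $ \<alpha>) (s w) * X j (s w) $ \<beta>)
    | Inr m \<Rightarrow> \<Sum>l<k. a i l w * (\<Sum>\<beta>\<in>UNIV. dz \<beta> (\<lambda>y. X l y $ \<alpha>) (s w) * dz m (\<lambda>y. s y $ \<beta>) w))" for \<alpha> \<iota>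
  proof -
    have "(A ** C w) $ \<alpha> $ \<iota> = (\<Sum>\<beta>\<in>UNIV. (\<Sum>l<k. a i l w * dz \<beta> (\<lambda>y. X l y $ \<alpha>) (s w)) * C w $ \<beta> $ \<iota>)"
      by (simp add: A_def matrix_matrix_mult_def)
    also have "\<dots> = (\<Sum>l<k. a i l w * (\<Sum>\<beta>\<in>UNIV. dz \<beta> (\<lambda>y. X l y $ \<alpha>) (s w) * C w $ \<beta> $ \<iota>))"
      unfolding sum_distrib_right sum_distrib_left by (subst sum.swap) (simp add: mult.assoc)
    finally show ?thesis by (simp add: C_def frame_matrix_def split: sum.split)
  qed
  have "D - A ** C w = C w ** (\<chi> \<iota>' \<iota>. r (\<sigma> \<iota>') (\<sigma> \<iota>))"
    unfolding C_def[of w]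
  proof (rule frame_coefficients[OF \<sigma>], fold C_def[of w])
    fix \<alpha> \<iota>
    show "(D - A ** C w) $ \<alpha> $ \<iota> = (\<Sum>j<k. X j (s w) $ \<alpha> * r (Inl j) (\<sigma> \<iota>))
      + (\<Sum>m\<in>UNIV. (\<chi> \<alpha>. dz m (\<lambda>y. s y $ \<alpha>) w) $ \<alpha> * r (Inr m) (\<sigma> \<iota>))"
    proof (cases "\<sigma> \<iota>")
      case (Inl j)
      note j = lk[OF Inl]
      have "D $ \<alpha> $ \<iota> = dzbar i (\<lambda>y. X j (s y) $ \<alpha>) w" by (simp add: D_def entry Inl)
      also have "\<dots> = (\<Sum>\<beta>\<in>UNIV. \<Sum>l<k. a i l w * (dz \<beta> (\<lambda>y. X j y $ \<alpha>) (s w) * X l (s w) $ \<beta>))"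
        unfolding compbar[OF j] slice[OF w] sum_distrib_left by (simp add: mult_ac)
      also have "\<dots> = (\<Sum>l<k. a i l w * (\<Sum>\<beta>\<in>UNIV. dz \<beta> (\<lambda>y. X j y $ \<alpha>) (s w) * X l (s w) $ \<beta>))"
        unfolding sum_distrib_left by (rule sum.swap)
      also have "\<dots> = (\<Sum>l<k. a i l w * ((\<Sum>\<beta>\<in>UNIV. dz \<beta> (\<lambda>y. X l y $ \<alpha>) (s w) * X j (s w) $ \<beta>)
          - (\<Sum>m<k. c l j m * X m (s w) $ \<alpha>)))"
        by (intro sum.cong refl) (simp add: bracket[OF _ j sw])
      also have "\<dots> = (A ** C w) $ \<alpha> $ \<iota> - (\<Sum>l<k. \<Sum>m<k. a i l w * c l j m * X m (s w) $ \<alpha>)"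
        by (simp add: AC Inl right_diff_distrib sum_subtractf sum_distrib_left mult.assoc)
      also have "(\<Sum>l<k. \<Sum>m<k. a i l w * c l j m * X m (s w) $ \<alpha>) = (\<Sum>m<k. X m (s w) $ \<alpha> * (\<Sum>l<k. a i l w * c l j m))"
        unfolding sum_distrib_left by (subst sum.swap) (simp add: mult_ac)
      finally show ?thesis by (simp add: Inl r_def sum_negf)
    next
      case (Inr m)
      have prod: "(\<lambda>y. a i j y * X j (s y) $ \<alpha>) differentiable (at w)" if "j \<in> {..<k}" for j
        using that by (intro dif[OF _ w] smooth_on_mult V a Xs) auto
      have "D $ \<alpha> $ \<iota> = dzbar i (dz m (\<lambda>y. s y $ \<alpha>)) w" by (simp add: D_def entry Inr)
      also have "\<dots> = dz m (dzbar i (\<lambda>y. s y $ \<alpha>)) w" by (rule dz_commute(2)[OF V ss w, symmetric])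
      also have "\<dots> = dz m (\<lambda>w. \<Sum>j<k. a i j w * X j (s w) $ \<alpha>) w"
        by (rule dz_cong(1)[OF V w slice dif[OF smooth_on_dz(2)[OF V ss] w]])
      also have "\<dots> = (\<Sum>j<k. dz m (\<lambda>w. a i j w * X j (s w) $ \<alpha>) w)" by (rule dz_sum(1)[OF prod])
      also have "\<dots> = (\<Sum>j<k. dz m (a i j) w * X j (s w) $ \<alpha> + a i j w *
          (\<Sum>\<beta>\<in>UNIV. dz \<beta> (\<lambda>y. X j y $ \<alpha>) (s w) * dz m (\<lambda>y. s y $ \<beta>) w))"
        by (intro sum.cong refl) (simp add: dz_mult(1)[OF dif[OF a w] dif[OF Xs w]] comp)
      also have "\<dots> = (\<Sum>j<k. X j (s w) $ \<alpha> * dz m (a i j) w) + (A ** C w) $ \<alpha> $ \<iota>"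
        by (simp add: AC Inr sum.distrib mult.commute)
      finally show ?thesis by (simp add: Inr r_def)
    qed
  qed
  then have D: "D = A ** C w + C w ** (\<chi> \<iota>' \<iota>. r (\<sigma> \<iota>') (\<sigma> \<iota>))" by (simp add: algebra_simps)
  have "dzbar i \<tau> w = \<tau> w * trace (N ** D)"
    unfolding \<tau> D_def by (rule dz_det(2)[OF dif[OF Csm w] NC(1)])
  also have "trace (N ** D) = trace (N ** (A ** C w)) + trace (N ** (C w ** (\<chi> \<iota>' \<iota>. r (\<sigma> \<iota>') (\<sigma> \<iota>))))"
    by (simp add: D matrix_add_ldistrib trace_add)
  \<comment> \<open>The trace is unchanged by conjugation with the frame.\<close>
  also have "trace (N ** (A ** C w)) = trace A"
    using trace_mul_sym[of "N" "A ** C w"] NC(2) by (simp add: matrix_mul_assoc[symmetric])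
  also have "trace A = (\<Sum>l<k. a i l w * (\<Sum>\<beta>\<in>UNIV. dz \<beta> (\<lambda>y. X l y $ \<beta>) (s w)))"
    unfolding trace_def A_def sum_distrib_left by (simp, rule sum.swap)
  also have "trace (N ** (C w ** (\<chi> \<iota>' \<iota>. r (\<sigma> \<iota>') (\<sigma> \<iota>)))) = trace (\<chi> \<iota>' \<iota>. r (\<sigma> \<iota>') (\<sigma> \<iota>))"
    by (simp add: matrix_mul_assoc NC(1))
  \<comment> \<open>Only the columns of generators meet the diagonal of \<open>r\<close>, and what
    they contribute there are traces of the structure constants.\<close>
  also have "\<dots> = 0"
  proof -
    have "(\<Sum>j<k. \<Sum>l<k. a i l w * c l j j) = (\<Sum>l<k. a i l w * (\<Sum>j<k. c l j j))"
      unfolding sum_distrib_left by (rule sum.swap)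
    then have "(\<Sum>j<k. \<Sum>l<k. a i l w * c l j j) = 0" by (simp add: unimod)
    then show ?thesis unfolding trace_frame_coefficients[OF \<sigma>] by (simp add: r_def sum_negf)
  qed
  finally show "dzbar i \<tau> w = \<tau> w * (\<Sum>l<k. a i l w * (\<Sum>\<beta>\<in>UNIV. dz \<beta> (\<lambda>y. X l y $ \<beta>) (s w)))" by simp
qed

text \<open>A unipotent change of frame clears the components of the \<open>z m\<close> along the
  \<open>x j\<close>. The Gram matrix of the new frame splits into a diagonal block and
  \<open>g\<close>, and its determinant is that of \<open>h\<close> times the squared modulus of the
  frame determinant.\<close>

lemma det_frame_matrix_gram:
  fixes \<sigma> :: "'n::finite \<Rightarrow> nat + 'q::finite" and h :: "complex^'n^'n" and g :: "complex^'q^'q"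
  assumes \<sigma>: "bij_betw \<sigma> UNIV ({..<k} <+> UNIV)"
    and z: "\<And>m. z m = y m + (\<Sum>j<k. b m j *s x j)"
    and xx: "\<And>i j. i < k \<Longrightarrow> j < k \<Longrightarrow> i \<noteq> j \<Longrightarrow> hform h (x i) (x j) = 0"
    and xy: "\<And>j m. j < k \<Longrightarrow> hform h (x j) (y m) = 0" and yx: "\<And>j m. j < k \<Longrightarrow> hform h (y m) (x j) = 0"
    and yy: "\<And>l m. hform h (y l) (y m) = g $ l $ m"
  shows "det (frame_matrix \<sigma> x z) * det h * cnj (det (frame_matrix \<sigma> x z)) = (\<Prod>j<k. hform h (x j) (x j)) * det g"
proof -
  define c where "c x' x'' = (case x' of Inl j \<Rightarrow> (case x'' of Inl l \<Rightarrow> if j = l then 1 else 0 | Inr m \<Rightarrow> b m j)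
      | Inr l \<Rightarrow> (case x'' of Inl j \<Rightarrow> 0 | Inr m \<Rightarrow> if l = m then 1 else 0))" for x' x'' :: "nat + 'q"
  have lk: "l < k" if "\<sigma> \<iota> = Inl l" for \<iota> l
    using bij_betwE[OF \<sigma>, rule_format, of \<iota>] that by auto
  have inj: "inj \<sigma>" using \<sigma> by (simp add: bij_betw_def)
  have F: "frame_matrix \<sigma> x z = frame_matrix \<sigma> x y ** (\<chi> \<iota>' \<iota>. c (\<sigma> \<iota>') (\<sigma> \<iota>))"
  proof (rule frame_coefficients[OF \<sigma>])
    fix \<alpha> \<iota>
    show "frame_matrix \<sigma> x z $ \<alpha> $ \<iota> = (\<Sum>j<k. x j $ \<alpha> * c (Inl j) (\<sigma> \<iota>)) + (\<Sum>m\<in>UNIV. y m $ \<alpha> * c (Inr m) (\<sigma> \<iota>))"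
    proof (cases "\<sigma> \<iota>")
      case (Inl l)
      have "(\<Sum>j<k. x j $ \<alpha> * (if j = l then 1 else 0)) = (\<Sum>j<k. if j = l then x j $ \<alpha> else 0)"
        by (intro sum.cong) auto
      then show ?thesis using lk[OF Inl] by (simp add: frame_matrix_def c_def Inl)
    next
      case (Inr m)
      have "(\<Sum>l\<in>UNIV. y l $ \<alpha> * (if l = m then 1 else 0)) = (\<Sum>l\<in>UNIV. if l = m then y l $ \<alpha> else 0)"
        by (intro sum.cong) auto
      then show ?thesis by (simp add: frame_matrix_def c_def Inr z mult.commute)
    qed
  qed
  let ?R = "{\<iota>. \<exists>m. \<sigma> \<iota> = Inr m}"
  have "det (\<chi> \<iota>' \<iota>. c (\<sigma> \<iota>') (\<sigma> \<iota>)) = 1"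
  proof (rule det_unipotent[where R = ?R])
    fix i j assume "i \<in> ?R \<or> j \<notin> ?R"
    then show "(\<chi> \<iota>' \<iota>. c (\<sigma> \<iota>') (\<sigma> \<iota>)) $ i $ j = (if i = j then 1 else 0)"
      using inj by (auto simp: c_def inj_eq split: sum.split dest: injD) (metis injD)+
  qed
  then have dF: "det (frame_matrix \<sigma> x z) = det (frame_matrix \<sigma> x y)" by (simp add: F det_mul)
  define r where "r m = inv_into UNIV \<sigma> (Inr m)" for m
  have \<sigma>r: "\<sigma> (r m) = Inr m" for m
    unfolding r_def by (rule f_inv_into_f) (use \<sigma> in \<open>auto simp: bij_betw_def\<close>)
  have injr: "inj r" by (metis \<sigma>r injI sum.inject(2))
  have rr: "range r = ?R" using \<sigma>r inj by (auto simp: image_iff) (metis injD)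
  let ?G = "(\<chi> i j. hform h (column i (frame_matrix \<sigma> x y)) (column j (frame_matrix \<sigma> x y))) :: complex^'n^'n"
  have col: "column i (frame_matrix \<sigma> x y) = (case \<sigma> i of Inl j \<Rightarrow> x j | Inr m \<Rightarrow> y m)" for i
    by (simp add: column_def frame_matrix_def vec_eq_iff split: sum.split)
  have "det (frame_matrix \<sigma> x y) * det h * cnj (det (frame_matrix \<sigma> x y)) = det ?G"
    by (rule det_hform_columns[symmetric])
  also have "\<dots> = (\<Prod>i\<in>- range r. ?G $ i $ i) * det (\<chi> a b. ?G $ r a $ r b)"
  proof (rule det_block_diagonal[OF injr])
    fix i j assume ij: "i \<notin> range r \<or> j \<notin> range r" "i \<noteq> j"
    have "\<sigma> i \<noteq> \<sigma> j" using ij(2) inj by (auto dest: injD)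
    with ij show "?G $ i $ j = 0"
      using lk xx xy yx unfolding rr by (auto simp: col split: sum.split)
  qed
  also have "(\<chi> a b. ?G $ r a $ r b) = g" by (simp add: vec_eq_iff col \<sigma>r yy)
  also have "(\<Prod>i\<in>- range r. ?G $ i $ i) = (\<Prod>j<k. hform h (x j) (x j))"
  proof (rule prod.reindex_bij_witness[of _ "\<lambda>j. inv_into UNIV \<sigma> (Inl j)" "\<lambda>i. case \<sigma> i of Inl j \<Rightarrow> j | Inr _ \<Rightarrow> 0"])
    have si: "\<sigma> (inv_into UNIV \<sigma> (Inl j)) = Inl j" if "j < k" for j
      by (rule f_inv_into_f) (use \<sigma> that in \<open>auto simp: bij_betw_def\<close>)
    show "\<And>i. i \<in> - range r \<Longrightarrow> inv_into UNIV \<sigma> (Inl (case \<sigma> i of Inl j \<Rightarrow> j | Inr _ \<Rightarrow> 0)) = i"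
      unfolding rr by (auto split: sum.split simp: inv_into_f_f[OF inj]) (metis inj inv_f_f)
    show "\<And>i. i \<in> - range r \<Longrightarrow> (case \<sigma> i of Inl j \<Rightarrow> j | Inr _ \<Rightarrow> 0) \<in> {..<k}"
      unfolding rr using lk by (auto split: sum.split)
    show "\<And>j. j \<in> {..<k} \<Longrightarrow> (case \<sigma> (inv_into UNIV \<sigma> (Inl j)) of Inl j \<Rightarrow> j | Inr _ \<Rightarrow> 0) = j"
      using si by auto
    show "\<And>j. j \<in> {..<k} \<Longrightarrow> inv_into UNIV \<sigma> (Inl j) \<in> - range r"
      unfolding rr using si by auto
    show "\<And>i. i \<in> - range r \<Longrightarrow> hform h (x (case \<sigma> i of Inl j \<Rightarrow> j | Inr _ \<Rightarrow> 0)) (x (case \<sigma> i of Inl j \<Rightarrow> j | Inr _ \<Rightarrow> 0)) = ?G $ i $ i"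
      unfolding rr by (auto simp: col split: sum.split)
  qed
  finally show ?thesis by (simp add: dF)
qed

lemma hform_orthogonal_sums:
  fixes k :: nat
  assumes "\<And>i j. i < k \<Longrightarrow> j < k \<Longrightarrow> i \<noteq> j \<Longrightarrow> hform h (x i) (x j) = 0"
  shows "hform h (\<Sum>j<k. c j *s x j) (\<Sum>j<k. d j *s x j) = (\<Sum>j<k. c j * cnj (d j) * hform h (x j) (x j))"
proof -
  have "hform h (\<Sum>j<k. c j *s x j) (\<Sum>j<k. d j *s x j) =
      (\<Sum>i<k. \<Sum>j<k. c i * cnj (d j) * hform h (x i) (x j))"
    unfolding hform_sum_left by (simp add: hform_sum_right hform_scale_left hform_scale_right sum_distrib_left mult_ac)
  also have "\<dots> = (\<Sum>i<k. \<Sum>j<k. if j = i then c i * cnj (d i) * hform h (x i) (x i) else 0)"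
    using assms by (intro sum.cong refl) auto
  also have "\<dots> = (\<Sum>j<k. c j * cnj (d j) * hform h (x j) (x j))" by (intro sum.cong refl, subst sum.delta) auto
  finally show ?thesis .
qed

text \<open>The whole computation in one coordinate chart. The conjugated coefficients in
  \<open>slice'\<close> record that the vertical part of the derivative of \<open>s\<close> is real
  in the frame \<open>X j\<close>; \<open>mom\<close> is the vanishing of the momentum map along the
  slice.\<close>

lemma reduced_ricci_potential:
  fixes s :: "complex^'q::finite \<Rightarrow> complex^'n::finite" and X :: "nat \<Rightarrow> complex^'n \<Rightarrow> complex^'n"
    and \<sigma> :: "'n \<Rightarrow> nat + 'q" and h :: "complex^'n \<Rightarrow> complex^'n^'n" and g :: "complex^'q \<Rightarrow> complex^'q^'q"
  assumes V: "open V" and S: "open S" and sVS: "s ` V \<subseteq> S" and s: "smooth_on V s"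
    and X: "\<And>j. j < k \<Longrightarrow> smooth_on S (X j)"
    and holo: "\<And>j i \<alpha> y. j < k \<Longrightarrow> y \<in> S \<Longrightarrow> dzbar i (\<lambda>y. X j y $ \<alpha>) y = 0"
    and a: "\<And>i j. j < k \<Longrightarrow> smooth_on V (a i j)"
    and bracket: "\<And>l j \<alpha> y. l < k \<Longrightarrow> j < k \<Longrightarrow> y \<in> S \<Longrightarrow>
      (\<Sum>\<beta>\<in>UNIV. dz \<beta> (\<lambda>y. X l y $ \<alpha>) y * X j y $ \<beta>) =
      (\<Sum>\<beta>\<in>UNIV. dz \<beta> (\<lambda>y. X j y $ \<alpha>) y * X l y $ \<beta>) + (\<Sum>m<k. c l j m * X m y $ \<alpha>)"
    and unimod: "\<And>l. l < k \<Longrightarrow> (\<Sum>j<k. c l j j) = 0"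
    and \<sigma>: "bij_betw \<sigma> UNIV ({..<k} <+> UNIV)"
    and slice: "\<And>i w. w \<in> V \<Longrightarrow> (\<chi> \<alpha>. dzbar i (\<lambda>y. s y $ \<alpha>) w) = (\<Sum>j<k. a i j w *s X j (s w))"
    and slice': "\<And>i w. w \<in> V \<Longrightarrow> (\<chi> \<alpha>. dz i (\<lambda>y. s y $ \<alpha>) w) = Y i w + (\<Sum>j<k. cnj (a i j w) *s X j (s w))"
    and h: "smooth_on S h"
    and herm: "\<And>z \<alpha> \<beta>. z \<in> S \<Longrightarrow> h z $ \<beta> $ \<alpha> = cnj (h z $ \<alpha> $ \<beta>)"
    and pos: "\<And>z v. z \<in> S \<Longrightarrow> v \<noteq> 0 \<Longrightarrow> 0 < Re (hform (h z) v v)"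
    and f: "smooth_on S f"
    and ric: "\<And>z. z \<in> S \<Longrightarrow> ddbar (\<lambda>y. complex_of_real (ln (Re (det (h y))) + f y)) z = - h z"
    and mom: "\<And>l w. l < k \<Longrightarrow> w \<in> V \<Longrightarrow> (\<Sum>i\<in>UNIV. dz i (\<lambda>y. X l y $ i) (s w)) +
      (\<Sum>\<alpha>\<in>UNIV. dz \<alpha> (\<lambda>y. complex_of_real (ln (Re (det (h y))) + f y)) (s w) * X l (s w) $ \<alpha>) = 0"
    and gherm: "\<And>w \<alpha> \<beta>. w \<in> V \<Longrightarrow> g w $ \<beta> $ \<alpha> = cnj (g w $ \<alpha> $ \<beta>)"
    and gpos: "\<And>w v. w \<in> V \<Longrightarrow> v \<noteq> 0 \<Longrightarrow> 0 < Re (hform (g w) v v)"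
    and Xnz: "\<And>j w. j < k \<Longrightarrow> w \<in> V \<Longrightarrow> X j (s w) \<noteq> 0"
    and xx: "\<And>i j w. i < k \<Longrightarrow> j < k \<Longrightarrow> i \<noteq> j \<Longrightarrow> w \<in> V \<Longrightarrow> hform (h (s w)) (X i (s w)) (X j (s w)) = 0"
    and yx: "\<And>j m w. j < k \<Longrightarrow> w \<in> V \<Longrightarrow> hform (h (s w)) (Y m w) (X j (s w)) = 0"
    and yy: "\<And>l m w. w \<in> V \<Longrightarrow> hform (h (s w)) (Y l w) (Y m w) = g w $ l $ m"
    and F: "\<And>w. w \<in> V \<Longrightarrow> F w = f (s w) + ln (\<Prod>j<k. Re (hform (h (s w)) (X j (s w)) (X j (s w))))"
    and w: "w \<in> V"
  shows "ddbar (\<lambda>y. complex_of_real (ln (Re (det (g y))) + F y)) w = - g w"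
proof -
  define \<Phi> where "\<Phi> y = ln (Re (det (h y))) + f y" for y
  define \<tau> where "\<tau> = (\<lambda>w. det (frame_matrix \<sigma> (\<lambda>j. X j (s w)) (\<lambda>m. \<chi> \<alpha>. dz m (\<lambda>y. s y $ \<alpha>) w)))"
  define n where "n j w = hform (h (s w)) (X j (s w)) (X j (s w))" for j w
  have inS: "s w \<in> S" if "w \<in> V" for w using sVS that by blast
  have nreal: "n j w = complex_of_real (Re (n j w))" if "w \<in> V" for j w
    using hform_hermitian[OF herm[OF inS[OF that]], of "X j (s w)" "X j (s w)"] by (simp add: n_def complex_eq_iff)
  have npos: "Re (n j w) > 0" if "j < k" "w \<in> V" for j w
    unfolding n_def by (rule pos[OF inS[OF that(2)] Xnz[OF that]])
  have xy: "hform (h (s w)) (X j (s w)) (Y m w) = 0" if "j < k" "w \<in> V" for j m w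
    using hform_hermitian[OF herm[OF inS[OF that(2)]], of "Y m w" "X j (s w)"] yx[OF that, of m] by simp
  have dh: "det (h z) = complex_of_real (Re (det (h z)))" "Re (det (h z)) > 0" if "z \<in> S" for z
    using hermitian_posdef_det(1,2)[OF herm[OF that] pos[OF that]] by (auto simp: complex_eq_iff)
  have dg: "det (g w) = complex_of_real (Re (det (g w)))" "Re (det (g w)) > 0" if "w \<in> V" for w
    using hermitian_posdef_det(1,2)[OF gherm[OF that] gpos[OF that]] by (auto simp: complex_eq_iff)
  have gram: "(cmod (\<tau> w))\<^sup>2 * Re (det (h (s w))) = (\<Prod>j<k. Re (n j w)) * Re (det (g w))" if w: "w \<in> V" for w
  proof -
    have "\<tau> w * det (h (s w)) * cnj (\<tau> w) = (\<Prod>j<k. n j w) * det (g w)"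
      unfolding \<tau>_def n_def
      by (rule det_frame_matrix_gram[OF \<sigma>, where y = "\<lambda>m. Y m w" and b = "\<lambda>i j. cnj (a i j w)"])
        (use slice'[OF w] xx[OF _ _ _ w] xy[OF _ w] yx[OF _ w] yy[OF w] in auto)
    also have "\<tau> w * det (h (s w)) * cnj (\<tau> w) = complex_of_real ((cmod (\<tau> w))\<^sup>2 * Re (det (h (s w))))"
      unfolding of_real_mult complex_norm_square dh(1)[OF inS[OF w], symmetric] by simp
    also have "(\<Prod>j<k. n j w) * det (g w) = complex_of_real ((\<Prod>j<k. Re (n j w)) * Re (det (g w)))"
      unfolding of_real_mult of_real_prod nreal[OF w, symmetric] dg(1)[OF w, symmetric] ..
    finally show ?thesis by (simp only: of_real_eq_iff)
  qed
  have prodpos: "(\<Prod>j<k. Re (n j w)) > 0" if "w \<in> V" for w using npos[OF _ that] by (intro prod_pos) auto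
  \<comment> \<open>The Gram identity also shows that the frame is nondegenerate, as its right hand
    side is positive.\<close>
  have nz: "\<tau> w \<noteq> 0" if w: "w \<in> V" for w
  proof
    assume "\<tau> w = 0"
    then have "(\<Prod>j<k. Re (n j w)) * Re (det (g w)) = 0" using gram[OF w] by simp
    moreover have "(\<Prod>j<k. Re (n j w)) * Re (det (g w)) > 0" using prodpos[OF w] dg(2)[OF w] by simp
    ultimately show False by (metis less_irrefl)
  qed
  have slc: "dzbar i (\<lambda>y. s y $ \<alpha>) w = (\<Sum>j<k. a i j w * X j (s w) $ \<alpha>)" if "w \<in> V" for i \<alpha> w
    using slice[OF that, of i] by (simp add: vec_eq_iff)
  note fd = dzbar_frame_det[OF V S sVS s X holo a bracket unimod slc \<sigma> nz[unfolded \<tau>_def]]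
  have \<tau>sm: "smooth_on V \<tau>" unfolding \<tau>_def by (rule fd(1); (assumption | rule w))
  have \<tau>d: "dzbar i \<tau> w = \<tau> w * (\<Sum>l<k. a i l w * (\<Sum>\<beta>\<in>UNIV. dz \<beta> (\<lambda>y. X l y $ \<beta>) (s w)))" if "w \<in> V" for i w
    unfolding \<tau>_def by (rule fd(2); (assumption | rule that))
  have \<Phi>sm: "smooth_on S \<Phi>"
    unfolding \<Phi>_def by (intro smooth_on_add S f smooth_on_ln smooth_on_Re smooth_on_det h dh(2))
  have "ddbar (\<lambda>y. complex_of_real (ln (Re (det (g y))) + F y)) w $ l $ i = - g w $ l $ i" for l i
  proof -
    have "ddbar (\<lambda>y. complex_of_real (ln (Re (det (g y))) + F y)) w $ l $ i =
      (\<Sum>\<alpha>\<in>UNIV. \<Sum>\<beta>\<in>UNIV. ddbar (\<lambda>y. complex_of_real (\<Phi> y)) (s w) $ \<alpha> $ \<beta> *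
      (dz l (\<lambda>y. s y $ \<alpha>) w * cnj (dz i (\<lambda>y. s y $ \<beta>) w)
       - dzbar i (\<lambda>y. s y $ \<alpha>) w * cnj (dzbar l (\<lambda>y. s y $ \<beta>) w)))"
    proof (rule ddbar_reduced_potential[OF V S sVS s \<Phi>sm \<tau>sm nz _ _ w])
      fix w i assume w: "w \<in> V"
      \<comment> \<open>\<open>mom\<close> trades the divergences in the derivative of
        \<open>\<tau>\<close> for derivatives of the potential, which gives the equation required of
        the correcting factor.\<close>
      have "(\<Sum>l<k. a i l w * (\<Sum>\<beta>\<in>UNIV. dz \<beta> (\<lambda>y. X l y $ \<beta>) (s w)))
        = (\<Sum>l<k. - (a i l w * (\<Sum>\<alpha>\<in>UNIV. dz \<alpha> (\<lambda>y. complex_of_real (\<Phi> y)) (s w) * X l (s w) $ \<alpha>)))"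
      proof (intro sum.cong refl)
        fix l assume "l \<in> {..<k}"
        then show "a i l w * (\<Sum>\<beta>\<in>UNIV. dz \<beta> (\<lambda>y. X l y $ \<beta>) (s w)) =
           - (a i l w * (\<Sum>\<alpha>\<in>UNIV. dz \<alpha> (\<lambda>y. complex_of_real (\<Phi> y)) (s w) * X l (s w) $ \<alpha>))"
          using mom[OF _ w, of l] by (simp add: \<Phi>_def add_eq_0_iff2)
      qed
      also have "\<dots> = - (\<Sum>\<alpha>\<in>UNIV. dz \<alpha> (\<lambda>y. complex_of_real (\<Phi> y)) (s w) * dzbar i (\<lambda>y. s y $ \<alpha>) w)"
        unfolding slc[OF w] sum_distrib_left sum_negf by (subst sum.swap) (simp add: mult_ac)
      finally show "dzbar i \<tau> w = - \<tau> w * (\<Sum>\<alpha>\<in>UNIV. dz \<alpha> (\<lambda>y. complex_of_real (\<Phi> y)) (s w) * dzbar i (\<lambda>y. s y $ \<alpha>) w)"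
        unfolding \<tau>d[OF w] by simp
    next
      fix w assume w: "w \<in> V"
      have "ln ((cmod (\<tau> w))\<^sup>2 * Re (det (h (s w)))) = ln (\<Prod>j<k. Re (n j w)) + ln (Re (det (g w)))"
        unfolding gram[OF w] using prodpos[OF w] dg(2)[OF w] by (rule ln_mult_pos)
      moreover have "ln ((cmod (\<tau> w))\<^sup>2 * Re (det (h (s w)))) = ln ((cmod (\<tau> w))\<^sup>2) + ln (Re (det (h (s w))))"
        using nz[OF w] dh(2)[OF inS[OF w]] by (intro ln_mult_pos) auto
      ultimately show "ln (Re (det (g w))) + F w = ln ((cmod (\<tau> w))\<^sup>2) + \<Phi> (s w)"
        by (simp add: F[OF w] \<Phi>_def n_def)
    qed
    also have "\<dots> = - hform (h (s w)) (\<chi> \<alpha>. dz l (\<lambda>y. s y $ \<alpha>) w) (\<chi> \<alpha>. dz i (\<lambda>y. s y $ \<alpha>) w)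
       + hform (h (s w)) (\<chi> \<alpha>. dzbar i (\<lambda>y. s y $ \<alpha>) w) (\<chi> \<alpha>. dzbar l (\<lambda>y. s y $ \<alpha>) w)"
      unfolding \<Phi>_def ric[OF inS[OF w]] hform_def
      by (simp add: sum_negf sum_subtractf right_diff_distrib mult.assoc)
    \<comment> \<open>The vertical contributions to the two terms are equal, because the
      coefficients in \<open>slice\<close> and \<open>slice'\<close> are conjugate; only
      \<open>g\<close> survives.\<close>
    also have "hform (h (s w)) (\<chi> \<alpha>. dzbar i (\<lambda>y. s y $ \<alpha>) w) (\<chi> \<alpha>. dzbar l (\<lambda>y. s y $ \<alpha>) w)
       = (\<Sum>j<k. a i j w * cnj (a l j w) * n j w)"
      unfolding slice[OF w] n_def by (rule hform_orthogonal_sums[OF xx[OF _ _ _ w]])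
    also have "hform (h (s w)) (\<chi> \<alpha>. dz l (\<lambda>y. s y $ \<alpha>) w) (\<chi> \<alpha>. dz i (\<lambda>y. s y $ \<alpha>) w)
       = g w $ l $ i + (\<Sum>j<k. cnj (a l j w) * a i j w * n j w)"
    proof -
      have "hform (h (s w)) (\<Sum>j<k. cnj (a l j w) *s X j (s w)) (\<Sum>j<k. cnj (a i j w) *s X j (s w))
         = (\<Sum>j<k. cnj (a l j w) * cnj (cnj (a i j w)) * n j w)"
        unfolding n_def by (rule hform_orthogonal_sums[OF xx[OF _ _ _ w]])
      then show ?thesis
        unfolding slice'[OF w] hform_add_left hform_add_right
        using yy[OF w] yx[OF _ w] xy[OF _ w] by (simp add: hform_sum_left hform_sum_right hform_scale_left hform_scale_right)
    qed
    finally show ?thesis by (simp add: mult.commute)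
  qed
  then show ?thesis by (simp add: vec_eq_iff)
qed

section \<open>Smooth maps into manifolds\<close>

text \<open>With the trivial chart group two points of a chart domain have the same image only if
  they are equal. The open quotient map is thus a parametrization of an open set.\<close>

lemma manifold_chart:
  assumes m: "manifold P T A" and c: "c \<in> A"
  shows "open (cdom c)" "connected (cdom c)" "inj_on (cpar c) (cdom c)"
    and "\<And>z. z \<in> cdom c \<Longrightarrow> cpar c z \<in> topspace T"
    and "openin T (cimg c)"
    and "\<And>U. open U \<Longrightarrow> U \<subseteq> cdom c \<Longrightarrow> openin T (cpar c ` U)"
    and "\<And>U. openin T U \<Longrightarrow> open {z \<in> cdom c. cpar c z \<in> U}"
proof -
  have ch: "orbifold_chart P T c" and tr: "cgrp c = {\<lambda>z\<in>cdom c. z}"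
    using m c by (auto simp: manifold_def orbifold_def)
  show o: "open (cdom c)" and "connected (cdom c)" using ch by (auto simp: orbifold_chart_def)
  have eq: "cpar c z = cpar c w \<longleftrightarrow> z = w" if "z \<in> cdom c" "w \<in> cdom c" for z w
    using ch that by (simp add: orbifold_chart_def tr)
  then show "inj_on (cpar c) (cdom c)" by (auto simp: inj_on_def)
  have cm: "continuous_map (top_of_set (cdom c)) T (cpar c)" and om: "open_map (top_of_set (cdom c)) T (cpar c)"
    using ch by (auto simp: orbifold_chart_def)
  show "cpar c z \<in> topspace T" if "z \<in> cdom c" for z
    using cm that by (auto simp: continuous_map_def Pi_iff)
  show img: "openin T (cpar c ` U)" if "open U" "U \<subseteq> cdom c" for U
    using om that by (auto simp: open_map_def openin_open_eq[OF o])
  show "openin T (cimg c)" unfolding cimg_def by (rule img[OF o]) simp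
  show "open {z \<in> cdom c. cpar c z \<in> U}" if "openin T U" for U
    using openin_continuous_map_preimage[OF cm that] by (simp add: openin_open_eq[OF o])
qed

lemma coords_inverse:
  assumes "manifold P T A" "c \<in> A"
  shows "z \<in> cdom c \<Longrightarrow> coords c (cpar c z) = z"
    and "x \<in> cimg c \<Longrightarrow> cpar c (coords c x) = x"
    and "x \<in> cimg c \<Longrightarrow> coords c x \<in> cdom c"
  using manifold_chart(3)[OF assms]
  by (simp_all add: coords_def cimg_def inv_into_f_f f_inv_into_f inv_into_into)

lemma manifold_cover:
  assumes "manifold P T A" "x \<in> topspace T"
  obtains c where "c \<in> A" "x \<in> cimg c"
  using assms by (auto simp: manifold_def orbifold_def)

lemma cpar_in_cimg: "z \<in> cdom c \<Longrightarrow> cpar c z \<in> cimg c"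
  by (simp add: cimg_def)

lemma smooth_intoD:
  assumes "smooth_into T A S F" "d \<in> A"
  shows "open {s \<in> S. F s \<in> cimg d}" "smooth_on {s \<in> S. F s \<in> cimg d} (\<lambda>s. coords d (F s))"
  using assms by (auto simp: smooth_into_def comp_def)

lemma smooth_into_topspace: "smooth_into T A S F \<Longrightarrow> s \<in> S \<Longrightarrow> F s \<in> topspace T"
  by (auto simp: smooth_into_def)

text \<open>\<open>smooth_into\<close> asks for open preimages of charts as well as smoothness on
  them; both can be checked near each point.\<close>

lemma smooth_intoI_local:
  assumes T: "\<And>s. s \<in> S \<Longrightarrow> F s \<in> topspace T"
    and loc: "\<And>d s. d \<in> A \<Longrightarrow> s \<in> S \<Longrightarrow> F s \<in> cimg d \<Longrightarrow>
      \<exists>U. open U \<and> s \<in> U \<and> U \<subseteq> S \<and> F ` U \<subseteq> cimg d \<and> smooth_on U (\<lambda>s. coords d (F s))"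
  shows "smooth_into T A S F"
  unfolding smooth_into_def
proof (intro conjI ballI)
  show "F ` S \<subseteq> topspace T" using T by auto
  fix d assume d: "d \<in> A"
  show "open {s \<in> S. F s \<in> cimg d}"
  proof (subst open_subopen)
    show "\<forall>x\<in>{s \<in> S. F s \<in> cimg d}. \<exists>U. open U \<and> x \<in> U \<and> U \<subseteq> {s \<in> S. F s \<in> cimg d}"
    proof
      fix s assume "s \<in> {s \<in> S. F s \<in> cimg d}"
      then show "\<exists>U. open U \<and> s \<in> U \<and> U \<subseteq> {s \<in> S. F s \<in> cimg d}"
        using loc[OF d, of s] by auto
    qed
  qed
  show "smooth_on {s \<in> S. F s \<in> cimg d} (coords d \<circ> F)"
    unfolding comp_def
  proof (rule smooth_on_local)
    fix s assume "s \<in> {s \<in> S. F s \<in> cimg d}"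
    then show "\<exists>U. open U \<and> s \<in> U \<and> smooth_on U (\<lambda>s. coords d (F s))"
      using loc[OF d, of s] by auto
  qed
qed

lemma smooth_into_compose:
  fixes \<phi> :: "'a::real_normed_vector \<Rightarrow> 's::euclidean_space"
  assumes F: "smooth_into T A S F" and \<phi>: "smooth_on S' \<phi>" "open S'" "\<phi> ` S' \<subseteq> S"
  shows "smooth_into T A S' (\<lambda>s. F (\<phi> s))"
proof (rule smooth_intoI_local)
  show "F (\<phi> s) \<in> topspace T" if "s \<in> S'" for s using smooth_into_topspace[OF F] \<phi>(3) that by blast
  fix d s assume d: "d \<in> A" "s \<in> S'" "F (\<phi> s) \<in> cimg d"
  let ?O = "{s \<in> S. F s \<in> cimg d}"
  let ?U = "S' \<inter> \<phi> -` ?O"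
  have "open ?U"
    by (rule continuous_open_preimage[OF smooth_on_continuous[OF \<phi>(1)] \<phi>(2) smooth_intoD(1)[OF F d(1)]])
  moreover have "smooth_on ?U (\<lambda>s. coords d (F (\<phi> s)))"
    by (rule smooth_on_compose[OF smooth_intoD(2)[OF F d(1)] \<open>open ?U\<close> smooth_intoD(1)[OF F d(1)]
          smooth_on_subset[OF \<phi>(1)]]) auto
  ultimately show "\<exists>U. open U \<and> s \<in> U \<and> U \<subseteq> S' \<and> (\<lambda>s. F (\<phi> s)) ` U \<subseteq> cimg d \<and> smooth_on U (\<lambda>s. coords d (F (\<phi> s)))"
    using d \<phi>(3) by (intro exI[of _ ?U]) auto
qed

lemma smooth_into_const:
  assumes "open S" "x \<in> topspace T"
  shows "smooth_into T A S (\<lambda>s. x)"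
  by (rule smooth_intoI_local) (use assms smooth_on_const in auto)

lemma smooth_into_cong: "smooth_into T A S F \<Longrightarrow> (\<And>s. s \<in> S \<Longrightarrow> F s = F' s) \<Longrightarrow> open S \<Longrightarrow> smooth_into T A S F'"
proof (rule smooth_intoI_local)
  assume F: "smooth_into T A S F" and eq: "\<And>s. s \<in> S \<Longrightarrow> F s = F' s"
  show "F' s \<in> topspace T" if "s \<in> S" for s using smooth_into_topspace[OF F that] eq[OF that] by simp
  fix d s assume d: "d \<in> A" "s \<in> S" "F' s \<in> cimg d"
  have "smooth_on {s \<in> S. F s \<in> cimg d} (\<lambda>s. coords d (F' s))"
    by (rule smooth_on_cong[OF smooth_intoD(1)[OF F d(1)] _ smooth_intoD(2)[OF F d(1)]]) (use eq in auto)
  then show "\<exists>U. open U \<and> s \<in> U \<and> U \<subseteq> S \<and> F' ` U \<subseteq> cimg d \<and> smooth_on U (\<lambda>s. coords d (F' s))"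
    using d eq smooth_intoD(1)[OF F d(1)] by (intro exI[of _ "{s \<in> S. F s \<in> cimg d}"]) auto
qed

text \<open>On the domain of a transition into the chart \<open>d\<close>, the map
  \<open>coords d \<circ> cpar c\<close> coincides with that transition, since \<open>cpar d\<close>
  is injective.\<close>

lemma smooth_into_chart:
  assumes m: "manifold smooth_on T A" and c: "c \<in> A"
  shows "smooth_into T A (cdom c) (cpar c)"
proof (rule smooth_intoI_local)
  show "cpar c s \<in> topspace T" if "s \<in> cdom c" for s by (rule manifold_chart(4)[OF m c that])
  fix d z assume d: "d \<in> A" "z \<in> cdom c" "cpar c z \<in> cimg d"
  then have "cpar c z = cpar d (coords d (cpar c z))" "coords d (cpar c z) \<in> cdom d"
    using coords_inverse[OF m d(1)] by auto
  then obtain W l where W: "transition smooth_on c d W l" "z \<in> W"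
    using m c d unfolding manifold_def orbifold_def by meson
  have l: "coords d (cpar c y) = l y" "cpar c y \<in> cimg d" if "y \<in> W" for y
  proof -
    have "l y \<in> cdom d" "cpar d (l y) = cpar c y" using W(1) that by (auto simp: transition_def)
    then show "coords d (cpar c y) = l y" "cpar c y \<in> cimg d"
      using coords_inverse(1)[OF m d(1)] cpar_in_cimg by metis+
  qed
  have "smooth_on W (\<lambda>s. coords d (cpar c s))"
    by (rule smooth_on_cong[of W l]) (use W l in \<open>auto simp: transition_def\<close>)
  then show "\<exists>U. open U \<and> z \<in> U \<and> U \<subseteq> cdom c \<and> cpar c ` U \<subseteq> cimg d \<and> smooth_on U (\<lambda>s. coords d (cpar c s))"
    using W l by (intro exI[of _ W]) (auto simp: transition_def)
qed

text \<open>Multiplication and action are given as smooth maps on products of chart domains. Near a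
  fixed parameter both arguments remain in fixed charts, which is enough.\<close>

lemma smooth_into_compose2:
  fixes E1 :: "('a::euclidean_space, 'x) ochart set" and E2 :: "('b::euclidean_space, 'y) ochart set"
    and S :: "'s::real_normed_vector set"
  assumes m1: "manifold P1 T1 E1" and m2: "manifold P2 T2 E2"
    and \<mu>: "\<And>a b. a \<in> E1 \<Longrightarrow> b \<in> E2 \<Longrightarrow> smooth_into T A (cdom a \<times> cdom b) (\<lambda>(s, t). \<mu> (cpar a s) (cpar b t))"
    and F1: "smooth_into T1 E1 S F1" and F2: "smooth_into T2 E2 S F2"
  shows "smooth_into T A S (\<lambda>s. \<mu> (F1 s) (F2 s))"
proof -
  have loc: "\<exists>U. open U \<and> s \<in> U \<and> U \<subseteq> S \<and> smooth_into T A U (\<lambda>s. \<mu> (F1 s) (F2 s))" if s: "s \<in> S" for s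
  proof -
    obtain a where a: "a \<in> E1" "F1 s \<in> cimg a" by (rule manifold_cover[OF m1 smooth_into_topspace[OF F1 s]])
    obtain b where b: "b \<in> E2" "F2 s \<in> cimg b"
      by (rule manifold_cover[OF m2 smooth_into_topspace[OF F2 s]])
    let ?U = "{s \<in> S. F1 s \<in> cimg a} \<inter> {s \<in> S. F2 s \<in> cimg b}"
    have U: "open ?U" using smooth_intoD(1)[OF F1 a(1)] smooth_intoD(1)[OF F2 b(1)] by blast
    let ?\<phi> = "\<lambda>s. (coords a (F1 s), coords b (F2 s))"
    have "smooth_on ?U ?\<phi>"
      by (rule smooth_on_Pair[OF U smooth_on_subset[OF smooth_intoD(2)[OF F1 a(1)]] smooth_on_subset[OF smooth_intoD(2)[OF F2 b(1)]]]) auto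
    moreover have "?\<phi> ` ?U \<subseteq> cdom a \<times> cdom b"
      using coords_inverse(3)[OF m1 a(1)] coords_inverse(3)[OF m2 b(1)] by auto
    ultimately have "smooth_into T A ?U (\<lambda>s. (\<lambda>(s, t). \<mu> (cpar a s) (cpar b t)) (?\<phi> s))"
      by (rule smooth_into_compose[OF \<mu>[OF a(1) b(1)] _ U])
    then have "smooth_into T A ?U (\<lambda>s. \<mu> (F1 s) (F2 s))"
      by (rule smooth_into_cong[OF _ _ U]) (auto simp: coords_inverse(2)[OF m1 a(1)] coords_inverse(2)[OF m2 b(1)])
    then show ?thesis using s a b U by blast
  qed
  show ?thesis
  proof (rule smooth_intoI_local)
    show "\<mu> (F1 s) (F2 s) \<in> topspace T" if "s \<in> S" for s
      using loc[OF that] smooth_into_topspace[of T A _ "\<lambda>s. \<mu> (F1 s) (F2 s)" s] by blast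
    fix d s assume d: "d \<in> A" "s \<in> S" "\<mu> (F1 s) (F2 s) \<in> cimg d"
    obtain U where U: "open U" "s \<in> U" "U \<subseteq> S" "smooth_into T A U (\<lambda>s. \<mu> (F1 s) (F2 s))" using loc[OF d(2)] by blast
    then show "\<exists>U. open U \<and> s \<in> U \<and> U \<subseteq> S \<and> (\<lambda>s. \<mu> (F1 s) (F2 s)) ` U \<subseteq> cimg d \<and> smooth_on U (\<lambda>s. coords d (\<mu> (F1 s) (F2 s)))"
      using smooth_intoD(1,2)[OF U(4) d(1)] d by (intro exI[of _ "{s \<in> U. \<mu> (F1 s) (F2 s) \<in> cimg d}"]) auto
  qed
qed

lemma smooth_into_compose1:
  fixes E1 :: "('a::euclidean_space, 'x) ochart set" and S :: "'s::real_normed_vector set"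
  assumes m1: "manifold P1 T1 E1"
    and \<mu>: "\<And>a. a \<in> E1 \<Longrightarrow> smooth_into T A (cdom a) (\<lambda>s. \<mu> (cpar a s))"
    and F1: "smooth_into T1 E1 S F1"
  shows "smooth_into T A S (\<lambda>s. \<mu> (F1 s))"
proof -
  have "smooth_into T A (cdom a \<times> cdom b) (\<lambda>(s, t). \<mu> (cpar a s))" if "a \<in> E1" "b \<in> E1" for a b
  proof -
    have o: "open (cdom a \<times> cdom b)"
      using manifold_chart(1)[OF m1 that(1)] manifold_chart(1)[OF m1 that(2)] by (rule open_Times)
    have "smooth_into T A (cdom a \<times> cdom b) (\<lambda>p. \<mu> (cpar a (fst p)))"
      by (rule smooth_into_compose[OF \<mu>[OF that(1)]
            smooth_on_bounded_linear[OF bounded_linear_fst o smooth_on_ident[OF o]] o]) auto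
    then show ?thesis by (simp add: case_prod_unfold)
  qed
  from smooth_into_compose2[OF m1 m1 this F1 F1] show ?thesis .
qed

lemma smooth_into_eventually:
  assumes "smooth_into T A S F" "d \<in> A" "s \<in> S" "F s \<in> cimg d"
  shows "\<forall>\<^sub>F t in nhds s. t \<in> S \<and> F t \<in> cimg d"
    and "((\<lambda>s. coords d (F s)) has_derivative frechet_derivative (\<lambda>s. coords d (F s)) (at s)) (at s)"
proof -
  show "\<forall>\<^sub>F t in nhds s. t \<in> S \<and> F t \<in> cimg d"
    using eventually_nhds_in_open[OF smooth_intoD(1)[OF assms(1,2)], of s] assms by simp
  show "((\<lambda>s. coords d (F s)) has_derivative frechet_derivative (\<lambda>s. coords d (F s)) (at s)) (at s)"
    by (rule smooth_on_has_derivative[OF smooth_intoD(2)[OF assms(1,2)]]) (use assms in simp)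
qed

lemma has_derivative_transform_eventually_nhds:
  assumes "(f has_derivative f') (at x)" "\<forall>\<^sub>F y in nhds x. f y = g y"
  shows "(g has_derivative f') (at x)"
proof -
  obtain U where "open U" "x \<in> U" "\<And>y. y \<in> U \<Longrightarrow> f y = g y" using assms(2) by (auto simp: eventually_nhds)
  then show ?thesis using has_derivative_transform_within_open[OF assms(1)] by blast
qed

section \<open>Holomorphic isometric actions\<close>

locale kahler_lie_action =
  fixes T :: "'m topology" and A :: "(complex^'n::finite, 'm) ochart set" and h :: "('n, 'm) htensor"
    and G :: "('g, 'b) monoid_scheme" (structure) and TG :: "'g topology" and E :: "(real^'p::finite, 'g) ochart set"
    and e :: "(real^'p, 'g) ochart" and act :: "'g \<Rightarrow> 'm \<Rightarrow> 'm"
    and f :: "'m \<Rightarrow> real" and J :: "'m \<Rightarrow> real^'p \<Rightarrow> real"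
  assumes M: "manifold holo_on T A" and metric: "kahler_metric A h" and pot: "ricci_potential A h f"
    and lie: "lie_group G TG E" and e: "e \<in> E" and one_e: "\<one> \<in> cimg e"
    and action: "smooth_action G E T A act"
    and isom: "\<And>g. g \<in> carrier G \<Longrightarrow> holomorphic_isometry A h (act g)"
    and mom: "momentum_map G e act A h f T J"
begin

abbreviation "s0 \<equiv> coords e \<one>"
abbreviation "gen \<equiv> generator G e act"

lemma group_G: "group G" and topTG: "topspace TG = carrier G" and mG: "manifold smooth_on TG E"
  using lie by (auto simp: lie_group_def)

sublocale group G by (rule group_G)

lemma e_chart: "open (cdom e)" "s0 \<in> cdom e" "cpar e s0 = \<one>"
  using manifold_chart(1)[OF mG e] coords_inverse(2,3)[OF mG e one_e] by auto

lemma smooth_mult: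
  assumes "smooth_into TG E S F" "smooth_into TG E S F'"
  shows "smooth_into TG E S (\<lambda>s. F s \<otimes> F' s)"
  by (rule smooth_into_compose2[OF mG mG _ assms]) (use lie in \<open>auto simp: lie_group_def\<close>)

lemma smooth_inv:
  assumes "smooth_into TG E S F"
  shows "smooth_into TG E S (\<lambda>s. inv (F s))"
  by (rule smooth_into_compose1[OF mG _ assms]) (use lie in \<open>auto simp: lie_group_def\<close>)

lemma act_facts:
  shows "x \<in> topspace T \<Longrightarrow> act \<one> x = x"
    and "x \<in> topspace T \<Longrightarrow> g \<in> carrier G \<Longrightarrow> act g x \<in> topspace T"
    and "x \<in> topspace T \<Longrightarrow> g \<in> carrier G \<Longrightarrow> g' \<in> carrier G \<Longrightarrow> act (g \<otimes> g') x = act g (act g' x)"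
proof -
  interpret a: group_action G "topspace T" act using action by (simp add: smooth_action_def)
  show "x \<in> topspace T \<Longrightarrow> act \<one> x = x" using a.id_eq_one by (metis restrict_apply')
  show "x \<in> topspace T \<Longrightarrow> g \<in> carrier G \<Longrightarrow> act g x \<in> topspace T" using a.element_image by blast
  show "x \<in> topspace T \<Longrightarrow> g \<in> carrier G \<Longrightarrow> g' \<in> carrier G \<Longrightarrow> act (g \<otimes> g') x = act g (act g' x)"
    using a.composition_rule by blast
qed

lemma smooth_act:
  assumes "smooth_into TG E S F" "smooth_into T A S x"
  shows "smooth_into T A S (\<lambda>s. act (F s) (x s))"
  by (rule smooth_into_compose2[OF mG M _ assms]) (use action in \<open>auto simp: smooth_action_def\<close>)

text \<open>The action in coordinates, jointly in the group parameter near the identity and in the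
  point, so that mixed second derivatives make sense.\<close>

definition flow :: "(complex^'n, 'm) ochart \<Rightarrow> (real^'p) \<times> (complex^'n) \<Rightarrow> complex^'n" where
  "flow c p = coords c (act (cpar e (fst p)) (cpar c (snd p)))"

definition flow_dom :: "(complex^'n, 'm) ochart \<Rightarrow> ((real^'p) \<times> (complex^'n)) set" where
  "flow_dom c = {p \<in> cdom e \<times> cdom c. act (cpar e (fst p)) (cpar c (snd p)) \<in> cimg c}"

lemma flow_smooth:
  assumes c: "c \<in> A"
  shows "open (flow_dom c)" "smooth_on (flow_dom c) (flow c)"
proof -
  have "smooth_into T A (cdom e \<times> cdom c) (\<lambda>p. act (cpar e (fst p)) (cpar c (snd p)))"
    using action e c by (auto simp: smooth_action_def case_prod_unfold)
  from smooth_intoD[OF this c] show "open (flow_dom c)" "smooth_on (flow_dom c) (flow c)"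
    by (simp_all add: flow_dom_def flow_def[abs_def])
qed

lemma flow_origin:
  assumes c: "c \<in> A" and z: "z \<in> cdom c"
  shows "(s0, z) \<in> flow_dom c" "flow c (s0, z) = z"
  using manifold_chart(4)[OF M c z] coords_inverse(1)[OF M c z] z
  by (auto simp: flow_dom_def flow_def e_chart act_facts cpar_in_cimg)

lemma gen_eq_flow:
  assumes c: "c \<in> A" and z: "z \<in> cdom c"
  shows "gen c z \<xi> = frechet_derivative (flow c) (at (s0, z)) (\<xi>, 0)"
    and "((\<lambda>s. coords c (act (cpar e s) (cpar c z))) has_derivative gen c z) (at s0)"
proof -
  have "((\<lambda>s. flow c (s, z)) has_derivative (\<lambda>\<xi>. frechet_derivative (flow c) (at (s0, z)) (\<xi>, 0))) (at s0)"
  proof (rule has_derivative_compose[of "\<lambda>s. (s, z)" "\<lambda>\<xi>. (\<xi>, 0)"])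
    show "((\<lambda>s. (s, z)) has_derivative (\<lambda>\<xi>. (\<xi>, 0))) (at s0)"
      by (auto intro!: derivative_eq_intros)
    show "(flow c has_derivative frechet_derivative (flow c) (at (s0, z))) (at (s0, z))"
      by (rule smooth_on_has_derivative[OF flow_smooth(2)[OF c] flow_origin(1)[OF c z]])
  qed
  then have d: "((\<lambda>s. coords c (act (cpar e s) (cpar c z))) has_derivative
      (\<lambda>\<xi>. frechet_derivative (flow c) (at (s0, z)) (\<xi>, 0))) (at s0)" by (simp add: flow_def)
  from frechet_eq[OF d] show "gen c z \<xi> = frechet_derivative (flow c) (at (s0, z)) (\<xi>, 0)"
    by (simp add: generator_def)
  show "((\<lambda>s. coords c (act (cpar e s) (cpar c z))) has_derivative gen c z) (at s0)"
    using d frechet_eq[OF d] by (simp add: generator_def)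
qed

lemma linear_gen: "c \<in> A \<Longrightarrow> z \<in> cdom c \<Longrightarrow> linear (gen c z)"
  using gen_eq_flow(2) has_derivative_linear by blast

lemma smooth_gen:
  assumes c: "c \<in> A"
  shows "smooth_on (cdom c) (\<lambda>z. gen c z \<xi>)"
proof -
  note o = manifold_chart(1)[OF M c]
  have "smooth_on (cdom c) (\<lambda>z. (\<lambda>p. frechet_derivative (flow c) (at p) (\<xi>, 0)) (s0, z))"
    by (rule smooth_on_compose[OF smooth_on_frechet_derivative[OF flow_smooth(2)[OF c]] o flow_smooth(1)[OF c]])
      (use o flow_origin[OF c] in \<open>auto intro!: smooth_on_Pair smooth_on_const smooth_on_ident\<close>)
  then show ?thesis by (rule smooth_on_cong[OF o, rotated]) (simp add: gen_eq_flow(1)[OF c])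
qed

text \<open>This is a mixed second derivative of the flow. By symmetry the differentiation in the
  point comes first, where each single group element is known to be holomorphic.\<close>

lemma gen_derivative:
  assumes c: "c \<in> A" and z: "z \<in> cdom c"
  shows "((\<lambda>z. gen c z \<xi>) has_derivative
     (\<lambda>v. frechet_derivative (\<lambda>p. frechet_derivative (flow c) (at p) (0, v)) (at (s0, z)) (\<xi>, 0))) (at z)"
proof -
  note o = manifold_chart(1)[OF M c]
  let ?D = "\<lambda>p. frechet_derivative (flow c) (at p) (\<xi>, 0)"
  have "((\<lambda>z. ?D (s0, z)) has_derivative (\<lambda>v. frechet_derivative ?D (at (s0, z)) (0, v))) (at z)"
  proof (rule has_derivative_compose[of "\<lambda>z. (s0, z)" "\<lambda>v. (0, v)"])
    show "((\<lambda>z. (s0, z)) has_derivative (\<lambda>v. (0, v))) (at z)"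
      by (auto intro!: derivative_eq_intros)
    show "(?D has_derivative frechet_derivative ?D (at (s0, z))) (at (s0, z))"
      by (rule smooth_on_has_derivative[OF smooth_on_frechet_derivative[OF flow_smooth(2)[OF c]] flow_origin(1)[OF c z]])
  qed
  then have "((\<lambda>z. gen c z \<xi>) has_derivative (\<lambda>v. frechet_derivative ?D (at (s0, z)) (0, v))) (at z)"
    by (rule has_derivative_transform_within_open[OF _ o z]) (simp add: gen_eq_flow(1)[OF c])
  then show ?thesis
    by (simp add: second_derivative_symmetric[OF flow_smooth[OF c] flow_origin(1)[OF c z], of "(\<xi>, 0)"])
qed

lemma isometry_derivative:
  assumes g: "g \<in> carrier G" and c: "c \<in> A" and d: "d \<in> A" and z: "z \<in> cdom c" "act g (cpar c z) \<in> cimg d"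
  defines "l \<equiv> \<lambda>z. coords d (act g (cpar c z))"
  shows "(l has_derivative frechet_derivative l (at z)) (at z)"
    and "frechet_derivative l (at z) (\<i> *s v) = \<i> *s frechet_derivative l (at z) v"
    and "hform (h c z) v w = hform (h d (l z)) (frechet_derivative l (at z) v) (frechet_derivative l (at z) w)"
proof -
  let ?W = "{z \<in> cdom c. act g (cpar c z) \<in> cimg d}"
  have 1: "holo_on ?W l" "\<forall>z\<in>?W. \<forall>v w. hform (h c z) v w =
      hform (h d (l z)) (frechet_derivative l (at z) v) (frechet_derivative l (at z) w)"
    using isom[OF g] c d unfolding holomorphic_isometry_def Let_def comp_def l_def by blast+
  have zW: "z \<in> ?W" using z by simp
  from 1 zW have hl: "l differentiable (at z)" and cl: "\<And>v. frechet_derivative l (at z) (\<i> *s v) = \<i> *s frechet_derivative l (at z) v"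
    unfolding holo_on_def by blast+
  show "(l has_derivative frechet_derivative l (at z)) (at z)" by (rule frechet_derivative_worksI[OF hl])
  show "frechet_derivative l (at z) (\<i> *s v) = \<i> *s frechet_derivative l (at z) v" by (rule cl)
  show "hform (h c z) v w = hform (h d (l z)) (frechet_derivative l (at z) v) (frechet_derivative l (at z) w)"
    using 1(2) zW by blast
qed

lemma flow_partial:
  assumes c: "c \<in> A" and p: "(s, z) \<in> flow_dom c"
  shows "frechet_derivative (flow c) (at (s, z)) (0, \<i> *s v) = \<i> *s frechet_derivative (flow c) (at (s, z)) (0, v)"
    and "hform (h c z) v w = hform (h c (flow c (s, z))) (frechet_derivative (flow c) (at (s, z)) (0, v))
       (frechet_derivative (flow c) (at (s, z)) (0, w))"
proof -
  let ?g = "cpar e s" and ?l = "\<lambda>z. coords c (act (cpar e s) (cpar c z))"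
  have s: "s \<in> cdom e" and z: "z \<in> cdom c" "act ?g (cpar c z) \<in> cimg c" using p by (auto simp: flow_dom_def)
  have g: "?g \<in> carrier G" using manifold_chart(4)[OF mG e s] by (simp add: topTG)
  have "((\<lambda>z. flow c (s, z)) has_derivative (\<lambda>v. frechet_derivative (flow c) (at (s, z)) (0, v))) (at z)"
  proof (rule has_derivative_compose[of "\<lambda>z. (s, z)" "\<lambda>v. (0, v)"])
    show "((\<lambda>z. (s, z)) has_derivative (\<lambda>v. (0, v))) (at z)"
      by (auto intro!: derivative_eq_intros)
    show "(flow c has_derivative frechet_derivative (flow c) (at (s, z))) (at (s, z))"
      by (rule smooth_on_has_derivative[OF flow_smooth(2)[OF c] p])
  qed
  from frechet_eq[OF this] have fe: "frechet_derivative (flow c) (at (s, z)) (0, v) = frechet_derivative ?l (at z) v" for v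
    by (simp add: flow_def)
  show "frechet_derivative (flow c) (at (s, z)) (0, \<i> *s v) = \<i> *s frechet_derivative (flow c) (at (s, z)) (0, v)"
    unfolding fe by (rule isometry_derivative(2)[OF g c c z])
  show "hform (h c z) v w = hform (h c (flow c (s, z))) (frechet_derivative (flow c) (at (s, z)) (0, v))
       (frechet_derivative (flow c) (at (s, z)) (0, w))"
    unfolding fe using isometry_derivative(3)[OF g c c z] by (simp add: flow_def)
qed

text \<open>Every group element acts with complex linear derivative; differentiating this property
  in the group parameter at the identity makes the derivative of a generator complex linear.\<close>

lemma gen_holomorphic:
  assumes c: "c \<in> A" and z: "z \<in> cdom c"
  shows "dzbar i (\<lambda>z. gen c z \<xi> $ \<alpha>) z = 0"
    and "dz i (\<lambda>z. gen c z \<xi> $ \<alpha>) z =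
      frechet_derivative (\<lambda>p. frechet_derivative (flow c) (at p) (0, axis i 1)) (at (s0, z)) (\<xi>, 0) $ \<alpha>"
    and "frechet_derivative (\<lambda>z. gen c z \<xi>) (at z) v $ \<alpha> = (\<Sum>i\<in>UNIV. dz i (\<lambda>z. gen c z \<xi> $ \<alpha>) z * v $ i)"
proof -
  let ?D = "\<lambda>v p. frechet_derivative (flow c) (at p) (0, v)"
  have "frechet_derivative (?D (\<i> *s v)) (at (s0, z)) (\<xi>, 0) = \<i> *s frechet_derivative (?D v) (at (s0, z)) (\<xi>, 0)" for v
  proof -
    have "bounded_linear (\<lambda>x::complex^'n. \<i> *s x)"
    proof -
      have "linear (\<lambda>x::complex^'n. \<i> *s x)"
        by (rule linearI) (simp_all add: vec_eq_iff algebra_simps)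
      then show ?thesis by (simp add: linear_conv_bounded_linear)
    qed
    from bounded_linear.has_derivative[OF this smooth_on_has_derivative[OF smooth_on_frechet_derivative[OF flow_smooth(2)[OF c]] flow_origin(1)[OF c z]]]
    have "((\<lambda>p. \<i> *s ?D v p) has_derivative (\<lambda>w. \<i> *s frechet_derivative (?D v) (at (s0, z)) w)) (at (s0, z))" .
    then have "((?D (\<i> *s v)) has_derivative (\<lambda>w. \<i> *s frechet_derivative (?D v) (at (s0, z)) w)) (at (s0, z))"
      by (rule has_derivative_transform_within_open[OF _ flow_smooth(1)[OF c] flow_origin(1)[OF c z]])
        (use flow_partial(1)[OF c] in auto)
    from frechet_eq[OF this] show ?thesis by simp
  qed
  then have lin: "frechet_derivative (?D (\<i> *s v)) (at (s0, z)) (\<xi>, 0) $ \<alpha> = \<i> * frechet_derivative (?D v) (at (s0, z)) (\<xi>, 0) $ \<alpha>" for v by simp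
  note d = bounded_linear.has_derivative[OF bounded_linear_vec_nth gen_derivative[OF c z, of \<xi>], of \<alpha>]
  show "dzbar i (\<lambda>z. gen c z \<xi> $ \<alpha>) z = 0" by (rule holomorphic_dz(1)[OF d lin])
  show "dz i (\<lambda>z. gen c z \<xi> $ \<alpha>) z = frechet_derivative (?D (axis i 1)) (at (s0, z)) (\<xi>, 0) $ \<alpha>"
    by (rule holomorphic_dz(2)[OF d lin])
  show "frechet_derivative (\<lambda>z. gen c z \<xi>) (at z) v $ \<alpha> = (\<Sum>i\<in>UNIV. dz i (\<lambda>z. gen c z \<xi> $ \<alpha>) z * v $ i)"
    using holomorphic_dz(3)[OF d lin, of v] frechet_eq[OF gen_derivative[OF c z, of \<xi>]] by simp
qed

section \<open>Divergence of generators and the weighted volume\<close>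

lemma metric_facts:
  assumes c: "c \<in> A"
  shows "smooth_on (cdom c) (h c)"
    and "\<And>z \<alpha> \<beta>. z \<in> cdom c \<Longrightarrow> h c z $ \<beta> $ \<alpha> = cnj (h c z $ \<alpha> $ \<beta>)"
    and "\<And>z v. z \<in> cdom c \<Longrightarrow> v \<noteq> 0 \<Longrightarrow> 0 < Re (hform (h c z) v v)"
    and "\<And>z u v w. z \<in> cdom c \<Longrightarrow> ext_deriv2 (\<lambda>y. form11 (h c y)) z u v w = 0"
  using metric c unfolding kahler_metric_def by blast+

definition divergence :: "(complex^'n, 'm) ochart \<Rightarrow> complex^'n \<Rightarrow> real^'p \<Rightarrow> complex" where
  "divergence c z \<xi> = (\<Sum>i\<in>UNIV. dz i (\<lambda>y. gen c y \<xi> $ i) z)"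

text \<open>The logarithm of the density \<open>det h\<close> weighted by \<open>exp f\<close>. Its
  \<open>ddbar\<close> is \<open>- h\<close>, so it is minus a local Kaehler potential.\<close>

definition potential :: "(complex^'n, 'm) ochart \<Rightarrow> complex^'n \<Rightarrow> real" where
  "potential c y = ln (Re (det (h c y))) + f (cpar c y)"

lemma det_metric:
  assumes "c \<in> A" "z \<in> cdom c"
  shows "Im (det (h c z)) = 0" "Re (det (h c z)) > 0"
  using hermitian_posdef_det(1,2)[OF metric_facts(2)[OF assms] metric_facts(3)[OF assms]] by auto

lemma smooth_f: "c \<in> A \<Longrightarrow> smooth_on (cdom c) (\<lambda>y. f (cpar c y))"
  using pot by (simp add: ricci_potential_def smooth_fun_def comp_def)

lemma smooth_potential:
  assumes c: "c \<in> A"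
  shows "smooth_on (cdom c) (potential c)"
  unfolding potential_def[abs_def]
  using manifold_chart(1)[OF M c]
  by (intro smooth_on_add smooth_f[OF c] smooth_on_ln smooth_on_Re smooth_on_det metric_facts(1)[OF c] det_metric[OF c])

text \<open>Isometries preserve the volume density: \<open>det h\<close> at \<open>z\<close> is the
  squared modulus of the Jacobian times \<open>det h\<close> at the image point. The identity is the
  derivative of this relation at the neutral element, where the Jacobian has the divergence as its
  derivative.\<close>

lemma killing_det:
  assumes c: "c \<in> A" and z: "z \<in> cdom c"
  shows "2 * Re (divergence c z \<xi>) * Re (det (h c z)) + frechet_derivative (\<lambda>y. Re (det (h c y))) (at z) (gen c z \<xi>) = 0"
proof -
  note o = manifold_chart(1)[OF M c]
  \<comment> \<open>The holomorphic Jacobian matrix at \<open>z\<close> of the group element with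
    parameter \<open>s\<close>.\<close>
  define L where "L s = (\<chi> \<alpha> \<beta>. frechet_derivative (flow c) (at (s, z)) (0, axis \<beta> 1) $ \<alpha>)" for s
  define U where "U = {s. (s, z) \<in> flow_dom c}"
  have U: "open U"
  proof -
    have "open ((\<lambda>s. (s, z)) -` flow_dom c)" by (intro open_vimage flow_smooth(1)[OF c] continuous_intros)
    then show ?thesis by (simp add: U_def vimage_def)
  qed
  have s0: "s0 \<in> U" using flow_origin[OF c z] by (simp add: U_def)
  have colL: "column \<beta> (L s) = frechet_derivative (flow c) (at (s, z)) (0, axis \<beta> 1)" for \<beta> s
    by (simp add: column_def L_def)
  have inv: "det (h c z) = det (L s) * det (h c (flow c (s, z))) * cnj (det (L s))" if s: "s \<in> U" for s
  proof -
    have "det (L s) * det (h c (flow c (s, z))) * cnj (det (L s)) =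
        det (\<chi> i j. hform (h c (flow c (s, z))) (column i (L s)) (column j (L s)))"
      by (rule det_hform_columns[symmetric])
    also have "(\<chi> i j. hform (h c (flow c (s, z))) (column i (L s)) (column j (L s))) = (\<chi> i j. h c z $ i $ j)"
      unfolding colL using flow_partial(2)[OF c, of s z] s by (simp add: U_def hform_axis[symmetric] del: hform_axis)
    finally show ?thesis by simp
  qed
  let ?D = "\<lambda>\<beta> p. frechet_derivative (flow c) (at p) (0, axis \<beta> 1)"
  have ps: "((\<lambda>s. (s, z)) has_derivative (\<lambda>\<xi>. (\<xi>, 0))) (at s0)" by (auto intro!: derivative_eq_intros)
  have dcol: "((\<lambda>s. ?D \<beta> (s, z)) has_derivative (\<lambda>\<xi>. frechet_derivative (?D \<beta>) (at (s0, z)) (\<xi>, 0))) (at s0)" for \<beta>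
    by (rule has_derivative_compose[OF ps smooth_on_has_derivative[OF smooth_on_frechet_derivative[OF flow_smooth(2)[OF c]] flow_origin(1)[OF c z]]])
  define L' where "L' \<xi> = (\<chi> \<alpha> \<beta>. frechet_derivative (?D \<beta>) (at (s0, z)) (\<xi>, 0) $ \<alpha>)" for \<xi>
  have "((\<lambda>s. \<Sum>\<alpha>\<in>UNIV. axis \<alpha> (\<Sum>\<beta>\<in>UNIV. axis \<beta> (?D \<beta> (s, z) $ \<alpha>))) has_derivative
      (\<lambda>\<xi>. \<Sum>\<alpha>\<in>UNIV. axis \<alpha> (\<Sum>\<beta>\<in>UNIV. axis \<beta> (frechet_derivative (?D \<beta>) (at (s0, z)) (\<xi>, 0) $ \<alpha>)))) (at s0)"
    by (intro has_derivative_sum bounded_linear.has_derivative[OF bounded_linear_axis]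
        bounded_linear.has_derivative[OF bounded_linear_vec_nth dcol])
  moreover have "(\<Sum>\<alpha>\<in>UNIV. axis \<alpha> (\<Sum>\<beta>\<in>UNIV. axis \<beta> (g \<alpha> \<beta>))) = (\<chi> \<alpha> \<beta>. g \<alpha> \<beta>)" for g :: "'n \<Rightarrow> 'n \<Rightarrow> complex"
  proof -
    have inner: "(\<Sum>\<beta>\<in>UNIV. axis \<beta> (g \<alpha> \<beta>)) = (\<chi> \<beta>. g \<alpha> \<beta>)" for \<alpha>
      using vec_eq_sum_axis[of "\<chi> \<beta>. g \<alpha> \<beta>"] by simp
    show ?thesis unfolding inner using vec_eq_sum_axis[of "\<chi> \<alpha> \<beta>. g \<alpha> \<beta>"] by simp
  qed
  ultimately have dL: "(L has_derivative L') (at s0)" by (simp add: L_def[abs_def] L'_def[abs_def])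
  have L0: "L s0 = mat 1"
  proof -
    have "((\<lambda>z. flow c (s0, z)) has_derivative (\<lambda>v. frechet_derivative (flow c) (at (s0, z)) (0, v))) (at z)"
      by (rule has_derivative_compose[of "\<lambda>z. (s0, z)" "\<lambda>v. (0, v)"], auto intro!: derivative_eq_intros)
        (rule smooth_on_has_derivative[OF flow_smooth(2)[OF c] flow_origin(1)[OF c z]])
    moreover have "((\<lambda>z. flow c (s0, z)) has_derivative (\<lambda>v. v)) (at z)"
      by (rule has_derivative_transform_within_open[OF has_derivative_ident o z]) (simp add: flow_origin(2)[OF c])
    ultimately have "(\<lambda>v. frechet_derivative (flow c) (at (s0, z)) (0, v)) = (\<lambda>v. v)" by (rule has_derivative_unique)
    then have "frechet_derivative (flow c) (at (s0, z)) (0, v) = v" for v by (rule fun_cong)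
    then show ?thesis by (simp add: L_def vec_eq_iff mat_def axis_def)
  qed
  have ddet: "((\<lambda>s. det (L s)) has_derivative (\<lambda>\<xi>. trace (L' \<xi>))) (at s0)" by (rule has_derivative_det_at_one[OF dL L0])
  have tr: "trace (L' \<xi>) = divergence c z \<xi>" for \<xi>
    by (simp add: trace_def L'_def divergence_def gen_holomorphic(2)[OF c z])
  have dets: "smooth_on (cdom c) (\<lambda>y. det (h c y))" by (rule smooth_on_det[OF o metric_facts(1)[OF c]])
  let ?d = "frechet_derivative (\<lambda>y. det (h c y)) (at z)"
  have dd: "((\<lambda>y. det (h c y)) has_derivative ?d) (at z)" by (rule smooth_on_has_derivative[OF dets z])
  have dfl: "((\<lambda>s. det (h c (flow c (s, z)))) has_derivative (\<lambda>\<xi>. ?d (gen c z \<xi>))) (at s0)"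
    using has_derivative_compose[of "\<lambda>s. flow c (s, z)" "gen c z" s0 UNIV] gen_eq_flow(2)[OF c z] dd flow_origin(2)[OF c z]
    by (simp add: flow_def)
  have prod: "((\<lambda>s. det (L s) * det (h c (flow c (s, z))) * cnj (det (L s))) has_derivative
     (\<lambda>\<xi>. det (L s0) * det (h c (flow c (s0, z))) * cnj (trace (L' \<xi>)) +
       (det (L s0) * ?d (gen c z \<xi>) + trace (L' \<xi>) * det (h c (flow c (s0, z)))) * cnj (det (L s0)))) (at s0)"
    by (intro has_derivative_mult has_derivative_cnj ddet dfl)
  have "((\<lambda>s. det (L s) * det (h c (flow c (s, z))) * cnj (det (L s))) has_derivative (\<lambda>\<xi>. 0)) (at s0)"
    by (rule has_derivative_transform_within_open[OF has_derivative_const U s0]) (rule inv)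
  from has_derivative_unique[OF prod this]
  have "det (L s0) * det (h c (flow c (s0, z))) * cnj (trace (L' \<xi>)) +
       (det (L s0) * ?d (gen c z \<xi>) + trace (L' \<xi>) * det (h c (flow c (s0, z)))) * cnj (det (L s0)) = 0"
    by (rule fun_cong)
  then have "det (h c z) * cnj (divergence c z \<xi>) + ?d (gen c z \<xi>) + divergence c z \<xi> * det (h c z) = 0"
    by (simp add: L0 flow_origin(2)[OF c z] tr add.assoc)
  then have "Re (det (h c z) * cnj (divergence c z \<xi>) + ?d (gen c z \<xi>) + divergence c z \<xi> * det (h c z)) = 0" by simp
  moreover have "frechet_derivative (\<lambda>y. Re (det (h c y))) (at z) = (\<lambda>v. Re (?d v))"
    by (rule frechet_eq[OF has_derivative_Re[OF dd]])
  ultimately show ?thesis using det_metric(1)[OF c z] by (simp add: algebra_simps)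
qed

end

lemma ddbar_add:
  assumes "open S" "smooth_on S u" "smooth_on S v" "z \<in> S"
  shows "ddbar (\<lambda>y. u y + v y) z = ddbar u z + ddbar v z"
proof -
  note dif = smooth_on_differentiable
  have "dz i (dzbar j (\<lambda>y. u y + v y)) z = dz i (dzbar j u) z + dz i (dzbar j v) z" for i j
  proof -
    have "dz i (dzbar j (\<lambda>y. u y + v y)) z = dz i (\<lambda>y. dzbar j u y + dzbar j v y) z"
      by (rule dz_cong(1)[OF assms(1,4) dz_add(2)[OF dif[OF assms(2)] dif[OF assms(3)]]])
        (use dif[OF smooth_on_dz(2)[OF assms(1) smooth_on_add[OF assms(1-3)]] assms(4)] in auto)
    then show ?thesis
      by (simp add: dz_add(1)[OF dif[OF smooth_on_dz(2)[OF assms(1,2)] assms(4)] dif[OF smooth_on_dz(2)[OF assms(1,3)] assms(4)]])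
  qed
  then show ?thesis by (simp add: vec_eq_iff ddbar_def)
qed

section \<open>The momentum map and the invariance of the Ricci potential\<close>

context kahler_lie_action
begin

lemma ddbar_potential:
  assumes c: "c \<in> A" and z: "z \<in> cdom c"
  shows "ddbar (\<lambda>y. complex_of_real (potential c y)) z = - h c z"
proof -
  note o = manifold_chart(1)[OF M c]
  let ?d = "ddbar (\<lambda>y. complex_of_real (ln (Re (det (h c y))))) z"
  let ?f = "ddbar (\<lambda>y. complex_of_real (f (cpar c y))) z"
  have "form11 (- ?d) v w = form11 (h c z + ?f) v w" for v w
  proof -
    have "ricci_form (h c) z v w - form11 (h c z) v w = form11 ?f v w"
      using pot c z unfolding ricci_potential_def by blast
    then show ?thesis by (simp add: form11_add ricci_form_def algebra_simps)
  qed
  then have "- ?d = h c z + ?f" by (rule form11_inject)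
  then have d: "?d = - (h c z + ?f)" by (simp only: minus_equation_iff[of ?d])
  have "ddbar (\<lambda>y. complex_of_real (potential c y)) z = ?d + ?f"
    unfolding potential_def of_real_add
    by (rule ddbar_add[OF o _ _ z]; intro smooth_on_of_real o smooth_f[OF c] smooth_on_ln smooth_on_Re smooth_on_det
        metric_facts(1)[OF c] det_metric[OF c])
  then show ?thesis unfolding d by simp
qed

text \<open>The equation \<open>laplace_f u = u\<close> makes \<open>u\<close> explicit: it is minus
  the divergence minus the derivative of the potential along the generator. In the differential,
  \<open>1 / pi\<close> is the normalization \<open>1 / (2 * pi)\<close> of \<open>J\<close> times
  the factor 2 from twice a real part.\<close>

lemma momentum_formulas:
  assumes c: "c \<in> A"
  shows "z \<in> cdom c \<Longrightarrow> complex_of_real (J (cpar c z) \<xi>) = - (\<i> / (2 * of_real pi) *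
      (divergence c z \<xi> + (\<Sum>k\<in>UNIV. dz k (\<lambda>y. complex_of_real (potential c y)) z * gen c z \<xi> $ k)))"
    and "smooth_on (cdom c) (\<lambda>y. J (cpar c y) \<xi>)"
    and "z \<in> cdom c \<Longrightarrow> frechet_derivative (\<lambda>y. J (cpar c y) \<xi>) (at z) v = - Im (hform (h c z) (gen c z \<xi>) v) / pi"
proof -
  note o = manifold_chart(1)[OF M c]
  obtain u where u: "smooth_fun A u"
    and u2: "\<And>c z. c \<in> A \<Longrightarrow> z \<in> cdom c \<Longrightarrow> grad10 (h c z) (u \<circ> cpar c) z = gen c z \<xi> \<and>
           laplace_f (h c z) (f \<circ> cpar c) (u \<circ> cpar c) z = u (cpar c z)"
    and u3: "\<And>x. x \<in> topspace T \<Longrightarrow> complex_of_real (J x \<xi>) = \<i> / (2 * of_real pi) * u x"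
    using mom unfolding momentum_map_def by meson
  define U where "U = (\<lambda>y. u (cpar c y))"
  have U: "smooth_on (cdom c) U" using u c by (simp add: smooth_fun_def comp_def U_def)
  have grad: "grad10 (h c z) U z = gen c z \<xi>" if "z \<in> cdom c" for z
    using u2[OF c that] by (simp add: comp_def U_def)
  have lap: "laplace_f (h c z) (\<lambda>y. f (cpar c y)) U z = U z" if "z \<in> cdom c" for z
    using u2[OF c that] by (simp add: comp_def U_def)
  have JU: "complex_of_real (J (cpar c y) \<xi>) = \<i> / (2 * of_real pi) * U y" if "y \<in> cdom c" for y
    using u3[OF manifold_chart(4)[OF M c that]] by (simp add: U_def)
  note fm = laplace_f_eq_divergence[OF o _ metric_facts(1)[OF c] smooth_gen[OF c] U metric_facts(2,3)[OF c] metric_facts(4)[OF c] smooth_f[OF c] grad]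
  show 1: "complex_of_real (J (cpar c z) \<xi>) = - (\<i> / (2 * of_real pi) *
      (divergence c z \<xi> + (\<Sum>k\<in>UNIV. dz k (\<lambda>y. complex_of_real (potential c y)) z * gen c z \<xi> $ k)))" if z: "z \<in> cdom c" for z
  proof -
    have "U z = - (divergence c z \<xi> + (\<Sum>k\<in>UNIV. dz k (\<lambda>y. complex_of_real (potential c y)) z * gen c z \<xi> $ k))"
      unfolding lap[OF z, symmetric] divergence_def potential_def by (rule fm(1)) (use z in auto)
    then show ?thesis unfolding JU[OF z] by (simp only: mult_minus_right)
  qed
  have JRe: "J (cpar c y) \<xi> = Re (\<i> / (2 * of_real pi) * U y)" if "y \<in> cdom c" for y
    using arg_cong[OF JU[OF that], of Re] by simp
  have "smooth_on (cdom c) (\<lambda>y. Re (\<i> / (2 * of_real pi) * U y))"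
    by (intro smooth_on_Re smooth_on_mult smooth_on_const o U)
  then show sm: "smooth_on (cdom c) (\<lambda>y. J (cpar c y) \<xi>)"
    by (rule smooth_on_cong[OF o, rotated]) (simp add: JRe)
  show "frechet_derivative (\<lambda>y. J (cpar c y) \<xi>) (at z) v = - Im (hform (h c z) (gen c z \<xi>) v) / pi" if z: "z \<in> cdom c" for z v
  proof -
    let ?J = "\<lambda>y. complex_of_real (J (cpar c y) \<xi>)"
    note dJ = smooth_on_has_derivative[OF sm z]
    have bar: "dzbar j ?J z = \<i> / (2 * of_real pi) * (\<Sum>k\<in>UNIV. h c z $ k $ j * gen c z \<xi> $ k)" for j
    proof -
      have "dzbar j ?J z = dzbar j (\<lambda>y. \<i> / (2 * of_real pi) * U y) z"
        by (rule dz_cong(2)[OF o z JU smooth_on_differentiable[OF smooth_on_of_real[OF o sm] z]])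
      also have "\<dots> = \<i> / (2 * of_real pi) * dzbar j U z"
        by (subst dz_mult(2)) (use smooth_on_differentiable[OF U z] in \<open>auto simp: dz_const\<close>)
      also have "dzbar j U z = (\<Sum>k\<in>UNIV. h c z $ k $ j * gen c z \<xi> $ k)"
        by (rule fm(2)) (use z in auto)
      finally show ?thesis .
    qed
    have dzJ: "dz j ?J z = cnj (dzbar j ?J z)" for j using dz_of_real(1)[OF dJ, of j] by simp
    have "(\<Sum>j\<in>UNIV. dzbar j ?J z * cnj (v $ j)) = \<i> / (2 * of_real pi) * hform (h c z) (gen c z \<xi>) v"
      unfolding hform_def bar sum_distrib_left sum_distrib_right by (subst sum.swap) (simp add: mult_ac)
    moreover have "(\<Sum>j\<in>UNIV. dz j ?J z * v $ j) = cnj (\<Sum>j\<in>UNIV. dzbar j ?J z * cnj (v $ j))"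
      by (simp add: dzJ)
    ultimately have "(\<Sum>j\<in>UNIV. dz j ?J z * v $ j) = cnj (\<i> / (2 * of_real pi) * hform (h c z) (gen c z \<xi>) v)"
      by (simp only:)
    then have "complex_of_real (frechet_derivative (\<lambda>y. J (cpar c y) \<xi>) (at z) v) =
       complex_of_real (2 * Re (cnj (\<i> / (2 * of_real pi) * hform (h c z) (gen c z \<xi>) v)))"
      using dz_of_real(2)[OF dJ, of v] by simp
    then show ?thesis by (simp only: of_real_eq_iff) (simp add: field_simps)
  qed
qed

lemma moment_eq_zero_iff:
  assumes "c \<in> A" "z \<in> cdom c"
  shows "J (cpar c z) \<xi> = 0 \<longleftrightarrow>
    divergence c z \<xi> + (\<Sum>k\<in>UNIV. dz k (\<lambda>y. complex_of_real (potential c y)) z * gen c z \<xi> $ k) = 0"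
proof -
  let ?Q = "divergence c z \<xi> + (\<Sum>k\<in>UNIV. dz k (\<lambda>y. complex_of_real (potential c y)) z * gen c z \<xi> $ k)"
  have "complex_of_real (J (cpar c z) \<xi>) = 0 \<longleftrightarrow> ?Q = 0"
    unfolding momentum_formulas(1)[OF assms] by (simp only: neg_equal_0_iff_equal mult_eq_0_iff) simp
  then show ?thesis by simp
qed

text \<open>\<open>J\<close> is real valued, so the derivative of \<open>potential\<close> along the
  generator is minus twice the real part of the divergence. Invariance of the volume gives the same
  value for \<open>ln (det h)\<close> alone; the difference of the two is the derivative of
  \<open>f\<close>.\<close>

lemma derivative_f_gen:
  assumes c: "c \<in> A" and z: "z \<in> cdom c"
  shows "frechet_derivative (\<lambda>y. f (cpar c y)) (at z) (gen c z \<xi>) = 0"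
proof -
  note o = manifold_chart(1)[OF M c]
  let ?Q = "divergence c z \<xi> + (\<Sum>k\<in>UNIV. dz k (\<lambda>y. complex_of_real (potential c y)) z * gen c z \<xi> $ k)"
  have "Im (complex_of_real (J (cpar c z) \<xi>)) = 0" by simp
  then have "Im (\<i> / (2 * of_real pi) * ?Q) = 0" unfolding momentum_formulas(1)[OF c z] by simp
  then have "Re ?Q = 0" by simp
  moreover have "complex_of_real (frechet_derivative (potential c) (at z) (gen c z \<xi>)) =
      complex_of_real (2 * Re (\<Sum>k\<in>UNIV. dz k (\<lambda>y. complex_of_real (potential c y)) z * gen c z \<xi> $ k))"
    using dz_of_real(2)[OF smooth_on_has_derivative[OF smooth_potential[OF c] z]] by simp
  then have "frechet_derivative (potential c) (at z) (gen c z \<xi>) = 2 * Re (\<Sum>k\<in>UNIV. dz k (\<lambda>y. complex_of_real (potential c y)) z * gen c z \<xi> $ k)"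
    by (simp only: of_real_eq_iff)
  ultimately have 1: "frechet_derivative (potential c) (at z) (gen c z \<xi>) = - 2 * Re (divergence c z \<xi>)" by simp
  have dr: "smooth_on (cdom c) (\<lambda>y. Re (det (h c y)))" by (intro smooth_on_Re smooth_on_det o metric_facts(1)[OF c])
  have "(potential c has_derivative (\<lambda>v. frechet_derivative (\<lambda>y. Re (det (h c y))) (at z) v * inverse (Re (det (h c z)))
      + frechet_derivative (\<lambda>y. f (cpar c y)) (at z) v)) (at z)"
    unfolding potential_def
    by (intro has_derivative_add has_derivative_ln det_metric[OF c z] smooth_on_has_derivative[OF dr z]
        smooth_on_has_derivative[OF smooth_f[OF c] z])
  from frechet_eq[OF this] have "frechet_derivative (potential c) (at z) (gen c z \<xi>) =
     frechet_derivative (\<lambda>y. Re (det (h c y))) (at z) (gen c z \<xi>) * inverse (Re (det (h c z)))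
      + frechet_derivative (\<lambda>y. f (cpar c y)) (at z) (gen c z \<xi>)" by simp
  moreover have "frechet_derivative (\<lambda>y. Re (det (h c y))) (at z) (gen c z \<xi>) = - 2 * Re (divergence c z \<xi>) * Re (det (h c z))"
    using killing_det[OF c z, of \<xi>] by simp
  moreover have "x * r * inverse r = x" if "r > 0" for x r :: real using that by simp
  ultimately show ?thesis using 1 det_metric(2)[OF c z] by simp
qed

text \<open>Right translation by the inverse of \<open>F s1\<close> moves the family to the neutral
  element, where generators are defined; the base point becomes \<open>act (F s1) x\<close>.\<close>

lemma velocity:
  fixes F :: "'s::real_normed_vector \<Rightarrow> 'g"
  assumes S: "open S" and F: "smooth_into TG E S F" and s1: "s1 \<in> S" and x: "x \<in> topspace T"
    and c: "c \<in> A" "act (F s1) x \<in> cimg c"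
  shows "((\<lambda>s. coords c (act (F s) x)) has_derivative
     (\<lambda>\<sigma>. gen c (coords c (act (F s1) x)) (frechet_derivative (\<lambda>s. coords e (F s \<otimes> inv (F s1))) (at s1) \<sigma>))) (at s1)"
proof -
  have Fs: "F s \<in> carrier G" if "s \<in> S" for s using smooth_into_topspace[OF F that] topTG by simp
  let ?R = "\<lambda>s. F s \<otimes> inv (F s1)"
  let ?z = "coords c (act (F s1) x)"
  have R: "smooth_into TG E S ?R"
    by (rule smooth_mult[OF F smooth_into_const[OF S]]) (simp add: topTG Fs s1)
  have R1: "?R s1 = \<one>" using Fs[OF s1] by simp
  note ev = smooth_into_eventually[OF R e s1, unfolded R1, OF one_e]
  have z: "?z \<in> cdom c" "cpar c ?z = act (F s1) x" using coords_inverse(2,3)[OF M c] by auto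
  have "((\<lambda>s. coords c (act (cpar e (coords e (?R s))) (cpar c ?z))) has_derivative
      (\<lambda>\<sigma>. gen c ?z (frechet_derivative (\<lambda>s. coords e (?R s)) (at s1) \<sigma>))) (at s1)"
  proof (rule has_derivative_compose[OF ev(2)])
    show "((\<lambda>s. coords c (act (cpar e s) (cpar c ?z))) has_derivative gen c ?z) (at (coords e (?R s1)))"
      unfolding R1 by (rule gen_eq_flow(2)[OF c(1) z(1)])
  qed
  then show ?thesis
  proof (rule has_derivative_transform_eventually_nhds)
    show "\<forall>\<^sub>F s in nhds s1. coords c (act (cpar e (coords e (?R s))) (cpar c ?z)) = coords c (act (F s) x)"
      using ev(1)
    proof eventually_elim
      case (elim s)
      have "act (?R s) (act (F s1) x) = act (?R s \<otimes> F s1) x"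
        using Fs[OF s1] Fs elim x by (subst act_facts(3)) auto
      also have "?R s \<otimes> F s1 = F s" using Fs[OF s1] Fs elim by (simp add: m_assoc)
      finally show ?case using elim by (simp add: z(2) coords_inverse(2)[OF mG e])
    qed
  qed
qed

lemma f_constant_on_chart:
  assumes x: "x \<in> topspace T" and a: "a \<in> E" and s: "s \<in> cdom a" "t \<in> cdom a"
  shows "f (act (cpar a s) x) = f (act (cpar a t) x)"
proof -
  let ?\<phi> = "\<lambda>s. f (act (cpar a s) x)"
  note o = manifold_chart(1,2)[OF mG a]
  have d: "(?\<phi> has_derivative (\<lambda>h. 0)) (at s1)" if s1: "s1 \<in> cdom a" for s1
  proof -
    have g: "cpar a s1 \<in> carrier G" using manifold_chart(4)[OF mG a s1] topTG by simp
    obtain c where c: "c \<in> A" "act (cpar a s1) x \<in> cimg c"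
      by (rule manifold_cover[OF M act_facts(2)[OF x g]])
    let ?z = "coords c (act (cpar a s1) x)"
    have z: "?z \<in> cdom c" using coords_inverse(3)[OF M c] .
    have "((\<lambda>s. f (cpar c (coords c (act (cpar a s) x)))) has_derivative
       (\<lambda>\<sigma>. frechet_derivative (\<lambda>y. f (cpar c y)) (at ?z) (gen c ?z
          (frechet_derivative (\<lambda>s. coords e (cpar a s \<otimes> inv (cpar a s1))) (at s1) \<sigma>)))) (at s1)"
      by (rule has_derivative_compose[OF velocity[OF o(1) smooth_into_chart[OF mG a] s1 x c]
            smooth_on_has_derivative[OF smooth_f[OF c(1)] z]])
    then have "((\<lambda>s. f (cpar c (coords c (act (cpar a s) x)))) has_derivative (\<lambda>\<sigma>. 0)) (at s1)"
      by (simp add: derivative_f_gen[OF c(1) z])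
    moreover have "\<forall>\<^sub>F s in nhds s1. f (cpar c (coords c (act (cpar a s) x))) = ?\<phi> s"
      using smooth_into_eventually(1)[OF smooth_act[OF smooth_into_chart[OF mG a] smooth_into_const[OF o(1) x]] c(1) s1 c(2)]
      by eventually_elim (simp add: coords_inverse(2)[OF M c(1)])
    ultimately show ?thesis by (rule has_derivative_transform_eventually_nhds)
  qed
  show ?thesis by (rule has_derivative_zero_unique_connected[OF o d s])
qed

text \<open>For fixed \<open>x\<close> the value \<open>f (act g x)\<close> does not change within a
  connected chart of the group. It is therefore locally constant in \<open>g\<close>, and
  \<open>K\<close> is connected.\<close>

lemma f_invariant:
  assumes K: "connectedin TG K" "\<one> \<in> K" "k \<in> K" and x: "x \<in> topspace T"
  shows "f (act k x) = f x"
proof -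
  have op: "openin TG {g \<in> carrier G. P (f (act g x))}" for P
  proof (subst openin_subopen, intro ballI)
    fix g assume g: "g \<in> {g \<in> carrier G. P (f (act g x))}"
    then obtain a where a: "a \<in> E" "g \<in> cimg a" using manifold_cover[OF mG] topTG by blast
    then obtain s where s: "s \<in> cdom a" "g = cpar a s" by (auto simp: cimg_def)
    have "cimg a \<subseteq> {g \<in> carrier G. P (f (act g x))}"
    proof
      fix g' assume "g' \<in> cimg a"
      then obtain t where t: "t \<in> cdom a" "g' = cpar a t" by (auto simp: cimg_def)
      then show "g' \<in> {g \<in> carrier G. P (f (act g x))}"
        using f_constant_on_chart[OF x a(1) s(1) t(1)] g s manifold_chart(4)[OF mG a(1) t(1)] topTG by simp
    qed
    then show "\<exists>U. openin TG U \<and> g \<in> U \<and> U \<subseteq> {g \<in> carrier G. P (f (act g x))}"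
      using manifold_chart(5)[OF mG a(1)] a(2) by blast
  qed
  let ?U = "{g \<in> carrier G. f (act g x) = f x}" and ?V = "{g \<in> carrier G. f (act g x) \<noteq> f x}"
  have "K \<subseteq> carrier G" using K(1) topTG by (auto simp: connectedin_def)
  moreover have "act \<one> x = x" by (rule act_facts(1)[OF x])
  ultimately have "K \<subseteq> ?U \<union> ?V" "?U \<inter> ?V \<inter> K = {}" "?U \<inter> K \<noteq> {}" using K(2) by auto
  moreover have "openin TG ?U" "openin TG ?V" by (rule op)+
  ultimately have "K \<inter> ?V = {}" using K(1) unfolding connectedin by blast
  then show ?thesis using K(3) \<open>K \<subseteq> carrier G\<close> by auto
qed

end

lemma continuous_map_of_charts:
  fixes \<phi> :: "'x \<Rightarrow> 'b::topological_space"
  assumes m: "manifold P T A" and \<phi>: "\<And>a. a \<in> A \<Longrightarrow> continuous_on (cdom a) (\<lambda>s. \<phi> (cpar a s))"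
  shows "continuous_map T euclidean \<phi>"
  unfolding continuous_map_def
proof (intro conjI allI impI)
  show "\<phi> \<in> topspace T \<rightarrow> topspace euclidean" by simp
  fix U :: "'b set" assume "openin euclidean U"
  then have U: "open U" by simp
  show "openin T {x \<in> topspace T. \<phi> x \<in> U}"
  proof (subst openin_subopen, intro ballI)
    fix x assume x: "x \<in> {x \<in> topspace T. \<phi> x \<in> U}"
    then obtain a where a: "a \<in> A" "x \<in> cimg a" using manifold_cover[OF m] by blast
    let ?V = "cdom a \<inter> (\<lambda>s. \<phi> (cpar a s)) -` U"
    have "open ?V" by (rule continuous_open_preimage[OF \<phi>[OF a(1)] manifold_chart(1)[OF m a(1)] U])
    then have "openin T (cpar a ` ?V)" by (rule manifold_chart(6)[OF m a(1)]) auto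
    moreover have "x \<in> cpar a ` ?V" using a(2) x by (auto simp: cimg_def)
    moreover have "cpar a ` ?V \<subseteq> {x \<in> topspace T. \<phi> x \<in> U}" using manifold_chart(4)[OF m a(1)] by auto
    ultimately show "\<exists>V. openin T V \<and> x \<in> V \<and> V \<subseteq> {x \<in> topspace T. \<phi> x \<in> U}" by blast
  qed
qed

section \<open>The adjoint representation and the transformation of generators\<close>

context kahler_lie_action
begin

lemma cpar_carrier: "a \<in> E \<Longrightarrow> s \<in> cdom a \<Longrightarrow> cpar a s \<in> carrier G"
  using manifold_chart(4)[OF mG] topTG by simp

lemma smooth_conj:
  assumes "g \<in> carrier G" "smooth_into TG E S F" "open S"
  shows "smooth_into TG E S (\<lambda>s. g \<otimes> F s \<otimes> inv g)"
  using assms topTG by (intro smooth_mult smooth_into_const) auto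

lemma Ad_derivative:
  assumes g: "g \<in> carrier G"
  shows "((\<lambda>s. coords e (g \<otimes> cpar e s \<otimes> inv g)) has_derivative Ad G e g) (at s0)"
    and "\<forall>\<^sub>F s in nhds s0. s \<in> cdom e \<and> g \<otimes> cpar e s \<otimes> inv g \<in> cimg e"
proof -
  have sm: "smooth_into TG E (cdom e) (\<lambda>s. g \<otimes> cpar e s \<otimes> inv g)"
    by (rule smooth_conj[OF g smooth_into_chart[OF mG e] e_chart(1)])
  have 1: "g \<otimes> cpar e s0 \<otimes> inv g \<in> cimg e" using g e_chart one_e by simp
  show "((\<lambda>s. coords e (g \<otimes> cpar e s \<otimes> inv g)) has_derivative Ad G e g) (at s0)"
    unfolding Ad_def by (rule smooth_into_eventually(2)[OF sm e e_chart(2) 1])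
  show "\<forall>\<^sub>F s in nhds s0. s \<in> cdom e \<and> g \<otimes> cpar e s \<otimes> inv g \<in> cimg e"
    by (rule smooth_into_eventually(1)[OF sm e e_chart(2) 1])
qed

lemma conj_origin: "g \<in> carrier G \<Longrightarrow> coords e (g \<otimes> cpar e s0 \<otimes> inv g) = s0"
  by (simp add: e_chart)

lemma linear_Ad: "g \<in> carrier G \<Longrightarrow> linear (Ad G e g)"
  using Ad_derivative(1) has_derivative_linear by blast

lemma Ad_mult:
  assumes g: "g \<in> carrier G" and g': "g' \<in> carrier G"
  shows "Ad G e (g \<otimes> g') \<xi> = Ad G e g (Ad G e g' \<xi>)"
proof -
  have "((\<lambda>s. coords e (g \<otimes> cpar e (coords e (g' \<otimes> cpar e s \<otimes> inv g')) \<otimes> inv g)) has_derivative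
      (\<lambda>\<xi>. Ad G e g (Ad G e g' \<xi>))) (at s0)"
    by (rule has_derivative_compose[OF Ad_derivative(1)[OF g']]) (simp only: conj_origin[OF g'] Ad_derivative(1)[OF g])
  then have "((\<lambda>s. coords e (g \<otimes> g' \<otimes> cpar e s \<otimes> inv (g \<otimes> g'))) has_derivative
      (\<lambda>\<xi>. Ad G e g (Ad G e g' \<xi>))) (at s0)"
  proof (rule has_derivative_transform_eventually_nhds)
    show "\<forall>\<^sub>F s in nhds s0. coords e (g \<otimes> cpar e (coords e (g' \<otimes> cpar e s \<otimes> inv g')) \<otimes> inv g)
        = coords e (g \<otimes> g' \<otimes> cpar e s \<otimes> inv (g \<otimes> g'))"
      using Ad_derivative(2)[OF g']
    proof eventually_elim
      case (elim s)
      then have s: "cpar e s \<in> carrier G" using cpar_carrier[OF e] by blast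
      show ?case using elim s g g' by (simp add: coords_inverse(2)[OF mG e] m_assoc inv_mult_group)
    qed
  qed
  from frechet_eq[OF this] show ?thesis by (simp add: Ad_def fun_eq_iff)
qed

lemma Ad_one: "Ad G e \<one> \<xi> = \<xi>"
proof -
  have "((\<lambda>s. coords e (\<one> \<otimes> cpar e s \<otimes> inv \<one>)) has_derivative (\<lambda>\<xi>. \<xi>)) (at s0)"
    by (rule has_derivative_transform_within_open[OF has_derivative_ident e_chart(1,2)])
      (simp add: cpar_carrier[OF e] coords_inverse(1)[OF mG e])
  from frechet_eq[OF this] show ?thesis by (simp add: Ad_def)
qed

text \<open>\<open>Ad\<close> is the partial derivative, at the neutral element, of conjugation as a
  smooth map of two variables.\<close>

lemma smooth_Ad:
  assumes a: "a \<in> E"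
  shows "smooth_on (cdom a) (\<lambda>t. Ad G e (cpar a t) \<xi>)"
proof -
  note o = manifold_chart(1)[OF mG a]
  have oo: "open (cdom a \<times> cdom e)" using o e_chart(1) by (rule open_Times)
  have f: "smooth_into TG E (cdom a \<times> cdom e) (\<lambda>p. cpar a (fst p))"
    by (rule smooth_into_compose[OF smooth_into_chart[OF mG a] smooth_on_bounded_linear[OF bounded_linear_fst oo smooth_on_ident[OF oo]] oo]) auto
  have g: "smooth_into TG E (cdom a \<times> cdom e) (\<lambda>p. cpar e (snd p))"
    by (rule smooth_into_compose[OF smooth_into_chart[OF mG e] smooth_on_bounded_linear[OF bounded_linear_snd oo smooth_on_ident[OF oo]] oo]) auto
  let ?F = "\<lambda>p. cpar a (fst p) \<otimes> cpar e (snd p) \<otimes> inv (cpar a (fst p))"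
  have F: "smooth_into TG E (cdom a \<times> cdom e) ?F" by (rule smooth_mult[OF smooth_mult[OF f g] smooth_inv[OF f]])
  let ?O = "{p \<in> cdom a \<times> cdom e. ?F p \<in> cimg e}"
  let ?\<kappa> = "\<lambda>p. coords e (?F p)"
  note O = smooth_intoD[OF F e]
  have in_O: "(t, s0) \<in> ?O" if "t \<in> cdom a" for t
    using that cpar_carrier[OF a that] e_chart one_e by simp
  have Ad: "frechet_derivative ?\<kappa> (at (t, s0)) (0, \<xi>) = Ad G e (cpar a t) \<xi>" if t: "t \<in> cdom a" for t
  proof -
    have "((\<lambda>s. ?\<kappa> (t, s)) has_derivative (\<lambda>\<xi>. frechet_derivative ?\<kappa> (at (t, s0)) (0, \<xi>))) (at s0)"
    proof (rule has_derivative_compose[of "\<lambda>s. (t, s)" "\<lambda>\<xi>. (0, \<xi>)"])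
      show "((\<lambda>s. (t, s)) has_derivative (\<lambda>\<xi>. (0, \<xi>))) (at s0)" by (auto intro!: derivative_eq_intros)
      show "(?\<kappa> has_derivative frechet_derivative ?\<kappa> (at (t, s0))) (at (t, s0))"
        by (rule smooth_on_has_derivative[OF O(2) in_O[OF t]])
    qed
    from frechet_eq[OF this] show ?thesis by (simp add: Ad_def)
  qed
  have "smooth_on (cdom a) (\<lambda>t. (\<lambda>p. frechet_derivative ?\<kappa> (at p) (0, \<xi>)) (t, s0))"
    by (rule smooth_on_compose[OF smooth_on_frechet_derivative[OF O(2)] o O(1) smooth_on_Pair[OF o smooth_on_ident[OF o] smooth_on_const]])
      (use in_O in blast)
  then show ?thesis by (rule smooth_on_cong[OF o, rotated]) (rule Ad)
qed

text \<open>Both sides are the velocity at \<open>s0\<close> of the curve family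
  \<open>act (g \<otimes> cpar e s) x\<close>: once as the image under \<open>g\<close> of the orbit
  through \<open>x\<close>, once as the orbit through \<open>act g x\<close> under the conjugated
  elements.\<close>

lemma gen_transform:
  assumes g: "g \<in> carrier G" and c: "c \<in> A" and d: "d \<in> A" and z: "z \<in> cdom c" "act g (cpar c z) \<in> cimg d"
  shows "frechet_derivative (\<lambda>z. coords d (act g (cpar c z))) (at z) (gen c z \<xi>) =
    gen d (coords d (act g (cpar c z))) (Ad G e g \<xi>)"
proof -
  let ?l = "\<lambda>z. coords d (act g (cpar c z))" and ?x = "cpar c z"
  have x: "?x \<in> topspace T" by (rule manifold_chart(4)[OF M c z(1)])
  have F: "smooth_into TG E (cdom e) (\<lambda>s. g \<otimes> cpar e s)"
    using g topTG e_chart(1) by (intro smooth_mult smooth_into_const smooth_into_chart[OF mG e]) auto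
  have F0: "g \<otimes> cpar e s0 = g" using g by (simp add: e_chart)
  have "((\<lambda>s. coords d (act (g \<otimes> cpar e s) ?x)) has_derivative
     (\<lambda>\<sigma>. gen d (coords d (act (g \<otimes> cpar e s0) ?x))
       (frechet_derivative (\<lambda>s. coords e (g \<otimes> cpar e s \<otimes> inv (g \<otimes> cpar e s0))) (at s0) \<sigma>))) (at s0)"
    by (rule velocity[OF e_chart(1) F e_chart(2) x d]) (simp only: F0 z(2))
  then have 1: "((\<lambda>s. coords d (act (g \<otimes> cpar e s) ?x)) has_derivative (\<lambda>\<sigma>. gen d (?l z) (Ad G e g \<sigma>))) (at s0)"
    unfolding F0 Ad_def .
  have z0: "coords c (act (cpar e s0) ?x) = z" using x z(1) by (simp add: e_chart act_facts coords_inverse(1)[OF M c])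
  have "((\<lambda>s. ?l (coords c (act (cpar e s) ?x))) has_derivative (\<lambda>\<sigma>. frechet_derivative ?l (at z) (gen c z \<sigma>))) (at s0)"
    by (rule has_derivative_compose[OF gen_eq_flow(2)[OF c z(1)]])
      (simp only: z0 isometry_derivative(1)[OF g c d z])
  then have 2: "((\<lambda>s. coords d (act (g \<otimes> cpar e s) ?x)) has_derivative (\<lambda>\<sigma>. frechet_derivative ?l (at z) (gen c z \<sigma>))) (at s0)"
  proof (rule has_derivative_transform_eventually_nhds)
    have "act (cpar e s0) ?x \<in> cimg c" using x z(1) by (simp add: e_chart act_facts cpar_in_cimg)
    from smooth_into_eventually(1)[OF smooth_act[OF smooth_into_chart[OF mG e] smooth_into_const[OF e_chart(1) x]] c e_chart(2) this]
    show "\<forall>\<^sub>F s in nhds s0. ?l (coords c (act (cpar e s) ?x)) = coords d (act (g \<otimes> cpar e s) ?x)"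
      by eventually_elim (simp add: coords_inverse(2)[OF M c] act_facts(3)[OF x g cpar_carrier[OF e]])
  qed
  from fun_cong[OF has_derivative_unique[OF 2 1]] show ?thesis .
qed

lemma gram_transform:
  assumes g: "g \<in> carrier G" and c: "c \<in> A" and d: "d \<in> A" and z: "z \<in> cdom c" "act g (cpar c z) \<in> cimg d"
  shows "hform (h c z) (gen c z \<xi>) (gen c z \<eta>) =
    hform (h d (coords d (act g (cpar c z)))) (gen d (coords d (act g (cpar c z))) (Ad G e g \<xi>))
      (gen d (coords d (act g (cpar c z))) (Ad G e g \<eta>))"
  unfolding isometry_derivative(3)[OF g c d z, of "gen c z \<xi>"] gen_transform[OF g c d z] ..

text \<open>A change of charts is the action of the neutral element, for which \<open>Ad\<close> is
  the identity.\<close>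

lemma gram_chart:
  assumes c: "c \<in> A" and d: "d \<in> A" and x: "x \<in> cimg c" "x \<in> cimg d"
  shows "hform (h c (coords c x)) (gen c (coords c x) \<xi>) (gen c (coords c x) \<eta>) =
    hform (h d (coords d x)) (gen d (coords d x) \<xi>) (gen d (coords d x) \<eta>)"
proof -
  have z: "coords c x \<in> cdom c" "cpar c (coords c x) = x" using coords_inverse[OF M c] x by auto
  have "act \<one> x = x" using manifold_chart(4)[OF M c z(1)] z(2) by (simp add: act_facts(1))
  then show ?thesis
    using gram_transform[OF one_closed c d z(1), of \<xi> \<eta>] x z by (simp add: Ad_one)
qed

text \<open>The Gram entries agree in any two charts around the point, so the chart picked by
  \<open>SOME\<close> in \<open>wedge_norm\<close> may be replaced by any other.\<close>

lemma wedge_norm_chart: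
  assumes d: "d \<in> A" and x: "x \<in> cimg d"
  shows "wedge_norm A h gen bs x = mv_norm (h d (coords d x)) (map (gen d (coords d x)) bs)"
proof -
  define c where "c = (SOME c. c \<in> A \<and> x \<in> cimg c)"
  have "c \<in> A \<and> x \<in> cimg c" unfolding c_def by (rule someI[of _ d]) (use d x in simp)
  then have c: "c \<in> A" "x \<in> cimg c" by auto
  have "mv_norm (h c (coords c x)) (map (gen c (coords c x)) bs) = mv_norm (h d (coords d x)) (map (gen d (coords d x)) bs)"
  proof -
    have "(\<Prod>i<length bs. hform (h c (coords c x)) (map (gen c (coords c x)) bs ! i) (map (gen c (coords c x)) bs ! p i))
      = (\<Prod>i<length bs. hform (h d (coords d x)) (map (gen d (coords d x)) bs ! i) (map (gen d (coords d x)) bs ! p i))"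
      if p: "p permutes {..<length bs}" for p
    proof (intro prod.cong refl)
      fix i assume i: "i \<in> {..<length bs}"
      then have "p i < length bs" using permutes_in_image[OF p, of i] by simp
      then show "hform (h c (coords c x)) (map (gen c (coords c x)) bs ! i) (map (gen c (coords c x)) bs ! p i)
        = hform (h d (coords d x)) (map (gen d (coords d x)) bs ! i) (map (gen d (coords d x)) bs ! p i)"
        using i gram_chart[OF c(1) d c(2) x] by simp
    qed
    then have "(\<Sum>p | p permutes {..<length bs}. of_int (sign p) * (\<Prod>i<length bs. hform (h c (coords c x)) (map (gen c (coords c x)) bs ! i) (map (gen c (coords c x)) bs ! p i)))
      = (\<Sum>p | p permutes {..<length bs}. of_int (sign p) * (\<Prod>i<length bs. hform (h d (coords d x)) (map (gen d (coords d x)) bs ! i) (map (gen d (coords d x)) bs ! p i)))"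
      by (intro sum.cong refl) auto
    then show ?thesis by (simp only: mv_norm_def length_map)
  qed
  then show ?thesis by (simp add: wedge_norm_def c_def Let_def)
qed

end

section \<open>The kernel group\<close>

lemma leibniz_eq_det_pad:
  fixes r :: "'i \<Rightarrow> 'p::finite"
  assumes S: "finite S" and r: "inj_on r S"
  shows "leibniz S f = det (\<chi> a b. if a \<in> r ` S \<and> b \<in> r ` S then f (inv_into S r a) (inv_into S r b)
      else if a = b then 1 else 0)"
proof -
  let ?f = "\<lambda>a b. f (inv_into S r a) (inv_into S r b)"
  have "leibniz S f = leibniz S (\<lambda>i j. ?f (r i) (r j))"
  proof -
    have "(\<Prod>i\<in>S. f i (p i)) = (\<Prod>i\<in>S. ?f (r i) (r (p i)))" if p: "p permutes S" for p
      using r permutes_in_image[OF p] by (intro prod.cong) auto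
    then show ?thesis unfolding leibniz_def by (intro sum.cong) auto
  qed
  also have "\<dots> = leibniz (r ` S) ?f"
    by (rule leibniz_reindex[OF S, symmetric]) (use r in \<open>auto simp: bij_betw_def\<close>)
  finally show ?thesis by (simp only: det_pad_eq_leibniz)
qed

text \<open>The finite type \<open>'p\<close> only serves to reduce the statement to the determinant of matrices indexed by a type.\<close>

lemma leibniz_mult:
  fixes r :: "'i \<Rightarrow> 'p::finite" and f g :: "'i \<Rightarrow> 'i \<Rightarrow> 'a::comm_ring_1"
  assumes S: "finite S" and r: "inj_on r S"
  shows "leibniz S (\<lambda>i j. \<Sum>l\<in>S. f i l * g l j) = leibniz S f * leibniz S g"
proof -
  define P :: "('i \<Rightarrow> 'i \<Rightarrow> 'a) \<Rightarrow> 'a^'p^'p" where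
    "P f = (\<chi> a b. if a \<in> r ` S \<and> b \<in> r ` S then f (inv_into S r a) (inv_into S r b)
      else if a = b then 1 else 0)" for f
  have "(P f ** P g) $ a $ b = P (\<lambda>i j. \<Sum>l\<in>S. f i l * g l j) $ a $ b" for a b
  proof -
    have s: "(\<Sum>c\<in>UNIV. P f $ a $ c * P g $ c $ b) =
      (\<Sum>c\<in>r ` S. P f $ a $ c * P g $ c $ b) + (\<Sum>c\<in>- (r ` S). P f $ a $ c * P g $ c $ b)"
      by (subst sum.union_disjoint[symmetric]) (auto intro: sum.cong)
    have r1: "(\<Sum>c\<in>r ` S. P f $ a $ c * P g $ c $ b) = (\<Sum>l\<in>S. P f $ a $ r l * P g $ r l $ b)"
      by (rule sum.reindex_cong[OF r]) auto
    have out: "(\<Sum>c\<in>- (r ` S). P f $ a $ c * P g $ c $ b) = (if a \<in> r ` S then 0 else if a = b then 1 else 0)"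
    proof (cases "a \<in> r ` S")
      case True
      then show ?thesis by (auto intro!: sum.neutral simp: P_def)
    next
      case False
      have "(\<Sum>c\<in>- (r ` S). P f $ a $ c * P g $ c $ b) = (\<Sum>c\<in>- (r ` S). if c = a then P g $ c $ b else 0)"
        using False by (intro sum.cong) (auto simp: P_def)
      then show ?thesis using False by (simp add: P_def)
    qed
    show ?thesis
    proof (cases "a \<in> r ` S \<and> b \<in> r ` S")
      case True
      then have "(\<Sum>l\<in>S. P f $ a $ r l * P g $ r l $ b) = (\<Sum>l\<in>S. f (inv_into S r a) l * g l (inv_into S r b))"
        using r by (intro sum.cong) (auto simp: P_def)
      then show ?thesis using True by (simp add: matrix_matrix_mult_def s r1 out) (simp add: P_def)
    next
      case False
      then have "(\<Sum>l\<in>S. P f $ a $ r l * P g $ r l $ b) = 0"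
        by (intro sum.neutral) (auto simp: P_def)
      then show ?thesis using False by (simp add: matrix_matrix_mult_def s r1 out) (auto simp: P_def)
    qed
  qed
  then have "P f ** P g = P (\<lambda>i j. \<Sum>l\<in>S. f i l * g l j)" by (simp add: vec_eq_iff)
  then have "det (P (\<lambda>i j. \<Sum>l\<in>S. f i l * g l j)) = det (P f) * det (P g)" by (simp only: det_mul[symmetric])
  moreover have "leibniz S f = det (P f)" for f unfolding P_def by (rule leibniz_eq_det_pad[OF S r])
  ultimately show ?thesis by simp
qed

lemma leibniz_transpose:
  fixes r :: "'i \<Rightarrow> 'p::finite" and f :: "'i \<Rightarrow> 'i \<Rightarrow> 'a::comm_ring_1"
  assumes S: "finite S" and r: "inj_on r S"
  shows "leibniz S (\<lambda>i j. f j i) = leibniz S f"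
proof -
  let ?P = "(\<chi> a b. if a \<in> r ` S \<and> b \<in> r ` S then f (inv_into S r a) (inv_into S r b)
      else if a = b then 1 else 0) :: 'a^'p^'p"
  have "(\<chi> a b. if a \<in> r ` S \<and> b \<in> r ` S then f (inv_into S r b) (inv_into S r a)
      else if a = b then 1 else 0) = transpose ?P"
    by (auto simp: vec_eq_iff transpose_def)
  then show ?thesis
    using leibniz_eq_det_pad[OF S r, of f] leibniz_eq_det_pad[OF S r, of "\<lambda>i j. f j i"] by (simp only: det_transpose)
qed

lemma has_derivative_leibniz_at_one:
  fixes f :: "'x::real_normed_vector \<Rightarrow> 'i \<Rightarrow> 'i \<Rightarrow> real" and r :: "'i \<Rightarrow> 'p::finite"
  assumes S: "finite S" and r: "inj_on r S"
    and d: "\<And>i j. i \<in> S \<Longrightarrow> j \<in> S \<Longrightarrow> ((\<lambda>x. f x i j) has_derivative (\<lambda>v. f' v i j)) (at x)"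
    and one: "\<And>i j. i \<in> S \<Longrightarrow> j \<in> S \<Longrightarrow> f x i j = (if i = j then 1 else 0)"
  shows "((\<lambda>x. leibniz S (f x)) has_derivative (\<lambda>v. \<Sum>i\<in>S. f' v i i)) (at x)"
proof -
  define P :: "'x \<Rightarrow> real^'p^'p" where
    "P x = (\<chi> a b. if a \<in> r ` S \<and> b \<in> r ` S then f x (inv_into S r a) (inv_into S r b)
      else if a = b then 1 else 0)" for x
  define P' :: "'x \<Rightarrow> real^'p^'p" where
    "P' v = (\<chi> a b. if a \<in> r ` S \<and> b \<in> r ` S then f' v (inv_into S r a) (inv_into S r b) else 0)" for v
  have entry: "((\<lambda>x. P x $ a $ b) has_derivative (\<lambda>v. P' v $ a $ b)) (at x)" for a b
    using d[of "inv_into S r a" "inv_into S r b"]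
    by (cases "a \<in> r ` S \<and> b \<in> r ` S") (auto simp: P_def P'_def inv_into_into)
  have vec: "((\<lambda>x. \<Sum>a\<in>UNIV. axis a (\<Sum>b\<in>UNIV. axis b (P x $ a $ b))) has_derivative
      (\<lambda>v. \<Sum>a\<in>UNIV. axis a (\<Sum>b\<in>UNIV. axis b (P' v $ a $ b)))) (at x)"
    by (intro has_derivative_sum bounded_linear.has_derivative[OF bounded_linear_axis] entry)
  then have "(P has_derivative P') (at x)" by (simp flip: vec_eq_sum_axis)
  moreover have "P x = mat 1"
    using one by (auto simp: P_def vec_eq_iff mat_def inv_into_into dest: inv_into_injective)
  ultimately have "((\<lambda>x. det (P x)) has_derivative (\<lambda>v. trace (P' v))) (at x)" by (rule has_derivative_det_at_one)
  moreover have "trace (P' v) = (\<Sum>i\<in>S. f' v i i)" for v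
  proof -
    have "trace (P' v) = (\<Sum>a\<in>r ` S. P' v $ a $ a)"
      unfolding trace_def by (rule sum.mono_neutral_right) (auto simp: P'_def)
    also have "\<dots> = (\<Sum>i\<in>S. f' v i i)"
      by (rule sum.reindex_cong[OF r]) (use r in \<open>auto simp: P'_def\<close>)
    finally show ?thesis .
  qed
  moreover have "det (P x) = leibniz S (f x)" for x unfolding P_def by (rule leibniz_eq_det_pad[OF S r, symmetric])
  ultimately show ?thesis by simp
qed

locale kahler_kernel_action = kahler_lie_action T A h G TG E e act f J
  for T :: "'m topology" and A :: "(complex^'n::finite, 'm) ochart set" and h :: "('n, 'm) htensor"
    and G :: "('g, 'b) monoid_scheme" (structure) and TG :: "'g topology" and E :: "(real^'p::finite, 'g) ochart set"
    and e :: "(real^'p, 'g) ochart" and act :: "'g \<Rightarrow> 'm \<Rightarrow> 'm"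
    and f :: "'m \<Rightarrow> real" and J :: "'m \<Rightarrow> real^'p \<Rightarrow> real" +
  fixes \<mu> :: "real^'p \<Rightarrow> real" and K :: "'g set" and \<xi>s :: "(real^'p) list"
  assumes K: "compact_kernel_group G TG E e \<mu> K"
    and basis: "basis_of (kernel_algebra G TG E e \<mu>) \<xi>s"
begin

lemma K_facts:
  shows "K \<subseteq> carrier G" "\<one> \<in> K" "\<And>x y. x \<in> K \<Longrightarrow> y \<in> K \<Longrightarrow> x \<otimes> y \<in> K" "\<And>x. x \<in> K \<Longrightarrow> inv x \<in> K"
    and "compactin TG K" "connectedin TG K" "K \<subseteq> isotropy G e \<mu>"
proof -
  let ?I = "G\<lparr>carrier := isotropy G e \<mu>\<rparr>"
  have "normal K ?I" using K by (simp add: compact_kernel_group_def)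
  then interpret I: normal K ?I .
  note sg = I.subgroup_axioms
  show "K \<subseteq> isotropy G e \<mu>" using subgroup.subset[OF sg] by simp
  then show sub: "K \<subseteq> carrier G" by (auto simp: isotropy_def)
  show "\<one> \<in> K" using subgroup.one_closed[OF sg] by simp
  show "x \<otimes> y \<in> K" if "x \<in> K" "y \<in> K" for x y using subgroup.m_closed[OF sg that] by simp
  \<comment> \<open>Inversion in the isotropy group is formed with respect to a smaller carrier; the
    left inverse property identifies it with inversion in \<open>G\<close>.\<close>
  show "inv x \<in> K" if x: "x \<in> K" for x
  proof -
    have "inv\<^bsub>?I\<^esub> x \<in> K" by (rule subgroup.m_inv_closed[OF sg x])
    moreover have "inv\<^bsub>?I\<^esub> x \<otimes> x = \<one>" using I.l_inv[of x] x subgroup.subset[OF sg] by auto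
    ultimately show ?thesis using inv_equality sub x by (metis subsetD)
  qed
  show "compactin TG K" "connectedin TG K" using K by (auto simp: compact_kernel_group_def)
qed

definition "\<kk> = kernel_algebra G TG E e \<mu>"

lemma lie_algebra_K: "lie_algebra_of G TG E e K = \<kk>"
  using K by (simp add: compact_kernel_group_def \<kk>_def)

abbreviation "k \<equiv> length \<xi>s"

lemma basis_facts: "distinct \<xi>s" "independent (set \<xi>s)" "span (set \<xi>s) = \<kk>"
  using basis by (auto simp: basis_of_def \<kk>_def)

lemma xi_in: "j < k \<Longrightarrow> \<xi>s ! j \<in> \<kk>"
  using basis_facts(3) span_base nth_mem by blast

lemma curve:
  assumes "\<xi> \<in> \<kk>"
  obtains \<gamma> where "smooth_into TG E UNIV \<gamma>" "\<forall>s t. \<gamma> (s + t) = \<gamma> s \<otimes> \<gamma> t" "range \<gamma> \<subseteq> K" "\<gamma> 0 = \<one>"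
    "((\<lambda>t. coords e (\<gamma> t)) has_vector_derivative \<xi>) (at 0)"
proof -
  obtain \<gamma> where g: "\<xi> = vector_derivative (\<lambda>t. coords e (\<gamma> t)) (at 0)" "one_parameter G TG E \<gamma>" "range \<gamma> \<subseteq> K"
    using assms unfolding lie_algebra_K[symmetric] lie_algebra_of_def by blast
  have g0: "\<gamma> 0 = \<one>"
  proof -
    have "\<gamma> 0 \<otimes> \<gamma> 0 = \<gamma> 0" using g(2) unfolding one_parameter_def by (metis add_0)
    moreover have "\<gamma> 0 \<in> carrier G" using g(3) K_facts(1) by auto
    ultimately show ?thesis by (metis l_cancel_one)
  qed
  have sm: "smooth_into TG E UNIV \<gamma>" using g(2) by (simp add: one_parameter_def)
  have "(\<lambda>t. coords e (\<gamma> t)) differentiable at 0"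
    using smooth_into_eventually(2)[OF sm e, of 0] one_e g0 by (auto intro: differentiableI)
  then have "((\<lambda>t. coords e (\<gamma> t)) has_vector_derivative \<xi>) (at 0)"
    unfolding g(1) by (simp add: vector_derivative_works)
  then show ?thesis using that sm g g0 by (simp add: one_parameter_def)
qed

text \<open>Conjugation by \<open>g\<close> carries a one-parameter group in \<open>K\<close> to
  another one, and its initial velocity by \<open>Ad\<close>.\<close>

lemma Ad_invariant:
  assumes g: "g \<in> K" and \<xi>: "\<xi> \<in> \<kk>"
  shows "Ad G e g \<xi> \<in> \<kk>"
proof -
  obtain \<gamma> where \<gamma>: "smooth_into TG E UNIV \<gamma>" "\<forall>s t. \<gamma> (s + t) = \<gamma> s \<otimes> \<gamma> t" "range \<gamma> \<subseteq> K" "\<gamma> 0 = \<one>"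
    "((\<lambda>t. coords e (\<gamma> t)) has_vector_derivative \<xi>) (at 0)" by (rule curve[OF \<xi>])
  have gc: "g \<in> carrier G" and \<gamma>c: "\<gamma> t \<in> carrier G" for t using g \<gamma>(3) K_facts(1) by auto
  let ?\<delta> = "\<lambda>t. g \<otimes> \<gamma> t \<otimes> inv g"
  have "one_parameter G TG E ?\<delta>"
    unfolding one_parameter_def
  proof (intro conjI allI)
    show "smooth_into TG E UNIV ?\<delta>" by (rule smooth_conj[OF gc \<gamma>(1)]) simp
    show "?\<delta> (s + t) = ?\<delta> s \<otimes> ?\<delta> t" for s t
    proof -
      have 1: "inv g \<otimes> (g \<otimes> x) = x" if "x \<in> carrier G" for x using gc that by (simp add: m_assoc[symmetric])
      have "g \<otimes> (a \<otimes> b) \<otimes> inv g = g \<otimes> a \<otimes> inv g \<otimes> (g \<otimes> b \<otimes> inv g)"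
        if "a \<in> carrier G" "b \<in> carrier G" for a b
      proof -
        have "g \<otimes> a \<otimes> inv g \<otimes> (g \<otimes> b \<otimes> inv g) = g \<otimes> (a \<otimes> (inv g \<otimes> (g \<otimes> (b \<otimes> inv g))))"
          using that gc by (simp only: m_assoc m_closed inv_closed)
        also have "\<dots> = g \<otimes> (a \<otimes> b) \<otimes> inv g" using that gc by (simp only: 1 m_assoc m_closed inv_closed)
        finally show ?thesis by (rule sym)
      qed
      moreover have "\<gamma> (s + t) = \<gamma> s \<otimes> \<gamma> t" using \<gamma>(2) by blast
      ultimately show ?thesis using \<gamma>c by simp
    qed
  qed
  moreover have "range ?\<delta> \<subseteq> K"
  proof
    fix y assume "y \<in> range ?\<delta>"
    then obtain t where "y = ?\<delta> t" by (rule rangeE)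
    moreover have "\<gamma> t \<in> K" using \<gamma>(3) by (rule subsetD) (rule rangeI)
    ultimately show "y \<in> K" using K_facts(3)[OF K_facts(3)[OF g] K_facts(4)[OF g]] by simp
  qed
  moreover have "vector_derivative (\<lambda>t. coords e (?\<delta> t)) (at 0) = Ad G e g \<xi>"
  proof (rule vector_derivative_at)
    have "((\<lambda>t. coords e (g \<otimes> cpar e (coords e (\<gamma> t)) \<otimes> inv g)) has_derivative (\<lambda>t. Ad G e g (t *\<^sub>R \<xi>))) (at 0)"
      by (rule has_derivative_compose[OF \<gamma>(5)[unfolded has_vector_derivative_def]]) (simp only: \<gamma>(4) Ad_derivative(1)[OF gc])
    moreover have "\<forall>\<^sub>F t in nhds 0. coords e (g \<otimes> cpar e (coords e (\<gamma> t)) \<otimes> inv g) = coords e (?\<delta> t)"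
      using smooth_into_eventually(1)[OF \<gamma>(1) e, of 0] one_e \<gamma>(4)
      by (simp add: coords_inverse(2)[OF mG e] eventually_mono)
    ultimately have "((\<lambda>t. coords e (?\<delta> t)) has_derivative (\<lambda>t. Ad G e g (t *\<^sub>R \<xi>))) (at 0)"
      by (rule has_derivative_transform_eventually_nhds)
    then show "((\<lambda>t. coords e (?\<delta> t)) has_vector_derivative Ad G e g \<xi>) (at 0)"
      by (simp add: has_vector_derivative_def linear_cmul[OF linear_Ad[OF gc]])
  qed
  ultimately have "Ad G e g \<xi> \<in> lie_algebra_of G TG E e K"
    unfolding lie_algebra_of_def by (intro CollectI exI[of _ ?\<delta>] conjI) simp_all
  then show ?thesis by (simp only: lie_algebra_K)
qed

section \<open>The determinant of the adjoint representation on the kernel algebra\<close>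

lemma ex_coefficient: "\<exists>c. linear c \<and> (\<forall>j<k. c (\<xi>s ! j) = (if j = m then 1 else (0::real)))"
proof -
  obtain c :: "real^'p \<Rightarrow> real" where c: "linear c" "\<forall>x\<in>set \<xi>s. c x = (if x = \<xi>s ! m \<and> m < k then 1 else 0)"
    using linear_independent_extend[OF basis_facts(2), of "\<lambda>x. if x = \<xi>s ! m \<and> m < k then 1 else 0"] by blast
  have "c (\<xi>s ! j) = (if j = m then 1 else 0)" if j: "j < k" for j
  proof -
    have "c (\<xi>s ! j) = (if \<xi>s ! j = \<xi>s ! m \<and> m < k then 1 else 0)" using c(2) nth_mem[OF j] by blast
    moreover have "\<xi>s ! j = \<xi>s ! m \<and> m < k \<longleftrightarrow> j = m" using j nth_eq_iff_index_eq[OF basis_facts(1) j] by blast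
    ultimately show ?thesis by simp
  qed
  then show ?thesis using c(1) by blast
qed

text \<open>Coordinates with respect to \<open>\<xi>s\<close>, extended linearly to the whole Lie
  algebra so that they can be applied to \<open>Ad\<close> of arbitrary group elements and
  differentiated.\<close>

definition coef :: "nat \<Rightarrow> real^'p \<Rightarrow> real" where
  "coef m = (SOME c. linear c \<and> (\<forall>j<k. c (\<xi>s ! j) = (if j = m then 1 else 0)))"

lemma coef: "linear (coef m)" "j < k \<Longrightarrow> coef m (\<xi>s ! j) = (if j = m then 1 else 0)"
  using someI_ex[OF ex_coefficient, of m] unfolding coef_def by auto

lemma coef_expand:
  assumes "v \<in> \<kk>"
  shows "v = (\<Sum>m<k. coef m v *\<^sub>R \<xi>s ! m)"
proof -
  have lin: "linear (\<lambda>v. \<Sum>m<k. coef m v *\<^sub>R \<xi>s ! m)"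
    by (rule linearI) (simp_all add: linear_add[OF coef(1)] linear_cmul[OF coef(1)] scaleR_add_left sum.distrib scaleR_sum_right)
  have eq: "x = (\<Sum>m<k. coef m x *\<^sub>R \<xi>s ! m)" if "x \<in> set \<xi>s" for x
  proof -
    from that have "\<exists>j<k. \<xi>s ! j = x" by (simp only: in_set_conv_nth)
    then obtain j where j: "j < k" and jx: "\<xi>s ! j = x" by (elim exE conjE)
    have "(\<Sum>m<k. coef m x *\<^sub>R \<xi>s ! m) = (\<Sum>m<k. if m = j then \<xi>s ! m else 0)"
      by (intro sum.cong refl) (simp add: jx[symmetric] coef(2)[OF j])
    also have "\<dots> = x" using j jx by simp
    finally show ?thesis by (rule sym)
  qed
  have "v \<in> span (set \<xi>s)" using assms basis_facts(3) by simp
  with linear_eq_on_span[OF linear_id[unfolded id_def] lin eq] show ?thesis by blast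
qed

text \<open>Row \<open>j\<close> holds the coordinates of the image of the \<open>j\<close>-th basis
  vector, the transpose of the usual matrix; products appear in reversed order.\<close>

definition adm :: "'g \<Rightarrow> nat \<Rightarrow> nat \<Rightarrow> real" where
  "adm g j m = coef m (Ad G e g (\<xi>s ! j))"

lemma Ad_expand: "g \<in> K \<Longrightarrow> j < k \<Longrightarrow> Ad G e g (\<xi>s ! j) = (\<Sum>m<k. adm g j m *\<^sub>R \<xi>s ! m)"
  unfolding adm_def by (rule coef_expand[OF Ad_invariant[OF _ xi_in]])

lemma ex_index: "\<exists>r::nat \<Rightarrow> 'p. inj_on r {..<k}"
proof -
  have "card {..<k} \<le> card (UNIV :: 'p set)"
    using independent_bound[OF basis_facts(2)] by (simp add: distinct_card[OF basis_facts(1)])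
  then show ?thesis using card_le_inj[of "{..<k}" "UNIV :: 'p set"] by auto
qed

text \<open>The determinant of \<open>Ad\<close> on \<kk>; on \<open>K\<close> its absolute value is
  the modular function, up to inversion.\<close>

definition addet :: "'g \<Rightarrow> real" where
  "addet g = leibniz {..<k} (adm g)"

lemma addet_mult:
  assumes g: "g \<in> K" and g': "g' \<in> K"
  shows "addet (g \<otimes> g') = addet g * addet g'"
proof -
  obtain r :: "nat \<Rightarrow> 'p" where r: "inj_on r {..<k}" using ex_index ..
  have gc: "g \<in> carrier G" "g' \<in> carrier G" using g g' K_facts(1) by auto
  have "adm (g \<otimes> g') j m = (\<Sum>l<k. adm g' j l * adm g l m)" if j: "j < k" for j m
    unfolding adm_def[of "g \<otimes> g'"] Ad_mult[OF gc] Ad_expand[OF g' j]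
    by (simp add: linear_sum[OF linear_Ad[OF gc(1)]] linear_cmul[OF linear_Ad[OF gc(1)]] linear_sum[OF coef(1)] linear_cmul[OF coef(1)] adm_def)
  then have "addet (g \<otimes> g') = leibniz {..<k} (\<lambda>j m. \<Sum>l\<in>{..<k}. adm g' j l * adm g l m)"
    unfolding addet_def leibniz_def by (intro sum.cong refl arg_cong2[where f = "(*)"] prod.cong) auto
  also have "\<dots> = addet g' * addet g" unfolding addet_def by (rule leibniz_mult[OF finite_lessThan r])
  finally show ?thesis by (simp add: mult.commute)
qed

lemma adm_one: "j < k \<Longrightarrow> adm \<one> j m = (if j = m then 1 else 0)"
  by (simp add: adm_def Ad_one coef(2))

lemma addet_one: "addet \<one> = 1"
proof -
  have "addet \<one> = (\<Prod>j<k. adm \<one> j j)" unfolding addet_def by (rule leibniz_diagonal) (auto simp: adm_one)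
  then show ?thesis by (simp add: adm_one)
qed

lemma smooth_adm: "a \<in> E \<Longrightarrow> smooth_on (cdom a) (\<lambda>t. adm (cpar a t) j m)"
  unfolding adm_def by (rule smooth_on_linear[OF coef(1) manifold_chart(1)[OF mG] smooth_Ad])

text \<open>A continuous homomorphism from a compact group to the multiplicative group of the reals has values of modulus one.\<close>

lemma abs_addet: 
  assumes "g \<in> K"
  shows "\<bar>addet g\<bar> = 1"
proof -
  have "continuous_map TG euclidean addet"
  proof (rule continuous_map_of_charts[OF mG])
    fix a assume a: "a \<in> E"
    show "continuous_on (cdom a) (\<lambda>s. addet (cpar a s))"
      unfolding addet_def leibniz_def
      by (intro continuous_on_sum continuous_on_mult continuous_on_const continuous_on_prod smooth_on_continuous smooth_adm a)
  qed
  then have "compactin euclidean (addet ` K)" using K_facts(5) image_compactin by blast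
  then have "bounded (addet ` K)" by (simp add: compact_imp_bounded)
  then obtain C where C: "\<And>g. g \<in> K \<Longrightarrow> \<bar>addet g\<bar> \<le> C" unfolding bounded_iff by auto
  have pow: "\<exists>g'\<in>K. addet g' = addet g ^ n" if g: "g \<in> K" for g and n :: nat
  proof (induction n)
    case 0
    then show ?case using K_facts(2) addet_one by auto
  next
    case (Suc n)
    then obtain g' where "g' \<in> K" "addet g' = addet g ^ n" by blast
    then show ?case using g K_facts(3) addet_mult by (intro bexI[of _ "g \<otimes> g'"]) auto
  qed
  have le: "\<bar>addet g\<bar> \<le> 1" if g: "g \<in> K" for g
  proof (rule ccontr)
    assume "\<not> \<bar>addet g\<bar> \<le> 1"
    then obtain n where "C < \<bar>addet g\<bar> ^ n" using real_arch_pow[of "\<bar>addet g\<bar>" C] by auto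
    moreover obtain g' where "g' \<in> K" "addet g' = addet g ^ n" using pow[OF g] by blast
    ultimately show False using C[of g'] by (simp add: power_abs)
  qed
  have gc: "g \<in> carrier G" using assms K_facts(1) by auto
  have "addet (inv g) * addet g = 1"
    using addet_mult[OF K_facts(4)[OF assms] assms] gc by (simp add: addet_one)
  then have "\<bar>addet (inv g)\<bar> * \<bar>addet g\<bar> = 1" by (simp add: abs_mult[symmetric])
  moreover have "\<bar>addet (inv g)\<bar> * \<bar>addet g\<bar> \<le> 1 * \<bar>addet g\<bar>"
    by (rule mult_right_mono[OF le[OF K_facts(4)[OF assms]]]) simp
  ultimately show ?thesis using le[OF assms] by simp
qed

text \<open>The constants are the derivatives of the matrix of \<open>Ad\<close> along the
  one-parameter group with velocity \<open>\<xi>s ! l\<close>. Their trace is the derivative of a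
  determinant of modulus one, hence zero. The bracket relation is the derivative, along the same
  group, of the rule by which group elements transform generators.\<close>

lemma structure_constants:
  shows "\<exists>c. \<forall>l<k. (\<Sum>j<k. c l j j) = 0 \<and> (\<forall>a\<in>A. \<forall>z\<in>cdom a. \<forall>j<k.
      frechet_derivative (\<lambda>z. gen a z (\<xi>s ! l)) (at z) (gen a z (\<xi>s ! j)) =
      frechet_derivative (\<lambda>z. gen a z (\<xi>s ! j)) (at z) (gen a z (\<xi>s ! l)) + (\<Sum>m<k. c l j m *\<^sub>R gen a z (\<xi>s ! m)))"
proof -
  let ?P = "\<lambda>l c. (\<Sum>j<k. c j j) = 0 \<and> (\<forall>a\<in>A. \<forall>z\<in>cdom a. \<forall>j<k.
      frechet_derivative (\<lambda>z. gen a z (\<xi>s ! l)) (at z) (gen a z (\<xi>s ! j)) =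
      frechet_derivative (\<lambda>z. gen a z (\<xi>s ! j)) (at z) (gen a z (\<xi>s ! l)) + (\<Sum>m<k. c j m *\<^sub>R gen a z (\<xi>s ! m)))"
  have "\<exists>c. ?P l c"
    if l: "l < k" for l
  proof -
    obtain r :: "nat \<Rightarrow> 'p" where r: "inj_on r {..<k}" using ex_index ..
    obtain \<gamma> where \<gamma>: "smooth_into TG E UNIV \<gamma>" "\<forall>s t. \<gamma> (s + t) = \<gamma> s \<otimes> \<gamma> t" "range \<gamma> \<subseteq> K" "\<gamma> 0 = \<one>"
      "((\<lambda>t. coords e (\<gamma> t)) has_vector_derivative (\<xi>s ! l)) (at 0)" by (rule curve[OF xi_in[OF l]])
    let ?\<sigma> = "\<lambda>t. coords e (\<gamma> t)"
    have \<sigma>: "(?\<sigma> has_derivative (\<lambda>t. t *\<^sub>R (\<xi>s ! l))) (at 0)" using \<gamma>(5) by (simp add: has_vector_derivative_def)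
    have \<sigma>0: "?\<sigma> 0 = s0" by (simp add: \<gamma>(4))
    have ev: "\<forall>\<^sub>F t in nhds 0. \<gamma> t \<in> cimg e" using smooth_into_eventually(1)[OF \<gamma>(1) e, of 0] one_e \<gamma>(4) by simp
    define D where "D j m = frechet_derivative (\<lambda>s. adm (cpar e s) j m) (at s0) (\<xi>s ! l)" for j m
    have dm: "((\<lambda>t. adm (\<gamma> t) j m) has_derivative (\<lambda>t. t * D j m)) (at 0)" for j m
    proof -
      note da = smooth_on_has_derivative[OF smooth_adm[OF e, of j m] e_chart(2)]
      have "((\<lambda>t. adm (cpar e (?\<sigma> t)) j m) has_derivative
          (\<lambda>t. frechet_derivative (\<lambda>s. adm (cpar e s) j m) (at s0) (t *\<^sub>R (\<xi>s ! l)))) (at 0)"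
        by (rule has_derivative_compose[OF \<sigma>]) (simp only: \<sigma>0 da)
      then have "((\<lambda>t. adm (cpar e (?\<sigma> t)) j m) has_derivative (\<lambda>t. t * D j m)) (at 0)"
        by (simp add: linear_cmul[OF has_derivative_linear[OF da]] D_def)
      then show ?thesis
        by (rule has_derivative_transform_eventually_nhds)
          (use ev in \<open>auto elim!: eventually_mono simp: coords_inverse(2)[OF mG e]\<close>)
    qed
    have dl: "((\<lambda>t. addet (\<gamma> t)) has_derivative (\<lambda>t. \<Sum>j<k. t * D j j)) (at 0)"
      unfolding addet_def
      by (rule has_derivative_leibniz_at_one[OF finite_lessThan r dm]) (simp add: \<gamma>(4) adm_one)
    \<comment> \<open>The square is constant whatever the sign of the determinant, so its derivative
      vanishes.\<close>
    have "(\<lambda>t. addet (\<gamma> t) * addet (\<gamma> t)) = (\<lambda>t. 1)"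
    proof
      fix t
      have "\<bar>addet (\<gamma> t)\<bar> = 1" using abs_addet \<gamma>(3) by blast
      then show "addet (\<gamma> t) * addet (\<gamma> t) = 1" by (metis abs_mult_self_eq mult_1)
    qed
    with has_derivative_mult[OF dl dl]
    have "((\<lambda>t. 1::real) has_derivative (\<lambda>t. addet (\<gamma> 0) * (\<Sum>j<k. t * D j j) + (\<Sum>j<k. t * D j j) * addet (\<gamma> 0))) (at 0)" by simp
    from has_derivative_unique[OF this has_derivative_const]
    have "addet (\<gamma> 0) * (\<Sum>j<k. 1 * D j j) + (\<Sum>j<k. 1 * D j j) * addet (\<gamma> 0) = 0" by (rule fun_cong)
    then have tr: "(\<Sum>j<k. D j j) = 0" by (simp add: \<gamma>(4) addet_one)
    have "frechet_derivative (\<lambda>z. gen a z (\<xi>s ! l)) (at z) (gen a z (\<xi>s ! j)) =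
      frechet_derivative (\<lambda>z. gen a z (\<xi>s ! j)) (at z) (gen a z (\<xi>s ! l)) + (\<Sum>m<k. D j m *\<^sub>R gen a z (\<xi>s ! m))"
      if a: "a \<in> A" and z: "z \<in> cdom a" and j: "j < k" for a z j
    proof -
      let ?v = "gen a z (\<xi>s ! j)"
      let ?Dv = "\<lambda>p. frechet_derivative (flow a) (at p) (0, ?v)"
      have fl0: "(?\<sigma> 0, z) \<in> flow_dom a" unfolding \<sigma>0 by (rule flow_origin(1)[OF a z])
      have pz: "((\<lambda>t. (?\<sigma> t, z)) has_derivative (\<lambda>t. (t *\<^sub>R (\<xi>s ! l), 0))) (at 0)"
        by (intro has_derivative_Pair \<sigma> has_derivative_const)
      have evdom: "\<forall>\<^sub>F t in nhds 0. \<gamma> t \<in> cimg e \<and> (?\<sigma> t, z) \<in> flow_dom a"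
      proof (rule eventually_conj[OF ev])
        have "isCont (\<lambda>t. (?\<sigma> t, z)) 0" by (rule has_derivative_continuous[OF pz])
        then have "filterlim (\<lambda>t. (?\<sigma> t, z)) (nhds (?\<sigma> 0, z)) (nhds 0)"
          by (simp add: isCont_def tendsto_nhds_iff)
        then show "\<forall>\<^sub>F t in nhds 0. (?\<sigma> t, z) \<in> flow_dom a"
          by (rule eventually_compose_filterlim[OF eventually_nhds_in_open[OF flow_smooth(1)[OF a] fl0]])
      qed
      \<comment> \<open>The push-forward of generator \<open>j\<close> by \<open>\<gamma> t\<close>
        is differentiated at \<open>t = 0\<close> in two ways: as a derivative of the flow, and
        through the expansion of \<open>Ad\<close> in the basis.\<close>
      have "((\<lambda>t. ?Dv (?\<sigma> t, z)) has_derivative (\<lambda>t. frechet_derivative ?Dv (at (s0, z)) (t *\<^sub>R (\<xi>s ! l), 0))) (at 0)"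
        by (rule has_derivative_compose[OF pz])
          (simp only: \<sigma>0 smooth_on_has_derivative[OF smooth_on_frechet_derivative[OF flow_smooth(2)[OF a]] flow_origin(1)[OF a z]])
      then have 1: "((\<lambda>t. ?Dv (?\<sigma> t, z)) has_derivative (\<lambda>t. frechet_derivative (\<lambda>z. gen a z (t *\<^sub>R (\<xi>s ! l))) (at z) ?v)) (at 0)"
        by (simp add: frechet_eq[OF gen_derivative[OF a z]])
      have fl: "((\<lambda>t. flow a (?\<sigma> t, z)) has_derivative (\<lambda>t. gen a z (t *\<^sub>R (\<xi>s ! l)))) (at 0)"
        unfolding flow_def fst_conv snd_conv
        by (rule has_derivative_compose[OF \<sigma>]) (simp only: \<sigma>0 gen_eq_flow(2)[OF a z])
      have g: "((\<lambda>t. gen a (flow a (?\<sigma> t, z)) \<xi>) has_derivative (\<lambda>t. frechet_derivative (\<lambda>z. gen a z \<xi>) (at z) (gen a z (t *\<^sub>R (\<xi>s ! l))))) (at 0)" for \<xi>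
        by (rule has_derivative_compose[OF fl])
          (simp only: \<sigma>0 flow_origin(2)[OF a z] smooth_on_has_derivative[OF smooth_gen[OF a] z])
      have 2: "((\<lambda>t. \<Sum>m<k. adm (\<gamma> t) j m *\<^sub>R gen a (flow a (?\<sigma> t, z)) (\<xi>s ! m)) has_derivative
         (\<lambda>t. \<Sum>m<k. adm (\<gamma> 0) j m *\<^sub>R frechet_derivative (\<lambda>z. gen a z (\<xi>s ! m)) (at z) (gen a z (t *\<^sub>R (\<xi>s ! l)))
            + (t * D j m) *\<^sub>R gen a (flow a (?\<sigma> 0, z)) (\<xi>s ! m))) (at 0)"
        by (intro has_derivative_sum has_derivative_scaleR dm g)
      have "\<forall>\<^sub>F t in nhds 0. ?Dv (?\<sigma> t, z) = (\<Sum>m<k. adm (\<gamma> t) j m *\<^sub>R gen a (flow a (?\<sigma> t, z)) (\<xi>s ! m))"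
        using evdom
      proof eventually_elim
        case (elim t)
        then have gt: "cpar e (?\<sigma> t) = \<gamma> t" using coords_inverse(2)[OF mG e] by blast
        have tK: "\<gamma> t \<in> K" "\<gamma> t \<in> carrier G" using \<gamma>(3) K_facts(1) by auto
        have img: "act (\<gamma> t) (cpar a z) \<in> cimg a" using elim gt by (simp add: flow_dom_def)
        have lz: "flow a (?\<sigma> t, z) = coords a (act (\<gamma> t) (cpar a z))" by (simp add: flow_def gt)
        have "((\<lambda>y. flow a (?\<sigma> t, y)) has_derivative (\<lambda>v. frechet_derivative (flow a) (at (?\<sigma> t, z)) (0, v))) (at z)"
        proof (rule has_derivative_compose[of "\<lambda>y. (?\<sigma> t, y)" "\<lambda>v. (0, v)"])
          show "((\<lambda>y. (?\<sigma> t, y)) has_derivative (\<lambda>v. (0, v))) (at z)" by (auto intro!: derivative_eq_intros)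
          show "(flow a has_derivative frechet_derivative (flow a) (at (?\<sigma> t, z))) (at (?\<sigma> t, z))"
            by (rule smooth_on_has_derivative[OF flow_smooth(2)[OF a]]) (use elim in simp)
        qed
        from frechet_eq[OF this] have "?Dv (?\<sigma> t, z) = frechet_derivative (\<lambda>z. coords a (act (\<gamma> t) (cpar a z))) (at z) ?v"
          by (simp add: flow_def gt)
        also have "\<dots> = gen a (flow a (?\<sigma> t, z)) (Ad G e (\<gamma> t) (\<xi>s ! j))"
          unfolding lz by (rule gen_transform[OF tK(2) a a z img])
        also have "\<dots> = (\<Sum>m<k. adm (\<gamma> t) j m *\<^sub>R gen a (flow a (?\<sigma> t, z)) (\<xi>s ! m))"
        proof -
          have "flow a (?\<sigma> t, z) \<in> cdom a" unfolding lz by (rule coords_inverse(3)[OF M a img])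
          note lin = linear_gen[OF a this]
          show ?thesis unfolding Ad_expand[OF tK(1) j] by (simp only: linear_sum[OF lin] linear_cmul[OF lin])
        qed
        finally show ?case .
      qed
      from has_derivative_transform_eventually_nhds[OF 1 this]
      have "frechet_derivative (\<lambda>z. gen a z (1 *\<^sub>R (\<xi>s ! l))) (at z) ?v =
        (\<Sum>m<k. adm (\<gamma> 0) j m *\<^sub>R frechet_derivative (\<lambda>z. gen a z (\<xi>s ! m)) (at z) (gen a z (1 *\<^sub>R (\<xi>s ! l)))
            + (1 * D j m) *\<^sub>R gen a (flow a (?\<sigma> 0, z)) (\<xi>s ! m))"
        using has_derivative_unique[OF _ 2] by (blast dest: fun_cong)
      also have "\<dots> = (\<Sum>m<k. (if m = j then frechet_derivative (\<lambda>z. gen a z (\<xi>s ! m)) (at z) (gen a z (\<xi>s ! l)) else 0)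
            + D j m *\<^sub>R gen a z (\<xi>s ! m))"
        using j by (intro sum.cong refl) (simp add: \<gamma>(4) adm_one flow_origin(2)[OF a z])
      also have "\<dots> = frechet_derivative (\<lambda>z. gen a z (\<xi>s ! j)) (at z) (gen a z (\<xi>s ! l)) + (\<Sum>m<k. D j m *\<^sub>R gen a z (\<xi>s ! m))"
        using j by (simp add: sum.distrib)
      finally show ?thesis by simp
    qed
    then show ?thesis using tr by (intro exI[of _ D]) blast
  qed
  then have "\<forall>l. \<exists>c. l < k \<longrightarrow> ?P l c" by blast
  from choice[OF this] obtain c where "\<forall>l. l < k \<longrightarrow> ?P l (c l)" ..
  then show ?thesis by (intro exI[of _ c]) blast
qed

end

section \<open>Ray reduction\<close>

lemma linear_functional_multiple:
  fixes g \<mu> :: "'a::real_vector \<Rightarrow> real"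
  assumes g: "linear g" and \<mu>: "linear \<mu>" and ker: "\<And>x. \<mu> x = 0 \<Longrightarrow> g x = 0"
  shows "\<exists>t. g = (\<lambda>x. t * \<mu> x)"
proof (cases "\<forall>x. \<mu> x = 0")
  case True
  then show ?thesis using ker by (intro exI[of _ 0]) auto
next
  case False
  then obtain y where y: "\<mu> y \<noteq> 0" by blast
  have "g x = g y / \<mu> y * \<mu> x" for x
  proof -
    have "\<mu> (x - (\<mu> x / \<mu> y) *\<^sub>R y) = 0" using y by (simp add: linear_diff[OF \<mu>] linear_cmul[OF \<mu>])
    then have "g (x - (\<mu> x / \<mu> y) *\<^sub>R y) = 0" by (rule ker)
    then show ?thesis by (simp add: linear_diff[OF g] linear_cmul[OF g])
  qed
  then show ?thesis by blast
qed

text \<open>The coefficients form a row of the inverse of the padded matrix. Applied to a Gram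
  matrix, they give the vector dual to one member of a frame.\<close>

lemma leibniz_nonzero_dual:
  fixes r :: "'i \<Rightarrow> 'p::finite" and f :: "'i \<Rightarrow> 'i \<Rightarrow> 'a::field"
  assumes S: "finite S" and r: "inj_on r S" and nz: "leibniz S f \<noteq> 0" and i0: "i0 \<in> S"
  shows "\<exists>c. \<forall>j\<in>S. (\<Sum>i\<in>S. c i * f i j) = (if i0 = j then 1 else 0)"
proof -
  let ?P = "(\<chi> a b. if a \<in> r ` S \<and> b \<in> r ` S then f (inv_into S r a) (inv_into S r b)
      else if a = b then 1 else 0) :: 'a^'p^'p"
  have "invertible ?P" unfolding invertible_det_nz leibniz_eq_det_pad[OF S r, symmetric] by (rule nz)
  then obtain N where N: "N ** ?P = mat 1" using matrix_inv_left by blast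
  have "(\<Sum>i\<in>S. N $ r i0 $ r i * f i j) = (if i0 = j then 1 else 0)" if j: "j \<in> S" for j
  proof -
    have "(\<Sum>i\<in>S. N $ r i0 $ r i * f i j) = (\<Sum>i\<in>S. N $ r i0 $ r i * ?P $ r i $ r j)"
      using r j by (intro sum.cong) auto
    also have "\<dots> = (\<Sum>b\<in>r ` S. N $ r i0 $ b * ?P $ b $ r j)" by (rule sum.reindex_cong[OF r, symmetric]) auto
    also have "\<dots> = (\<Sum>b\<in>UNIV. N $ r i0 $ b * ?P $ b $ r j)"
    proof (rule sum.mono_neutral_left)
      show "\<forall>b\<in>UNIV - r ` S. N $ r i0 $ b * ?P $ b $ r j = 0"
      proof
        fix b assume b: "b \<in> UNIV - r ` S"
        then have "b \<noteq> r j" using j by auto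
        then have "?P $ b $ r j = 0" using b by simp
        then show "N $ r i0 $ b * ?P $ b $ r j = 0" by (simp only: mult_zero_right)
      qed
    qed auto
    also have "\<dots> = (N ** ?P) $ r i0 $ r j" by (simp add: matrix_matrix_mult_def)
    also have "\<dots> = (if i0 = j then 1 else 0)" using r i0 j by (simp add: N mat_def inj_on_eq_iff)
    finally show ?thesis .
  qed
  then show ?thesis by (intro exI[of _ "\<lambda>i. N $ r i0 $ r i"] ballI)
qed

lemma mv_norm_leibniz: "mv_norm a vs = sqrt (Re (leibniz {..<length vs} (\<lambda>i j. hform a (vs ! i) (vs ! j))))"
  by (simp add: mv_norm_def leibniz_def)

locale ray_reduction = kahler_kernel_action T A h G TG E e act f J \<mu> K \<xi>s
  for T :: "'m topology" and A :: "(complex^'n::finite, 'm) ochart set" and h :: "('n, 'm) htensor"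
    and G :: "('g, 'b) monoid_scheme" (structure) and TG :: "'g topology" and E :: "(real^'p::finite, 'g) ochart set"
    and e :: "(real^'p, 'g) ochart" and act :: "'g \<Rightarrow> 'm \<Rightarrow> 'm"
    and f :: "'m \<Rightarrow> real" and J :: "'m \<Rightarrow> real^'p \<Rightarrow> real"
    and \<mu> :: "real^'p \<Rightarrow> real" and K :: "'g set" and \<xi>s :: "(real^'p) list" +
  fixes \<mm> :: "(real^'p) set" and \<eta>s :: "(real^'p) list" and Y :: "'m set topology"
    and B :: "(complex^'q::finite, 'm set) ochart set" and hr :: "('q, 'm set) htensor"
  assumes \<mu>: "linear \<mu>"
    and red: "ray_reduced_kahler_orbifold G TG E e T A h act J \<mu> K Y B hr"
    and \<mm>: "subspace \<mm>" "isotropy_algebra G TG E e \<mu> \<inter> \<mm> = {0}"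
      "{a + b | a b. a \<in> isotropy_algebra G TG E e \<mu> \<and> b \<in> \<mm>} = UNIV" "\<forall>\<eta>\<in>\<mm>. \<mu> \<eta> = 0"
    and basis_\<mm>: "basis_of \<mm> \<eta>s"
    and frame: "adapted_frames A h (generator G e act) (ray_preimage T J \<mu>) \<xi>s"
    and nonzero: "\<forall>x\<in>ray_preimage T J \<mu>. wedge_norm A h (generator G e act) (\<xi>s @ \<eta>s) x \<noteq> 0"
begin

section \<open>The preimage of the ray and the orbit directions\<close>

definition "N = ray_preimage T J \<mu>"
definition "\<pi> = ray_projection G K act"

lemma red_facts:
  shows "proper_action_on TG K T N act" "quotient_map (subtopology T N) Y \<pi>" "orbifold holo_on Y B" "kahler_metric B hr"
    and "projected_kahler A h (horizontal J \<mu> h gen \<kk>) N \<pi> B hr"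
  using red unfolding ray_reduced_kahler_orbifold_def N_def \<pi>_def \<kk>_def by auto

lemma N_facts:
  assumes "x \<in> N"
  shows "x \<in> topspace T" "\<exists>r>0. J x = (\<lambda>\<xi>. r * \<mu> \<xi>)"
  using assms by (auto simp: N_def ray_preimage_def)

text \<open>Properness is stated for a map with target \<open>N \<times> N\<close>, and a closed map
  has its image in the space of its target.\<close>

lemma act_N:
  assumes g: "g \<in> K" and x: "x \<in> N"
  shows "act g x \<in> N"
proof -
  let ?X = "prod_topology (subtopology TG K) (subtopology T N)" and ?Z = "prod_topology (subtopology T N) (subtopology T N)"
  have "closed_map ?X ?Z (\<lambda>(k, x). (x, act k x))"
    using red_facts(1) proper_imp_closed_map unfolding proper_action_on_def by blast
  then have "(\<lambda>(k, x). (x, act k x)) ` topspace ?X \<subseteq> topspace ?Z" 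
    using closed_map_imp_subset_topspace by blast
  moreover have "(g, x) \<in> topspace ?X"
    using g x subsetD[OF K_facts(1) g] N_facts(1)[OF x] by (simp add: topTG)
  ultimately have "(x, act g x) \<in> topspace ?Z" by force
  then show ?thesis by auto
qed

lemma xi_kernel: "\<xi> \<in> \<kk> \<Longrightarrow> \<mu> \<xi> = 0"
  by (simp add: \<kk>_def kernel_algebra_def)

lemma moment_vanishes: "x \<in> N \<Longrightarrow> \<mu> \<xi> = 0 \<Longrightarrow> J x \<xi> = 0"
  using N_facts(2) by fastforce

abbreviation "X j c z \<equiv> gen c z (\<xi>s ! j)"

text \<open>Directions in \<kk> are realized by curves inside one orbit of \<open>K\<close>, hence
  inside \<open>N\<close> and inside one fibre of the projection. Functions that are constant or
  finitely valued on orbits are differentiated along these curves.\<close>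

lemma orbit_curve:
  assumes c: "c \<in> A" and z: "z \<in> cdom c" "cpar c z \<in> N" and \<xi>: "\<xi> \<in> \<kk>"
  obtains \<Phi> U where "open U" "(0::real) \<in> U" "smooth_on U \<Phi>" "\<Phi> 0 = z"
    "(\<Phi> has_derivative (\<lambda>t. gen c z (t *\<^sub>R \<xi>))) (at 0)"
    "\<forall>t\<in>U. \<Phi> t \<in> cdom c" "\<forall>t\<in>U. \<exists>g\<in>K. cpar c (\<Phi> t) = act g (cpar c z)"
proof -
  let ?x = "cpar c z"
  obtain \<gamma> where \<gamma>': "smooth_into TG E UNIV \<gamma>" "\<forall>s t. \<gamma> (s + t) = \<gamma> s \<otimes> \<gamma> t" "range \<gamma> \<subseteq> K" "\<gamma> 0 = \<one>"
    "((\<lambda>t. coords e (\<gamma> t)) has_vector_derivative \<xi>) (at 0)" by (rule curve[OF \<xi>])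
  note \<gamma> = \<gamma>'(1,3-5)
  have x: "?x \<in> topspace T" by (rule N_facts(1)[OF z(2)])
  have x0: "act (\<gamma> 0) ?x = ?x" "act (\<gamma> 0) ?x \<in> cimg c" using z(1) by (simp_all add: \<gamma>(3) act_facts(1)[OF x] cpar_in_cimg)
  have "((\<lambda>t. coords c (act (\<gamma> t) ?x)) has_derivative
     (\<lambda>t. gen c (coords c (act (\<gamma> 0) ?x)) (frechet_derivative (\<lambda>s. coords e (\<gamma> s \<otimes> inv (\<gamma> 0))) (at 0) t))) (at 0)"
    by (rule velocity[OF open_UNIV \<gamma>(1) UNIV_I x c x0(2)])
  moreover have "(\<lambda>s. coords e (\<gamma> s \<otimes> inv (\<gamma> 0))) = (\<lambda>s. coords e (\<gamma> s))"
  proof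
    fix s
    have "\<gamma> s \<in> carrier G" using \<gamma>(2) K_facts(1) by auto
    then show "coords e (\<gamma> s \<otimes> inv (\<gamma> 0)) = coords e (\<gamma> s)" by (simp add: \<gamma>(3))
  qed
  moreover have "frechet_derivative (\<lambda>s. coords e (\<gamma> s)) (at 0) = (\<lambda>t. t *\<^sub>R \<xi>)"
    using frechet_eq[OF \<gamma>(4)[unfolded has_vector_derivative_def]] .
  ultimately have d: "((\<lambda>t. coords c (act (\<gamma> t) ?x)) has_derivative (\<lambda>t. gen c z (t *\<^sub>R \<xi>))) (at 0)"
    by (simp add: x0 coords_inverse(1)[OF M c z(1)])
  note D = smooth_intoD[OF smooth_act[OF \<gamma>(1) smooth_into_const[OF open_UNIV x]] c]
  show ?thesis
  proof (rule that[OF D(1) _ D(2) _ d])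
    show "0 \<in> {s \<in> UNIV. act (\<gamma> s) ?x \<in> cimg c}" using x0(2) by simp
    show "coords c (act (\<gamma> 0) ?x) = z" by (simp add: x0 coords_inverse(1)[OF M c z(1)])
    show "\<forall>t\<in>{s \<in> UNIV. act (\<gamma> s) ?x \<in> cimg c}. coords c (act (\<gamma> t) ?x) \<in> cdom c"
      using coords_inverse(3)[OF M c] by simp
    show "\<forall>t\<in>{s \<in> UNIV. act (\<gamma> s) ?x \<in> cimg c}. \<exists>g\<in>K. cpar c (coords c (act (\<gamma> t) ?x)) = act g ?x"
    proof
      fix t assume "t \<in> {s \<in> UNIV. act (\<gamma> s) ?x \<in> cimg c}"
      then show "\<exists>g\<in>K. cpar c (coords c (act (\<gamma> t) ?x)) = act g ?x"
        using \<gamma>(2) coords_inverse(2)[OF M c] by (intro bexI[of _ "\<gamma> t"]) auto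
    qed
  qed
qed

text \<open>On \<open>N\<close> the component of \<open>J\<close> along \<open>\<eta>\<close>
  vanishes, and orbits of \<open>K\<close> stay in \<open>N\<close>. Its derivative along such an
  orbit is the imaginary part in question, up to a nonzero factor.\<close>

lemma tangency:
  assumes c: "c \<in> A" and z: "z \<in> cdom c" "cpar c z \<in> N" and \<xi>: "\<xi> \<in> \<kk>" and \<eta>: "\<mu> \<eta> = 0"
  shows "Im (hform (h c z) (gen c z \<eta>) (gen c z \<xi>)) = 0"
proof -
  obtain \<Phi> U where U: "open U" "(0::real) \<in> U" and \<Phi>: "smooth_on U \<Phi>" "\<Phi> 0 = z"
    and d: "(\<Phi> has_derivative (\<lambda>t. gen c z (t *\<^sub>R \<xi>))) (at 0)" and \<Phi>U: "\<forall>t\<in>U. \<Phi> t \<in> cdom c"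
    and orb: "\<forall>t\<in>U. \<exists>g\<in>K. cpar c (\<Phi> t) = act g (cpar c z)"
    by (rule orbit_curve[OF c z \<xi>])
  have "((\<lambda>t. J (cpar c (\<Phi> t)) \<eta>) has_derivative
      (\<lambda>t. frechet_derivative (\<lambda>y. J (cpar c y) \<eta>) (at z) (gen c z (t *\<^sub>R \<xi>)))) (at 0)"
    by (rule has_derivative_compose[OF d])
      (simp only: \<Phi>(2) smooth_on_has_derivative[OF momentum_formulas(2)[OF c] z(1)])
  then have "((\<lambda>t. 0) has_derivative (\<lambda>t. frechet_derivative (\<lambda>y. J (cpar c y) \<eta>) (at z) (gen c z (t *\<^sub>R \<xi>)))) (at 0)"
  proof (rule has_derivative_transform_within_open[OF _ U])
    fix t assume "t \<in> U"
    then obtain g where "g \<in> K" "cpar c (\<Phi> t) = act g (cpar c z)" using orb by blast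
    then show "J (cpar c (\<Phi> t)) \<eta> = 0" using act_N[OF _ z(2)] moment_vanishes[OF _ \<eta>] by simp
  qed
  from has_derivative_unique[OF this has_derivative_const]
  have "frechet_derivative (\<lambda>y. J (cpar c y) \<eta>) (at z) (gen c z (1 *\<^sub>R \<xi>)) = 0" by (rule fun_cong)
  then show ?thesis by (simp add: momentum_formulas(3)[OF c z(1)])
qed

text \<open>The frame is orthogonal for the real part of the metric by assumption, and tangency
  takes care of the imaginary part.\<close>

lemma frame_orthogonal:
  assumes c: "c \<in> A" and z: "z \<in> cdom c" "cpar c z \<in> N"
  shows "i < k \<Longrightarrow> j < k \<Longrightarrow> i \<noteq> j \<Longrightarrow> hform (h c z) (X i c z) (X j c z) = 0"
    and "j < k \<Longrightarrow> X j c z \<noteq> 0"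
proof -
  have ol: "orthogonal_list (h c z) (map (gen c z) \<xi>s)"
    using frame c z by (auto simp: adapted_frames_def N_def)
  show "hform (h c z) (X i c z) (X j c z) = 0" if "i < k" "j < k" "i \<noteq> j" for i j
  proof -
    have "Re (hform (h c z) (X i c z) (X j c z)) = 0" using ol that by (simp add: orthogonal_list_def)
    moreover have "Im (hform (h c z) (X i c z) (X j c z)) = 0"
      by (rule tangency[OF c z xi_in[OF that(2)] xi_kernel[OF xi_in[OF that(1)]]])
    ultimately show ?thesis by (simp add: complex_eq_iff)
  qed
  show "X j c z \<noteq> 0" if "j < k" for j
    using ol that nth_mem[of j "map (gen c z) \<xi>s"] by (auto simp: orthogonal_list_def)
qed

text \<open>In a decomposition \<open>\<xi> = a + b\<close> with \<open>b\<close> in \<mm>, where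
  \<mu> vanishes, also \<open>\<mu> a = 0\<close>; so \<open>a\<close> belongs to the kernel
  algebra.\<close>

lemma kernel_span: "\<mu> \<xi> = 0 \<Longrightarrow> \<xi> \<in> span (set (\<xi>s @ \<eta>s))"
proof -
  assume 0: "\<mu> \<xi> = 0"
  have "\<xi> \<in> {a + b | a b. a \<in> isotropy_algebra G TG E e \<mu> \<and> b \<in> \<mm>}" unfolding \<mm>(3) by simp
  then obtain a b where ab: "\<xi> = a + b" "a \<in> isotropy_algebra G TG E e \<mu>" "b \<in> \<mm>" by blast
  have "\<mu> a = 0" using 0 ab \<mm>(4) by (simp add: linear_add[OF \<mu>])
  then have "a \<in> span (set \<xi>s)" using ab(2) by (simp add: basis_facts(3) \<kk>_def kernel_algebra_def)
  moreover have "b \<in> span (set \<eta>s)" using ab(3) basis_\<mm> by (simp add: basis_of_def)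
  ultimately show ?thesis unfolding ab(1) using span_mono[of "set \<xi>s" "set (\<xi>s @ \<eta>s)"] span_mono[of "set \<eta>s" "set (\<xi>s @ \<eta>s)"]
    by (intro span_add) auto
qed

lemma dJ_eq: "c \<in> A \<Longrightarrow> z \<in> cdom c \<Longrightarrow> dJ J c z v = (\<lambda>\<xi>. - Im (hform (h c z) (gen c z \<xi>) v) / pi)"
  by (simp add: dJ_def momentum_formulas(3) fun_eq_iff)

lemma linear_dJ:
  assumes "c \<in> A" "z \<in> cdom c"
  shows "linear (dJ J c z v)"
  unfolding dJ_eq[OF assms]
  by (rule linearI) (simp_all add: linear_add[OF linear_gen[OF assms]] linear_cmul[OF linear_gen[OF assms]]
      hform_add_left hform_scaleR_left algebra_simps add_divide_distrib diff_divide_distrib)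

text \<open>The hypothesis makes the differential of \<open>J\<close> in direction \<open>v\<close>
  vanish on the kernel of \<mu>, and a functional with this property is a multiple of \<mu>.\<close>

lemma ray_tangentI:
  assumes c: "c \<in> A" and z: "z \<in> cdom c" and v: "\<And>\<xi>. \<xi> \<in> set (\<xi>s @ \<eta>s) \<Longrightarrow> Im (hform (h c z) (gen c z \<xi>) v) = 0"
  shows "v \<in> ray_tangent J \<mu> c z"
proof -
  have "dJ J c z v \<xi> = 0" if "\<mu> \<xi> = 0" for \<xi>
    by (rule linear_eq_0_on_span[OF linear_dJ[OF c z] _ kernel_span[OF that]]) (simp add: dJ_eq[OF c z] v)
  from linear_functional_multiple[OF linear_dJ[OF c z] \<mu> this]
  show ?thesis by (simp add: ray_tangent_def)
qed

lemma horizontal_complex: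
  assumes "c \<in> A" "z \<in> cdom c" "cpar c z \<in> N" "v \<in> horizontal J \<mu> h gen \<kk> c z"
  shows "\<i> *s v \<in> horizontal J \<mu> h gen \<kk> c z"
  using red_facts(5) assms unfolding projected_kahler_def by blast

lemma hform_gen_span:
  assumes c: "c \<in> A" and z: "z \<in> cdom c" and v: "\<And>j. j < k \<Longrightarrow> hform (h c z) v (X j c z) = 0" and \<xi>: "\<xi> \<in> \<kk>"
  shows "hform (h c z) v (gen c z \<xi>) = 0"
proof -
  note lin = linear_gen[OF c z]
  have "gen c z \<xi> = (\<Sum>m<k. coef m \<xi> *\<^sub>R X m c z)"
    by (subst coef_expand[OF \<xi>]) (simp only: linear_sum[OF lin] linear_cmul[OF lin])
  then show ?thesis using v by (simp add: hform_sum_right hform_scaleR_right)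
qed

text \<open>If \<open>\<eta>s\<close> were nonempty, the vector dual to its first element within the complex span of the frame
  would be horizontal but not its multiple by \<open>\<i>\<close>.\<close>

lemma eta_empty:
  assumes x: "x \<in> N"
  shows "\<eta>s = []"
proof (rule ccontr)
  assume "\<eta>s \<noteq> []"
  let ?bs = "\<xi>s @ \<eta>s" and ?n = "length (\<xi>s @ \<eta>s)"
  have kn: "k < ?n" using \<open>\<eta>s \<noteq> []\<close> by simp
  obtain c where c: "c \<in> A" "x \<in> cimg c" by (rule manifold_cover[OF M N_facts(1)[OF x]])
  let ?z = "coords c x"
  have z: "?z \<in> cdom c" "cpar c ?z = x" using coords_inverse(2,3)[OF M c] by auto
  have b\<mm>: "distinct \<eta>s" "independent (set \<eta>s)" "span (set \<eta>s) = \<mm>" using basis_\<mm> by (auto simp: basis_of_def)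
  \<comment> \<open>The two bases together are no longer than the dimension of the Lie algebra,
    because \<kk> and \<mm> meet in zero; this makes \<open>'p\<close> large enough to index the
    Gram matrix.\<close>
  have "?n \<le> CARD('p)"
  proof -
    have sk: "subspace \<kk>" using basis_facts(3) subspace_span by metis
    have "0 \<in> \<kk>" "0 \<in> \<mm>" using sk \<mm>(1) subspace_0 by auto
    then have "\<kk> \<inter> \<mm> = {0}" using \<mm>(2) by (auto simp: \<kk>_def kernel_algebra_def)
    then have "dim {x + y |x y. x \<in> \<kk> \<and> y \<in> \<mm>} = dim \<kk> + dim \<mm>"
      using dim_sums_Int[OF sk \<mm>(1)] by (simp add: dim_eq_0)
    moreover have "dim {x + y |x y. x \<in> \<kk> \<and> y \<in> \<mm>} \<le> CARD('p)"
      using dim_subset_UNIV[of "{x + y |x y. x \<in> \<kk> \<and> y \<in> \<mm>}"] by simp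
    moreover have "dim \<kk> = k"
      using dim_span_eq_card_independent[OF basis_facts(2)] basis_facts(3) by (simp add: distinct_card[OF basis_facts(1)])
    moreover have "dim \<mm> = length \<eta>s"
      using dim_span_eq_card_independent[OF b\<mm>(2)] b\<mm>(3) by (simp add: distinct_card[OF b\<mm>(1)])
    ultimately show ?thesis by simp
  qed
  then obtain r :: "nat \<Rightarrow> 'p" where r: "inj_on r {..<?n}"
    using card_le_inj[of "{..<?n}" "UNIV :: 'p set"] by auto
  let ?g = "\<lambda>i j. hform (h c ?z) (gen c ?z (?bs ! i)) (gen c ?z (?bs ! j))"
  have "leibniz {..<?n} (\<lambda>i j. hform (h c ?z) (map (gen c ?z) ?bs ! i) (map (gen c ?z) ?bs ! j)) \<noteq> 0"
    using nonzero x wedge_norm_chart[OF c, of ?bs] by (auto simp: N_def mv_norm_leibniz simp del: map_append length_append)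
  moreover have "leibniz {..<?n} (\<lambda>i j. hform (h c ?z) (map (gen c ?z) ?bs ! i) (map (gen c ?z) ?bs ! j)) = leibniz {..<?n} ?g"
  proof -
    have "(\<Prod>i<?n. hform (h c ?z) (map (gen c ?z) ?bs ! i) (map (gen c ?z) ?bs ! p i)) = (\<Prod>i<?n. ?g i (p i))"
      if p: "p permutes {..<?n}" for p
      using permutes_in_image[OF p] by (intro prod.cong) (auto simp del: map_append length_append)
    then show ?thesis unfolding leibniz_def by (intro sum.cong) auto
  qed
  ultimately have "leibniz {..<?n} ?g \<noteq> 0" by simp
  \<comment> \<open>Position \<open>k\<close> of the joined list is the first element of
    \<open>\<eta>s\<close>.\<close>
  from leibniz_nonzero_dual[OF finite_lessThan r this, of k] kn
  obtain a where a: "\<And>j. j < ?n \<Longrightarrow> (\<Sum>i<?n. a i * ?g i j) = (if k = j then 1 else 0)" by auto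
  define v where "v = (\<Sum>i<?n. a i *s gen c ?z (?bs ! i))"
  have hv: "hform (h c ?z) v (gen c ?z (?bs ! j)) = (if k = j then 1 else 0)" if "j < ?n" for j
    using a[OF that] by (simp add: v_def hform_sum_left hform_scale_left)
  have hv': "hform (h c ?z) (gen c ?z (?bs ! j)) v = (if k = j then 1 else 0)" if "j < ?n" for j
    using hv[OF that] hform_hermitian[OF metric_facts(2)[OF c(1) z(1)], of "gen c ?z (?bs ! j)" v] by simp
  have "v \<in> ray_tangent J \<mu> c ?z"
  proof (rule ray_tangentI[OF c(1) z(1)])
    fix \<xi> assume "\<xi> \<in> set (\<xi>s @ \<eta>s)"
    then obtain j where "j < ?n" "\<xi> = ?bs ! j" unfolding in_set_conv_nth by blast
    then show "Im (hform (h c ?z) (gen c ?z \<xi>) v) = 0" using hv'[of j] by simp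
  qed
  moreover have "hform (h c ?z) v (gen c ?z \<xi>) = 0" if "\<xi> \<in> \<kk>" for \<xi>
  proof (rule hform_gen_span[OF c(1) z(1) _ that])
    fix j assume "j < k"
    then show "hform (h c ?z) v (X j c ?z) = 0" using hv[of j] by (simp add: nth_append)
  qed
  ultimately have "v \<in> horizontal J \<mu> h gen \<kk> c ?z" by (simp add: horizontal_def)
  then have "\<i> *s v \<in> ray_tangent J \<mu> c ?z"
    using horizontal_complex[OF c(1) z(1)] x z(2) by (auto simp: horizontal_def)
  then obtain t where t: "dJ J c ?z (\<i> *s v) = (\<lambda>\<xi>. t * \<mu> \<xi>)" by (auto simp: ray_tangent_def)
  have "\<eta>s ! 0 \<in> set \<eta>s" using \<open>\<eta>s \<noteq> []\<close> by simp
  then have "?bs ! k \<in> \<mm>" using b\<mm>(3) span_base[of "\<eta>s ! 0" "set \<eta>s"] by (simp add: nth_append)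
  \<comment> \<open>\<mu> vanishes on \<mm>, whereas the duality of \<open>v\<close> makes this
    value \<open>1 / pi\<close>.\<close>
  then have "dJ J c ?z (\<i> *s v) (?bs ! k) = 0" using \<mm>(4) by (simp add: t)
  then show False using hv'[OF kn] by (simp add: dJ_eq[OF c(1) z(1)] hform_scale_right)
qed

text \<open>Horizontal vectors are defined by the real part of the metric; invariance under
  \<open>\<i>\<close> upgrades this to Hermitian orthogonality. Conversely, \<open>\<eta>s\<close>
  is empty here, so \<open>\<xi>s\<close> spans the kernel of \<mu> and orthogonality to its
  generators already implies tangency to \<open>N\<close>.\<close>

lemma horizontal_eq:
  assumes c: "c \<in> A" and z: "z \<in> cdom c" "cpar c z \<in> N"
  shows "horizontal J \<mu> h gen \<kk> c z = {v. \<forall>j<k. hform (h c z) v (X j c z) = 0}"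
proof (intro subset_antisym subsetI)
  fix v assume v: "v \<in> horizontal J \<mu> h gen \<kk> c z"
  have "hform (h c z) v (X j c z) = 0" if "j < k" for j
  proof -
    have "Re (hform (h c z) v (X j c z)) = 0" using v xi_in[OF that] by (simp add: horizontal_def)
    moreover have "Re (hform (h c z) (\<i> *s v) (X j c z)) = 0"
      using horizontal_complex[OF c z v] xi_in[OF that] by (simp add: horizontal_def)
    ultimately show ?thesis by (simp add: hform_scale_left complex_eq_iff)
  qed
  then show "v \<in> {v. \<forall>j<k. hform (h c z) v (X j c z) = 0}" by simp
next
  fix v assume v: "v \<in> {v. \<forall>j<k. hform (h c z) v (X j c z) = 0}"
  have "v \<in> ray_tangent J \<mu> c z"
  proof (rule ray_tangentI[OF c z(1)])
    fix \<xi> assume "\<xi> \<in> set (\<xi>s @ \<eta>s)"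
    then obtain j where j: "j < k" "\<xi> = \<xi>s ! j" unfolding eta_empty[OF z(2)] append_Nil2 in_set_conv_nth by blast
    then have "hform (h c z) (X j c z) v = 0"
      using v hform_hermitian[OF metric_facts(2)[OF c z(1)], of v "X j c z"] by simp
    then show "Im (hform (h c z) (gen c z \<xi>) v) = 0" by (simp add: j)
  qed
  moreover have "hform (h c z) v (gen c z \<xi>) = 0" if "\<xi> \<in> \<kk>" for \<xi>
    by (rule hform_gen_span[OF c z(1) _ that]) (use v in simp)
  ultimately show "v \<in> horizontal J \<mu> h gen \<kk> c z" by (simp add: horizontal_def)
qed

lemma wedge_norm_on_N:
  assumes c: "c \<in> A" and z: "z \<in> cdom c" "cpar c z \<in> N"
  shows "(wedge_norm A h gen (\<xi>s @ \<eta>s) (cpar c z))\<^sup>2 = (\<Prod>j<k. Re (hform (h c z) (X j c z) (X j c z)))"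
    and "\<And>j. j < k \<Longrightarrow> 0 < Re (hform (h c z) (X j c z) (X j c z))"
proof -
  show pos: "0 < Re (hform (h c z) (X j c z) (X j c z))" if "j < k" for j
    by (rule metric_facts(3)[OF c z(1) frame_orthogonal(2)[OF c z that]])
  have re: "hform (h c z) (X j c z) (X j c z) = complex_of_real (Re (hform (h c z) (X j c z) (X j c z)))" for j
    using hform_hermitian[OF metric_facts(2)[OF c z(1)], of "X j c z" "X j c z"] by (simp add: complex_eq_iff)
  let ?g = "\<lambda>i j. hform (h c z) (map (gen c z) \<xi>s ! i) (map (gen c z) \<xi>s ! j)"
  have "leibniz {..<k} ?g = (\<Prod>j<k. ?g j j)"
    by (rule leibniz_diagonal) (use frame_orthogonal(1)[OF c z] in auto)
  also have "\<dots> = (\<Prod>j<k. complex_of_real (Re (hform (h c z) (X j c z) (X j c z))))"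
    using re by (intro prod.cong) auto
  also have "\<dots> = complex_of_real (\<Prod>j<k. Re (hform (h c z) (X j c z) (X j c z)))" by simp
  finally have "wedge_norm A h gen (\<xi>s @ \<eta>s) (cpar c z) = sqrt (\<Prod>j<k. Re (hform (h c z) (X j c z) (X j c z)))"
    using wedge_norm_chart[OF c cpar_in_cimg[OF z(1)], of "\<xi>s @ \<eta>s"]
    by (simp add: eta_empty[OF z(2)] coords_inverse(1)[OF M c z(1)] mv_norm_leibniz del: of_real_prod)
  then show "(wedge_norm A h gen (\<xi>s @ \<eta>s) (cpar c z))\<^sup>2 = (\<Prod>j<k. Re (hform (h c z) (X j c z) (X j c z)))"
    using prod_nonneg[of "{..<k}" "\<lambda>j. Re (hform (h c z) (X j c z) (X j c z))"] pos less_imp_le by auto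
qed

text \<open>Moving the point by \<open>g\<close> changes the Gram matrix by a congruence with the
  real matrix of \<open>Ad\<close>, whose determinant squares to one.\<close>

lemma wedge_norm_invariant:
  assumes g: "g \<in> K" and x: "x \<in> N"
  shows "wedge_norm A h gen (\<xi>s @ \<eta>s) (act g x) = wedge_norm A h gen (\<xi>s @ \<eta>s) x"
proof -
  have gc: "g \<in> carrier G" using g K_facts(1) by auto
  obtain c where c: "c \<in> A" "x \<in> cimg c" by (rule manifold_cover[OF M N_facts(1)[OF x]])
  obtain d where d: "d \<in> A" "act g x \<in> cimg d" by (rule manifold_cover[OF M act_facts(2)[OF N_facts(1)[OF x] gc]])
  let ?z = "coords c x" and ?w = "coords d (act g x)"
  have z: "?z \<in> cdom c" "cpar c ?z = x" using coords_inverse(2,3)[OF M c] by auto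
  have w: "?w \<in> cdom d" using coords_inverse(3)[OF M d] .
  obtain r :: "nat \<Rightarrow> 'p" where r: "inj_on r {..<k}" using ex_index ..
  define \<Gamma> where "\<Gamma> i j = hform (h d ?w) (X i d ?w) (X j d ?w)" for i j
  note lin = linear_gen[OF d(1) w]
  have gram: "hform (h c ?z) (X i c ?z) (X j c ?z) =
      (\<Sum>l\<in>{..<k}. (\<Sum>m\<in>{..<k}. complex_of_real (adm g i m) * \<Gamma> m l) * complex_of_real (adm g j l))"
    if i: "i < k" and j: "j < k" for i j
  proof -
    have "hform (h c ?z) (X i c ?z) (X j c ?z) = hform (h d ?w) (gen d ?w (Ad G e g (\<xi>s ! i))) (gen d ?w (Ad G e g (\<xi>s ! j)))"
      using gram_transform[OF gc c(1) d(1) z(1), of "\<xi>s ! i" "\<xi>s ! j"] d(2) by (simp add: z(2))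
    also have "\<dots> = hform (h d ?w) (\<Sum>m<k. adm g i m *\<^sub>R X m d ?w) (\<Sum>l<k. adm g j l *\<^sub>R X l d ?w)"
      unfolding Ad_expand[OF g i] Ad_expand[OF g j] by (simp only: linear_sum[OF lin] linear_cmul[OF lin])
    also have "\<dots> = (\<Sum>l<k. \<Sum>m<k. complex_of_real (adm g i m) * \<Gamma> m l * complex_of_real (adm g j l))"
      unfolding hform_sum_right hform_sum_left hform_scaleR_left hform_scaleR_right \<Gamma>_def sum_distrib_left
      by (intro sum.cong refl) (simp add: mult_ac)
    finally show ?thesis by (simp add: sum_distrib_right)
  qed
  let ?M = "\<lambda>i j. complex_of_real (adm g i j)"
  have lM: "leibniz {..<k} ?M = complex_of_real (addet g)"
    by (simp add: leibniz_def addet_def)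
  have "leibniz {..<k} (\<lambda>i j. hform (h c ?z) (X i c ?z) (X j c ?z)) =
      leibniz {..<k} (\<lambda>i j. \<Sum>l\<in>{..<k}. (\<Sum>m\<in>{..<k}. ?M i m * \<Gamma> m l) * ?M j l)"
  proof -
    have "(\<Prod>i<k. hform (h c ?z) (X i c ?z) (X (p i) c ?z)) = (\<Prod>i<k. \<Sum>l\<in>{..<k}. (\<Sum>m\<in>{..<k}. ?M i m * \<Gamma> m l) * ?M (p i) l)"
      if p: "p permutes {..<k}" for p
      using permutes_in_image[OF p] by (intro prod.cong refl gram) auto
    then show ?thesis unfolding leibniz_def by (intro sum.cong) auto
  qed
  also have "\<dots> = leibniz {..<k} (\<lambda>i l. \<Sum>m\<in>{..<k}. ?M i m * \<Gamma> m l) * leibniz {..<k} (\<lambda>l j. ?M j l)"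
    by (rule leibniz_mult[OF finite_lessThan r])
  also have "\<dots> = leibniz {..<k} ?M * leibniz {..<k} \<Gamma> * leibniz {..<k} ?M"
    unfolding leibniz_mult[OF finite_lessThan r] leibniz_transpose[OF finite_lessThan r, of ?M] ..
  also have "\<dots> = leibniz {..<k} \<Gamma>"
  proof -
    have "addet g * addet g = 1" using abs_addet[OF g] by (metis abs_mult_self_eq mult_1)
    then have "complex_of_real (addet g) * complex_of_real (addet g) = 1" by (metis of_real_1 of_real_mult)
    then show ?thesis unfolding lM by (simp add: mult.assoc mult.left_commute)
  qed
  finally have eq: "leibniz {..<k} (\<lambda>i j. hform (h c ?z) (X i c ?z) (X j c ?z)) = leibniz {..<k} \<Gamma>" .
  have lm: "leibniz {..<k} (\<lambda>i j. hform a (map \<phi> \<xi>s ! i) (map \<phi> \<xi>s ! j)) = leibniz {..<k} (\<lambda>i j. hform a (\<phi> (\<xi>s ! i)) (\<phi> (\<xi>s ! j)))"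
    for a :: "complex^'n^'n" and \<phi>
  proof -
    have "(\<Prod>i<k. hform a (map \<phi> \<xi>s ! i) (map \<phi> \<xi>s ! p i)) = (\<Prod>i<k. hform a (\<phi> (\<xi>s ! i)) (\<phi> (\<xi>s ! p i)))"
      if p: "p permutes {..<k}" for p
      using permutes_in_image[OF p] by (intro prod.cong) auto
    then show ?thesis unfolding leibniz_def by (intro sum.cong) auto
  qed
  show ?thesis
    unfolding wedge_norm_chart[OF c] wedge_norm_chart[OF d] eta_empty[OF x] append_Nil2 mv_norm_leibniz length_map lm
    using eq by (simp add: \<Gamma>_def[abs_def])
qed

end

lemma card_vec_family_basis:
  fixes u :: "'i \<Rightarrow> 'a::field^'n::finite"
  assumes I: "finite I" and ind: "\<And>c i. (\<Sum>i\<in>I. c i *s u i) = 0 \<Longrightarrow> i \<in> I \<Longrightarrow> c i = 0"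
    and sp: "\<And>v. \<exists>c. v = (\<Sum>i\<in>I. c i *s u i)"
  shows "card I = CARD('n)"
proof -
  have inj: "inj_on u I"
  proof (rule inj_onI, rule ccontr)
    fix i j assume ij: "i \<in> I" "j \<in> I" "u i = u j" "i \<noteq> j"
    let ?c = "\<lambda>l. if l = i then 1 else if l = j then - 1 else (0::'a)"
    have "(\<Sum>l\<in>I. ?c l *s u l) = (\<Sum>l\<in>I. (if l = i then u l else 0) - (if l = j then u l else 0))"
      using ij(4) by (intro sum.cong) (auto simp: vec_eq_iff)
    also have "\<dots> = 0" using I ij by (simp add: sum_subtractf)
    finally have "?c i = 0" using ind[of ?c i] ij(1) by blast
    then show False by simp
  qed
  have "vec.independent (u ` I)"
  proof (rule vec.independent_if_scalars_zero)
    fix f x assume s: "(\<Sum>x\<in>u ` I. f x *s x) = 0" and x: "x \<in> u ` I"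
    then obtain i where i: "i \<in> I" "x = u i" by auto
    have "(\<Sum>i\<in>I. f (u i) *s u i) = 0" using s by (simp add: sum.reindex[OF inj])
    from ind[OF this i(1)] show "f x = 0" by (simp add: i(2))
  qed (use I in simp)
  moreover have "UNIV \<subseteq> vec.span (u ` I)"
  proof
    fix v
    obtain c where "v = (\<Sum>i\<in>I. c i *s u i)" using sp by blast
    then show "v \<in> vec.span (u ` I)" by (simp only:) (intro vec.span_sum vec.span_scale vec.span_base imageI)
  qed
  ultimately have "vec.dim (UNIV :: ('a^'n) set) = card (u ` I)"
    by (intro vec.dim_unique[of "u ` I"]) auto
  then show ?thesis by (simp only: vec_dim_card card_image[OF inj])
qed

lemma smooth_on_hform:
  fixes a :: "'a::real_normed_vector \<Rightarrow> complex^'n::finite^'n"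
  assumes "open S" "smooth_on S a" "smooth_on S v" "smooth_on S w"
  shows "smooth_on S (\<lambda>x. hform (a x) (v x) (w x))"
  unfolding hform_def
  by (intro smooth_on_sum smooth_on_mult smooth_on_cnj smooth_on_vec_nth assms)

section \<open>Linearity of the momentum map and descent to the quotient\<close>

context ray_reduction
begin

text \<open>The momentum map is characterized separately for each \<xi>, so linearity is read off
  from the explicit formula, in which the generator enters linearly.\<close>

lemma linear_J:
  assumes x: "x \<in> topspace T"
  shows "linear (J x)"
proof -
  obtain c where c: "c \<in> A" "x \<in> cimg c" by (rule manifold_cover[OF M x])
  define z where "z = coords c x"
  have z: "z \<in> cdom c" "cpar c z = x" using coords_inverse(2,3)[OF M c] by (auto simp: z_def)
  note o = manifold_chart(1)[OF M c(1)]
  let ?P = "\<lambda>k. dz k (\<lambda>y. complex_of_real (potential c y)) z"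
  let ?Q = "\<lambda>\<xi>. divergence c z \<xi> + (\<Sum>k\<in>UNIV. ?P k * gen c z \<xi> $ k)"
  have dif: "(\<lambda>y. gen c y \<xi> $ i) differentiable (at z)" for \<xi> i
    by (rule smooth_on_differentiable[OF smooth_on_vec_nth[OF o smooth_gen[OF c(1)]] z(1)])
  have add: "divergence c z (\<xi> + \<eta>) = divergence c z \<xi> + divergence c z \<eta>" for \<xi> \<eta>
  proof -
    have "dz i (\<lambda>y. gen c y (\<xi> + \<eta>) $ i) z = dz i (\<lambda>y. gen c y \<xi> $ i) z + dz i (\<lambda>y. gen c y \<eta> $ i) z" for i
    proof -
      have "dz i (\<lambda>y. gen c y (\<xi> + \<eta>) $ i) z = dz i (\<lambda>y. gen c y \<xi> $ i + gen c y \<eta> $ i) z"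
        by (rule dz_cong(1)[OF o z(1) _ dif]) (simp add: linear_add[OF linear_gen[OF c(1)]])
      then show ?thesis by (simp add: dz_add(1)[OF dif dif])
    qed
    then show ?thesis by (simp add: divergence_def sum.distrib)
  qed
  have scale: "divergence c z (r *\<^sub>R \<xi>) = complex_of_real r * divergence c z \<xi>" for r \<xi>
  proof -
    have "dz i (\<lambda>y. gen c y (r *\<^sub>R \<xi>) $ i) z = complex_of_real r * dz i (\<lambda>y. gen c y \<xi> $ i) z" for i
    proof -
      have "dz i (\<lambda>y. gen c y (r *\<^sub>R \<xi>) $ i) z = dz i (\<lambda>y. complex_of_real r * gen c y \<xi> $ i) z"
        by (rule dz_cong(1)[OF o z(1) _ dif]) (simp only: linear_cmul[OF linear_gen[OF c(1)]] vector_scaleR_component, simp only: scaleR_conv_of_real)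
      then show ?thesis using dif by (simp add: dz_mult(1) dz_const)
    qed
    then show ?thesis by (simp add: divergence_def sum_distrib_left)
  qed
  have J: "J x \<xi> = Re (- (\<i> / (2 * of_real pi) * ?Q \<xi>))" for \<xi>
    using arg_cong[OF momentum_formulas(1)[OF c(1) z(1), of \<xi>], of Re] z(2) by simp
  have Qa: "?Q (\<xi> + \<eta>) = ?Q \<xi> + ?Q \<eta>" for \<xi> \<eta>
    by (simp add: add linear_add[OF linear_gen[OF c(1) z(1)]] distrib_left sum.distrib)
  have Qs: "?Q (r *\<^sub>R \<xi>) = complex_of_real r * ?Q \<xi>" for r \<xi>
    unfolding scale linear_cmul[OF linear_gen[OF c(1) z(1)]] vector_scaleR_component
    by (simp add: scaleR_conv_of_real distrib_left sum_distrib_left mult_ac)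
  show ?thesis
  proof (rule linearI)
    show "J x (\<xi> + \<eta>) = J x \<xi> + J x \<eta>" for \<xi> \<eta>
      unfolding J Qa by (simp only: distrib_left minus_add_distrib plus_complex.simps)
    show "J x (r *\<^sub>R \<xi>) = r *\<^sub>R J x \<xi>" for r \<xi>
    proof -
      have "Re (- (a * (complex_of_real r * q))) = r *\<^sub>R Re (- (a * q))" for a q by (simp add: algebra_simps)
      then show ?thesis unfolding J Qs .
    qed
  qed
qed

lemma proj_eq:
  assumes g: "g \<in> K" and x: "x \<in> N"
  shows "\<pi> (act g x) = \<pi> x"
proof -
  have xt: "x \<in> topspace T" by (rule N_facts(1)[OF x])
  have gc: "g \<in> carrier G" using g K_facts(1) by blast
  have 1: "act (k' \<otimes> g) x = act k' (act g x)" if "k' \<in> K" for k'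
    using act_facts(3)[OF xt _ gc] that K_facts(1) by blast
  show ?thesis
    unfolding \<pi>_def ray_projection_def orbit_def
  proof (intro subset_antisym subsetI)
    fix y assume "y \<in> {act ga (act g x) |ga. ga \<in> carrier (G\<lparr>carrier := K\<rparr>)}"
    then obtain k' where "k' \<in> K" "y = act k' (act g x)" by auto
    then show "y \<in> {act ga x |ga. ga \<in> carrier (G\<lparr>carrier := K\<rparr>)}"
      using 1 K_facts(3)[OF _ g] by (intro CollectI exI[of _ "k' \<otimes> g"]) auto
  next
    fix y assume "y \<in> {act ga x |ga. ga \<in> carrier (G\<lparr>carrier := K\<rparr>)}"
    then obtain k' where k': "k' \<in> K" "y = act k' x" by auto
    have "k' \<otimes> inv g \<otimes> g = k'" using k'(1) gc K_facts(1) by (simp add: m_assoc subset_iff)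
    then have "y = act (k' \<otimes> inv g) (act g x)"
      using 1[OF K_facts(3)[OF k'(1) K_facts(4)[OF g]]] k'(2) by simp
    then show "y \<in> {act ga (act g x) |ga. ga \<in> carrier (G\<lparr>carrier := K\<rparr>)}"
      using K_facts(3)[OF k'(1) K_facts(4)[OF g]] by (intro CollectI exI[of _ "k' \<otimes> inv g"]) auto
  qed
qed

text \<open>\<open>descend\<close> evaluates at an arbitrary point of the orbit; invariance makes
  the choice immaterial.\<close>

lemma descend_proj:
  assumes inv: "\<And>g. g \<in> K \<Longrightarrow> F (act g x) = F x" and x: "x \<in> N"
  shows "descend F (\<pi> x) = F x"
proof -
  have px: "\<pi> x = {act g x | g. g \<in> K}" by (auto simp: \<pi>_def ray_projection_def orbit_def)
  have "x \<in> \<pi> x" unfolding px using K_facts(2) act_facts(1)[OF N_facts(1)[OF x]] by (intro CollectI exI[of _ "\<one>"]) simp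
  then have "(SOME y. y \<in> \<pi> x) \<in> \<pi> x" by (rule someI)
  then obtain g where "g \<in> K" "(SOME y. y \<in> \<pi> x) = act g x" unfolding px by blast
  then show ?thesis by (simp add: descend_def inv)
qed

definition "fr = descend f"
definition "wr = descend (wedge_norm A h gen (\<xi>s @ \<eta>s))"

lemma descended:
  assumes "x \<in> N"
  shows "fr (\<pi> x) = f x" "wr (\<pi> x) = wedge_norm A h gen (\<xi>s @ \<eta>s) x"
  unfolding fr_def wr_def
  using descend_proj[OF f_invariant[OF K_facts(6,2) _ N_facts(1)[OF assms]] assms]
    descend_proj[OF wedge_norm_invariant[OF _ assms] assms] by auto

text \<open>Fibres of an orbifold chart are orbits of its finite group. Their finiteness will force
  lifts of the projection to be constant along orbits of \<open>K\<close>.\<close>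

lemma B_chart:
  assumes b: "b \<in> B"
  shows "open (cdom b)" "finite {w \<in> cdom b. cpar b w = y}"
    and "\<And>w. w \<in> cdom b \<Longrightarrow> \<exists>x\<in>N. cpar b w = \<pi> x"
proof -
  have ch: "orbifold_chart holo_on Y b" using red_facts(3) b by (simp add: orbifold_def)
  then show "open (cdom b)" by (simp add: orbifold_chart_def)
  have fin: "finite (cgrp b)" and eq: "\<And>z w. z \<in> cdom b \<Longrightarrow> w \<in> cdom b \<Longrightarrow> cpar b z = cpar b w \<longleftrightarrow> (\<exists>\<gamma>\<in>cgrp b. \<gamma> z = w)"
    using ch by (auto simp: orbifold_chart_def)
  show "finite {w \<in> cdom b. cpar b w = y}"
  proof (cases "\<exists>z\<in>cdom b. cpar b z = y")
    case True
    then obtain z where z: "z \<in> cdom b" "cpar b z = y" by blast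
    have "{w \<in> cdom b. cpar b w = y} \<subseteq> (\<lambda>\<gamma>. \<gamma> z) ` cgrp b"
    proof
      fix w assume "w \<in> {w \<in> cdom b. cpar b w = y}"
      then obtain \<gamma> where "\<gamma> \<in> cgrp b" "\<gamma> z = w" using eq[OF z(1), of w] z(2) by auto
      then show "w \<in> (\<lambda>\<gamma>. \<gamma> z) ` cgrp b" by blast
    qed
    then show ?thesis using fin finite_subset by blast
  next
    case False
    then have "{w \<in> cdom b. cpar b w = y} = {}" by blast
    then show ?thesis by (simp only: finite.emptyI)
  qed
  have cm: "continuous_map (top_of_set (cdom b)) Y (cpar b)" using ch by (simp add: orbifold_chart_def)
  have img: "\<pi> ` (topspace T \<inter> N) = topspace Y" using red_facts(2) by (simp add: quotient_map_def)
  show "\<exists>x\<in>N. cpar b w = \<pi> x" if "w \<in> cdom b" for w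
  proof -
    have "cpar b w \<in> topspace Y" using cm that by (simp add: continuous_map_def Pi_iff)
    then show ?thesis unfolding img[symmetric] by blast
  qed
qed

lemma quotient_metric:
  assumes b: "b \<in> B"
  shows "smooth_on (cdom b) (hr b)"
    and "\<And>z \<alpha> \<beta>. z \<in> cdom b \<Longrightarrow> hr b z $ \<beta> $ \<alpha> = cnj (hr b z $ \<alpha> $ \<beta>)"
    and "\<And>z v. z \<in> cdom b \<Longrightarrow> v \<noteq> 0 \<Longrightarrow> 0 < Re (hform (hr b z) v v)"
  using red_facts(4) b unfolding kahler_metric_def by blast+

text \<open>The local data supplied by \<open>projected_kahler\<close>, freed from the base point so
  that it can be evaluated along a whole slice.\<close>

definition lift where
  "lift c b W p \<longleftrightarrow> open W \<and> W \<subseteq> cdom c \<and> smooth_on W p \<and> p ` W \<subseteq> cdom b \<and>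
    (\<forall>y\<in>W. cpar c y \<in> N \<longrightarrow> cpar b (p y) = \<pi> (cpar c y) \<and>
       frechet_derivative p (at y) ` horizontal J \<mu> h gen \<kk> c y = UNIV \<and>
       (\<forall>v\<in>horizontal J \<mu> h gen \<kk> c y. frechet_derivative p (at y) (\<i> *s v) = \<i> *s frechet_derivative p (at y) v) \<and>
       (\<forall>v\<in>horizontal J \<mu> h gen \<kk> c y. \<forall>v'\<in>horizontal J \<mu> h gen \<kk> c y.
          hform (hr b (p y)) (frechet_derivative p (at y) v) (frechet_derivative p (at y) v') = hform (h c y) v v'))"

lemma ex_lift:
  assumes "b \<in> B" "w \<in> cdom b"
  obtains c z W p where "c \<in> A" "z \<in> W" "cpar c z \<in> N" "p z = w" "lift c b W p"
proof -
  obtain x where x: "x \<in> N" "cpar b w = \<pi> x" using B_chart(3)[OF assms] by blast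
  obtain c where c: "c \<in> A" "x \<in> cimg c" by (rule manifold_cover[OF M N_facts(1)[OF x(1)]])
  let ?z = "coords c x"
  have z: "?z \<in> cdom c" "cpar c ?z = x" using coords_inverse(2,3)[OF M c] by auto
  have c1: "cpar b w = \<pi> (cpar c ?z)" and c2: "cpar c ?z \<in> N" using x z by auto
  have PK: "projected_kahler A h (horizontal J \<mu> h gen \<kk>) N \<pi> B hr" by (rule red_facts(5))
  note r = PK[unfolded projected_kahler_def]
  note r1 = bspec[OF r c(1)]
  note r2 = bspec[OF r1 z(1)]
  note r3 = conjunct2[OF mp[OF r2 c2]]
  note r4 = bspec[OF r3 assms(1)]
  note r5 = mp[OF bspec[OF r4 assms(2)] c1]
  have "\<exists>W p. open W \<and> ?z \<in> W \<and> W \<subseteq> cdom c \<and> smooth_on W p \<and> p ` W \<subseteq> cdom b \<and> p ?z = w \<and>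
     (\<forall>y\<in>W. cpar c y \<in> N \<longrightarrow> cpar b (p y) = \<pi> (cpar c y) \<and>
       frechet_derivative p (at y) ` horizontal J \<mu> h gen \<kk> c y = UNIV \<and>
       (\<forall>v\<in>horizontal J \<mu> h gen \<kk> c y. frechet_derivative p (at y) (\<i> *s v) = \<i> *s frechet_derivative p (at y) v) \<and>
       (\<forall>v\<in>horizontal J \<mu> h gen \<kk> c y. \<forall>v'\<in>horizontal J \<mu> h gen \<kk> c y.
          hform (hr b (p y)) (frechet_derivative p (at y) v) (frechet_derivative p (at y) v') = hform (h c y) v v'))"
    by (rule r5)
  then obtain W p where "?z \<in> W" "p ?z = w" "lift c b W p" unfolding lift_def by blast
  then show ?thesis using that[OF c(1)] c2 by blast
qed

end

text \<open>In finite dimension an injective derivative is invertible, so the inverse function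
  theorem gives a differentiable local inverse. Its smoothness follows from the formula for its
  derivative.\<close>

lemma smooth_local_inverse:
  fixes Q :: "'a::euclidean_space \<Rightarrow> 'a"
  assumes U: "open U" and Q: "smooth_on U Q" and x: "x \<in> U"
    and inj: "\<And>v. frechet_derivative Q (at x) v = 0 \<Longrightarrow> v = 0"
  obtains V g where "open V" "Q x \<in> V" "g ` V \<subseteq> U" "smooth_on V g" "g (Q x) = x" "\<forall>y\<in>V. Q (g y) = y"
proof -
  let ?D = "\<lambda>y. frechet_derivative Q (at y)"
  have bl: "bounded_linear (?D y)" if "y \<in> U" for y
    using has_derivative_bounded_linear[OF smooth_on_has_derivative[OF Q that]] .
  define f' where "f' y = Blinfun (?D y)" for y
  have f': "blinfun_apply (f' y) = ?D y" if "y \<in> U" for y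
    unfolding f'_def by (rule bounded_linear_Blinfun_apply[OF bl[OF that]])
  have der: "(Q has_derivative blinfun_apply (f' y)) (at y)" if "y \<in> U" for y
    unfolding f'[OF that] by (rule smooth_on_has_derivative[OF Q that])
  have cont: "continuous_on U f'"
  proof (rule continuous_on_blinfun_componentwise)
    fix i :: 'a
    have "continuous_on U (\<lambda>y. ?D y i)" by (rule smooth_on_continuous[OF smooth_on_frechet_derivative[OF Q]])
    then show "continuous_on U (\<lambda>y. blinfun_apply (f' y) i)"
      by (rule continuous_on_eq) (simp add: f')
  qed
  have lin: "linear (?D x)" using bl[OF x] bounded_linear.linear by blast
  then have "inj (?D x)" using inj by (simp add: linear_injective_0)
  then obtain k where k: "linear k" "k \<circ> ?D x = id" using linear_injective_left_inverse[OF lin] by blast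
  have kb: "bounded_linear k" using k(1) by (simp add: linear_conv_bounded_linear)
  have inv: "Blinfun k o\<^sub>L f' x = id_blinfun"
    by (rule blinfun_eqI) (use k(2) in \<open>simp add: f'[OF x] bounded_linear_Blinfun_apply[OF kb] fun_eq_iff\<close>)
  obtain U' V g g' where r: "open U'" "U' \<subseteq> U" "x \<in> U'" "open V" "Q x \<in> V" "homeomorphism U' V Q g"
    "\<And>y. y \<in> V \<Longrightarrow> (g has_derivative g' y) (at y)" "\<And>y. y \<in> V \<Longrightarrow> g' y = Hilbert_Choice.inv (blinfun_apply (f' (g y)))"
    "\<And>y. y \<in> V \<Longrightarrow> bij (blinfun_apply (f' (g y)))"
    by (rule inverse_function_theorem[OF U der cont x inv]) blast+
  have gV: "g ` V \<subseteq> U" using r(2,6) by (auto simp: homeomorphism_def)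
  show ?thesis
  proof (rule that[OF r(4,5) gV])
    show "smooth_on V g"
    proof (rule smooth_on_inverse_function[OF r(4) U gV Q r(7)])
      fix y v assume y: "y \<in> V"
      then have gy: "g y \<in> U" using gV by blast
      show "?D (g y) (g' y v) = v"
        unfolding r(8)[OF y] f'[OF gy, symmetric] by (rule surj_f_inv_f[OF bij_is_surj[OF r(9)[OF y]]])
    qed
    show "g (Q x) = x" "\<forall>y\<in>V. Q (g y) = y" using r(3,6) by (auto simp: homeomorphism_def)
  qed
qed

section \<open>Lifts of the projection and their slices\<close>

context ray_reduction
begin

abbreviation "n j c z \<equiv> hform (h c z) (X j c z) (X j c z)"
abbreviation "hor c z \<equiv> {v. \<forall>j<k. hform (h c z) v (X j c z) = 0}"

lemma n_pos:
  assumes "c \<in> A" "z \<in> cdom c" "cpar c z \<in> N" "j < k"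
  shows "n j c z = complex_of_real (Re (n j c z))" "Re (n j c z) > 0" "n j c z \<noteq> 0"
proof -
  show "n j c z = complex_of_real (Re (n j c z))"
    using hform_hermitian[OF metric_facts(2)[OF assms(1,2)], of "X j c z" "X j c z"] by (simp add: complex_eq_iff)
  show "Re (n j c z) > 0" by (rule wedge_norm_on_N(2)[OF assms])
  then show "n j c z \<noteq> 0" by auto
qed

lemma hform_vertical:
  assumes c: "c \<in> A" and z: "z \<in> cdom c" "cpar c z \<in> N" and m: "m < k"
  shows "hform (h c z) (\<Sum>j<k. a j *s X j c z) (X m c z) = a m * n m c z"
proof -
  have "hform (h c z) (\<Sum>j<k. a j *s X j c z) (X m c z) = (\<Sum>j<k. if j = m then a m * n m c z else 0)"
    unfolding hform_sum_left
    by (intro sum.cong refl) (use frame_orthogonal(1)[OF c z _ m] in \<open>auto simp: hform_scale_left\<close>)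
  then show ?thesis using m by simp
qed

lemma horizontal_part:
  assumes c: "c \<in> A" and z: "z \<in> cdom c" "cpar c z \<in> N"
  shows "v - (\<Sum>j<k. (hform (h c z) v (X j c z) / n j c z) *s X j c z) \<in> hor c z"
  using hform_vertical[OF c z] n_pos(3)[OF c z] by (simp add: hform_diff_left)

lemma lift_facts:
  assumes c: "c \<in> A" and l: "lift c b W p" and y: "y \<in> W" "cpar c y \<in> N"
  shows "y \<in> cdom c" "p y \<in> cdom b" "cpar b (p y) = \<pi> (cpar c y)"
    and "(p has_derivative frechet_derivative p (at y)) (at y)"
    and "\<exists>v\<in>hor c y. frechet_derivative p (at y) v = u"
    and "\<And>v. v \<in> hor c y \<Longrightarrow> frechet_derivative p (at y) (\<i> *s v) = \<i> *s frechet_derivative p (at y) v"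
    and "\<And>v v'. v \<in> hor c y \<Longrightarrow> v' \<in> hor c y \<Longrightarrow>
      hform (hr b (p y)) (frechet_derivative p (at y) v) (frechet_derivative p (at y) v') = hform (h c y) v v'"
    and "\<And>v. v \<in> hor c y \<Longrightarrow> frechet_derivative p (at y) v = 0 \<Longrightarrow> v = 0"
proof -
  have W: "W \<subseteq> cdom c" "smooth_on W p" "p ` W \<subseteq> cdom b" using l unfolding lift_def by blast+
  show yc: "y \<in> cdom c" using W(1) y(1) by blast
  note he = horizontal_eq[OF c yc y(2)]
  have r: "cpar b (p y) = \<pi> (cpar c y) \<and>
       frechet_derivative p (at y) ` hor c y = UNIV \<and>
       (\<forall>v\<in>hor c y. frechet_derivative p (at y) (\<i> *s v) = \<i> *s frechet_derivative p (at y) v) \<and>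
       (\<forall>v\<in>hor c y. \<forall>v'\<in>hor c y.
          hform (hr b (p y)) (frechet_derivative p (at y) v) (frechet_derivative p (at y) v') = hform (h c y) v v')"
    unfolding he[symmetric] using l y unfolding lift_def by blast
  show "p y \<in> cdom b" using W(3) y(1) by blast
  show "cpar b (p y) = \<pi> (cpar c y)" by (rule conjunct1[OF r])
  show "(p has_derivative frechet_derivative p (at y)) (at y)" by (rule smooth_on_has_derivative[OF W(2) y(1)])
  have "u \<in> frechet_derivative p (at y) ` hor c y" using conjunct1[OF conjunct2[OF r]] by (simp only: UNIV_I)
  then show "\<exists>v\<in>hor c y. frechet_derivative p (at y) v = u" by (elim imageE) (rule bexI, rule sym)
  show "frechet_derivative p (at y) (\<i> *s v) = \<i> *s frechet_derivative p (at y) v" if "v \<in> hor c y" for v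
    by (rule bspec[OF conjunct1[OF conjunct2[OF conjunct2[OF r]]] that])
  show iso: "hform (hr b (p y)) (frechet_derivative p (at y) v) (frechet_derivative p (at y) v') = hform (h c y) v v'"
    if "v \<in> hor c y" "v' \<in> hor c y" for v v'
    by (rule bspec[OF bspec[OF conjunct2[OF conjunct2[OF conjunct2[OF r]]] that(1)] that(2)])
  show "v = 0" if v: "v \<in> hor c y" and 0: "frechet_derivative p (at y) v = 0" for v
  proof (rule ccontr)
    assume "v \<noteq> 0"
    then have "0 < Re (hform (h c y) v v)" by (rule metric_facts(3)[OF c yc])
    then show False using iso[OF v v] 0 by (simp add: hform_zero_left)
  qed
qed

text \<open>A lift sends points of one orbit into one fibre of the orbifold chart, which is finite.
  Along a curve in the orbit it is continuous, hence constant.\<close>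

lemma lift_vertical:
  assumes b: "b \<in> B" and c: "c \<in> A" and l: "lift c b W p" and y: "y \<in> W" "cpar c y \<in> N" and j: "j < k"
  shows "frechet_derivative p (at y) (X j c y) = 0"
proof -
  note lf = lift_facts[OF c l y]
  have W: "open W" "smooth_on W p" "p ` W \<subseteq> cdom b" using l unfolding lift_def by blast+
  obtain \<Phi> U where U: "open U" "(0::real) \<in> U" and \<Phi>: "smooth_on U \<Phi>" "\<Phi> 0 = y"
    and d: "(\<Phi> has_derivative (\<lambda>t. gen c y (t *\<^sub>R \<xi>s ! j))) (at 0)"
    and \<Phi>U: "\<forall>t\<in>U. \<Phi> t \<in> cdom c" and orb: "\<forall>t\<in>U. \<exists>g\<in>K. cpar c (\<Phi> t) = act g (cpar c y)"
    by (rule orbit_curve[OF c lf(1) y(2) xi_in[OF j]])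
  have U': "open (U \<inter> \<Phi> -` W)" by (rule continuous_open_preimage[OF smooth_on_continuous[OF \<Phi>(1)] U(1) W(1)])
  moreover have "0 \<in> U \<inter> \<Phi> -` W" using U(2) \<Phi>(2) y(1) by simp
  ultimately obtain r where r: "r > 0" "ball 0 r \<subseteq> U \<inter> \<Phi> -` W" using openE by blast
  have cont: "continuous_on (ball 0 r) (\<lambda>t. p (\<Phi> t))"
    by (rule continuous_on_compose2[OF smooth_on_continuous[OF W(2)] continuous_on_subset[OF smooth_on_continuous[OF \<Phi>(1)]]])
      (use r in auto)
  have fin: "finite ((\<lambda>t. p (\<Phi> t)) ` ball 0 r)"
  proof (rule finite_subset[OF _ B_chart(2)[OF b, of "\<pi> (cpar c y)"]], rule image_subsetI)
    fix t :: real assume "t \<in> ball 0 r"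
    then have t: "t \<in> U" "\<Phi> t \<in> W" using r(2) by auto
    obtain g where g: "g \<in> K" "cpar c (\<Phi> t) = act g (cpar c y)" using bspec[OF orb t(1)] by blast
    have N: "cpar c (\<Phi> t) \<in> N" unfolding g(2) by (rule act_N[OF g(1) y(2)])
    show "p (\<Phi> t) \<in> {w \<in> cdom b. cpar b w = \<pi> (cpar c y)}"
      using lift_facts(2,3)[OF c l t(2) N] proj_eq[OF g(1) y(2)] g(2) by simp
  qed
  obtain a where "(\<lambda>t. p (\<Phi> t)) ` ball 0 r = {a}"
    using connected_finite_iff_sing[OF connected_continuous_image[OF cont convex_connected[OF convex_ball]]] fin r(1)
    by (auto simp only: image_is_empty ball_eq_empty not_le)
  then have a: "p (\<Phi> t) = a" if "t \<in> ball 0 r" for t using that by blast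
  have "((\<lambda>t. p (\<Phi> t)) has_derivative (\<lambda>t. frechet_derivative p (at y) (gen c y (t *\<^sub>R \<xi>s ! j)))) (at 0)"
    by (rule has_derivative_compose[OF d]) (simp only: \<Phi>(2) lf(4))
  then have "((\<lambda>t. a) has_derivative (\<lambda>t. frechet_derivative p (at y) (gen c y (t *\<^sub>R \<xi>s ! j)))) (at 0)"
    by (rule has_derivative_transform_within_open[OF _ open_ball centre_in_ball[THEN iffD2, OF r(1)] a])
  from has_derivative_unique[OF this has_derivative_const]
  have "frechet_derivative p (at y) (gen c y (1 *\<^sub>R \<xi>s ! j)) = 0" by (rule fun_cong)
  then show ?thesis by simp
qed

text \<open>The derivative of a lift is bijective on the horizontal space, which is a complex
  subspace on which it is complex linear; its inverse inherits the linearity.\<close>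

lemma ex_horizontal_lift:
  assumes c: "c \<in> A" and l: "lift c b W p" and y: "y \<in> W" "cpar c y \<in> N"
  obtains L :: "complex^'q \<Rightarrow> complex^'n" where "linear L" "\<forall>a u. L (a *s u) = a *s L u"
    "\<forall>u. L u \<in> hor c y" "\<forall>u. frechet_derivative p (at y) (L u) = u" "\<forall>v\<in>hor c y. L (frechet_derivative p (at y) v) = v"
proof -
  note lf = lift_facts[OF c l y]
  let ?D = "frechet_derivative p (at y)"
  have lin: "linear ?D" using has_derivative_linear[OF lf(4)] .
  have add: "v + v' \<in> hor c y" if "v \<in> hor c y" "v' \<in> hor c y" for v v' using that by (simp add: hform_add_left)
  have scale: "a *s v \<in> hor c y" if "v \<in> hor c y" for a v using that by (simp add: hform_scale_left)
  have uniq: "v = v'" if v: "v \<in> hor c y" "v' \<in> hor c y" "?D v = ?D v'" for v v'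
  proof -
    have "v - v' \<in> hor c y" using v(1,2) by (simp add: hform_diff_left)
    moreover have "?D (v - v') = 0" using v(3) by (simp add: linear_diff[OF lin])
    ultimately have "v - v' = 0" by (rule lf(8))
    then show ?thesis by simp
  qed
  have Dscale: "?D (a *s v) = a *s ?D v" if v: "v \<in> hor c y" for a v
  proof -
    have e: "a *s x = Re a *\<^sub>R x + Im a *\<^sub>R (\<i> *s x)" for x :: "complex^'d::finite"
      unfolding vec_eq_iff by (simp add: complex_eq_iff)
    show ?thesis by (subst (1 2) e) (simp only: linear_add[OF lin] linear_cmul[OF lin] lf(6)[OF v])
  qed
  obtain L where L: "\<And>u. L u \<in> hor c y" "\<And>u. ?D (L u) = u" 
  proof -
    have "\<forall>u. \<exists>v. v \<in> hor c y \<and> ?D v = u" using lf(5) by blast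
    then have "\<exists>L. \<forall>u. L u \<in> hor c y \<and> ?D (L u) = u" by (rule choice)
    then show ?thesis using that by blast
  qed
  show ?thesis
  proof (rule that[of L])
    have sc: "L (a *s u) = a *s L u" for a u by (rule uniq[OF L(1) scale[OF L(1)]]) (simp only: L(2) Dscale[OF L(1)])
    then show "\<forall>a u. L (a *s u) = a *s L u" by blast
    show "linear L"
    proof (rule linearI)
      show "L (u + v) = L u + L v" for u v by (rule uniq[OF L(1) add[OF L(1) L(1)]]) (simp only: L(2) linear_add[OF lin])
      show "L (r *\<^sub>R u) = r *\<^sub>R L u" for r u using sc[of "of_real r" u] by (simp only: scaleC_of_real)
    qed
    show "\<forall>v\<in>hor c y. L (?D v) = v" by (intro ballI) (rule uniq[OF L(1) _ L(2)])
  qed (intro allI; rule L)+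
qed

text \<open>The generators and the horizontal lifts of the standard basis form a complex basis, so
  \<open>'n\<close> has as many elements as \<open>{..<k}\<close> and \<open>'q\<close>
  together.\<close>

lemma ex_frame_index:
  assumes b: "b \<in> B" and c: "c \<in> A" and l: "lift c b W p" and y: "y \<in> W" "cpar c y \<in> N"
  shows "\<exists>\<sigma> :: 'n \<Rightarrow> nat + 'q. bij_betw \<sigma> UNIV ({..<k} <+> UNIV)"
proof -
  note lf = lift_facts[OF c l y]
  let ?D = "frechet_derivative p (at y)"
  obtain L :: "complex^'q \<Rightarrow> complex^'n" where L': "linear L" "\<forall>a u. L (a *s u) = a *s L u"
    "\<forall>u. L u \<in> hor c y" "\<forall>u. ?D (L u) = u" "\<forall>v\<in>hor c y. L (?D v) = v"
    by (rule ex_horizontal_lift[OF c l y])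
  note L = L'(1) L'(2-)[rule_format]
  define u :: "nat + 'q \<Rightarrow> complex^'n" where "u i = (case i of Inl j \<Rightarrow> X j c y | Inr i \<Rightarrow> L (axis i 1))" for i
  have Lsum: "L q = (\<Sum>i\<in>UNIV. q $ i *s L (axis i 1))" for q
    by (subst basis_expansion[of q, symmetric]) (simp only: linear_sum[OF L(1)] L(2))
  have sum: "(\<Sum>i\<in>{..<k} <+> UNIV. a i *s u i) = (\<Sum>j<k. a (Inl j) *s X j c y) + L (\<chi> i. a (Inr i))" for a
    by (simp add: sum.Plus u_def Lsum[of "\<chi> i. a (Inr i)"])
  have "card ({..<k} <+> (UNIV :: 'q set)) = CARD('n)"
  proof (rule card_vec_family_basis[where u = u])
    show "finite ({..<k} <+> (UNIV :: 'q set))" by simp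
  next
    fix a i assume 0: "(\<Sum>i\<in>{..<k} <+> UNIV. a i *s u i) = 0" and i: "i \<in> {..<k} <+> (UNIV :: 'q set)"
    have 1: "a (Inl m) = 0" if m: "m < k" for m
    proof -
      have "hform (h c y) ((\<Sum>j<k. a (Inl j) *s X j c y) + L (\<chi> i. a (Inr i))) (X m c y) = 0"
        using 0 unfolding sum by (simp add: hform_zero_left)
      then have "a (Inl m) * n m c y = 0"
        using L(3)[of "\<chi> i. a (Inr i)"] m by (simp add: hform_add_left hform_vertical[OF c lf(1) y(2) m])
      then show ?thesis using n_pos(3)[OF c lf(1) y(2) m] by simp
    qed
    then have "L (\<chi> i. a (Inr i)) = 0" using 0 unfolding sum by simp
    then have "(\<chi> i. a (Inr i)) = 0" using L(4)[of "\<chi> i. a (Inr i)"] linear_0[OF has_derivative_linear[OF lf(4)]] by simp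
    then have "a (Inr m) = 0" for m by (simp add: vec_eq_iff)
    then show "a i = 0" using i 1 by auto
  next
    fix v
    let ?a = "\<lambda>j. hform (h c y) v (X j c y) / n j c y"
    define v' where "v' = v - (\<Sum>j<k. ?a j *s X j c y)"
    have "L (?D v') = v'" unfolding v'_def by (rule L(5)[OF horizontal_part[OF c lf(1) y(2)]])
    then have "v = (\<Sum>j<k. ?a j *s X j c y) + L (\<chi> i. ?D v' $ i)" by (simp add: v'_def)
    then show "\<exists>a. v = (\<Sum>i\<in>{..<k} <+> UNIV. a i *s u i)"
      unfolding sum by (intro exI[of _ "case_sum ?a (\<lambda>i. ?D v' $ i)"]) simp
  qed
  then show ?thesis using finite_same_card_bij[of "UNIV :: 'n set" "{..<k} <+> (UNIV :: 'q set)"] by simp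
qed

text \<open>Vanishing on \<kk> already gives \<open>J x = t * \<mu>\<close>, as
  \<open>\<xi>s\<close> spans the kernel of \<mu>. The test vector \<theta> determines the sign of
  \<open>t\<close>; if \<mu> is zero, so is \<open>J x\<close>, and \<open>r = 1\<close>
  serves.\<close>

lemma in_N:
  assumes x: "x \<in> topspace T" and \<eta>: "\<eta>s = []" and 0: "\<And>j. j < k \<Longrightarrow> J x (\<xi>s ! j) = 0"
    and pos: "(\<forall>\<xi>. \<mu> \<xi> = 0) \<or> 0 < J x \<theta> * \<mu> \<theta>"
  shows "x \<in> N"
proof -
  have "J x \<xi> = 0" if "\<mu> \<xi> = 0" for \<xi>
  proof (rule linear_eq_0_on_span[OF linear_J[OF x] _ kernel_span[OF that]])
    fix \<zeta> assume "\<zeta> \<in> set (\<xi>s @ \<eta>s)"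
    then obtain j where "j < k" "\<zeta> = \<xi>s ! j" using \<eta> by (auto simp: in_set_conv_nth)
    then show "J x \<zeta> = 0" using 0 by simp
  qed
  then obtain t where t: "J x = (\<lambda>\<xi>. t * \<mu> \<xi>)" using linear_functional_multiple[OF linear_J[OF x] \<mu>] by blast
  show ?thesis
  proof (cases "\<forall>\<xi>. \<mu> \<xi> = 0")
    case True
    then have "J x = (\<lambda>\<xi>. 1 * \<mu> \<xi>)" using t by simp
    then show ?thesis using x unfolding N_def ray_preimage_def by (intro CollectI conjI exI[of _ 1]) auto
  next
    case False
    then have "0 < t * (\<mu> \<theta> * \<mu> \<theta>)" using pos by (simp only: t mult.assoc) blast
    then have "0 < t" by (metis zero_less_mult_iff zero_le_square not_less)
    then show ?thesis using x t unfolding N_def ray_preimage_def by blast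
  qed
qed

definition slice where
  "slice c b W p V s \<longleftrightarrow> lift c b W p \<and> open V \<and> V \<subseteq> cdom b \<and> smooth_on V s \<and> s ` V \<subseteq> W \<and>
    (\<forall>v\<in>V. cpar c (s v) \<in> N) \<and> (\<forall>v\<in>V. p (s v) = v)"

text \<open>The section comes from the local inverse of a map \<open>Q\<close> that completes the
  lift by coordinates along the orbits and transverse to \<open>N\<close>. A vector killed by the
  derivative of \<open>Q\<close> is horizontal and killed by the derivative of the lift, hence
  zero.\<close>

lemma ex_slice:
  assumes b: "b \<in> B" and w: "w \<in> cdom b"
  shows "\<exists>c\<in>A. \<exists>W p V s. slice c b W p V s \<and> w \<in> V"
proof -
  obtain c z W p where c: "c \<in> A" and z: "z \<in> W" "cpar c z \<in> N" and pz: "p z = w" and l: "lift c b W p"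
    by (rule ex_lift[OF b w])
  note lf = lift_facts[OF c l z]
  let ?D = "frechet_derivative p (at z)"
  have W: "open W" "W \<subseteq> cdom c" "smooth_on W p" using l unfolding lift_def by blast+
  obtain L :: "complex^'q \<Rightarrow> complex^'n" where L': "linear L" "\<forall>a u. L (a *s u) = a *s L u"
    "\<forall>u. L u \<in> hor c z" "\<forall>u. ?D (L u) = u" "\<forall>v\<in>hor c z. L (?D v) = v"
    by (rule ex_horizontal_lift[OF c l z])
  note L = L'(1) L'(2-)[rule_format]
  \<comment> \<open>The imaginary parts of \<open>\<kappa>\<close> cut out the preimage of the ray, the real parts fix the position along the orbits.\<close>
  define \<kappa> where "\<kappa> j y = complex_of_real (Re (hform (h c z) (y - z) (X j c z))) + \<i> * complex_of_real (J (cpar c y) (\<xi>s ! j))" for j y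
  define \<kappa>' where "\<kappa>' j v = complex_of_real (Re (hform (h c z) v (X j c z))) + \<i> * complex_of_real (Im (hform (h c z) v (X j c z)) / pi)" for j v
  define Q where "Q y = L (p y) + (\<Sum>j<k. \<kappa> j y *s X j c z)" for y
  \<comment> \<open>Horizontal vectors and generators are orthogonal, so the two summands of
    \<open>Q\<close> can be separated.\<close>
  have key: "(\<forall>j<k. a j = 0) \<and> u = 0" if 0: "L u + (\<Sum>j<k. a j *s X j c z) = 0" for u a
  proof -
    have 1: "a m = 0" if m: "m < k" for m
    proof -
      have "hform (h c z) (L u + (\<Sum>j<k. a j *s X j c z)) (X m c z) = 0" unfolding 0 by (rule hform_zero_left)
      then have "a m * n m c z = 0"
        using L(3)[of u] m by (simp add: hform_add_left hform_vertical[OF c lf(1) z(2) m])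
      then show ?thesis using n_pos(3)[OF c lf(1) z(2) m] by simp
    qed
    then have "L u = 0" using 0 by simp
    then have "u = 0" using L(4)[of u] linear_0[OF has_derivative_linear[OF lf(4)]] by simp
    with 1 show ?thesis by blast
  qed
  have lh: "bounded_linear (\<lambda>v. Re (hform (h c z) v x))" for x
    unfolding linear_conv_bounded_linear[symmetric]
    by (rule linearI) (simp_all add: hform_add_left hform_scaleR_left)
  have sm\<kappa>: "smooth_on W (\<kappa> j)" for j
    unfolding \<kappa>_def[abs_def]
    by (intro smooth_on_add smooth_on_mult smooth_on_const smooth_on_of_real smooth_on_bounded_linear[OF lh]
        smooth_on_diff smooth_on_ident W(1) smooth_on_subset[OF momentum_formulas(2)[OF c] W(2)])
  have scale_bl: "bounded_linear (\<lambda>a. a *s (x::complex^'n))" for x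
    unfolding linear_conv_bounded_linear[symmetric]
    by (rule linearI) (simp_all add: vec_eq_iff algebra_simps)
  have smQ: "smooth_on W Q"
    unfolding Q_def[abs_def]
    by (intro smooth_on_add smooth_on_sum smooth_on_linear[OF L(1)] W(1,3) smooth_on_bounded_linear[OF scale_bl] sm\<kappa>)
  have d\<kappa>: "(\<kappa> j has_derivative \<kappa>' j) (at z)" for j
  proof -
    have 1: "((\<lambda>y. Re (hform (h c z) (y - z) (X j c z))) has_derivative (\<lambda>v. Re (hform (h c z) (v - 0) (X j c z)))) (at z)"
      by (rule bounded_linear.has_derivative[OF lh]) (intro has_derivative_diff has_derivative_ident has_derivative_const)
    have "frechet_derivative (\<lambda>y. J (cpar c y) (\<xi>s ! j)) (at z) v = Im (hform (h c z) v (X j c z)) / pi" for v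
      using arg_cong[OF hform_hermitian[OF metric_facts(2)[OF c lf(1)], of v "X j c z"], of Im]
      by (simp add: momentum_formulas(3)[OF c lf(1)])
    then have "frechet_derivative (\<lambda>y. J (cpar c y) (\<xi>s ! j)) (at z) = (\<lambda>v. Im (hform (h c z) v (X j c z)) / pi)"
      by (rule ext)
    then have 2: "((\<lambda>y. J (cpar c y) (\<xi>s ! j)) has_derivative (\<lambda>v. Im (hform (h c z) v (X j c z)) / pi)) (at z)"
      using smooth_on_has_derivative[OF momentum_formulas(2)[OF c] lf(1), of "\<xi>s ! j"] by simp
    show ?thesis unfolding \<kappa>_def[abs_def] \<kappa>'_def[abs_def]
      using has_derivative_add[OF has_derivative_of_real[OF 1] has_derivative_mult_right[OF has_derivative_of_real[OF 2], of \<i>]]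
      by (simp only: diff_zero)
  qed
  have dQ: "(Q has_derivative (\<lambda>v. L (?D v) + (\<Sum>j<k. \<kappa>' j v *s X j c z))) (at z)"
    unfolding Q_def[abs_def]
    by (intro has_derivative_add has_derivative_sum bounded_linear.has_derivative[OF scale_bl] d\<kappa>
        bounded_linear.has_derivative[OF L(1)[unfolded linear_conv_bounded_linear]] lf(4))
  have "v = 0" if "frechet_derivative Q (at z) v = 0" for v
  proof -
    from key[OF that[unfolded frechet_eq[OF dQ]]] have k: "\<And>j. j < k \<Longrightarrow> \<kappa>' j v = 0" "?D v = 0" by blast+
    have "v \<in> hor c z" using k(1) by (simp add: \<kappa>'_def complex_eq_iff)
    then show ?thesis using k(2) by (rule lf(8))
  qed
  then obtain V1 g where V1: "open V1" "Q z \<in> V1" "g ` V1 \<subseteq> W" "smooth_on V1 g" "g (Q z) = z" "\<forall>y\<in>V1. Q (g y) = y"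
    by (rule smooth_local_inverse[OF W(1) smQ z(1)])
  have Qz: "Q z = L w"
  proof -
    have "\<kappa> j z = 0" if "j < k" for j
      using moment_vanishes[OF z(2) xi_kernel[OF xi_in[OF that]]] by (simp add: \<kappa>_def hform_zero_left)
    then show ?thesis by (simp add: Q_def pz)
  qed
  define V2 where "V2 = cdom b \<inter> L -` V1"
  have V2: "open V2" unfolding V2_def
    by (rule continuous_open_preimage[OF _ B_chart(1)[OF b] V1(1)])
      (rule linear_continuous_on[OF L(1)[unfolded linear_conv_bounded_linear]])
  have wV2: "w \<in> V2" using w V1(2) Qz by (simp add: V2_def)
  \<comment> \<open>Restricting the inverse of \<open>Q\<close> to the image of \<open>L\<close>
    forces all components \<open>\<kappa>\<close> to vanish.\<close>
  define s where "s v = g (L v)" for v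
  have sW: "s ` V2 \<subseteq> W" using V1(3) by (auto simp: s_def V2_def)
  have sms: "smooth_on V2 s" unfolding s_def[abs_def]
    by (rule smooth_on_compose[OF V1(4) V2 V1(1) smooth_on_linear[OF L(1) V2 smooth_on_ident[OF V2]]]) (auto simp: V2_def)
  have ps: "p (s v) = v \<and> (\<forall>j<k. J (cpar c (s v)) (\<xi>s ! j) = 0)" if v: "v \<in> V2" for v
  proof -
    have "Q (s v) = L v" unfolding s_def by (rule bspec[OF V1(6)]) (use v in \<open>simp add: V2_def\<close>)
    then have "L (p (s v) - v) + (\<Sum>j<k. \<kappa> j (s v) *s X j c z) = 0" by (simp add: Q_def linear_diff[OF L(1)] algebra_simps)
    from key[OF this] show ?thesis by (auto simp: \<kappa>_def complex_eq_iff)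
  qed
  obtain \<theta> where \<theta>: "(\<forall>\<xi>. \<mu> \<xi> = 0) \<or> \<mu> \<theta> \<noteq> 0" by blast
  \<comment> \<open>Positivity is an open condition that singles out the ray in the line spanned by
    \<mu>. The summand 1 makes it hold everywhere when \<mu> is zero.\<close>
  define \<phi> where "\<phi> v = J (cpar c (s v)) \<theta> * \<mu> \<theta> + (if \<forall>\<xi>. \<mu> \<xi> = 0 then 1 else 0)" for v
  have "continuous_on V2 \<phi>" unfolding \<phi>_def[abs_def]
    using smooth_on_continuous[OF smooth_on_compose[OF smooth_on_subset[OF momentum_formulas(2)[OF c] W(2)] V2 W(1) sms sW]]
    by (intro continuous_intros) 
  then have V: "open (V2 \<inter> \<phi> -` {0<..})" by (rule continuous_open_preimage[OF _ V2 open_greaterThan])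
  let ?V = "V2 \<inter> \<phi> -` {0<..}"
  have "w \<in> ?V"
  proof -
    obtain r where r: "r > 0" "J (cpar c z) = (\<lambda>\<xi>. r * \<mu> \<xi>)" using N_facts(2)[OF z(2)] by blast
    have "s w = z" by (simp add: s_def Qz[symmetric] V1(5))
    then have "\<phi> w > 0" using \<theta> r by (auto simp: \<phi>_def mult.assoc zero_less_mult_iff)
    then show ?thesis using wV2 by simp
  qed
  moreover have "slice c b W p ?V s"
    unfolding slice_def
  proof (intro conjI l V ballI)
    show "?V \<subseteq> cdom b" by (auto simp: V2_def)
    show "smooth_on ?V s" by (rule smooth_on_subset[OF sms]) blast
    show "s ` ?V \<subseteq> W" using sW by blast
    fix v assume v: "v \<in> ?V"
    then show "p (s v) = v" using ps by blast
    have sv: "s v \<in> cdom c" using sW W(2) v by blast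
    show "cpar c (s v) \<in> N"
    proof (rule in_N[OF manifold_chart(4)[OF M c sv] eta_empty[OF z(2)]])
      show "J (cpar c (s v)) (\<xi>s ! j) = 0" if "j < k" for j using ps v that by blast
      show "(\<forall>\<xi>. \<mu> \<xi> = 0) \<or> 0 < J (cpar c (s v)) \<theta> * \<mu> \<theta>" using v by (auto simp: \<phi>_def split: if_splits)
    qed
  qed
  ultimately show ?thesis using c by blast
qed

end

section \<open>The Ricci form of the quotient\<close>

lemma dz_vector:
  fixes s :: "complex^'q::finite \<Rightarrow> complex^'n::finite"
  assumes "(s has_derivative s') (at w)"
  shows "(\<chi> \<alpha>. dz i (\<lambda>y. s y $ \<alpha>) w) = (1/2) *s (s' (axis i 1) - \<i> *s s' (axis i \<i>))"
    and "(\<chi> \<alpha>. dzbar i (\<lambda>y. s y $ \<alpha>) w) = (1/2) *s (s' (axis i 1) + \<i> *s s' (axis i \<i>))"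
proof -
  have d: "((\<lambda>y. s y $ \<alpha>) has_derivative (\<lambda>v. s' v $ \<alpha>)) (at w)" for \<alpha>
    by (rule bounded_linear.has_derivative[OF bounded_linear_vec_nth assms])
  show "(\<chi> \<alpha>. dz i (\<lambda>y. s y $ \<alpha>) w) = (1/2) *s (s' (axis i 1) - \<i> *s s' (axis i \<i>))"
    "(\<chi> \<alpha>. dzbar i (\<lambda>y. s y $ \<alpha>) w) = (1/2) *s (s' (axis i 1) + \<i> *s s' (axis i \<i>))"
    by (simp_all add: vec_eq_iff dz_eq[OF d] dzbar_eq[OF d] diff_divide_distrib add_divide_distrib)
qed

context ray_reduction
begin

text \<open>The derivative of the slice is a horizontal lift plus a vertical part with real
  coefficients. The lift is complex linear and enters only the \<open>dz\<close> derivatives; a real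
  coefficient form enters \<open>dz\<close> and \<open>dzbar\<close> with conjugate
  coefficients.\<close>

lemma slice_decomposition:
  assumes b: "b \<in> B" and c: "c \<in> A" and sl: "slice c b W p V s" and w: "w \<in> V"
  defines "a \<equiv> \<lambda>i j. hform (h c (s w)) (\<chi> \<alpha>. dzbar i (\<lambda>y. s y $ \<alpha>) w) (X j c (s w)) / n j c (s w)"
  defines "Z \<equiv> \<lambda>i. (\<chi> \<alpha>. dz i (\<lambda>y. s y $ \<alpha>) w) - (\<Sum>j<k. cnj (a i j) *s X j c (s w))"
  shows "(\<chi> \<alpha>. dzbar i (\<lambda>y. s y $ \<alpha>) w) = (\<Sum>j<k. a i j *s X j c (s w))"
    and "Z i \<in> hor c (s w)"
    and "hform (h c (s w)) (Z i) (Z m) = hr b w $ i $ m"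
proof -
  have l: "lift c b W p" and V: "open V" and sms: "smooth_on V s" and sW: "s ` V \<subseteq> W"
    and sN: "\<And>v. v \<in> V \<Longrightarrow> cpar c (s v) \<in> N" and ps: "\<And>v. v \<in> V \<Longrightarrow> p (s v) = v"
    using sl unfolding slice_def by blast+
  have W: "W \<subseteq> cdom c" using l unfolding lift_def by blast
  have sw: "s w \<in> W" "s w \<in> cdom c" using sW W w by blast+
  note lf = lift_facts[OF c l sw(1) sN[OF w]]
  let ?h = "hform (h c (s w))" and ?D = "frechet_derivative p (at (s w))"
  define S where "S = frechet_derivative s (at w)"
  have dS: "(s has_derivative S) (at w)" unfolding S_def by (rule smooth_on_has_derivative[OF sms w])
  have linD: "linear ?D" and linS: "linear S" using has_derivative_linear[OF lf(4)] has_derivative_linear[OF dS] by blast+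
  define \<kappa> where "\<kappa> j u = Re (?h (S u) (X j c (s w))) / Re (n j c (s w))" for j u
  define P where "P u = S u - (\<Sum>j<k. \<kappa> j u *\<^sub>R X j c (s w))" for u
  \<comment> \<open>The slice stays in \<open>N\<close>, where the components of \<open>J\<close>
    along \<kk> vanish; differentiating this kills the imaginary part.\<close>
  have real: "?h (S u) (X j c (s w)) / n j c (s w) = complex_of_real (\<kappa> j u)" if j: "j < k" for j u
  proof -
    have "((\<lambda>v. J (cpar c (s v)) (\<xi>s ! j)) has_derivative
        (\<lambda>u. frechet_derivative (\<lambda>y. J (cpar c y) (\<xi>s ! j)) (at (s w)) (S u))) (at w)"
      by (rule has_derivative_compose[OF dS smooth_on_has_derivative[OF momentum_formulas(2)[OF c] sw(2)]])
    then have "((\<lambda>v. 0) has_derivative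
        (\<lambda>u. frechet_derivative (\<lambda>y. J (cpar c y) (\<xi>s ! j)) (at (s w)) (S u))) (at w)"
      by (rule has_derivative_transform_within_open[OF _ V w]) (rule moment_vanishes[OF sN xi_kernel[OF xi_in[OF j]]])
    from has_derivative_unique[OF this has_derivative_const]
    have "frechet_derivative (\<lambda>y. J (cpar c y) (\<xi>s ! j)) (at (s w)) (S u) = 0" by (rule fun_cong)
    then have "Im (?h (X j c (s w)) (S u)) = 0" by (simp add: momentum_formulas(3)[OF c sw(2)])
    then have "Im (?h (S u) (X j c (s w))) = 0"
      using arg_cong[OF hform_hermitian[OF metric_facts(2)[OF c sw(2)], of "S u" "X j c (s w)"], of Im] by simp
    then have "?h (S u) (X j c (s w)) = complex_of_real (Re (?h (S u) (X j c (s w))))" by (simp add: complex_eq_iff)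
    then show ?thesis
      using n_pos(1)[OF c sw(2) sN[OF w] j] unfolding \<kappa>_def of_real_divide by metis
  qed
  have P: "P u = S u - (\<Sum>j<k. (?h (S u) (X j c (s w)) / n j c (s w)) *s X j c (s w))" for u
    unfolding P_def by (intro arg_cong2[where f = "(-)"] refl sum.cong) (simp only: lessThan_iff real scaleC_of_real)
  have Phor: "P u \<in> hor c (s w)" for u unfolding P by (rule horizontal_part[OF c sw(2) sN[OF w]])
  have DP: "?D (P u) = u" for u
  proof -
    have "((\<lambda>v. p (s v)) has_derivative (\<lambda>u. ?D (S u))) (at w)" by (rule has_derivative_compose[OF dS lf(4)])
    then have "((\<lambda>v. v) has_derivative (\<lambda>u. ?D (S u))) (at w)"
      by (rule has_derivative_transform_within_open[OF _ V w]) (rule ps)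
    from has_derivative_unique[OF this has_derivative_ident] have "?D (S u) = u" by (rule fun_cong)
    then show ?thesis
      using lift_vertical[OF b c l sw(1) sN[OF w]]
      by (simp add: P_def linear_diff[OF linD] linear_sum[OF linD] linear_cmul[OF linD])
  qed
  \<comment> \<open>Both sides are horizontal with the same image under the derivative of the lift,
    which is injective there.\<close>
  have Pi: "P (\<i> *s u) = \<i> *s P u" for u
  proof -
    have "P (\<i> *s u) - \<i> *s P u \<in> hor c (s w)"
      using Phor[of "\<i> *s u"] Phor[of u] by (simp add: hform_diff_left hform_scale_left)
    moreover have "?D (P (\<i> *s u) - \<i> *s P u) = 0"
      by (simp add: linear_diff[OF linD] lf(6)[OF Phor] DP)
    ultimately have "P (\<i> *s u) - \<i> *s P u = 0" by (rule lf(8))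
    then show ?thesis by simp
  qed
  have S: "S u = P u + (\<Sum>j<k. complex_of_real (\<kappa> j u) *s X j c (s w))" for u
    by (simp add: P_def scaleC_of_real)
  have ii: "\<i> *s (\<i> *s v) = - (v :: complex^'n)" for v by (simp add: vec_eq_iff)
  let ?e = "\<lambda>i. axis i (1::complex)"
  define d where "d i j = (complex_of_real (\<kappa> j (?e i)) + \<i> * complex_of_real (\<kappa> j (axis i \<i>))) / 2" for i j
  have db: "(\<chi> \<alpha>. dzbar i (\<lambda>y. s y $ \<alpha>) w) = (\<Sum>j<k. d i j *s X j c (s w))" for i
  proof -
    have "S (?e i) + \<i> *s S (axis i \<i>) =
      (\<Sum>j<k. complex_of_real (\<kappa> j (?e i)) *s X j c (s w)) + \<i> *s (\<Sum>j<k. complex_of_real (\<kappa> j (axis i \<i>)) *s X j c (s w))"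
      unfolding S[of "?e i"] S[of "axis i \<i>"] unfolding axis_imaginary Pi vec.scale_right_distrib ii by simp
    also have "\<dots> = 2 *s (\<Sum>j<k. d i j *s X j c (s w))"
      by (simp add: vec_eq_iff d_def sum_distrib_left sum.distrib[symmetric] algebra_simps add_divide_distrib)
    finally show ?thesis unfolding dz_vector(2)[OF dS] by simp
  qed
  have ad: "a i j = d i j" if "j < k" for i j
    unfolding a_def db using hform_vertical[OF c sw(2) sN[OF w] that] n_pos(3)[OF c sw(2) sN[OF w] that] by simp
  show "(\<chi> \<alpha>. dzbar i (\<lambda>y. s y $ \<alpha>) w) = (\<Sum>j<k. a i j *s X j c (s w))"
    unfolding db by (intro sum.cong refl) (simp add: ad)
  have "(\<chi> \<alpha>. dz i (\<lambda>y. s y $ \<alpha>) w) = P (?e i) + (\<Sum>j<k. cnj (d i j) *s X j c (s w))" for i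
  proof -
    have "S (?e i) - \<i> *s S (axis i \<i>) = 2 *s P (?e i) +
      ((\<Sum>j<k. complex_of_real (\<kappa> j (?e i)) *s X j c (s w)) - \<i> *s (\<Sum>j<k. complex_of_real (\<kappa> j (axis i \<i>)) *s X j c (s w)))"
      unfolding S[of "?e i"] S[of "axis i \<i>"] unfolding axis_imaginary Pi vec.scale_right_distrib ii
      by (simp add: vec_eq_iff)
    also have "\<dots> = 2 *s (P (?e i) + (\<Sum>j<k. cnj (d i j) *s X j c (s w)))"
      by (simp add: vec_eq_iff d_def sum_distrib_left sum_subtractf algebra_simps diff_divide_distrib)
    finally show ?thesis unfolding dz_vector(1)[OF dS] by simp
  qed
  moreover have "(\<Sum>j<k. cnj (a i j) *s X j c (s w)) = (\<Sum>j<k. cnj (d i j) *s X j c (s w))" for i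
    by (intro sum.cong refl) (simp add: ad)
  ultimately have Z: "Z i = P (?e i)" for i by (simp add: Z_def)
  show "Z i \<in> hor c (s w)" unfolding Z by (rule Phor)
  have "?h (Z i) (Z m) = hform (hr b (p (s w))) (?D (P (?e i))) (?D (P (?e m)))"
    unfolding Z by (rule lf(7)[OF Phor Phor, symmetric])
  then show "?h (Z i) (Z m) = hr b w $ i $ m" by (simp only: DP ps[OF w] hform_axis)
qed

abbreviation "Fb b w \<equiv> fr (cpar b w) + ln ((wr (cpar b w))\<^sup>2)"

lemma slice_potential:
  assumes c: "c \<in> A" and sl: "slice c b W p V s" and w: "w \<in> V"
  shows "Fb b w = f (cpar c (s w)) + ln (\<Prod>j<k. Re (n j c (s w)))"
proof -
  have l: "lift c b W p" and sw: "s w \<in> W" and sN: "cpar c (s w) \<in> N" and ps: "p (s w) = w"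
    using sl w unfolding slice_def by blast+
  note lf = lift_facts[OF c l sw sN]
  have e: "cpar b w = \<pi> (cpar c (s w))" using lf(3) ps by simp
  show ?thesis unfolding e descended[OF sN] wedge_norm_on_N(1)[OF c lf(1) sN] ..
qed

lemma smooth_slice_potential:
  assumes c: "c \<in> A" and sl: "slice c b W p V s"
  shows "smooth_on V (Fb b)"
proof -
  have l: "lift c b W p" and V: "open V" and sms: "smooth_on V s" and sW: "s ` V \<subseteq> W"
    and sN: "\<And>v. v \<in> V \<Longrightarrow> cpar c (s v) \<in> N"
    using sl unfolding slice_def by blast+
  have W: "W \<subseteq> cdom c" using l unfolding lift_def by blast
  note o = manifold_chart(1)[OF M c]
  have sc: "s ` V \<subseteq> cdom c" using sW W by blast
  have "smooth_on V (\<lambda>w. f (cpar c (s w)) + ln (\<Prod>j<k. Re (n j c (s w))))"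
  proof (intro smooth_on_add smooth_on_ln smooth_on_prod V smooth_on_compose[OF smooth_f[OF c] V o sms sc])
    show "smooth_on V (\<lambda>w. Re (n j c (s w)))" for j
      by (rule smooth_on_compose[OF smooth_on_Re[OF o smooth_on_hform[OF o metric_facts(1)[OF c] smooth_gen[OF c] smooth_gen[OF c]]] V o sms sc])
    fix w assume w: "w \<in> V"
    then have "s w \<in> cdom c" using sc by blast
    then show "0 < (\<Prod>j<k. Re (n j c (s w)))" using n_pos(2)[OF c _ sN[OF w]] by (intro prod_pos) simp
  qed
  then show ?thesis by (rule smooth_on_cong[OF V, rotated]) (simp only: slice_potential[OF c sl])
qed

lemma slice_ddbar:
  assumes b: "b \<in> B" and c: "c \<in> A" and sl: "slice c b W p V s" and w: "w \<in> V"
  shows "ddbar (\<lambda>y. complex_of_real (ln (Re (det (hr b y))) + Fb b y)) w = - hr b w"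
proof -
  have l: "lift c b W p" and V: "open V" and Vb: "V \<subseteq> cdom b" and sms: "smooth_on V s" and sW: "s ` V \<subseteq> W"
    and sN: "\<And>v. v \<in> V \<Longrightarrow> cpar c (s v) \<in> N"
    using sl unfolding slice_def by blast+
  have W: "W \<subseteq> cdom c" using l unfolding lift_def by blast
  note o = manifold_chart(1)[OF M c]
  have sc: "s ` V \<subseteq> cdom c" using sW W by blast
  have sx: "s v \<in> cdom c" if "v \<in> V" for v using sc that by blast
  obtain cs where cs: "\<forall>l<k. (\<Sum>j<k. cs l j j) = 0 \<and> (\<forall>a\<in>A. \<forall>z\<in>cdom a. \<forall>j<k.
      frechet_derivative (\<lambda>z. gen a z (\<xi>s ! l)) (at z) (gen a z (\<xi>s ! j)) =
      frechet_derivative (\<lambda>z. gen a z (\<xi>s ! j)) (at z) (gen a z (\<xi>s ! l)) + (\<Sum>m<k. cs l j m *\<^sub>R gen a z (\<xi>s ! m)))"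
    using structure_constants by blast
  have "s w \<in> W" using sW w by blast
  then obtain \<sigma> :: "'n \<Rightarrow> nat + 'q" where \<sigma>: "bij_betw \<sigma> UNIV ({..<k} <+> UNIV)"
    using ex_frame_index[OF b c l _ sN[OF w]] by blast
  define a where "a i j w = hform (h c (s w)) (\<chi> \<alpha>. dzbar i (\<lambda>y. s y $ \<alpha>) w) (X j c (s w)) / n j c (s w)" for i j w
  define Z where "Z i w = (\<chi> \<alpha>. dz i (\<lambda>y. s y $ \<alpha>) w) - (\<Sum>j<k. cnj (a i j w) *s X j c (s w))" for i w
  note dec = slice_decomposition[OF b c sl, folded a_def, folded Z_def]
  show ?thesis
  proof (rule reduced_ricci_potential[where S = "cdom c" and X = "\<lambda>j z. X j c z" and c = "\<lambda>l j m. complex_of_real (cs l j m)"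
        and a = a and Y = Z and h = "h c" and f = "\<lambda>y. f (cpar c y)" and V = V and s = s and \<sigma> = \<sigma>])
    show "smooth_on V (a i j)" if j: "j < k" for i j
    proof -
      have hs: "smooth_on V (\<lambda>w. h c (s w))" by (rule smooth_on_compose[OF metric_facts(1)[OF c] V o sms sc])
      have xs: "smooth_on V (\<lambda>w. X j c (s w))" by (rule smooth_on_compose[OF smooth_gen[OF c] V o sms sc])
      have ds: "smooth_on V (\<lambda>w. \<chi> \<alpha>. dzbar i (\<lambda>y. s y $ \<alpha>) w)"
        by (rule smooth_on_vecI[OF V]) (simp only: vec_lambda_beta, rule smooth_on_dz(2)[OF V smooth_on_vec_nth[OF V sms]])
      have nz: "n j c (s v) \<noteq> 0" if "v \<in> V" for v by (rule n_pos(3)[OF c sx[OF that] sN[OF that] j])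
      show ?thesis unfolding a_def[abs_def]
        by (rule smooth_on_divide[OF V smooth_on_hform[OF V hs ds xs] smooth_on_hform[OF V hs xs xs] nz])
    qed
    show "(\<Sum>\<beta>\<in>UNIV. dz \<beta> (\<lambda>y. X l c y $ \<alpha>) y * X j c y $ \<beta>) =
      (\<Sum>\<beta>\<in>UNIV. dz \<beta> (\<lambda>y. X j c y $ \<alpha>) y * X l c y $ \<beta>) + (\<Sum>m<k. complex_of_real (cs l j m) * X m c y $ \<alpha>)"
      if lj: "l < k" "j < k" and y: "y \<in> cdom c" for l j \<alpha> y
    proof -
      have "frechet_derivative (\<lambda>z. X l c z) (at y) (X j c y) =
        frechet_derivative (\<lambda>z. X j c z) (at y) (X l c y) + (\<Sum>m<k. cs l j m *\<^sub>R X m c y)"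
        using cs lj c y by blast
      from arg_cong[OF this, of "\<lambda>v. v $ \<alpha>"] show ?thesis
        unfolding vector_add_component sum_component vector_scaleR_component gen_holomorphic(3)[OF c y]
        by (simp only: scaleR_conv_of_real)
    qed
    show "(\<Sum>j<k. complex_of_real (cs l j j)) = 0" if "l < k" for l
      using cs that by (simp only: of_real_sum[symmetric] of_real_0)
    show "(\<chi> \<alpha>. dzbar i (\<lambda>y. s y $ \<alpha>) v) = (\<Sum>j<k. a i j v *s X j c (s v))" if "v \<in> V" for i v
      by (rule dec(1)[OF that])
    show "(\<chi> \<alpha>. dz i (\<lambda>y. s y $ \<alpha>) v) = Z i v + (\<Sum>j<k. cnj (a i j v) *s X j c (s v))" for i v
      by (simp add: Z_def)
    show "ddbar (\<lambda>y. complex_of_real (ln (Re (det (h c y))) + f (cpar c y))) z = - h c z" if "z \<in> cdom c" for z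
      using ddbar_potential[OF c that] by (simp only: potential_def)
    \<comment> \<open>The slice lies in \<open>N\<close> and \<open>\<xi>s ! l\<close> in the kernel
      of \<mu>, so this component of the momentum map vanishes.\<close>
    show "(\<Sum>i\<in>UNIV. dz i (\<lambda>y. X l c y $ i) (s v)) +
      (\<Sum>\<alpha>\<in>UNIV. dz \<alpha> (\<lambda>y. complex_of_real (ln (Re (det (h c y))) + f (cpar c y))) (s v) * X l c (s v) $ \<alpha>) = 0"
      if lv: "l < k" "v \<in> V" for l v
      using iffD1[OF moment_eq_zero_iff[OF c sx[OF lv(2)]] moment_vanishes[OF sN[OF lv(2)] xi_kernel[OF xi_in[OF lv(1)]]]]
      by (simp only: potential_def divergence_def)
    show "hform (h c (s v)) (Z m v) (X j c (s v)) = 0" if "j < k" "v \<in> V" for j m v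
      using dec(2)[OF that(2)] that(1) by blast
    show "hform (h c (s v)) (Z l v) (Z m v) = hr b v $ l $ m" if "v \<in> V" for l m v by (rule dec(3)[OF that])
    show "hr b v $ \<beta> $ \<alpha> = cnj (hr b v $ \<alpha> $ \<beta>)" if "v \<in> V" for v \<alpha> \<beta>
      by (rule quotient_metric(2)[OF b subsetD[OF Vb that]])
    show "0 < Re (hform (hr b v) u u)" if "v \<in> V" "u \<noteq> 0" for v u
      by (rule quotient_metric(3)[OF b subsetD[OF Vb that(1)] that(2)])
    show "X j c (s v) \<noteq> 0" if "j < k" "v \<in> V" for j v by (rule frame_orthogonal(2)[OF c sx[OF that(2)] sN[OF that(2)] that(1)])
    show "hform (h c (s v)) (X i c (s v)) (X j c (s v)) = 0" if "i < k" "j < k" "i \<noteq> j" "v \<in> V" for i j v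
      by (rule frame_orthogonal(1)[OF c sx[OF that(4)] sN[OF that(4)] that(1-3)])
  qed (rule V o sc sms \<sigma> w smooth_gen[OF c] gen_holomorphic(1)[OF c] metric_facts(1-3)[OF c] smooth_f[OF c] slice_potential[OF c sl]; assumption?)+
qed

lemma smooth_reduced_potential: "b \<in> B \<Longrightarrow> smooth_on (cdom b) (Fb b)"
proof (rule smooth_on_local)
  fix w assume b: "b \<in> B" and w: "w \<in> cdom b"
  obtain c W p V s where c: "c \<in> A" and sl: "slice c b W p V s" and wV: "w \<in> V" using ex_slice[OF b w] by blast
  have "open V" using sl unfolding slice_def by blast
  then show "\<exists>U. open U \<and> w \<in> U \<and> smooth_on U (Fb b)" using smooth_slice_potential[OF c sl] wV by blast
qed

text \<open>The identity is local and a slice exists through every point of a quotient chart; it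
  only remains to split \<open>ddbar\<close> of the sum.\<close>

lemma reduced_ricci:
  assumes b: "b \<in> B" and w: "w \<in> cdom b"
  shows "ricci_form (hr b) w u v = form11 (hr b w) u v + form11 (ddbar (\<lambda>y. complex_of_real (Fb b y)) w) u v"
proof -
  obtain c W p V s where c: "c \<in> A" and sl: "slice c b W p V s" and wV: "w \<in> V" using ex_slice[OF b w] by blast
  note o = B_chart(1)[OF b]
  have det: "Re (det (hr b y)) > 0" if "y \<in> cdom b" for y
    by (rule hermitian_posdef_det(2)[OF quotient_metric(2)[OF b that] quotient_metric(3)[OF b that]])
  have sl: "smooth_on (cdom b) (\<lambda>y. complex_of_real (ln (Re (det (hr b y)))))"
    by (intro smooth_on_of_real o smooth_on_ln smooth_on_Re smooth_on_det quotient_metric(1)[OF b] det)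
  have sF: "smooth_on (cdom b) (\<lambda>y. complex_of_real (Fb b y))"
    by (rule smooth_on_of_real[OF o smooth_reduced_potential[OF b]])
  have alg: "- d = a + F" if "- a = d + F" for a d F :: "complex^'q^'q"
  proof -
    have "a = - (d + F)" by (simp flip: that)
    then show ?thesis by simp
  qed
  have "ddbar (\<lambda>y. complex_of_real (ln (Re (det (hr b y)))) + complex_of_real (Fb b y)) w = - hr b w"
    using slice_ddbar[OF b c \<open>slice c b W p V s\<close> wV] by (simp only: of_real_add)
  then have "- hr b w = ddbar (\<lambda>y. complex_of_real (ln (Re (det (hr b y))))) w + ddbar (\<lambda>y. complex_of_real (Fb b y)) w"
    unfolding ddbar_add[OF o sl sF w] by (rule sym)
  then have "- ddbar (\<lambda>y. complex_of_real (ln (Re (det (hr b y))))) w = hr b w + ddbar (\<lambda>y. complex_of_real (Fb b y)) w"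
    by (rule alg)
  then show ?thesis unfolding ricci_form_def by (simp only: form11_add)
qed

end

section \<open>Exactness of the forms given by a potential\<close>

lemma ddbar_second_derivative:
  fixes u :: "complex^'n::finite \<Rightarrow> complex"
  assumes S: "open S" and u: "smooth_on S u" and z: "z \<in> S"
  shows "frechet_derivative (\<lambda>y. frechet_derivative u (at y) (\<i> *s w)) (at z) v
      - frechet_derivative (\<lambda>y. frechet_derivative u (at y) (\<i> *s v)) (at z) w
    = - 2 * \<i> * (hform (ddbar u z) v w - hform (ddbar u z) w v)"
proof -
  \<comment> \<open>The parts of the second derivative of type (2,0) and (0,2). Both are symmetric
    and respectively linear and antilinear in the second vector, so they cancel in the difference;
    the mixed part remains.\<close>
  define Q where "Q v w = (\<Sum>j\<in>UNIV. \<Sum>i\<in>UNIV. dz j (dz i u) z * v $ j * w $ i)" for v w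
  define R where "R v w = (\<Sum>j\<in>UNIV. \<Sum>i\<in>UNIV. dzbar j (dzbar i u) z * cnj (v $ j) * cnj (w $ i))" for v w
  note comm = dz_commute[OF S u z]
  have sym: "Q v w = Q w v" "R v w = R w v" for v w
    unfolding Q_def R_def by (subst sum.swap, simp only: comm(1)[of _ ] mult_ac, subst sum.swap, simp add: comm mult_ac)+
  have "frechet_derivative (\<lambda>y. frechet_derivative u (at y) w) (at z) v
      = Q v w + hform (ddbar u z) v w + hform (ddbar u z) w v + R v w" for v w
  proof -
    have d: "frechet_derivative u (at y) w = (\<Sum>i\<in>UNIV. dz i u y * w $ i + dzbar i u y * cnj (w $ i))" if "y \<in> S" for y
      by (rule has_derivative_wirtinger[OF smooth_on_has_derivative[OF u that]])
    have dif: "dz i u differentiable (at z)" "dzbar i u differentiable (at z)" for i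
      by (rule smooth_on_differentiable[OF smooth_on_dz(1)[OF S u] z] smooth_on_differentiable[OF smooth_on_dz(2)[OF S u] z])+
    note has = frechet_derivative_worksI[OF dif(1)] frechet_derivative_worksI[OF dif(2)]
    have "((\<lambda>y. \<Sum>i\<in>UNIV. dz i u y * w $ i + dzbar i u y * cnj (w $ i)) has_derivative
      (\<lambda>v. \<Sum>i\<in>UNIV. frechet_derivative (dz i u) (at z) v * w $ i + frechet_derivative (dzbar i u) (at z) v * cnj (w $ i))) (at z)"
      by (intro has_derivative_sum has_derivative_add has_derivative_mult_left has)
    then have "((\<lambda>y. frechet_derivative u (at y) w) has_derivative
      (\<lambda>v. \<Sum>i\<in>UNIV. frechet_derivative (dz i u) (at z) v * w $ i + frechet_derivative (dzbar i u) (at z) v * cnj (w $ i))) (at z)"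
      by (rule has_derivative_transform_within_open[OF _ S z d[symmetric]])
    from fun_cong[OF frechet_eq[OF this], of v]
    have "frechet_derivative (\<lambda>y. frechet_derivative u (at y) w) (at z) v =
      (\<Sum>i\<in>UNIV. frechet_derivative (dz i u) (at z) v * w $ i + frechet_derivative (dzbar i u) (at z) v * cnj (w $ i))" .
    also have "\<dots> = (\<Sum>i\<in>UNIV. \<Sum>j\<in>UNIV. dz j (dz i u) z * v $ j * w $ i) + (\<Sum>i\<in>UNIV. \<Sum>j\<in>UNIV. dzbar j (dz i u) z * cnj (v $ j) * w $ i)
       + ((\<Sum>i\<in>UNIV. \<Sum>j\<in>UNIV. dz j (dzbar i u) z * v $ j * cnj (w $ i)) + (\<Sum>i\<in>UNIV. \<Sum>j\<in>UNIV. dzbar j (dzbar i u) z * cnj (v $ j) * cnj (w $ i)))"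
      unfolding has_derivative_wirtinger[OF has(1)] has_derivative_wirtinger[OF has(2)]
      by (simp only: sum_distrib_right distrib_right sum.distrib)
    also have "(\<Sum>i\<in>UNIV. \<Sum>j\<in>UNIV. dz j (dz i u) z * v $ j * w $ i) = Q v w" unfolding Q_def by (rule sum.swap)
    also have "(\<Sum>i\<in>UNIV. \<Sum>j\<in>UNIV. dzbar j (dzbar i u) z * cnj (v $ j) * cnj (w $ i)) = R v w" unfolding R_def by (rule sum.swap)
    also have "(\<Sum>i\<in>UNIV. \<Sum>j\<in>UNIV. dz j (dzbar i u) z * v $ j * cnj (w $ i)) = hform (ddbar u z) v w"
      by (subst sum.swap) (simp add: hform_def ddbar_def)
    also have "(\<Sum>i\<in>UNIV. \<Sum>j\<in>UNIV. dzbar j (dz i u) z * cnj (v $ j) * w $ i) = hform (ddbar u z) w v"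
      unfolding comm(2)[symmetric] by (simp add: hform_def ddbar_def mult_ac)
    finally show ?thesis by simp
  qed
  moreover have "Q v (\<i> *s w) = \<i> * Q v w" "R v (\<i> *s w) = - \<i> * R v w" for v w
    unfolding Q_def R_def by (simp_all add: sum_distrib_left mult_ac flip: sum_negf)
  ultimately show ?thesis
    by (simp add: sym[of w v] hform_scale_left hform_scale_right algebra_simps)
qed

text \<open>The constant is the product of \<open>\<i> / (2 * pi)\<close> from \<open>form11\<close>
  and \<open>\<i> / 2\<close>, the inverse of the factor \<open>- 2 * \<i>\<close> between the
  second derivatives and the mixed part.\<close>

lemma ddbar_exact:
  fixes u :: "complex^'n::finite \<Rightarrow> real"
  assumes S: "open S" and u: "smooth_on S u" and z: "z \<in> S"
  shows "form11 (ddbar (\<lambda>y. complex_of_real (u y)) z) v w =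
    complex_of_real (ext_deriv1 (\<lambda>y v. - (1 / (4 * pi)) * frechet_derivative u (at y) (\<i> *s v)) z v w)"
proof -
  let ?D = "\<lambda>v y. frechet_derivative u (at y) v"
  have sD: "smooth_on S (?D v)" for v by (rule smooth_on_frechet_derivative[OF u])
  have 1: "frechet_derivative (\<lambda>y. complex_of_real (u y)) (at y) v = complex_of_real (?D v y)" if "y \<in> S" for v y
    using fun_cong[OF frechet_eq[OF has_derivative_of_real[OF smooth_on_has_derivative[OF u that]]]] .
  have 2: "frechet_derivative (\<lambda>y. frechet_derivative (\<lambda>y. complex_of_real (u y)) (at y) v) (at z) w
      = complex_of_real (frechet_derivative (?D v) (at z) w)" for v w
  proof -
    have "((\<lambda>y. complex_of_real (?D v y)) has_derivative (\<lambda>w. complex_of_real (frechet_derivative (?D v) (at z) w))) (at z)"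
      by (rule has_derivative_of_real[OF smooth_on_has_derivative[OF sD z]])
    then have "((\<lambda>y. frechet_derivative (\<lambda>y. complex_of_real (u y)) (at y) v) has_derivative
        (\<lambda>w. complex_of_real (frechet_derivative (?D v) (at z) w))) (at z)"
      by (rule has_derivative_transform_within_open[OF _ S z]) (simp only: 1)
    from fun_cong[OF frechet_eq[OF this]] show ?thesis .
  qed
  have 3: "frechet_derivative (\<lambda>y. - (1 / (4 * pi)) * ?D v y) (at z) w = - (1 / (4 * pi)) * frechet_derivative (?D v) (at z) w" for v w
    using fun_cong[OF frechet_eq[OF has_derivative_mult_right[OF smooth_on_has_derivative[OF sD z]]]] .
  have alg: "Y = \<i> / 2 * X" if "X = - 2 * \<i> * Y" for X Y :: complex unfolding that by simp
  have "hform (ddbar (\<lambda>y. complex_of_real (u y)) z) v w - hform (ddbar (\<lambda>y. complex_of_real (u y)) z) w v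
    = \<i> / 2 * complex_of_real (frechet_derivative (?D (\<i> *s w)) (at z) v - frechet_derivative (?D (\<i> *s v)) (at z) w)"
    by (rule alg) (use ddbar_second_derivative[OF S smooth_on_of_real[OF S u] z, of w v] in \<open>simp only: 2 of_real_diff\<close>)
  note H = this
  show ?thesis unfolding form11_def ext_deriv1_def 3 H by (simp add: field_simps)
qed

text \<open>The form involves multiplication by \<open>\<i>\<close>, so its compatibility with
  changes of chart rests on the complex linearity of the derivatives of holomorphic
  transitions.\<close>

lemma smooth_fun_one_form:
  fixes B :: "(complex^'q::finite, 'y) ochart set" and F :: "'y \<Rightarrow> real"
  assumes o: "\<And>b. b \<in> B \<Longrightarrow> open (cdom b)" and F: "smooth_fun B F"
  shows "one_form B (\<lambda>b y v. - (1 / (4 * pi)) * frechet_derivative (\<lambda>y. F (cpar b y)) (at y) (\<i> *s v))"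
  unfolding one_form_def
proof (intro conjI ballI allI impI)
  have sm: "smooth_on (cdom b) (\<lambda>y. F (cpar b y))" if "b \<in> B" for b using F that by (simp add: smooth_fun_def comp_def)
  fix c assume c: "c \<in> B"
  show "smooth_on (cdom c) (\<lambda>z. - (1 / (4 * pi)) * frechet_derivative (\<lambda>y. F (cpar c y)) (at z) (\<i> *s v))" for v
    by (intro smooth_on_mult smooth_on_const smooth_on_frechet_derivative[OF sm[OF c]] o[OF c])
  show "linear (\<lambda>v. - (1 / (4 * pi)) * frechet_derivative (\<lambda>y. F (cpar c y)) (at z) (\<i> *s v))" if z: "z \<in> cdom c" for z
  proof -
    have lin: "linear (frechet_derivative (\<lambda>y. F (cpar c y)) (at z))"
      using has_derivative_linear[OF smooth_on_has_derivative[OF sm[OF c] z]] .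
    have i: "\<i> *s (r *\<^sub>R v) = r *\<^sub>R (\<i> *s v)" for r and v :: "complex^'q" by (simp add: vec_eq_iff)
    show ?thesis
      by (rule linearI) (simp_all only: vec.scale_right_distrib i linear_add[OF lin] linear_cmul[OF lin] distrib_left real_scaleR_def mult.left_commute)
  qed
  fix d W l z v assume d: "d \<in> B" and tr: "transition holo_on c d W l" and z: "z \<in> W"
  have W: "open W" "W \<subseteq> cdom c" "l ` W \<subseteq> cdom d" "holo_on W l" "\<And>z. z \<in> W \<Longrightarrow> cpar d (l z) = cpar c z"
    using tr unfolding transition_def by blast+
  have l: "(l has_derivative frechet_derivative l (at z)) (at z)"
    and li: "frechet_derivative l (at z) (\<i> *s v) = \<i> *s frechet_derivative l (at z) v"
    using W(4) z unfolding holo_on_def by (auto intro: frechet_derivative_worksI)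
  have lz: "l z \<in> cdom d" using W(3) z by blast
  have "((\<lambda>y. F (cpar d (l y))) has_derivative
      (\<lambda>v. frechet_derivative (\<lambda>y. F (cpar d y)) (at (l z)) (frechet_derivative l (at z) v))) (at z)"
    by (rule has_derivative_compose[OF l smooth_on_has_derivative[OF sm[OF d] lz]])
  then have "((\<lambda>y. F (cpar c y)) has_derivative
      (\<lambda>v. frechet_derivative (\<lambda>y. F (cpar d y)) (at (l z)) (frechet_derivative l (at z) v))) (at z)"
    by (rule has_derivative_transform_within_open[OF _ W(1) z]) (simp only: W(5))
  from fun_cong[OF frechet_eq[OF this], of "\<i> *s v"]
  show "- (1 / (4 * pi)) * frechet_derivative (\<lambda>y. F (cpar c y)) (at z) (\<i> *s v) =
    - (1 / (4 * pi)) * frechet_derivative (\<lambda>y. F (cpar d y)) (at (l z)) (\<i> *s frechet_derivative l (at z) v)"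
    by (simp only: li)
qed

lemma ricci_potential_represents_c1:
  fixes B :: "(complex^'q::finite, 'y) ochart set"
  assumes o: "\<And>b. b \<in> B \<Longrightarrow> open (cdom b)" and F: "ricci_potential B hr F"
  shows "represents_c1 B hr"
proof -
  have sF: "smooth_fun B F" and ric: "\<And>b z v w. b \<in> B \<Longrightarrow> z \<in> cdom b \<Longrightarrow>
      ricci_form (hr b) z v w - form11 (hr b z) v w = form11 (ddbar (\<lambda>y. complex_of_real (F (cpar b y))) z) v w"
    using F unfolding ricci_potential_def by blast+
  have "smooth_on (cdom b) (\<lambda>y. F (cpar b y))" if "b \<in> B" for b
    using sF that by (simp add: smooth_fun_def comp_def)
  note ex = ddbar_exact[OF o this]
  show ?thesis
    unfolding represents_c1_def
    by (intro exI[of _ "\<lambda>b y v. - (1 / (4 * pi)) * frechet_derivative (\<lambda>y. F (cpar b y)) (at y) (\<i> *s v)"] conjI ballI allI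
        smooth_fun_one_form[OF o sF]) (simp_all only: ric ex)
qed

context ray_reduction
begin

lemma reduced_ricci_potential_global:
  "ricci_potential B hr (\<lambda>y. fr y + ln ((wr y)\<^sup>2))"
  unfolding ricci_potential_def smooth_fun_def comp_def
  by (intro conjI ballI allI smooth_reduced_potential) (simp_all add: reduced_ricci)

lemma fano_reduced: "fano_kahler Y B hr"
  unfolding fano_kahler_def
  by (intro conjI red_facts(3,4) ricci_potential_represents_c1[OF B_chart(1) reduced_ricci_potential_global])

end

theorem theorem6p1:
  fixes T :: "'m topology" and A :: "(complex^'n, 'm) ochart set" and h :: "('n::finite, 'm) htensor"
    and G :: "'g monoid" and TG :: "'g topology" and E :: "(real^'p, 'g) ochart set"
    and e :: "(real^'p, 'g) ochart" and act :: "'g \<Rightarrow> 'm \<Rightarrow> 'm"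
    and f :: "'m \<Rightarrow> real" and J :: "'m \<Rightarrow> real^'p \<Rightarrow> real" and \<mu> :: "real^'p \<Rightarrow> real"
    and K :: "'g set" and \<mm> :: "(real^'p) set" and \<xi>s \<eta>s :: "(real^'p) list"
    and Y :: "'m set topology" and B :: "(complex^'q, 'm set) ochart set"
    and hr :: "('q::finite, 'm set) htensor"
  defines "gen \<equiv> generator G e act"
    and "N \<equiv> ray_preimage T J \<mu>"
    and "\<pi> \<equiv> ray_projection G K act"
    and "fr \<equiv> descend f"
    and "wr \<equiv> descend (wedge_norm A h (generator G e act) (\<xi>s @ \<eta>s))"
  assumes M: "compact_space T" "manifold holo_on T A" "fano_kahler T A h"
    and f: "ricci_potential A h f"
    and G: "lie_group G TG E" "e \<in> E" "\<one>\<^bsub>G\<^esub> \<in> cimg e"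
    and act: "smooth_action G E T A act" "\<And>g. g \<in> carrier G \<Longrightarrow> holomorphic_isometry A h (act g)"
    and J: "momentum_map G e act A h f T J"
    and \<mu>: "linear \<mu>"
    and K: "compact_kernel_group G TG E e \<mu> K"
    and red: "ray_reduced_kahler_orbifold G TG E e T A h act J \<mu> K Y B hr"
    and \<mm>: "subspace \<mm>" "isotropy_algebra G TG E e \<mu> \<inter> \<mm> = {0}"
      "{a + b | a b. a \<in> isotropy_algebra G TG E e \<mu> \<and> b \<in> \<mm>} = UNIV" "\<forall>\<eta>\<in>\<mm>. \<mu> \<eta> = 0"
    and bases: "basis_of (kernel_algebra G TG E e \<mu>) \<xi>s" "basis_of \<mm> \<eta>s"
    and frames: "adapted_frames A h gen N \<xi>s" "adapted_frames A h gen N \<eta>s"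
    and nonzero: "\<forall>x\<in>N. wedge_norm A h gen (\<xi>s @ \<eta>s) x \<noteq> 0"
  shows "(\<forall>x\<in>N. fr (\<pi> x) = f x \<and> wr (\<pi> x) = wedge_norm A h gen (\<xi>s @ \<eta>s) x) \<and>
    smooth_fun B (\<lambda>y. fr y + ln ((wr y)\<^sup>2)) \<and>
    (\<forall>b\<in>B. \<forall>z\<in>cdom b. \<forall>v w.
       ricci_form (hr b) z v w = form11 (hr b z) v w +
         form11 (ddbar (\<lambda>s. complex_of_real (fr (cpar b s) + ln ((wr (cpar b s))\<^sup>2))) z) v w) \<and>
    fano_kahler Y B hr"
proof -
  have kahler: "kahler_metric A h" using M(3) by (simp add: fano_kahler_def)
  interpret r: ray_reduction T A h G TG E e act f J \<mu> K \<xi>s \<mm> \<eta>s Y B hr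
    by (intro ray_reduction.intro kahler_kernel_action.intro kahler_lie_action.intro kahler_kernel_action_axioms.intro
        ray_reduction_axioms.intro M(2) kahler f G act J \<mu> K red \<mm> bases frames(1)[unfolded gen_def N_def]
        nonzero[unfolded gen_def N_def])
  have eq: "N = r.N" "\<pi> = r.\<pi>" "fr = r.fr" "wr = r.wr"
    unfolding N_def r.N_def \<pi>_def r.\<pi>_def fr_def r.fr_def wr_def r.wr_def by (rule refl)+
  show ?thesis
    unfolding eq gen_def
    using r.descended r.reduced_ricci r.fano_reduced r.reduced_ricci_potential_global
    unfolding ricci_potential_def by blast
qed

end
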